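(* Let $\omega\subset\mathbb{R}^2$, $\gamma_D$, $\lambda_1$, $\psi_1$, $\ell$, $\kappa$, $\tau$, $\beta$, $Q$, $\Gamma$, $g$ and $T_{\ell,\beta}$ be as in the context, and set $$A_j=\int_\omega \psi_1\,\partial_j\psi_1\,\mathrm{d}x'=\frac12\int_{\partial\omega} n_j|\psi_1|^2\,\mathrm{d}S(x'),\qquad j=1,2,$$ where $(n_1,n_2)$ is the outward unit normal to $\partial\omega$. Suppose there is a compact interval $I\subset\mathbb{R}$ such that $$\int_I \kappa(x_3)\big(A_1\cos\beta(x_3)+A_2\sin\beta(x_3)\big)\,\mathrm{d}x_3<0$$ and $\kappa(x_3)\big(A_1\cos\beta(x_3)+A_2\sin\beta(x_3)\big)\le 0$ for all $x_3\in\mathbb{R}\setminus I$. Then $\inf\sigma(T_{\ell,\beta})<\lambda_1$. In particular, if $\kappa$ is compactly supported, the discrete spectrum of $T_{\ell,\beta}$ is nonempty.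
   Context: $\omega\subset\mathbb{R}^2$ is a bounded domain (open connected set) whose boundary is piecewise $C^2$ and has no cusps. $\gamma_D\subset\partial\omega$ is a union of finitely many arcs, each of positive measure, and $\gamma_N=\partial\omega\setminus\gamma_D$. $\lambda_1$ is the lowest eigenvalue of $-\Delta'\psi=\lambda\psi$ in $\omega$, $\psi=0$ on $\gamma_D$, $\partial_n\psi=0$ on $\gamma_N$ (i.e. of the Laplacian associated with the form $\int_\omega|\nabla'\psi|^2$ on $H^1_0(\omega,\gamma_D)$, the $H^1(\omega)$ functions vanishing on $\gamma_D$). $\psi_1$ is the corresponding real-valued eigenfunction, positive in $\omega$ and normalized in $L^2(\omega)$. $\ell:\mathbb{R}\to\mathbb{R}^3$ is a $C^3$ curve parametrized by arc length, a diffeomorphism onto its image, possessing a global Frenet frame $\{\mathbf t,\mathbf n,\mathbf b\}$, with curvature $\kappa=|\ddot\ell|\ge0$ and torsion $\tau$. $\beta\in C^1(\mathbb{R})$ satisfies $\dot\beta=\tau$ (bending without twisting). With $\mathbf N_\beta=\mathbf n\cos\beta-\mathbf b\sin\beta$, $\mathbf B_\beta=\mathbf n\sin\beta+\mathbf b\cos\beta$, the tube is $Q_{\ell,\beta}=\{\ell(x_3)+x_1\mathbf N_\beta(x_3)+x_2\mathbf B_\beta(x_3): (x_1,x_2)\in\omega,\ x_3\in\mathbb{R}\}$; it is assumed that $a\|\kappa\|_\infty<1$ with $a=\sup_{x'\in\omega}|x'|$ and that the tube has no self-intersections. Let $Q=\omega\times\mathbb{R}$, $\Gamma=\gamma_D\times\mathbb{R}$,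 and $g(x)=1-(x_1\cos\beta(x_3)+x_2\sin\beta(x_3))\kappa(x_3)$. $T_{\ell,\beta}$ is the self-adjoint operator in the weighted space $L^2(Q,g)$ (inner product $(u,v)_{Q,g}=\int_Q g\,u\bar v$) associated with the closed form $a_{\ell,\beta}[u]=\int_Q\big[g(|\partial_1u|^2+|\partial_2u|^2)+g^{-1}|\partial_3u|^2\big]\mathrm{d}x$ on $H^1$ functions on $Q$ vanishing on $\Gamma$; it is unitarily equivalent to the Laplacian on $Q_{\ell,\beta}$ with Dirichlet condition on the image of $\Gamma$ and Neumann condition on the rest of the boundary. *)

theory Defs
  imports "HOL-Analysis.Analysis"
begin

definition C1c :: "'a::euclidean_space set \<Rightarrow> ('a \<Rightarrow> real) \<Rightarrow> bool" where
  "C1c U \<phi> \<longleftrightarrow> (\<forall>x. \<phi> differentiable (at x))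
     \<and> (\<forall>v. continuous_on UNIV (\<lambda>x. frechet_derivative \<phi> (at x) v))
     \<and> compact (closure {x. \<phi> x \<noteq> 0}) \<and> closure {x. \<phi> x \<noteq> 0} \<subseteq> U"

definition L2_on :: "'a::euclidean_space set \<Rightarrow> ('a \<Rightarrow> real) \<Rightarrow> bool" where
  "L2_on U f \<longleftrightarrow> set_borel_measurable lborel U f \<and> set_integrable lborel U (\<lambda>x. (f x)\<^sup>2)"

definition weak_deriv :: "'a::euclidean_space set \<Rightarrow> 'a \<Rightarrow> ('a \<Rightarrow> real) \<Rightarrow> ('a \<Rightarrow> real) \<Rightarrow> bool" where
  "weak_deriv U e f h \<longleftrightarrow> (\<forall>\<phi>. C1c U \<phi> \<longrightarrow>
      (LINT x:U|lborel. f x * frechet_derivative \<phi> (at x) e) = - (LINT x:U|lborel. h x * \<phi> x))"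

definition H1_on :: "'a::euclidean_space set \<Rightarrow> ('a \<Rightarrow> real) \<Rightarrow> bool" where
  "H1_on U f \<longleftrightarrow> L2_on U f \<and> (\<forall>e\<in>Basis. \<exists>h. L2_on U h \<and> weak_deriv U e f h)"

text \<open>A chosen weak derivative (unique up to null sets, so all integrals below are well defined).\<close>
definition wd :: "'a::euclidean_space set \<Rightarrow> 'a \<Rightarrow> ('a \<Rightarrow> real) \<Rightarrow> ('a \<Rightarrow> real)" where
  "wd U e f = (SOME h. L2_on U h \<and> weak_deriv U e f h)"

definition H1_0_on :: "'a::euclidean_space set \<Rightarrow> 'a set \<Rightarrow> ('a \<Rightarrow> real) \<Rightarrow> bool" where
  "H1_0_on U G u \<longleftrightarrow> H1_on U u \<and>
     (\<exists>\<phi>::nat \<Rightarrow> 'a \<Rightarrow> real. (\<forall>n. C1c UNIV (\<phi> n) \<and> closure {x. \<phi> n x \<noteq> 0} \<inter> G = {})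
        \<and> (\<lambda>n. (LINT x:U|lborel. (\<phi> n x - u x)\<^sup>2)
               + (\<Sum>e\<in>Basis. LINT x:U|lborel. (frechet_derivative (\<phi> n) (at x) e - wd U e u x)\<^sup>2))
          \<longlonglongrightarrow> 0)"

text \<open>H: the Hilbert space (as a set of representatives), D: form domain, a: form, ip: inner product.
  The associated operator T satisfies: u \<in> dom T and T u = f iff u \<in> D and a u v = ip f v for all v \<in> D.
  Hence (T - z) u = f iff u \<in> D and a u v - z * ip u v = ip f v for all v \<in> D.\<close>
definition form_resolvent_set :: "'f set \<Rightarrow> 'f set \<Rightarrow> ('f \<Rightarrow> 'f \<Rightarrow> real) \<Rightarrow> ('f \<Rightarrow> 'f \<Rightarrow> real) \<Rightarrow> real set" where
  "form_resolvent_set H D a ip = {z.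
      (\<forall>f\<in>H. \<exists>u\<in>D. \<forall>v\<in>D. a u v - z * ip u v = ip f v)
    \<and> (\<forall>u\<in>D. (\<forall>v\<in>D. a u v - z * ip u v = 0) \<longrightarrow> ip u u = 0)
    \<and> (\<exists>C. \<forall>f\<in>H. \<forall>u\<in>D. (\<forall>v\<in>D. a u v - z * ip u v = ip f v) \<longrightarrow> ip u u \<le> C * ip f f)}"

definition form_spectrum :: "'f set \<Rightarrow> 'f set \<Rightarrow> ('f \<Rightarrow> 'f \<Rightarrow> real) \<Rightarrow> ('f \<Rightarrow> 'f \<Rightarrow> real) \<Rightarrow> real set" where
  "form_spectrum H D a ip = UNIV - form_resolvent_set H D a ip"

definition form_eigenvalue :: "'f set \<Rightarrow> ('f \<Rightarrow> 'f \<Rightarrow> real) \<Rightarrow> ('f \<Rightarrow> 'f \<Rightarrow> real) \<Rightarrow> real \<Rightarrow> bool" where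
  "form_eigenvalue D a ip \<mu> \<longleftrightarrow> (\<exists>u\<in>D. ip u u \<noteq> 0 \<and> (\<forall>v\<in>D. a u v = \<mu> * ip u v))"

definition finite_multiplicity :: "'f set \<Rightarrow> ('f \<Rightarrow> 'f \<Rightarrow> real) \<Rightarrow> ('f \<Rightarrow> 'f \<Rightarrow> real) \<Rightarrow> real \<Rightarrow> bool" where
  "finite_multiplicity D a ip \<mu> \<longleftrightarrow> (\<exists>N::nat. \<forall>(us::nat \<Rightarrow> 'f) m.
      (\<forall>i<m. us i \<in> D \<and> (\<forall>v\<in>D. a (us i) v = \<mu> * ip (us i) v))
    \<and> (\<forall>i<m. \<forall>j<m. ip (us i) (us j) = (if i = j then 1 else 0)) \<longrightarrow> m \<le> N)"

definition form_discrete_spectrum :: "'f set \<Rightarrow> 'f set \<Rightarrow> ('f \<Rightarrow> 'f \<Rightarrow> real) \<Rightarrow> ('f \<Rightarrow> 'f \<Rightarrow> real) \<Rightarrow> real set" where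
  "form_discrete_spectrum H D a ip = {\<mu> \<in> form_spectrum H D a ip.
      form_eigenvalue D a ip \<mu> \<and> finite_multiplicity D a ip \<mu>
    \<and> (\<exists>\<epsilon>>0. form_spectrum H D a ip \<inter> {\<mu> - \<epsilon> <..< \<mu> + \<epsilon>} = {\<mu>})}"

definition C2_piece :: "(real \<Rightarrow> real \<times> real) \<Rightarrow> real \<Rightarrow> real \<Rightarrow> (real \<Rightarrow> real \<times> real) \<Rightarrow> bool" where
  "C2_piece c a b D \<longleftrightarrow> a < b \<and> (\<exists>D2. continuous_on {a..b} D \<and> continuous_on {a..b} D2
     \<and> (\<forall>t\<in>{a<..<b}. (c has_vector_derivative D t) (at t) \<and> (D has_vector_derivative D2 t) (at t))
     \<and> (\<forall>t\<in>{a..b}. D t \<noteq> 0))"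

text \<open>A closed Jordan curve (1-periodic parametrisation) that is piecewise regular C2,
  with no cusps at the corners (one-sided tangents are never opposite).\<close>
definition pw_C2_closed_curve :: "(real \<Rightarrow> real \<times> real) \<Rightarrow> bool" where
  "pw_C2_closed_curve c \<longleftrightarrow> continuous_on UNIV c \<and> (\<forall>t. c (t + 1) = c t) \<and> inj_on c {0..<1}
     \<and> (\<exists>(m::nat) (ts::nat \<Rightarrow> real) (Ds::nat \<Rightarrow> real \<Rightarrow> real \<times> real).
          m \<ge> 1 \<and> ts 0 = 0 \<and> ts m = 1
        \<and> (\<forall>i<m. C2_piece c (ts i) (ts (Suc i)) (Ds i))
        \<and> (\<forall>i\<in>{1..<m}. \<not> (\<exists>r>0. Ds (i - 1) (ts i) = - r *\<^sub>R Ds i (ts i)))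
        \<and> \<not> (\<exists>r>0. Ds (m - 1) 1 = - r *\<^sub>R Ds 0 0))"

definition cross_section :: "(real \<times> real) set \<Rightarrow> (real \<times> real) set \<Rightarrow> bool" where
  "cross_section \<omega> \<gamma>D \<longleftrightarrow> bounded \<omega> \<and> open \<omega> \<and> connected \<omega> \<and>
     (\<exists>cs::(real \<Rightarrow> real \<times> real) list. cs \<noteq> [] \<and> (\<forall>c\<in>set cs. pw_C2_closed_curve c)
        \<and> (\<forall>i<length cs. \<forall>j<length cs. i \<noteq> j \<longrightarrow> (cs!i) ` {0..1} \<inter> (cs!j) ` {0..1} = {})
        \<and> frontier \<omega> = (\<Union>c\<in>set cs. c ` {0..1})
        \<and> (\<exists>arcs::(nat \<times> real \<times> real) list.
             (\<forall>(k, s, t)\<in>set arcs. k < length cs \<and> s < t)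
           \<and> \<gamma>D = (\<Union>(k, s, t)\<in>set arcs. (cs!k) ` {s..t})))"

definition cs_form :: "(real \<times> real) set \<Rightarrow> (real \<times> real \<Rightarrow> real) \<Rightarrow> (real \<times> real \<Rightarrow> real) \<Rightarrow> real" where
  "cs_form \<omega> u v = (LINT x:\<omega>|lborel. (\<Sum>e\<in>Basis. wd \<omega> e u x * wd \<omega> e v x))"

definition cs_ip :: "(real \<times> real) set \<Rightarrow> (real \<times> real \<Rightarrow> real) \<Rightarrow> (real \<times> real \<Rightarrow> real) \<Rightarrow> real" where
  "cs_ip \<omega> u v = (LINT x:\<omega>|lborel. u x * v x)"

definition frenet_curve :: "(real \<Rightarrow> real^3) \<Rightarrow> (real \<Rightarrow> real) \<Rightarrow> (real \<Rightarrow> real)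
    \<Rightarrow> (real \<Rightarrow> real^3) \<Rightarrow> (real \<Rightarrow> real^3) \<Rightarrow> (real \<Rightarrow> real^3) \<Rightarrow> bool" where
  "frenet_curve ell \<kappa> \<tau> T N B \<longleftrightarrow>
     (\<exists>d2 d3. (\<forall>s. (ell has_vector_derivative T s) (at s)) \<and> (\<forall>s. (T has_vector_derivative d2 s) (at s))
        \<and> (\<forall>s. (d2 has_vector_derivative d3 s) (at s)) \<and> continuous_on UNIV d3
        \<and> (\<forall>s. \<kappa> s = norm (d2 s)))
   \<and> inj ell \<and> continuous_on (range ell) (inv ell)
   \<and> (\<forall>s. norm (T s) = 1 \<and> norm (N s) = 1 \<and> T s \<bullet> N s = 0 \<and> B s = cross3 (T s) (N s))
   \<and> (\<forall>s. (T has_vector_derivative (\<kappa> s *\<^sub>R N s)) (at s))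
   \<and> (\<forall>s. (N has_vector_derivative (- \<kappa> s *\<^sub>R T s + \<tau> s *\<^sub>R B s)) (at s))
   \<and> (\<forall>s. (B has_vector_derivative (- \<tau> s *\<^sub>R N s)) (at s))"

definition tube_map :: "(real \<Rightarrow> real^3) \<Rightarrow> (real \<Rightarrow> real^3) \<Rightarrow> (real \<Rightarrow> real^3) \<Rightarrow> (real \<Rightarrow> real)
    \<Rightarrow> (real \<times> real) \<times> real \<Rightarrow> real^3" where
  "tube_map ell N B \<beta> p = (case p of ((x1, x2), x3) \<Rightarrow>
      ell x3 + x1 *\<^sub>R (cos (\<beta> x3) *\<^sub>R N x3 - sin (\<beta> x3) *\<^sub>R B x3)
           + x2 *\<^sub>R (sin (\<beta> x3) *\<^sub>R N x3 + cos (\<beta> x3) *\<^sub>R B x3))"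

definition gw :: "(real \<Rightarrow> real) \<Rightarrow> (real \<Rightarrow> real) \<Rightarrow> (real \<times> real) \<times> real \<Rightarrow> real" where
  "gw \<kappa> \<beta> p = (case p of ((x1, x2), x3) \<Rightarrow> 1 - (x1 * cos (\<beta> x3) + x2 * sin (\<beta> x3)) * \<kappa> x3)"

definition e1 :: "(real \<times> real) \<times> real" where "e1 = ((1, 0), 0)"
definition e2 :: "(real \<times> real) \<times> real" where "e2 = ((0, 1), 0)"
definition e3 :: "(real \<times> real) \<times> real" where "e3 = ((0, 0), 1)"

definition tube_form :: "(real \<times> real) set \<Rightarrow> (real \<Rightarrow> real) \<Rightarrow> (real \<Rightarrow> real)
    \<Rightarrow> ((real \<times> real) \<times> real \<Rightarrow> real) \<Rightarrow> ((real \<times> real) \<times> real \<Rightarrow> real) \<Rightarrow> real" where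
  "tube_form \<omega> \<kappa> \<beta> u v = (LINT x:(\<omega> \<times> UNIV)|lborel.
      gw \<kappa> \<beta> x * (wd (\<omega> \<times> UNIV) e1 u x * wd (\<omega> \<times> UNIV) e1 v x
                  + wd (\<omega> \<times> UNIV) e2 u x * wd (\<omega> \<times> UNIV) e2 v x)
      + wd (\<omega> \<times> UNIV) e3 u x * wd (\<omega> \<times> UNIV) e3 v x / gw \<kappa> \<beta> x)"

definition tube_ip :: "(real \<times> real) set \<Rightarrow> (real \<Rightarrow> real) \<Rightarrow> (real \<Rightarrow> real)
    \<Rightarrow> ((real \<times> real) \<times> real \<Rightarrow> real) \<Rightarrow> ((real \<times> real) \<times> real \<Rightarrow> real) \<Rightarrow> real" where
  "tube_ip \<omega> \<kappa> \<beta> u v = (LINT x:(\<omega> \<times> UNIV)|lborel. gw \<kappa> \<beta> x * u x * v x)"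

definition T_spectrum :: "(real \<times> real) set \<Rightarrow> (real \<times> real) set \<Rightarrow> (real \<Rightarrow> real) \<Rightarrow> (real \<Rightarrow> real) \<Rightarrow> real set" where
  "T_spectrum \<omega> \<gamma>D \<kappa> \<beta> = form_spectrum {f. L2_on (\<omega> \<times> UNIV) f} {u. H1_0_on (\<omega> \<times> UNIV) (\<gamma>D \<times> UNIV) u}
      (tube_form \<omega> \<kappa> \<beta>) (tube_ip \<omega> \<kappa> \<beta>)"

definition T_discrete_spectrum :: "(real \<times> real) set \<Rightarrow> (real \<times> real) set \<Rightarrow> (real \<Rightarrow> real) \<Rightarrow> (real \<Rightarrow> real) \<Rightarrow> real set" where
  "T_discrete_spectrum \<omega> \<gamma>D \<kappa> \<beta> = form_discrete_spectrum {f. L2_on (\<omega> \<times> UNIV) f} {u. H1_0_on (\<omega> \<times> UNIV) (\<gamma>D \<times> UNIV) u}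
      (tube_form \<omega> \<kappa> \<beta>) (tube_ip \<omega> \<kappa> \<beta>)"

end

theory Submission
  imports Defs
begin

text \<open>Since \<open>\<beta>\<close> removes the twist, the form of the trial function \<open>\<psi>\<^sub>1(x') \<phi>(x\<^sub>3)\<close> minus \<open>\<lambda>\<^sub>1\<close> times its
  weighted square norm is \<open>\<integral> g (|\<nabla>\<psi>\<^sub>1|\<^sup>2 - \<lambda>\<^sub>1 \<psi>\<^sub>1\<^sup>2) \<phi>\<^sup>2\<close> plus a term bounded by a multiple of \<open>\<integral> \<phi>'\<^sup>2\<close>.
  Testing the equation of \<open>\<psi>\<^sub>1\<close> against \<open>x\<^sub>j \<psi>\<^sub>1\<close> turns the first term into
  \<open>\<integral> \<kappa> (A\<^sub>1 cos \<beta> + A\<^sub>2 sin \<beta>) \<phi>\<^sup>2\<close>, and wide plateau functions \<open>\<phi>\<close> make the whole negative, so the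
  bottom of the spectrum lies below \<open>\<lambda>\<^sub>1\<close>.

  For compactly supported curvature the bottom is shown to be an isolated eigenvalue of finite
  multiplicity. Outside a bounded piece of the tube the form is at least \<open>\<lambda>\<^sub>1\<close>: testing the equation of
  the positive function \<open>\<psi>\<^sub>1\<close> against \<open>v\<^sup>2 / \<psi>\<^sub>1\<close> gives this transverse bound without compactness of
  the embedding. On the bounded piece the Poincare inequality on small boxes away from the lateral
  boundary, together with a sliding argument near it (which uses that the boundary has no cusps),
  bounds the square norm by finitely many functionals plus a small multiple of the form. Hence, for
  every \<open>\<lambda>' < \<lambda>\<^sub>1\<close>, the form exceeds \<open>\<lambda>'\<close> up to a finite-rank perturbation.\<close>

section \<open>Closed nonnegative forms\<close>

text \<open>The operator exists only through its form, on representatives rather than classes, so no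
  spectral theorem is available: every resolvent claim becomes a minimization problem for a
  semidefinite form on a complete domain. Below the infimum \<open>m\<close> of the Rayleigh
  quotient the shifted form is coercive; just above \<open>m\<close> the equation is solved
  separately on the eigenspace and on its orthogonal complement. The weight \<open>g\<close> is
  affine in the transverse variables, so only the zeroth and first moments of |\<nabla>psi|^2 - lam
  psi^2 over the cross-section enter. The zeroth vanishes by the eigenvalue equation and the first
  ones are \<open>- A1\<close> and \<open>- A2\<close>; with the minus sign in \<open>g\<close> this
  gives the bending integral. Weak derivatives are picked by choice and determined only almost
  everywhere, while estimates along segments require classical functions. The estimates are
  therefore proved for C1 test functions vanishing near the Dirichlet part and extended by density,
  and the relation \<open>hasgrad\<close> carries an explicit gradient in place of the chosen
  one.\<close>

definition lincomb :: "real \<Rightarrow> ('a \<Rightarrow> real) \<Rightarrow> real \<Rightarrow> ('a \<Rightarrow> real) \<Rightarrow> 'a \<Rightarrow> real" where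
  "lincomb c u d v = (\<lambda>x. c * u x + d * v x)"

abbreviation fdiff :: "('a \<Rightarrow> real) \<Rightarrow> ('a \<Rightarrow> real) \<Rightarrow> 'a \<Rightarrow> real" where
  "fdiff u v \<equiv> lincomb 1 u (- 1) v"

text \<open>The degenerate case \<open>c = 0\<close> is included because the forms are only
  semidefinite: there the quadratic is affine, and an affine function bounded below is
  constant.\<close>

lemma discriminant_le:
  fixes a b c :: real
  assumes "\<And>t. 0 \<le> a + 2 * t * b + t\<^sup>2 * c" "0 \<le> c"
  shows "b\<^sup>2 \<le> a * c"
proof (cases "c = 0")
  case True
  have "b = 0"
  proof (rule ccontr)
    assume "b \<noteq> 0"
    \<comment> \<open>At this parameter the affine function takes the value -1.\<close>
    then show False using assms(1)[of "- (a + 1) / (2 * b)"] True by (simp add: field_simps)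
  qed
  then show ?thesis using True by simp
next
  case False
  then have c: "c > 0" using assms by simp
  have "0 \<le> a + 2 * (- b / c) * b + (- b / c)\<^sup>2 * c" by (rule assms)
  also have "\<dots> = (a * c - b\<^sup>2) / c" using c by (simp add: field_simps power2_eq_square)
  finally show ?thesis using c by (simp add: field_simps)
qed

text \<open>Only semidefinite: functions equal almost everywhere are distinct elements of
  \<open>V\<close>, so \<open>B u u = 0\<close> does not force \<open>u\<close> to be zero.
  Linearity is therefore stated through \<open>lincomb\<close> on actual functions, never on
  equivalence classes.\<close>

locale semi_inner =
  fixes V :: "('a \<Rightarrow> real) set" and B :: "('a \<Rightarrow> real) \<Rightarrow> ('a \<Rightarrow> real) \<Rightarrow> real"
  assumes lincomb_in: "u \<in> V \<Longrightarrow> v \<in> V \<Longrightarrow> lincomb c u d v \<in> V"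
    and B_lin: "u \<in> V \<Longrightarrow> v \<in> V \<Longrightarrow> w \<in> V \<Longrightarrow> B (lincomb c u d v) w = c * B u w + d * B v w"
    and B_sym: "u \<in> V \<Longrightarrow> v \<in> V \<Longrightarrow> B u v = B v u"
    and B_nonneg: "u \<in> V \<Longrightarrow> 0 \<le> B u u"
begin

lemma B_lin_right:
  "u \<in> V \<Longrightarrow> v \<in> V \<Longrightarrow> w \<in> V \<Longrightarrow> B w (lincomb c u d v) = c * B w u + d * B w v"
  using B_lin B_sym lincomb_in by metis

lemma B_square:
  assumes "u \<in> V" "v \<in> V"
  shows "B (lincomb c u d v) (lincomb c u d v) = c\<^sup>2 * B u u + 2 * c * d * B u v + d\<^sup>2 * B v v"
proof -
  have "B (lincomb c u d v) (lincomb c u d v)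
      = c * B u (lincomb c u d v) + d * B v (lincomb c u d v)"
    using assms by (intro B_lin lincomb_in)
  then show ?thesis using assms B_sym[of v u]
    by (simp add: B_lin_right power2_eq_square algebra_simps)
qed

lemma Cauchy_Schwarz:
  assumes "u \<in> V" "v \<in> V"
  shows "(B u v)\<^sup>2 \<le> B u u * B v v"
proof (rule discriminant_le)
  fix t
  show "0 \<le> B u u + 2 * t * B u v + t\<^sup>2 * B v v"
    using B_nonneg[OF lincomb_in[OF assms, of 1 t]] B_square[OF assms, of 1 t] by simp
qed (use B_nonneg assms in auto)

text \<open>The parallelogram law with the nonnegative term of the sum dropped.\<close>

lemma fdiff_le:
  assumes "u \<in> V" "v \<in> V"
  shows "B (fdiff u v) (fdiff u v) \<le> 2 * (B u u + B v v)"
  using B_square[OF assms, of 1 "-1"] B_square[OF assms, of 1 1]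
    B_nonneg[OF lincomb_in[OF assms, of 1 1]] by simp

end

text \<open>Completeness for the seminorm: the limit is determined only up to elements of seminorm
  zero. Cauchy sequences and limits are measured by the square of the seminorm, which avoids roots
  throughout.\<close>

definition form_complete :: "('a \<Rightarrow> real) set \<Rightarrow> (('a \<Rightarrow> real) \<Rightarrow> ('a \<Rightarrow> real) \<Rightarrow> real) \<Rightarrow> bool" where
  "form_complete W B \<longleftrightarrow> (\<forall>u::nat \<Rightarrow> 'a \<Rightarrow> real. (\<forall>n. u n \<in> W)
     \<and> (\<forall>e>0. \<exists>N. \<forall>m\<ge>N. \<forall>n\<ge>N. B (fdiff (u m) (u n)) (fdiff (u m) (u n)) < e)
     \<longrightarrow> (\<exists>l\<in>W. (\<lambda>n. B (fdiff (u n) l) (fdiff (u n) l)) \<longlonglongrightarrow> 0))"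

lemma form_completeD:
  assumes "form_complete W B" "\<And>n. u n \<in> W"
    "\<And>e. e > 0 \<Longrightarrow> \<exists>N. \<forall>m\<ge>N. \<forall>n\<ge>N. B (fdiff (u m) (u n)) (fdiff (u m) (u n)) < e"
  obtains l where "l \<in> W" "(\<lambda>n. B (fdiff (u n) l) (fdiff (u n) l)) \<longlonglongrightarrow> 0"
  using assms unfolding form_complete_def by blast

context semi_inner
begin

lemma tendsto_B:
  assumes "\<And>n. u n \<in> V" "l \<in> V" "w \<in> V" "(\<lambda>n. B (fdiff (u n) l) (fdiff (u n) l)) \<longlonglongrightarrow> 0"
  shows "(\<lambda>n. B (u n) w) \<longlonglongrightarrow> B l w"
proof -
  have "(\<lambda>n. (B (u n) w - B l w)\<^sup>2) \<longlonglongrightarrow> 0"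
  proof (rule tendsto_sandwich[OF always_eventually always_eventually tendsto_const])
    show "\<forall>n. 0 \<le> (B (u n) w - B l w)\<^sup>2" by simp
    show "\<forall>n. (B (u n) w - B l w)\<^sup>2 \<le> B (fdiff (u n) l) (fdiff (u n) l) * B w w"
    proof
      fix n
      show "(B (u n) w - B l w)\<^sup>2 \<le> B (fdiff (u n) l) (fdiff (u n) l) * B w w"
        using Cauchy_Schwarz[OF lincomb_in[OF assms(1)[of n] assms(2), of 1 "-1"] assms(3)]
        by (simp add: B_lin assms)
    qed
    show "(\<lambda>n. B (fdiff (u n) l) (fdiff (u n) l) * B w w) \<longlonglongrightarrow> 0"
      using tendsto_mult_left_zero[OF assms(4)] by simp
  qed
  then have "(\<lambda>n. B (u n) w - B l w) \<longlonglongrightarrow> 0"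
    by simp
  then show ?thesis by (simp add: LIM_zero_iff)
qed

lemma tendsto_B_square:
  assumes "\<And>n. u n \<in> V" "l \<in> V" "(\<lambda>n. B (fdiff (u n) l) (fdiff (u n) l)) \<longlonglongrightarrow> 0"
  shows "(\<lambda>n. B (u n) (u n)) \<longlonglongrightarrow> B l l"
proof -
  have eq: "B (u n) (u n) = B (fdiff (u n) l) (fdiff (u n) l) + 2 * B (u n) l - B l l" for n
    using B_square[OF assms(1)[of n] assms(2), of 1 "-1"] by simp
  have "(\<lambda>n. B (fdiff (u n) l) (fdiff (u n) l) + 2 * B (u n) l - B l l) \<longlonglongrightarrow> 0 + 2 * B l l - B l l"
    by (intro tendsto_intros assms(3) tendsto_B[OF assms(1,2) assms(2) assms(3)])
  then show ?thesis using eq by simp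
qed

text \<open>The direct method for the functional \<open>B v v - 2 * F v\<close>. The bound on
  \<open>F\<close> makes it bounded below, the parallelogram law makes every minimizing sequence
  Cauchy, and the limit satisfies the Euler equation \<open>B l w = F w\<close>.\<close>

theorem riesz:
  assumes W: "W \<subseteq> V" "W \<noteq> {}" and W_lin: "\<And>u v c d. u \<in> W \<Longrightarrow> v \<in> W \<Longrightarrow> lincomb c u d v \<in> W"
    and compl: "form_complete W B"
    and F_lin: "\<And>u v c d. u \<in> W \<Longrightarrow> v \<in> W \<Longrightarrow> F (lincomb c u d v) = c * F u + d * F v"
    and F_bound: "\<And>v. v \<in> W \<Longrightarrow> (F v)\<^sup>2 \<le> K * B v v"
  shows "\<exists>u\<in>W. \<forall>v\<in>W. B u v = F v"
proof -
  define J where "J v = B v v - 2 * F v" for v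
  \<comment> \<open>The bound \<open>K\<close> may be zero or negative; a positive constant allows
    it to be cancelled in the lower estimate for \<open>J\<close>.\<close>
  define K' where "K' = max K 1"
  have WV: "v \<in> V" if "v \<in> W" for v using that W by auto
  have J_ge: "- K' \<le> J v" if "v \<in> W" for v
  proof -
    have "(F v)\<^sup>2 \<le> K' * B v v"
      using F_bound[OF that] mult_right_mono[of K K' "B v v"] B_nonneg[OF WV[OF that]]
      by (simp add: K'_def)
    moreover have "0 \<le> (F v - K')\<^sup>2" by simp
    ultimately have "0 \<le> K' * (B v v - 2 * F v + K')"
      by (simp add: power2_eq_square algebra_simps)
    then show ?thesis
      unfolding J_def K'_def by (simp add: zero_le_mult_iff)
  qed
  define j where "j = Inf (J ` W)"
  have bdd: "bdd_below (J ` W)" using J_ge by (intro bdd_belowI2)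
  have j_le: "j \<le> J v" if "v \<in> W" for v
    unfolding j_def by (rule cInf_lower[OF _ bdd]) (use that in auto)
  have "\<exists>v\<in>W. J v < j + 1 / real (Suc n)" for n
  proof -
    have "\<exists>x\<in>J ` W. x < j + 1 / real (Suc n)"
      by (rule cInf_lessD) (use W in \<open>auto simp: j_def\<close>)
    then show ?thesis by auto
  qed
  then obtain v where v: "\<And>n. v n \<in> W" "\<And>n. J (v n) < j + 1 / real (Suc n)" by metis
  \<comment> \<open>The midpoint lies in \<open>W\<close>, so \<open>J\<close> there is at least
    \<open>j\<close>; the parallelogram law turns this into a bound for the distance of
    \<open>u\<close> and \<open>w\<close> by their defects from the infimum.\<close>
  have mid: "B (fdiff u w) (fdiff u w) \<le> 2 * (J u - j) + 2 * (J w - j)" if "u \<in> W" "w \<in> W" for u w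
  proof -
    let ?m = "lincomb (1/2) u (1/2) w"
    have "J ?m = (1/4) * B u u + (1/2) * B u w + (1/4) * B w w - F u - F w"
      unfolding J_def using that
      by (simp add: B_square WV F_lin power2_eq_square)
    moreover have "j \<le> J ?m" by (intro j_le W_lin that)
    moreover have "B (fdiff u w) (fdiff u w) = B u u - 2 * B u w + B w w"
      using that by (simp add: B_square WV)
    ultimately show ?thesis unfolding J_def by simp
  qed
  have cauchy: "\<exists>N. \<forall>m\<ge>N. \<forall>n\<ge>N. B (fdiff (v m) (v n)) (fdiff (v m) (v n)) < e" if e: "e > 0" for e
  proof -
    obtain N where N: "1 / real (Suc N) < e / 4"
      using nat_approx_posE[of "e/4"] e by auto
    have small: "1 / real (Suc n) < e / 4" if "n \<ge> N" for n
      using N that by (smt (verit) frac_le of_nat_0_less_iff of_nat_mono zero_less_Suc Suc_le_mono)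
    have "B (fdiff (v m) (v n)) (fdiff (v m) (v n)) < e" if "m \<ge> N" "n \<ge> N" for m n
    proof -
      have "J (v m) - j < e / 4" "J (v n) - j < e / 4"
        using v(2)[of m] v(2)[of n] small[OF that(1)] small[OF that(2)] by auto
      then have "2 * (J (v m) - j) + 2 * (J (v n) - j) < e" by simp
      then show ?thesis by (rule le_less_trans[OF mid[OF v(1) v(1)]])
    qed
    then show ?thesis by blast
  qed
  obtain l where l: "l \<in> W" "(\<lambda>n. B (fdiff (v n) l) (fdiff (v n) l)) \<longlonglongrightarrow> 0"
    using form_completeD[OF compl v(1) cauchy] by blast
  have "B l w = F w" if w: "w \<in> W" for w
  proof -
    \<comment> \<open>Along the line through \<open>v n\<close> in direction \<open>w\<close> the
      functional drops by at most 1/(n+1). The discriminant of this quadratic bounds its linear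
      coefficient, so the Euler equation holds approximately at \<open>v n\<close> and exactly in
      the limit.\<close>
    have le: "(B (v n) w - F w)\<^sup>2 \<le> (1 / real (Suc n)) * B w w" for n
    proof (rule discriminant_le)
      fix t
      have "j \<le> J (lincomb 1 (v n) t w)" by (intro j_le W_lin v w)
      also have "\<dots> = J (v n) + 2 * t * (B (v n) w - F w) + t\<^sup>2 * B w w"
        unfolding J_def using v(1)[of n] w by (simp add: B_square WV F_lin algebra_simps)
      finally show "0 \<le> 1 / real (Suc n) + 2 * t * (B (v n) w - F w) + t\<^sup>2 * B w w"
        using v(2)[of n] by linarith
    qed (use B_nonneg WV w in auto)
    have "(\<lambda>n. (B (v n) w - F w)\<^sup>2) \<longlonglongrightarrow> (B l w - F w)\<^sup>2"
      by (intro tendsto_intros tendsto_B l) (use WV v w l in auto)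
    moreover have "(\<lambda>n. (1 / real (Suc n)) * B w w) \<longlonglongrightarrow> 0"
      using LIMSEQ_inverse_real_of_nat by (intro tendsto_mult_left_zero) (simp add: inverse_eq_divide)
    ultimately have "(B l w - F w)\<^sup>2 \<le> 0"
      using le by (intro LIMSEQ_le) auto
    then show ?thesis by simp
  qed
  then show ?thesis using l(1) by blast
qed

end

text \<open>Passes completeness from the graph norm \<open>a + ip\<close> to a coercive shifted
  form, and on the eigenspace to \<open>ip\<close> alone.\<close>

lemma form_complete_equiv:
  assumes "form_complete W B1" and W_lin: "\<And>u v c d. u \<in> W \<Longrightarrow> v \<in> W \<Longrightarrow> lincomb c u d v \<in> W"
    and K: "K > 0" and le1: "\<And>u. u \<in> W \<Longrightarrow> B1 u u \<le> K * B2 u u" and le2: "\<And>u. u \<in> W \<Longrightarrow> B2 u u \<le> K * B1 u u"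
    and nn: "\<And>u. u \<in> W \<Longrightarrow> 0 \<le> B2 u u"
  shows "form_complete W B2"
  unfolding form_complete_def
proof (intro allI impI, elim conjE)
  fix u :: "nat \<Rightarrow> 'a \<Rightarrow> real"
  assume u: "\<forall>n. u n \<in> W"
    and c: "\<forall>e>0. \<exists>N. \<forall>m\<ge>N. \<forall>n\<ge>N. B2 (fdiff (u m) (u n)) (fdiff (u m) (u n)) < e"
  have "\<exists>N. \<forall>m\<ge>N. \<forall>n\<ge>N. B1 (fdiff (u m) (u n)) (fdiff (u m) (u n)) < e" if e: "e > 0" for e
  proof -
    obtain N where N: "\<And>m n. m \<ge> N \<Longrightarrow> n \<ge> N \<Longrightarrow> B2 (fdiff (u m) (u n)) (fdiff (u m) (u n)) < e / K"
      using c e K by (metis divide_pos_pos)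
    have "B1 (fdiff (u m) (u n)) (fdiff (u m) (u n)) < e" if "m \<ge> N" "n \<ge> N" for m n
    proof -
      have "B1 (fdiff (u m) (u n)) (fdiff (u m) (u n)) \<le> K * B2 (fdiff (u m) (u n)) (fdiff (u m) (u n))"
        using u by (intro le1 W_lin) auto
      also have "\<dots> < K * (e / K)" using N[OF that] K by (intro mult_strict_left_mono)
      finally show ?thesis using K by simp
    qed
    then show ?thesis by blast
  qed
  then obtain l where l: "l \<in> W" "(\<lambda>n. B1 (fdiff (u n) l) (fdiff (u n) l)) \<longlonglongrightarrow> 0"
    using form_completeD[OF assms(1), of u] u by blast
  have "(\<lambda>n. B2 (fdiff (u n) l) (fdiff (u n) l)) \<longlonglongrightarrow> 0"
  proof (rule tendsto_sandwich[OF always_eventually always_eventually tendsto_const])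
    show "\<forall>n. 0 \<le> B2 (fdiff (u n) l) (fdiff (u n) l)" using u l by (intro allI nn W_lin) auto
    show "\<forall>n. B2 (fdiff (u n) l) (fdiff (u n) l) \<le> K * B1 (fdiff (u n) l) (fdiff (u n) l)"
      using u l by (intro allI le2 W_lin) auto
    show "(\<lambda>n. K * B1 (fdiff (u n) l) (fdiff (u n) l)) \<longlonglongrightarrow> 0"
      using tendsto_mult_right_zero[OF l(2)] by simp
  qed
  then show "\<exists>l\<in>W. (\<lambda>n. B2 (fdiff (u n) l) (fdiff (u n) l)) \<longlonglongrightarrow> 0" using l by blast
qed

text \<open>Applied to the eigenspace and to its orthogonal complement, both cut out of the form
  domain by equations that survive limits in the graph norm.\<close>

lemma form_complete_closed:
  assumes "form_complete D B" "W \<subseteq> D"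
    and cl: "\<And>u l. (\<And>n. u n \<in> W) \<Longrightarrow> l \<in> D \<Longrightarrow> (\<lambda>n. B (fdiff (u n) l) (fdiff (u n) l)) \<longlonglongrightarrow> 0 \<Longrightarrow> l \<in> W"
  shows "form_complete W B"
  unfolding form_complete_def
proof (intro allI impI, elim conjE)
  fix u :: "nat \<Rightarrow> 'a \<Rightarrow> real"
  assume u: "\<forall>n. u n \<in> W"
    and c: "\<forall>e>0. \<exists>N. \<forall>m\<ge>N. \<forall>n\<ge>N. B (fdiff (u m) (u n)) (fdiff (u m) (u n)) < e"
  obtain l where l: "l \<in> D" "(\<lambda>n. B (fdiff (u n) l) (fdiff (u n) l)) \<longlonglongrightarrow> 0"
    using form_completeD[OF assms(1), of u] u c assms(2) by blast
  then show "\<exists>l\<in>W. (\<lambda>n. B (fdiff (u n) l) (fdiff (u n) l)) \<longlonglongrightarrow> 0" using cl[of u l] u by blast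
qed

text \<open>Bolzano-Weierstrass one coordinate at a time; refining the subsequence keeps the earlier
  coordinates convergent. The coordinates will be the finitely many functionals of the finite-rank
  bound, evaluated along a minimizing sequence.\<close>

lemma bounded_coordinates_subseq:
  fixes x :: "nat \<Rightarrow> nat \<Rightarrow> real"
  assumes "\<And>i. i < k \<Longrightarrow> bounded (range (x i))"
  shows "\<exists>r. strict_mono (r :: nat \<Rightarrow> nat) \<and> (\<forall>i<k. convergent (\<lambda>n. x i (r n)))"
  using assms
proof (induction k)
  case 0
  show ?case by (intro exI[of _ id]) (auto simp: strict_mono_def)
next
  case (Suc k)
  then obtain r where r: "strict_mono (r :: nat \<Rightarrow> nat)" "\<forall>i<k. convergent (\<lambda>n. x i (r n))" by force
  have "bounded (range (\<lambda>n. x k (r n)))"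
    by (rule bounded_subset[OF Suc.prems[of k]]) auto
  then obtain l s where s: "strict_mono (s :: nat \<Rightarrow> nat)" "((\<lambda>n. x k (r n)) \<circ> s) \<longlonglongrightarrow> l"
    using bounded_imp_convergent_subsequence by blast
  have "convergent (\<lambda>n. x i (r (s n)))" if "i < Suc k" for i
  proof (cases "i = k")
    case True
    then show ?thesis using s by (auto simp: convergent_def o_def)
  next
    case False
    then have "convergent (\<lambda>n. x i (r n))" using that r by simp
    then show ?thesis using convergent_subseq_convergent[OF _ s(1), of "\<lambda>n. x i (r n)"] by (simp add: o_def)
  qed
  then show ?case using strict_mono_o[OF r(1) s(1)] by (intro exI[of _ "r \<circ> s"]) (simp add: o_def)
qed

text \<open>Completeness of \<open>D\<close> in the graph norm \<open>a + ip\<close> expresses that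
  the form is closed.\<close>

locale nonneg_form = H: semi_inner H ip + D: semi_inner D a
  for H D :: "('a \<Rightarrow> real) set" and a ip +
  assumes D_sub: "D \<subseteq> H" and D_ne: "D \<noteq> {}"
    and D_complete: "form_complete D (\<lambda>u v. a u v + ip u v)"
begin

lemma in_H: "u \<in> D \<Longrightarrow> u \<in> H"
  using D_sub by auto

lemma semi_inner_shift:
  assumes "W \<subseteq> D" "\<And>u v c d. u \<in> W \<Longrightarrow> v \<in> W \<Longrightarrow> lincomb c u d v \<in> W"
    "\<And>u. u \<in> W \<Longrightarrow> z * ip u u \<le> a u u"
  shows "semi_inner W (\<lambda>u v. a u v - z * ip u v)"
proof
  fix u v w c d assume "u \<in> W" "v \<in> W" "w \<in> W"
  then have "u \<in> D" "v \<in> D" "w \<in> D" using assms(1) by auto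
  then show "a (lincomb c u d v) w - z * ip (lincomb c u d v) w
      = c * (a u w - z * ip u w) + d * (a v w - z * ip v w)"
    by (simp add: D.B_lin H.B_lin in_H algebra_simps)
next
  fix u v assume "u \<in> W" "v \<in> W"
  then have "u \<in> D" "v \<in> D" using assms(1) by auto
  then show "a u v - z * ip u v = a v u - z * ip v u"
    using D.B_sym H.B_sym in_H by metis
qed (use assms in auto)

lemma ip_tendsto:
  assumes "\<And>n. u n \<in> D" "l \<in> D" "(\<lambda>n. a (fdiff (u n) l) (fdiff (u n) l) + ip (fdiff (u n) l) (fdiff (u n) l)) \<longlonglongrightarrow> 0"
  shows "(\<lambda>n. ip (fdiff (u n) l) (fdiff (u n) l)) \<longlonglongrightarrow> 0" (is ?A)
    and "(\<lambda>n. a (fdiff (u n) l) (fdiff (u n) l)) \<longlonglongrightarrow> 0" (is ?B)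
proof -
  have d: "fdiff (u n) l \<in> D" for n by (intro D.lincomb_in assms)
  show ?A
    by (rule tendsto_sandwich[OF always_eventually always_eventually tendsto_const assms(3)])
      (use D.B_nonneg[OF d] H.B_nonneg[OF in_H[OF d]] in auto)
  show ?B
    by (rule tendsto_sandwich[OF always_eventually always_eventually tendsto_const assms(3)])
      (use D.B_nonneg[OF d] H.B_nonneg[OF in_H[OF d]] in auto)
qed

text \<open>The form is symmetric, so coercivity makes the shifted form itself an inner product
  equivalent to the graph norm, and the Riesz theorem solves the equation. The subspace
  \<open>W\<close> is left free because the lemma serves both the whole domain and the orthogonal
  complement of the eigenspace.\<close>

lemma lax_milgram:
  assumes W: "W \<subseteq> D" "W \<noteq> {}" "\<And>u v c d. u \<in> W \<Longrightarrow> v \<in> W \<Longrightarrow> lincomb c u d v \<in> W"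
    and compl: "form_complete W (\<lambda>u v. a u v + ip u v)"
    and c: "c > 0" "\<And>u. u \<in> W \<Longrightarrow> c * (a u u + ip u u) \<le> a u u - z * ip u u"
    and f: "f \<in> H"
  shows "\<exists>u\<in>W. \<forall>v\<in>W. a u v - z * ip u v = ip f v"
proof -
  have nn: "0 \<le> a u u" "0 \<le> ip u u" if "u \<in> W" for u
    using that W D.B_nonneg H.B_nonneg in_H by auto
  have coer: "z * ip u u \<le> a u u" "c * ip u u \<le> a u u - z * ip u u" if "u \<in> W" for u
  proof -
    have "0 \<le> c * a u u" "0 \<le> c * ip u u" using nn[OF that] c by simp_all
    then show "z * ip u u \<le> a u u" "c * ip u u \<le> a u u - z * ip u u"
      using c(2)[OF that] by (simp_all add: algebra_simps)
  qed
  interpret q: semi_inner W "\<lambda>u v. a u v - z * ip u v"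
    by (rule semi_inner_shift[OF W(1,3) coer(1)])
  \<comment> \<open>One constant for both directions of the norm equivalence: coercivity gives
    \<open>1 / c\<close>, boundedness of the shifted form gives
    \<open>1 + \<bar>z\<bar>\<close>.\<close>
  define K where "K = max (1 / c) (1 + \<bar>z\<bar>)"
  have K: "K > 0" unfolding K_def using c by (simp add: less_max_iff_disj)
  have complq: "form_complete W (\<lambda>u v. a u v - z * ip u v)"
  proof (rule form_complete_equiv[OF compl W(3) K])
    fix u assume u: "u \<in> W"
    have "a u u + ip u u \<le> (1 / c) * (a u u - z * ip u u)"
      using c(2)[OF u] c(1) by (simp add: field_simps)
    also have "\<dots> \<le> K * (a u u - z * ip u u)"
      using coer[OF u] by (intro mult_right_mono) (auto simp: K_def)
    finally show "a u u + ip u u \<le> K * (a u u - z * ip u u)" .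
    have "- z * ip u u \<le> \<bar>z\<bar> * ip u u" using nn[OF u] by (intro mult_right_mono) auto
    moreover have "0 \<le> \<bar>z\<bar> * a u u" using nn[OF u] by simp
    moreover have "(1 + \<bar>z\<bar>) * (a u u + ip u u) = a u u + ip u u + \<bar>z\<bar> * a u u + \<bar>z\<bar> * ip u u"
      by (simp add: algebra_simps)
    ultimately have "a u u - z * ip u u \<le> (1 + \<bar>z\<bar>) * (a u u + ip u u)"
      using nn[OF u] by linarith
    also have "\<dots> \<le> K * (a u u + ip u u)"
      using nn[OF u] by (intro mult_right_mono) (auto simp: K_def)
    finally show "a u u - z * ip u u \<le> K * (a u u + ip u u)" .
    show "0 \<le> a u u - z * ip u u" using coer[OF u] by simp
  qed
  show ?thesis
  proof (rule q.riesz[OF order_refl W(2,3) complq])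
    show "ip f (lincomb c u d v) = c * ip f u + d * ip f v" if "u \<in> W" "v \<in> W" for u v c d
      using that W(1) f in_H by (intro H.B_lin_right) auto
    show "(ip f v)\<^sup>2 \<le> (ip f f / c) * (a v v - z * ip v v)" if v: "v \<in> W" for v
    proof -
      have "(ip f v)\<^sup>2 \<le> ip f f * ip v v"
        using v W(1) f in_H by (intro H.Cauchy_Schwarz) auto
      also have "\<dots> \<le> ip f f * ((a v v - z * ip v v) / c)"
        using coer(2)[OF v] c(1) H.B_nonneg[OF f] by (intro mult_left_mono) (auto simp: field_simps)
      finally show ?thesis by simp
    qed
  qed
qed

lemma resolventI:
  assumes ex: "\<And>f. f \<in> H \<Longrightarrow> \<exists>u\<in>D. \<forall>v\<in>D. a u v - z * ip u v = ip f v"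
    and bd: "\<And>f u. f \<in> H \<Longrightarrow> u \<in> D \<Longrightarrow> (\<forall>v\<in>D. a u v - z * ip u v = ip f v) \<Longrightarrow> ip u u \<le> C * ip f f"
  shows "z \<in> form_resolvent_set H D a ip"
proof -
  have "ip u u = 0" if u: "u \<in> D" and e: "\<forall>v\<in>D. a u v - z * ip u v = 0" for u
  proof -
    \<comment> \<open>The zero right-hand side, written as a combination of \<open>u\<close> so that
      membership in \<open>H\<close> follows from closure under \<open>lincomb\<close>. The
      resolvent bound for it is the uniqueness clause.\<close>
    let ?f = "lincomb 0 u 0 u"
    have f: "?f \<in> H" and z: "v \<in> D \<Longrightarrow> ip ?f v = 0" "ip ?f ?f = 0" for v
      using u in_H by (simp_all add: H.lincomb_in H.B_lin)
    have "ip u u \<le> C * ip ?f ?f" by (rule bd[OF f u]) (use e z in auto)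
    then show ?thesis using z H.B_nonneg[OF in_H[OF u]] by simp
  qed
  then show ?thesis unfolding form_resolvent_set_def using ex bd by blast
qed

text \<open>Cauchy-Schwarz bounds the right-hand side by the product of the norms of
  \<open>f\<close> and \<open>u\<close>, and one factor of the norm of \<open>u\<close>
  cancels.\<close>

lemma ip_bound_of_weak:
  assumes c: "c > 0" "c * ip u u \<le> ip f u" and u: "u \<in> H" and f: "f \<in> H"
  shows "ip u u \<le> ip f f / c\<^sup>2"
proof (cases "ip u u = 0")
  case True
  then show ?thesis using H.B_nonneg[OF f] by simp
next
  case False
  then have p: "ip u u > 0" using H.B_nonneg[OF u] by simp
  have "(c * ip u u)\<^sup>2 \<le> (ip f u)\<^sup>2" using c p by (intro power_mono) auto
  also have "\<dots> \<le> ip f f * ip u u" by (rule H.Cauchy_Schwarz[OF f u])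
  finally have "c\<^sup>2 * ip u u \<le> ip f f" using p by (simp add: power2_eq_square)
  then show ?thesis using c by (simp add: field_simps)
qed

lemma coercive_resolvent:
  assumes c: "c > 0" "\<And>u. u \<in> D \<Longrightarrow> c * (a u u + ip u u) \<le> a u u - z * ip u u"
  shows "z \<in> form_resolvent_set H D a ip"
proof (rule resolventI)
  show "\<exists>u\<in>D. \<forall>v\<in>D. a u v - z * ip u v = ip f v" if "f \<in> H" for f
    by (rule lax_milgram[OF order_refl D_ne D.lincomb_in D_complete c that])
  fix f u assume f: "f \<in> H" and u: "u \<in> D" and e: "\<forall>v\<in>D. a u v - z * ip u v = ip f v"
  have "0 \<le> c * a u u" using D.B_nonneg[OF u] c by simp
  then have "c * ip u u \<le> ip f u" using c(2)[OF u] e u by (simp add: algebra_simps)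
  then show "ip u u \<le> (1 / c\<^sup>2) * ip f f"
    using ip_bound_of_weak[OF c(1) _ in_H[OF u] f] by simp
qed

lemma coercive_shift:
  assumes m: "m \<ge> 0" "z < m" and W: "W \<subseteq> D" "\<And>u. u \<in> W \<Longrightarrow> m * ip u u \<le> a u u"
  obtains c where "c > 0" "\<And>u. u \<in> W \<Longrightarrow> c * (a u u + ip u u) \<le> a u u - z * ip u u"
proof
  \<comment> \<open>Writing \<open>a\<close> as \<open>(1 - c) * a + c * a\<close> and bounding the
    first part by \<open>m\<close> leaves the two requirements \<open>c \<le> 1\<close> and
    \<open>c * (1 + m) \<le> m - z\<close>.\<close>
  define c where "c = min (1/2) ((m - z) / (1 + m))"
  show c: "c > 0" using m by (simp add: c_def)
  fix u assume u: "u \<in> W"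
  have c1: "c \<le> 1" "c * (1 + m) \<le> m - z"
  proof -
    have "c \<le> (m - z) / (1 + m)" by (simp add: c_def)
    then show "c * (1 + m) \<le> m - z" using m by (simp add: pos_le_divide_eq)
  qed (simp add: c_def)
  have nn: "0 \<le> ip u u" using u W in_H H.B_nonneg by auto
  have "(1 - c) * (m * ip u u) \<le> (1 - c) * a u u" using W(2)[OF u] c1 by (intro mult_left_mono) auto
  moreover have "c * (1 + m) * ip u u \<le> (m - z) * ip u u" using c1 nn by (intro mult_right_mono) auto
  ultimately show "c * (a u u + ip u u) \<le> a u u - z * ip u u" by (simp add: algebra_simps)
qed

end

section \<open>The bottom of the spectrum of a closed form\<close>

text \<open>\<open>m\<close> is the infimum of the Rayleigh quotient, possibly not attained. The
  near-minimizers are normalized so that they stay away from seminorm zero.\<close>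

locale form_bottom = nonneg_form +
  fixes m
  assumes m_nonneg: "0 \<le> m" and m_le: "u \<in> D \<Longrightarrow> m * ip u u \<le> a u u"
    and m_approx: "e > 0 \<Longrightarrow> \<exists>u\<in>D. ip u u = 1 \<and> a u u < m + e"
begin

lemma below_resolvent:
  assumes "z < m"
  shows "z \<in> form_resolvent_set H D a ip"
proof -
  obtain c where "c > 0" "\<And>u. u \<in> D \<Longrightarrow> c * (a u u + ip u u) \<le> a u u - z * ip u u"
    using coercive_shift[OF m_nonneg assms order_refl m_le] by blast
  then show ?thesis by (rule coercive_resolvent)
qed

sublocale q: semi_inner D "\<lambda>u v. a u v - m * ip u v"
  by (rule semi_inner_shift[OF order_refl D.lincomb_in m_le])

text \<open>If \<open>m\<close> were a resolvent point, a normalized near-minimizer \<open>u\<close>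
  would be the right-hand side of a solvable equation with solution \<open>w\<close>. Testing with
  \<open>u\<close> gives the value 1, but Cauchy-Schwarz for the semidefinite form
  \<open>a - m ip\<close> bounds it by the defect of \<open>u\<close> times a quantity controlled by
  the resolvent bound.\<close>

lemma bottom_in_spectrum: "m \<in> form_spectrum H D a ip"
proof (rule ccontr)
  assume "m \<notin> form_spectrum H D a ip"
  then have "m \<in> form_resolvent_set H D a ip" by (simp add: form_spectrum_def)
  then obtain C where ex: "\<And>f. f \<in> H \<Longrightarrow> \<exists>u\<in>D. \<forall>v\<in>D. a u v - m * ip u v = ip f v"
    and C: "\<And>f u. f \<in> H \<Longrightarrow> u \<in> D \<Longrightarrow> (\<forall>v\<in>D. a u v - m * ip u v = ip f v) \<Longrightarrow> ip u u \<le> C * ip f f"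
    unfolding form_resolvent_set_def by blast
  \<comment> \<open>Chosen so that \<open>(1 + \<bar>C\<bar>) * e\<close> is 1/2. The absolute value
    allows for any sign of the resolvent constant.\<close>
  define e where "e = 1 / (2 * (1 + \<bar>C\<bar>))"
  have e: "e > 0" by (simp add: e_def)
  obtain u where u: "u \<in> D" "ip u u = 1" "a u u < m + e" using m_approx[OF e] by blast
  obtain w where w: "w \<in> D" "\<forall>v\<in>D. a w v - m * ip w v = ip u v" using ex[OF in_H[OF u(1)]] by blast
  have ww: "ip w w \<le> C" using C[OF in_H[OF u(1)] w] u by simp
  have "(ip u w)\<^sup>2 \<le> C" using H.Cauchy_Schwarz[OF in_H[OF u(1)] in_H[OF w(1)]] u ww by simp
  also have "C \<le> (1 + \<bar>C\<bar>)\<^sup>2"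
  proof -
    have "C \<le> \<bar>C\<bar>" "0 \<le> C * C" "(1 + \<bar>C\<bar>)\<^sup>2 = 1 + C * C + 2 * \<bar>C\<bar>"
      by (auto simp: power2_eq_square algebra_simps)
    then show ?thesis by linarith
  qed
  finally have uw: "ip u w \<le> 1 + \<bar>C\<bar>" by (rule power2_le_imp_le) simp
  have "1 = (a w u - m * ip w u)\<^sup>2" using w u by simp
  also have "\<dots> \<le> (a w w - m * ip w w) * (a u u - m * ip u u)" by (rule q.Cauchy_Schwarz[OF w(1) u(1)])
  also have "\<dots> = ip u w * (a u u - m)" using w u by simp
  also have "\<dots> \<le> (1 + \<bar>C\<bar>) * e"
    using uw u m_le[OF u(1)] by (intro mult_mono) auto
  also have "\<dots> < 1" by (simp add: e_def)
  finally show False by simp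
qed

lemma Inf_spectrum: "Inf (form_spectrum H D a ip) = m"
proof (rule cInf_eq_minimum[OF bottom_in_spectrum])
  fix z assume "z \<in> form_spectrum H D a ip"
  then show "m \<le> z" using below_resolvent[of z] by (force simp: form_spectrum_def)
qed

end

section \<open>An isolated eigenvalue of finite multiplicity from a lower bound up to finite
  rank\<close>

locale form_discrete_bottom = form_bottom +
  fixes k :: nat and f :: "nat \<Rightarrow> 'a \<Rightarrow> real" and C lam'
  assumes f_in: "i < k \<Longrightarrow> f i \<in> H" and C_nonneg: "0 \<le> C" and lam': "m < lam'"
    and finite_rank: "u \<in> D \<Longrightarrow> lam' * ip u u \<le> a u u + C * (\<Sum>i<k. (ip (f i) u)\<^sup>2)"
begin

definition "E = {u \<in> D. \<forall>v\<in>D. a u v = m * ip u v}"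

lemma E_sub: "E \<subseteq> D" and E_eq: "u \<in> E \<Longrightarrow> v \<in> D \<Longrightarrow> a u v = m * ip u v"
  by (auto simp: E_def)

lemma E_ne: "E \<noteq> {}"
proof -
  obtain u where u: "u \<in> D" using D_ne by blast
  have "lincomb 0 u 0 u \<in> E"
    using u in_H by (simp add: E_def D.lincomb_in D.B_lin H.B_lin)
  then show ?thesis by blast
qed

lemma E_lin: "u \<in> E \<Longrightarrow> v \<in> E \<Longrightarrow> lincomb c u d v \<in> E"
  using in_H by (simp add: E_def D.lincomb_in D.B_lin H.B_lin algebra_simps)

text \<open>By Cauchy-Schwarz for the semidefinite form \<open>a - m ip\<close>, a vector on which
  this form vanishes is orthogonal to all of \<open>D\<close>. Minimizers of the Rayleigh quotient
  are thus eigenvectors.\<close>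

lemma E_I:
  assumes u: "u \<in> D" and "a u u \<le> m * ip u u"
  shows "u \<in> E"
proof -
  have z: "a u u - m * ip u u = 0" using assms m_le[OF u] by simp
  have "(a u v - m * ip u v)\<^sup>2 \<le> 0" if "v \<in> D" for v
    using q.Cauchy_Schwarz[OF u that] z by simp
  then show ?thesis using u by (simp add: E_def)
qed

text \<open>The finite-rank inequality replaces compactness. Along a subsequence the functionals
  converge; the difference of two members then has small \<open>a - m ip\<close> by the
  parallelogram law and small functionals, so the factor \<open>lam' - m\<close> forces its norm to
  be small. The subsequence is Cauchy in the graph norm and its limit is a normalized
  minimizer.\<close>

lemma minimizing_subseq:
  assumes u: "\<And>n. u n \<in> D" "\<And>n. ip (u n) (u n) = 1" "(\<lambda>n. a (u n) (u n)) \<longlonglongrightarrow> m"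
  obtains r l where "strict_mono (r :: nat \<Rightarrow> nat)" "l \<in> E" "ip l l = 1"
    "(\<lambda>n. ip (fdiff (u (r n)) l) (fdiff (u (r n)) l)) \<longlonglongrightarrow> 0"
proof -
  have "bounded (range (\<lambda>n. ip (f i) (u n)))" if "i < k" for i
  proof (rule boundedI)
    fix x assume "x \<in> range (\<lambda>n. ip (f i) (u n))"
    then obtain n where x: "x = ip (f i) (u n)" by auto
    have "x\<^sup>2 \<le> ip (f i) (f i)"
      using H.Cauchy_Schwarz[OF f_in[OF that] in_H[OF u(1)[of n]]] u(2)[of n] x by simp
    then show "norm x \<le> sqrt (ip (f i) (f i))" by (simp add: real_le_rsqrt)
  qed
  then obtain r where r: "strict_mono (r :: nat \<Rightarrow> nat)" "\<forall>i<k. convergent (\<lambda>n. ip (f i) (u (r n)))"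
    using bounded_coordinates_subseq[of k "\<lambda>i n. ip (f i) (u n)"] by blast
  define w where "w n = u (r n)" for n
  have w: "w n \<in> D" "ip (w n) (w n) = 1" for n using u by (simp_all add: w_def)
  have wa: "(\<lambda>n. a (w n) (w n)) \<longlonglongrightarrow> m"
    using LIMSEQ_subseq_LIMSEQ[OF u(3) r(1)] by (simp add: w_def o_def)
  define Q where "Q n = a (w n) (w n) - m" for n
  define R where "R n p = (\<Sum>i<k. (ip (f i) (w n) - ip (f i) (w p))\<^sup>2)" for n p
  have Q: "Q \<longlonglongrightarrow> 0" unfolding Q_def using wa by (simp add: LIM_zero)
  \<comment> \<open>The graph norm is \<open>a - m ip\<close> plus \<open>(1 + m)\<close> times
    \<open>ip\<close>, whereas the finite-rank inequality controls \<open>lam' - m\<close> times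
    \<open>ip\<close>; this is the conversion factor.\<close>
  define K where "K = (1 + m) / (lam' - m)"
  have K: "K \<ge> 0" using lam' m_nonneg by (simp add: K_def)
  have est: "a (fdiff (w n) (w p)) (fdiff (w n) (w p)) + ip (fdiff (w n) (w p)) (fdiff (w n) (w p))
      \<le> (1 + K) * (2 * (Q n + Q p)) + K * C * R n p" for n p
  proof -
    let ?d = "fdiff (w n) (w p)"
    have d: "?d \<in> D" using w by (intro D.lincomb_in)
    have q: "a ?d ?d - m * ip ?d ?d \<le> 2 * (Q n + Q p)"
      using q.fdiff_le[OF w(1) w(1), of n p] w by (simp add: Q_def)
    have "lam' * ip ?d ?d \<le> a ?d ?d + C * (\<Sum>i<k. (ip (f i) ?d)\<^sup>2)" by (rule finite_rank[OF d])
    also have "(\<Sum>i<k. (ip (f i) ?d)\<^sup>2) = R n p"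
      unfolding R_def using w f_in in_H by (intro sum.cong) (simp_all add: H.B_lin_right)
    finally have "(lam' - m) * ip ?d ?d \<le> 2 * (Q n + Q p) + C * R n p"
      using q by (simp add: algebra_simps)
    then have "ip ?d ?d \<le> (2 * (Q n + Q p) + C * R n p) / (lam' - m)"
      using lam' by (simp add: pos_le_divide_eq mult.commute)
    then have "(1 + m) * ip ?d ?d \<le> (1 + m) * ((2 * (Q n + Q p) + C * R n p) / (lam' - m))"
      using m_nonneg by (intro mult_left_mono) auto
    then have "(1 + m) * ip ?d ?d \<le> K * (2 * (Q n + Q p) + C * R n p)" by (simp add: K_def)
    then show ?thesis using q by (simp add: algebra_simps)
  qed
  have cauchy: "\<exists>N. \<forall>n\<ge>N. \<forall>p\<ge>N. a (fdiff (w n) (w p)) (fdiff (w n) (w p)) + ip (fdiff (w n) (w p)) (fdiff (w n) (w p)) < e"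
    if e: "e > 0" for e
  proof -
    \<comment> \<open>With both defects and each of the \<open>k\<close> squared differences below
      \<open>d\<close>, the estimate is \<open>d\<close> times the denominator without its last
      summand. That summand keeps the bound strictly below \<open>e\<close>.\<close>
    define d where "d = e / (4 * (1 + K) + K * C * (real k) + 1)"
    have den: "4 * (1 + K) + K * C * real k + 1 > 0" using K C_nonneg by (simp add: add_pos_nonneg add_nonneg_pos)
    have d: "d > 0" "d * (4 * (1 + K) + K * C * real k) < e"
      using den e by (simp_all add: d_def field_simps)
    have "\<forall>\<^sub>F n in sequentially. Q n < d" using Q d(1) by (rule order_tendstoD)
    then obtain N1 where N1: "\<And>n. n \<ge> N1 \<Longrightarrow> Q n < d" by (auto simp: eventually_sequentially)
    have "\<exists>N. \<forall>n\<ge>N. \<forall>p\<ge>N. (ip (f i) (w n) - ip (f i) (w p))\<^sup>2 < d" if "i < k" for i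
    proof -
      have "Cauchy (\<lambda>n. ip (f i) (w n))" using r(2) that by (simp add: w_def convergent_Cauchy)
      then obtain N where "\<forall>n\<ge>N. \<forall>p\<ge>N. norm (ip (f i) (w n) - ip (f i) (w p)) < sqrt d"
        using d(1) CauchyD[of _ "sqrt d"] by fastforce
      then show ?thesis using d(1) by (intro exI[of _ N]) (metis real_norm_def real_sqrt_abs real_sqrt_less_iff)
    qed
    then obtain M where M: "\<And>i n p. i < k \<Longrightarrow> n \<ge> M i \<Longrightarrow> p \<ge> M i \<Longrightarrow> (ip (f i) (w n) - ip (f i) (w p))\<^sup>2 < d"
      by metis
    \<comment> \<open>The sum dominates every \<open>M i\<close> and is defined even when
      \<open>k\<close> is zero.\<close>
    define N where "N = max N1 (\<Sum>i<k. M i)"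
    have "a (fdiff (w n) (w p)) (fdiff (w n) (w p)) + ip (fdiff (w n) (w p)) (fdiff (w n) (w p)) < e"
      if "n \<ge> N" "p \<ge> N" for n p
    proof -
      have MN: "M i \<le> N" if "i < k" for i
        using member_le_sum[of i "{..<k}" M] that by (simp add: N_def)
      have "R n p \<le> (\<Sum>i<k. d)"
        unfolding R_def using M MN that by (intro sum_mono) (meson lessThan_iff less_imp_le order_trans)
      then have R: "K * C * R n p \<le> K * C * (real k * d)" using K C_nonneg by (intro mult_left_mono) auto
      have "(1 + K) * (2 * (Q n + Q p)) \<le> (1 + K) * (4 * d)"
        using N1[of n] N1[of p] that K by (intro mult_left_mono) (auto simp: N_def)
      then have "(1 + K) * (2 * (Q n + Q p)) + K * C * R n p \<le> d * (4 * (1 + K) + K * C * real k)"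
        using R by (simp add: algebra_simps)
      then show ?thesis using est[of n p] d(2) by linarith
    qed
    then show ?thesis by blast
  qed
  obtain l where l: "l \<in> D" and conv: "(\<lambda>n. a (fdiff (w n) l) (fdiff (w n) l) + ip (fdiff (w n) l) (fdiff (w n) l)) \<longlonglongrightarrow> 0"
    using form_completeD[OF D_complete, of w] w(1) cauchy by blast
  note lim = ip_tendsto[OF w(1) l conv]
  have "(\<lambda>n. ip (w n) (w n)) \<longlonglongrightarrow> ip l l"
    using lim(1) l w(1) in_H by (intro H.tendsto_B_square) auto
  then have l1: "ip l l = 1" using w(2) LIMSEQ_unique[OF tendsto_const] by force
  have "(\<lambda>n. a (w n) (w n)) \<longlonglongrightarrow> a l l"
    using lim(2) l w(1) by (intro D.tendsto_B_square) auto
  then have "a l l = m" using wa LIMSEQ_unique by blast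
  then have "l \<in> E" using l l1 by (intro E_I) auto
  then show thesis using that r(1) l1 lim(1) by (simp add: w_def)
qed

lemma approx_seq:
  assumes "\<And>e. e > 0 \<Longrightarrow> \<exists>u\<in>W. ip u u = 1 \<and> a u u < m + e" "W \<subseteq> D"
  obtains u where "\<And>n::nat. u n \<in> W" "\<And>n. ip (u n) (u n) = 1" "(\<lambda>n. a (u n) (u n)) \<longlonglongrightarrow> m"
proof -
  have "\<exists>u\<in>W. ip u u = 1 \<and> a u u < m + inverse (real (Suc n))" for n using assms(1) by simp
  then obtain u where u: "\<And>n. u n \<in> W" "\<And>n. ip (u n) (u n) = 1" "\<And>n. a (u n) (u n) < m + inverse (real (Suc n))"
    by metis
  have "(\<lambda>n. m + inverse (real (Suc n))) \<longlonglongrightarrow> m + 0"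
    by (intro tendsto_intros LIMSEQ_inverse_real_of_nat)
  then have lim: "(\<lambda>n. m + inverse (real (Suc n))) \<longlonglongrightarrow> m" by simp
  have "(\<lambda>n. a (u n) (u n)) \<longlonglongrightarrow> m"
  proof (rule tendsto_sandwich[OF always_eventually always_eventually tendsto_const lim])
    show "\<forall>n. m \<le> a (u n) (u n)" using m_le u(1,2) assms(2) by (metis mult.right_neutral subsetD)
    show "\<forall>n. a (u n) (u n) \<le> m + inverse (real (Suc n))" using u(3) less_imp_le by blast
  qed
  then show thesis using that u(1,2) by blast
qed

lemma eigenvector_exists: "\<exists>u\<in>E. ip u u = 1"
proof -
  obtain u where "\<And>n::nat. u n \<in> D" "\<And>n. ip (u n) (u n) = 1" "(\<lambda>n. a (u n) (u n)) \<longlonglongrightarrow> m"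
    using approx_seq[of D] m_approx by blast
  then show ?thesis by (rule minimizing_subseq) blast
qed

text \<open>On \<open>E\<close> the form \<open>a\<close> is \<open>m\<close> times
  \<open>ip\<close>, so \<open>W\<close> is orthogonal to \<open>E\<close> for both forms, and the
  splitting of \<open>D\<close> reduces the operator.\<close>

definition "W = {w \<in> D. \<forall>v\<in>E. ip w v = 0}"

lemma W_sub: "W \<subseteq> D" and W_E: "w \<in> W \<Longrightarrow> v \<in> E \<Longrightarrow> ip w v = 0"
  by (auto simp: W_def)

lemma E_H: "u \<in> E \<Longrightarrow> u \<in> H" and E_D: "u \<in> E \<Longrightarrow> u \<in> D" and W_D: "w \<in> W \<Longrightarrow> w \<in> D"
  using E_sub W_sub in_H by auto

lemma E_W: "v \<in> E \<Longrightarrow> w \<in> W \<Longrightarrow> ip v w = 0"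
  using W_E H.B_sym E_H W_D in_H by metis

lemma W_lin: "u \<in> W \<Longrightarrow> v \<in> W \<Longrightarrow> lincomb c u d v \<in> W"
  using in_H E_H by (simp add: W_def D.lincomb_in H.B_lin)

lemma W_ne: "W \<noteq> {}"
proof -
  obtain u where u: "u \<in> D" using D_ne by blast
  have "lincomb 0 u 0 u \<in> W"
    using u in_H E_H by (simp add: W_def D.lincomb_in H.B_lin)
  then show ?thesis by blast
qed

lemma W_complete: "form_complete W (\<lambda>u v. a u v + ip u v)"
proof (rule form_complete_closed[OF D_complete W_sub])
  fix u :: "nat \<Rightarrow> 'a \<Rightarrow> real" and l
  assume u: "\<And>n. u n \<in> W" and l: "l \<in> D"
    and conv: "(\<lambda>n. a (fdiff (u n) l) (fdiff (u n) l) + ip (fdiff (u n) l) (fdiff (u n) l)) \<longlonglongrightarrow> 0"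
  have "ip l v = 0" if v: "v \<in> E" for v
  proof -
    have "(\<lambda>n. ip (u n) v) \<longlonglongrightarrow> ip l v"
      using ip_tendsto(1)[OF W_D[OF u] l conv] u l v
      by (intro H.tendsto_B) (auto intro: in_H W_D E_H)
    then show ?thesis using W_E[OF u v] LIMSEQ_unique[OF tendsto_const] by force
  qed
  then show "l \<in> W" using l by (simp add: W_def)
qed

text \<open>On the eigenspace the graph norm is \<open>1 + m\<close> times \<open>ip\<close>.
  Completeness for \<open>ip\<close> alone is what the orthogonal projection of an arbitrary element
  of \<open>H\<close> onto \<open>E\<close> relies on.\<close>

lemma E_complete: "form_complete E ip"
proof -
  have 1: "form_complete E (\<lambda>u v. a u v + ip u v)"
  proof (rule form_complete_closed[OF D_complete E_sub])
    fix u :: "nat \<Rightarrow> 'a \<Rightarrow> real" and l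
    assume u: "\<And>n. u n \<in> E" and l: "l \<in> D"
      and conv: "(\<lambda>n. a (fdiff (u n) l) (fdiff (u n) l) + ip (fdiff (u n) l) (fdiff (u n) l)) \<longlonglongrightarrow> 0"
    note lim = ip_tendsto[OF E_D[OF u] l conv]
    have "a l v = m * ip l v" if v: "v \<in> D" for v
    proof -
      have "(\<lambda>n. m * ip (u n) v) \<longlonglongrightarrow> m * ip l v"
        using lim(1) u l v by (intro tendsto_intros H.tendsto_B) (auto intro: in_H E_H)
      moreover have "(\<lambda>n. a (u n) v) \<longlonglongrightarrow> a l v"
        using lim(2) u l v by (intro D.tendsto_B) (auto intro: E_D)
      ultimately show ?thesis using E_eq[OF u v] LIMSEQ_unique by simp
    qed
    then show "l \<in> E" using l by (simp add: E_def)
  qed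
  have nn: "0 \<le> ip u u" if "u \<in> E" for u using that H.B_nonneg E_H by blast
  show ?thesis
  proof (rule form_complete_equiv[OF 1 E_lin, of "1 + m"])
    fix u assume u: "u \<in> E"
    show "a u u + ip u u \<le> (1 + m) * ip u u" using E_eq[OF u E_D[OF u]] by (simp add: algebra_simps)
    have "0 \<le> m * ip u u" "0 \<le> m * (m * ip u u)" using nn[OF u] m_nonneg by simp_all
    then show "ip u u \<le> (1 + m) * (a u u + ip u u)"
      using nn[OF u] E_eq[OF u E_D[OF u]] by (simp add: algebra_simps)
  qed (use m_nonneg nn in auto)
qed

lemma E_projection:
  assumes g: "g \<in> H"
  shows "\<exists>u\<in>E. \<forall>v\<in>E. ip u v = ip g v"
proof (rule H.riesz[OF _ E_ne E_lin E_complete])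
  show "E \<subseteq> H" using E_H by auto
  show "ip g (lincomb c u d v) = c * ip g u + d * ip g v" if "u \<in> E" "v \<in> E" for u v c d
    using that g E_H by (intro H.B_lin_right) auto
  show "(ip g v)\<^sup>2 \<le> ip g g * ip v v" if "v \<in> E" for v
    using H.Cauchy_Schwarz[OF g E_H[OF that]] .
qed

lemma E_W_decomp:
  assumes v: "v \<in> D"
  obtains p where "p \<in> E" "fdiff v p \<in> W" "\<And>h. h \<in> H \<Longrightarrow> ip h v = ip h p + ip h (fdiff v p)"
    "\<And>h. h \<in> D \<Longrightarrow> a h v = a h p + a h (fdiff v p)"
proof -
  obtain p where p: "p \<in> E" "\<forall>w\<in>E. ip p w = ip v w" using E_projection[OF in_H[OF v]] by blast
  show thesis
  proof
    show "p \<in> E" by fact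
    show "fdiff v p \<in> W"
      using p v in_H E_H E_D by (simp add: W_def D.lincomb_in H.B_lin)
    show "ip h v = ip h p + ip h (fdiff v p)" if "h \<in> H" for h
      using p v in_H E_H that by (simp add: H.B_lin_right)
    show "a h v = a h p + a h (fdiff v p)" if "h \<in> D" for h
      using p v E_D that by (simp add: D.B_lin_right)
  qed
qed

text \<open>Without a gap, \<open>W\<close> would contain a normalized minimizing sequence. A
  subsequence converges to a unit vector of \<open>E\<close>, yet all its members are orthogonal to
  \<open>E\<close>, so the limit would be orthogonal to itself.\<close>

lemma gap: "\<exists>e>0. \<forall>w\<in>W. (m + e) * ip w w \<le> a w w"
proof (rule ccontr)
  assume neg: "\<not> ?thesis"
  have "\<exists>u\<in>W. ip u u = 1 \<and> a u u < m + e" if e: "e > 0" for e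
  proof -
    obtain w where w: "w \<in> W" "a w w < (m + e) * ip w w" using neg e by (meson not_le)
    have p: "ip w w > 0"
    proof (rule ccontr)
      assume "\<not> ip w w > 0"
      then have "ip w w = 0" using H.B_nonneg[OF in_H[OF W_D[OF w(1)]]] by simp
      then show False using w D.B_nonneg[OF W_D[OF w(1)]] by simp
    qed
    define c where "c = 1 / sqrt (ip w w)"
    have c: "c\<^sup>2 * ip w w = 1" using p by (simp add: c_def power_divide)
    let ?u = "lincomb c w 0 w"
    have s: "ip ?u ?u = c\<^sup>2 * ip w w" "a ?u ?u = c\<^sup>2 * a w w"
      using w W_D in_H by (simp_all add: H.B_square D.B_square)
    have "c\<^sup>2 * a w w < c\<^sup>2 * ((m + e) * ip w w)"
      using w(2) p by (intro mult_strict_left_mono) (auto simp: c_def)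
    also have "\<dots> = m + e" using c by (metis mult.left_commute mult.right_neutral)
    finally show ?thesis using s c W_lin[OF w(1) w(1), of c 0] by metis
  qed
  then obtain u where u: "\<And>n::nat. u n \<in> W" "\<And>n. ip (u n) (u n) = 1" "(\<lambda>n. a (u n) (u n)) \<longlonglongrightarrow> m"
    using approx_seq[of W] W_sub by blast
  obtain r l where rl: "strict_mono (r :: nat \<Rightarrow> nat)" "l \<in> E" "ip l l = 1"
    "(\<lambda>n. ip (fdiff (u (r n)) l) (fdiff (u (r n)) l)) \<longlonglongrightarrow> 0"
    using minimizing_subseq[OF W_D[OF u(1)] u(2,3)] by blast
  have "(\<lambda>n. ip (u (r n)) l) \<longlonglongrightarrow> ip l l"
    using u rl by (intro H.tendsto_B) (auto intro: in_H W_D E_H)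
  then have "ip l l = 0" using W_E[OF u(1) rl(2)] LIMSEQ_unique[OF tendsto_const] by force
  then show False using rl by simp
qed

text \<open>The equation splits along \<open>E\<close> and \<open>W\<close>. On \<open>E\<close> the
  operator is multiplication by \<open>m\<close>, so the projection of the right-hand side is
  divided by \<open>m - z\<close>; on \<open>W\<close> the gap makes the shifted form coercive.
  Cross terms vanish for both \<open>a\<close> and \<open>ip\<close>, and the norm bounds of the two
  components add.\<close>

lemma above_resolvent:
  assumes e: "e > 0" "\<And>w. w \<in> W \<Longrightarrow> (m + e) * ip w w \<le> a w w" and z: "m < z" "z < m + e"
  shows "z \<in> form_resolvent_set H D a ip"
proof -
  obtain c where c: "c > 0" "\<And>u. u \<in> W \<Longrightarrow> c * (a u u + ip u u) \<le> a u u - z * ip u u"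
    using coercive_shift[of "m + e" z W] m_nonneg e z W_sub by auto
  show ?thesis
  proof (rule resolventI)
    fix g assume g: "g \<in> H"
    obtain w where w: "w \<in> W" "\<forall>v\<in>W. a w v - z * ip w v = ip g v"
      using lax_milgram[OF W_sub W_ne W_lin W_complete c g] by blast
    obtain p where p: "p \<in> E" "\<forall>v\<in>E. ip p v = ip g v" using E_projection[OF g] by blast
    let ?u = "lincomb (1 / (m - z)) p 1 w"
    have "a ?u v - z * ip ?u v = ip g v" if v: "v \<in> D" for v
    proof -
      obtain y where y: "y \<in> E" "fdiff v y \<in> W" "\<And>h. h \<in> H \<Longrightarrow> ip h v = ip h y + ip h (fdiff v y)"
        "\<And>h. h \<in> D \<Longrightarrow> a h v = a h y + a h (fdiff v y)" using E_W_decomp[OF v] by blast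
      have awy: "a w y = 0"
        using E_eq[OF y(1) W_D[OF w(1)]] E_W[OF y(1) w(1)] D.B_sym[OF W_D[OF w(1)] E_D[OF y(1)]] by simp
      have "a ?u v - z * ip ?u v = (1 / (m - z)) * (a p v - z * ip p v) + (a w v - z * ip w v)"
        using p w v by (simp add: D.B_lin H.B_lin E_D W_D in_H algebra_simps)
      also have "a p v - z * ip p v = (m - z) * ip p v" using E_eq[OF p(1) v] by (simp add: algebra_simps)
      also have "(1 / (m - z)) * ((m - z) * ip p v) = ip p v" using z by simp
      also have "ip p v = ip g y" using y(3)[OF E_H[OF p(1)]] E_W[OF p(1) y(2)] p(2) y(1) by simp
      also have "a w v - z * ip w v = ip g (fdiff v y)"
        using y(4)[OF W_D[OF w(1)]] y(3)[OF in_H[OF W_D[OF w(1)]]] awy W_E[OF w(1) y(1)] w(2) y(2) by simp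
      finally show ?thesis using y(3)[OF g] by simp
    qed
    moreover have "?u \<in> D" using p w E_D W_D by (intro D.lincomb_in) auto
    ultimately show "\<exists>u\<in>D. \<forall>v\<in>D. a u v - z * ip u v = ip g v" by blast
  next
    fix g u assume g: "g \<in> H" and u: "u \<in> D" and eq: "\<forall>v\<in>D. a u v - z * ip u v = ip g v"
    obtain y where y: "y \<in> E" "fdiff u y \<in> W" "\<And>h. h \<in> H \<Longrightarrow> ip h u = ip h y + ip h (fdiff u y)"
      "\<And>h. h \<in> D \<Longrightarrow> a h u = a h y + a h (fdiff u y)" using E_W_decomp[OF u] by blast
    let ?w = "fdiff u y"
    have yD: "y \<in> D" "?w \<in> D" using y E_D W_D by auto
    have yH: "y \<in> H" "?w \<in> H" "u \<in> H" using yD u in_H by auto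
    have ayw: "a y ?w = 0" "ip y ?w = 0" "ip ?w y = 0"
      using E_eq[OF y(1) yD(2)] E_W[OF y(1,2)] W_E[OF y(2,1)] by auto
    have awy: "a ?w y = 0" using ayw D.B_sym[OF yD] by simp
    have ip_u: "ip u y = ip y y" "ip u ?w = ip ?w ?w" "a u y = m * ip y y" "a u ?w = a ?w ?w"
      using y(3)[OF yH(1)] y(3)[OF yH(2)] y(4)[OF yD(1)] y(4)[OF yD(2)] ayw awy
        H.B_sym[OF yH(3,1)] H.B_sym[OF yH(3,2)] D.B_sym[OF u yD(1)] D.B_sym[OF u yD(2)] E_eq[OF y(1) yD(1)] by auto
    have "0 \<le> c * a ?w ?w" using D.B_nonneg[OF yD(2)] c by simp
    then have "c * ip ?w ?w \<le> ip g ?w"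
      using c(2)[OF y(2)] eq yD ip_u by (simp add: algebra_simps)
    then have 1: "ip ?w ?w \<le> ip g g / c\<^sup>2" by (rule ip_bound_of_weak[OF c(1) _ yH(2) g])
    have "(m - z) * ip y y = ip g y" using eq yD ip_u by (simp add: algebra_simps)
    \<comment> \<open>On \<open>E\<close> the shifted form is negative, so the sign of the
      right-hand side is reversed to obtain a positive factor.\<close>
    then have "(z - m) * ip y y = ip (lincomb (-1) g 0 g) y"
      using g yH by (simp add: H.B_lin algebra_simps)
    then have "ip y y \<le> ip (lincomb (-1) g 0 g) (lincomb (-1) g 0 g) / (z - m)\<^sup>2"
      using z g yH by (intro ip_bound_of_weak H.lincomb_in) auto
    then have 2: "ip y y \<le> ip g g / (z - m)\<^sup>2" using g by (simp add: H.B_square)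
    have "ip u u = ip y y + ip ?w ?w" using y(3)[OF yH(3)] ip_u by simp
    then show "ip u u \<le> (1 / c\<^sup>2 + 1 / (z - m)\<^sup>2) * ip g g" using 1 2 by (simp add: algebra_simps)
  qed
qed

text \<open>Summing the finite-rank inequality over an orthonormal family of eigenvectors and
  using Bessel's inequality bounds the length of the family.\<close>

lemma bessel:
  fixes n :: nat
  assumes us: "\<And>j. j < n \<Longrightarrow> us j \<in> H" "\<And>i j. i < n \<Longrightarrow> j < n \<Longrightarrow> ip (us i) (us j) = (if i = j then 1 else 0)"
    and g: "g \<in> H"
  shows "(\<Sum>j<n. (ip g (us j))\<^sup>2) \<le> ip g g"
proof -
  \<comment> \<open>\<open>r\<close> is \<open>g\<close> with its components along the first
    \<open>p\<close> vectors removed; its products with the remaining vectors are unchanged.\<close>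
  have "\<exists>r\<in>H. ip r r = ip g g - (\<Sum>j<p. (ip g (us j))\<^sup>2) \<and> (\<forall>i\<in>{p..<n}. ip r (us i) = ip g (us i))" if "p \<le> n" for p
    using that
  proof (induction p)
    case 0
    then show ?case using g by auto
  next
    case (Suc p)
    then obtain r where r: "r \<in> H" "ip r r = ip g g - (\<Sum>j<p. (ip g (us j))\<^sup>2)" "\<forall>i\<in>{p..<n}. ip r (us i) = ip g (us i)"
      by auto
    have p: "us p \<in> H" using us Suc by auto
    have rk: "ip r (us p) = ip g (us p)" using r(3) Suc by auto
    let ?r = "lincomb 1 r (- ip g (us p)) (us p)"
    have "ip ?r ?r = ip g g - (\<Sum>j<Suc p. (ip g (us j))\<^sup>2)"
      using r p rk us(2)[of p p] Suc by (simp add: H.B_square power2_eq_square)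
    moreover have "ip ?r (us i) = ip g (us i)" if "i \<in> {Suc p..<n}" for i
      using r p rk us(1)[of i] us(2)[of p i] that by (simp add: H.B_lin)
    ultimately show ?case using H.lincomb_in[OF r(1) p] by blast
  qed
  then obtain r where "r \<in> H" "ip r r = ip g g - (\<Sum>j<n. (ip g (us j))\<^sup>2)" by blast
  then show ?thesis using H.B_nonneg[of r] by simp
qed

lemma bottom_finite_multiplicity: "finite_multiplicity D a ip m"
proof -
  \<comment> \<open>By Bessel this bounds the total contribution of the functionals over any
    orthonormal family, whatever its length, while each member of the family contributes at least
    \<open>lam' - m\<close>.\<close>
  define T where "T = C * (\<Sum>i<k. ip (f i) (f i))"
  define N where "N = nat \<lceil>T / (lam' - m)\<rceil>"
  have "n \<le> N" if us: "\<forall>i<n. us i \<in> D \<and> (\<forall>v\<in>D. a (us i) v = m * ip (us i) v)"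
    and on: "\<forall>i<n. \<forall>j<n. ip (us i) (us j) = (if i = j then 1 else 0)" for us :: "nat \<Rightarrow> 'a \<Rightarrow> real" and n
  proof -
    have "lam' - m \<le> C * (\<Sum>i<k. (ip (f i) (us j))\<^sup>2)" if "j < n" for j
      using finite_rank[of "us j"] us on that by simp
    then have "(\<Sum>j<n. lam' - m) \<le> (\<Sum>j<n. C * (\<Sum>i<k. (ip (f i) (us j))\<^sup>2))" by (intro sum_mono) auto
    also have "\<dots> = C * (\<Sum>i<k. \<Sum>j<n. (ip (f i) (us j))\<^sup>2)"
      by (subst sum.swap) (simp add: sum_distrib_left)
    also have "\<dots> \<le> T" unfolding T_def
      using us on f_in in_H by (intro mult_left_mono sum_mono bessel C_nonneg) auto
    finally have "real n * (lam' - m) \<le> T" by simp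
    then have "real n \<le> T / (lam' - m)" using lam' by (simp add: pos_le_divide_eq)
    then show ?thesis unfolding N_def by linarith
  qed
  then show ?thesis unfolding finite_multiplicity_def by blast
qed

theorem bottom_in_discrete_spectrum: "m \<in> form_discrete_spectrum H D a ip"
proof -
  obtain u where u: "u \<in> E" "ip u u = 1" using eigenvector_exists by blast
  have "form_eigenvalue D a ip m"
    unfolding form_eigenvalue_def using u E_D E_eq by (metis zero_neq_one)
  moreover obtain e where e: "e > 0" "\<forall>w\<in>W. (m + e) * ip w w \<le> a w w" using gap by blast
  have "form_spectrum H D a ip \<inter> {m - e<..<m + e} \<subseteq> {m}"
  proof
    fix z assume z: "z \<in> form_spectrum H D a ip \<inter> {m - e<..<m + e}"
    then have "z \<notin> form_resolvent_set H D a ip" by (simp add: form_spectrum_def)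
    then show "z \<in> {m}" using z below_resolvent[of z] above_resolvent[of e z] e by force
  qed
  then have "form_spectrum H D a ip \<inter> {m - e<..<m + e} = {m}" using e bottom_in_spectrum by auto
  ultimately show ?thesis
    unfolding form_discrete_spectrum_def using bottom_in_spectrum bottom_finite_multiplicity e(1) by blast
qed

end

section \<open>Square-integrable functions\<close>

text \<open>For an arbitrary measure, so that one calculus covers the cross-section, the cylinder
  and the whole line.\<close>

definition L2 :: "'a measure \<Rightarrow> ('a \<Rightarrow> real) \<Rightarrow> bool" where
  "L2 M f \<longleftrightarrow> f \<in> borel_measurable M \<and> integrable M (\<lambda>x. (f x)\<^sup>2)"

text \<open>The integral of a nonintegrable function is 0, so the predicate is meaningful only
  together with square integrability of the members and of the limit. Those assumptions accompany it
  in most lemmas.\<close>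

definition L2conv :: "'a measure \<Rightarrow> (nat \<Rightarrow> 'a \<Rightarrow> real) \<Rightarrow> ('a \<Rightarrow> real) \<Rightarrow> bool" where
  "L2conv M u f \<longleftrightarrow> (\<lambda>n. \<integral>x. (u n x - f x)\<^sup>2 \<partial>M) \<longlonglongrightarrow> 0"

lemma L2_measurable: "L2 M f \<Longrightarrow> f \<in> borel_measurable M"
  and L2_square: "L2 M f \<Longrightarrow> integrable M (\<lambda>x. (f x)\<^sup>2)"
  by (auto simp: L2_def)

lemma L2_dom:
  assumes "L2 M f" "g \<in> borel_measurable M" "\<And>x. x \<in> space M \<Longrightarrow> \<bar>g x\<bar> \<le> K * \<bar>f x\<bar>"
  shows "L2 M g"
proof -
  have "integrable M (\<lambda>x. (g x)\<^sup>2)"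
  proof (rule Bochner_Integration.integrable_bound)
    show "integrable M (\<lambda>x. K\<^sup>2 * (f x)\<^sup>2)" using assms(1) by (simp add: L2_def)
    show "(\<lambda>x. (g x)\<^sup>2) \<in> borel_measurable M" using assms(2) by measurable
    show "AE x in M. norm ((g x)\<^sup>2) \<le> norm (K\<^sup>2 * (f x)\<^sup>2)"
    proof (rule AE_I2)
      fix x assume "x \<in> space M"
      then have "\<bar>g x\<bar>\<^sup>2 \<le> (K * \<bar>f x\<bar>)\<^sup>2" using assms(3) by (intro power_mono) auto
      then show "norm ((g x)\<^sup>2) \<le> norm (K\<^sup>2 * (f x)\<^sup>2)" by (simp add: power_mult_distrib)
    qed
  qed
  then show ?thesis using assms(2) by (simp add: L2_def)
qed

lemma L2_mult:
  assumes "L2 M f" "L2 M g"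
  shows "integrable M (\<lambda>x. f x * g x)"
proof (rule Bochner_Integration.integrable_bound)
  show "integrable M (\<lambda>x. (f x)\<^sup>2 + (g x)\<^sup>2)" using assms by (simp add: L2_def)
  show "(\<lambda>x. f x * g x) \<in> borel_measurable M" using assms by (auto simp: L2_def)
  show "AE x in M. norm (f x * g x) \<le> norm ((f x)\<^sup>2 + (g x)\<^sup>2)"
  proof (rule AE_I2)
    fix x
    have "0 \<le> (\<bar>f x\<bar> - \<bar>g x\<bar>)\<^sup>2" "0 \<le> (f x)\<^sup>2" "0 \<le> (g x)\<^sup>2" by simp_all
    moreover have "0 \<le> \<bar>f x\<bar> * \<bar>g x\<bar>" by simp
    moreover have "(\<bar>f x\<bar> - \<bar>g x\<bar>)\<^sup>2 = (f x)\<^sup>2 + (g x)\<^sup>2 - 2 * (\<bar>f x\<bar> * \<bar>g x\<bar>)" by (simp add: power2_diff)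
    ultimately have "\<bar>f x\<bar> * \<bar>g x\<bar> \<le> (f x)\<^sup>2 + (g x)\<^sup>2" by linarith
    then show "norm (f x * g x) \<le> norm ((f x)\<^sup>2 + (g x)\<^sup>2)" by (simp add: abs_mult)
  qed
qed

lemma L2_bmult:
  assumes "L2 M f" "b \<in> borel_measurable M" "\<And>x. x \<in> space M \<Longrightarrow> \<bar>b x\<bar> \<le> K"
  shows "L2 M (\<lambda>x. b x * f x)"
proof (rule L2_dom[OF assms(1), where K=K])
  show "(\<lambda>x. b x * f x) \<in> borel_measurable M" using assms by (auto simp: L2_def)
  show "\<bar>b x * f x\<bar> \<le> K * \<bar>f x\<bar>" if "x \<in> space M" for x
    using assms(3)[OF that] by (simp add: abs_mult mult_right_mono)
qed

lemma L2_lincomb: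
  assumes "L2 M f" "L2 M g"
  shows "L2 M (\<lambda>x. c * f x + d * g x)"
proof -
  have "(\<lambda>x. (c * f x + d * g x)\<^sup>2) = (\<lambda>x. c\<^sup>2 * (f x)\<^sup>2 + 2 * c * d * (f x * g x) + d\<^sup>2 * (g x)\<^sup>2)"
    by (auto simp: power2_eq_square algebra_simps)
  moreover have "integrable M (\<lambda>x. c\<^sup>2 * (f x)\<^sup>2 + 2 * c * d * (f x * g x) + d\<^sup>2 * (g x)\<^sup>2)"
    using assms L2_mult[OF assms] by (intro Bochner_Integration.integrable_add integrable_mult_right) (auto simp: L2_def)
  moreover have "(\<lambda>x. c * f x + d * g x) \<in> borel_measurable M" using assms by (auto simp: L2_def)
  ultimately show ?thesis by (simp add: L2_def)
qed

lemma L2_add: "L2 M f \<Longrightarrow> L2 M g \<Longrightarrow> L2 M (\<lambda>x. f x + g x)"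
  and L2_diff: "L2 M f \<Longrightarrow> L2 M g \<Longrightarrow> L2 M (\<lambda>x. f x - g x)"
  and L2_cmult: "L2 M f \<Longrightarrow> L2 M (\<lambda>x. c * f x)"
  using L2_lincomb[of M f g 1 1] L2_lincomb[of M f g 1 "-1"] L2_lincomb[of M f f c 0] by simp_all

lemma L2_CS:
  assumes "L2 M f" "L2 M g"
  shows "(\<integral>x. f x * g x \<partial>M)\<^sup>2 \<le> (\<integral>x. (f x)\<^sup>2 \<partial>M) * (\<integral>x. (g x)\<^sup>2 \<partial>M)"
proof -
  have q: "0 \<le> (\<integral>x. (f x)\<^sup>2 \<partial>M) + 2 * t * (\<integral>x. f x * g x \<partial>M) + t\<^sup>2 * (\<integral>x. (g x)\<^sup>2 \<partial>M)" for t
  proof -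
    have "0 \<le> (\<integral>x. (f x + t * g x)\<^sup>2 \<partial>M)" by (intro Bochner_Integration.integral_nonneg) auto
    also have "(\<lambda>x. (f x + t * g x)\<^sup>2) = (\<lambda>x. (f x)\<^sup>2 + (2 * t) * (f x * g x) + t\<^sup>2 * (g x)\<^sup>2)"
      by (auto simp: power2_eq_square algebra_simps)
    also have "(\<integral>x. (f x)\<^sup>2 + (2 * t) * (f x * g x) + t\<^sup>2 * (g x)\<^sup>2 \<partial>M)
        = (\<integral>x. (f x)\<^sup>2 \<partial>M) + 2 * t * (\<integral>x. f x * g x \<partial>M) + t\<^sup>2 * (\<integral>x. (g x)\<^sup>2 \<partial>M)"
      using assms L2_mult[OF assms] by (simp add: L2_def)
    finally show ?thesis .
  qed
  let ?a = "\<integral>x. (f x)\<^sup>2 \<partial>M" and ?b = "\<integral>x. f x * g x \<partial>M" and ?c = "\<integral>x. (g x)\<^sup>2 \<partial>M"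
  have c: "0 \<le> ?c" by (intro Bochner_Integration.integral_nonneg) auto
  show ?thesis using discriminant_le[OF q c] .
qed

lemma L2_triangle:
  assumes "L2 M f" "L2 M g"
  shows "(\<integral>x. (f x + g x)\<^sup>2 \<partial>M) \<le> 2 * (\<integral>x. (f x)\<^sup>2 \<partial>M) + 2 * (\<integral>x. (g x)\<^sup>2 \<partial>M)"
proof -
  have "(\<integral>x. (f x + g x)\<^sup>2 \<partial>M) \<le> (\<integral>x. 2 * (f x)\<^sup>2 + 2 * (g x)\<^sup>2 \<partial>M)"
  proof (rule integral_mono)
    show "integrable M (\<lambda>x. (f x + g x)\<^sup>2)" using L2_add[OF assms] by (simp add: L2_def)
    show "integrable M (\<lambda>x. 2 * (f x)\<^sup>2 + 2 * (g x)\<^sup>2)" using assms by (simp add: L2_def)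
    show "(f x + g x)\<^sup>2 \<le> 2 * (f x)\<^sup>2 + 2 * (g x)\<^sup>2" for x
      using sum_squares_ge_zero[of "f x - g x" 0] by (simp add: power2_eq_square algebra_simps)
  qed
  then show ?thesis using assms by (simp add: L2_def)
qed

text \<open>Covers multiplication by bounded functions and composition with Lipschitz functions in
  one statement.\<close>

lemma L2conv_dom:
  assumes "L2conv M u f" "\<And>n. L2 M (u n)" "L2 M f"
    "\<And>n x. x \<in> space M \<Longrightarrow> \<bar>w n x - g x\<bar> \<le> K * \<bar>u n x - f x\<bar>"
  shows "L2conv M w g"
  unfolding L2conv_def
proof (rule tendsto_sandwich[OF always_eventually always_eventually tendsto_const])
  show "\<forall>n. 0 \<le> (\<integral>x. (w n x - g x)\<^sup>2 \<partial>M)" by (auto intro!: Bochner_Integration.integral_nonneg)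
  show "\<forall>n. (\<integral>x. (w n x - g x)\<^sup>2 \<partial>M) \<le> K\<^sup>2 * (\<integral>x. (u n x - f x)\<^sup>2 \<partial>M)"
  proof
    fix n
    have i: "integrable M (\<lambda>x. (u n x - f x)\<^sup>2)" using L2_diff[OF assms(2,3)] by (simp add: L2_def)
    have "(\<integral>x. (w n x - g x)\<^sup>2 \<partial>M) \<le> (\<integral>x. K\<^sup>2 * (u n x - f x)\<^sup>2 \<partial>M)"
    proof (rule integral_mono')
      show "integrable M (\<lambda>x. K\<^sup>2 * (u n x - f x)\<^sup>2)" using i by simp
      fix x assume "x \<in> space M"
      then have "\<bar>w n x - g x\<bar>\<^sup>2 \<le> (K * \<bar>u n x - f x\<bar>)\<^sup>2" using assms(4) by (intro power_mono) auto
      then show "(w n x - g x)\<^sup>2 \<le> K\<^sup>2 * (u n x - f x)\<^sup>2" by (simp add: power_mult_distrib)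
    qed auto
    then show "(\<integral>x. (w n x - g x)\<^sup>2 \<partial>M) \<le> K\<^sup>2 * (\<integral>x. (u n x - f x)\<^sup>2 \<partial>M)" by simp
  qed
  show "(\<lambda>n. K\<^sup>2 * (\<integral>x. (u n x - f x)\<^sup>2 \<partial>M)) \<longlonglongrightarrow> 0"
    using assms(1) unfolding L2conv_def by (rule tendsto_mult_right_zero)
qed

lemma L2conv_bmult:
  assumes "L2conv M u f" "\<And>n. L2 M (u n)" "L2 M f" "\<And>x. x \<in> space M \<Longrightarrow> \<bar>b x\<bar> \<le> K"
  shows "L2conv M (\<lambda>n x. b x * u n x) (\<lambda>x. b x * f x)"
proof (rule L2conv_dom[OF assms(1-3), where K=K])
  fix n x assume "x \<in> space M"
  then show "\<bar>b x * u n x - b x * f x\<bar> \<le> K * \<bar>u n x - f x\<bar>"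
    using assms(4) by (simp flip: right_diff_distrib add: abs_mult mult_right_mono)
qed

lemma L2conv_lincomb:
  assumes "L2conv M u f" "\<And>n. L2 M (u n)" "L2 M f" "L2conv M w g" "\<And>n. L2 M (w n)" "L2 M g"
  shows "L2conv M (\<lambda>n x. c * u n x + d * w n x) (\<lambda>x. c * f x + d * g x)"
  unfolding L2conv_def
proof (rule tendsto_sandwich[OF always_eventually always_eventually tendsto_const])
  let ?I = "\<lambda>h. \<integral>x. (h x)\<^sup>2 \<partial>M"
  show "\<forall>n. 0 \<le> (\<integral>x. (c * u n x + d * w n x - (c * f x + d * g x))\<^sup>2 \<partial>M)" by (auto intro!: Bochner_Integration.integral_nonneg)
  show "\<forall>n. (\<integral>x. (c * u n x + d * w n x - (c * f x + d * g x))\<^sup>2 \<partial>M)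
     \<le> 2 * c\<^sup>2 * (\<integral>x. (u n x - f x)\<^sup>2 \<partial>M) + 2 * d\<^sup>2 * (\<integral>x. (w n x - g x)\<^sup>2 \<partial>M)"
  proof
    fix n
    have eq: "(c * u n x + d * w n x - (c * f x + d * g x)) = c * (u n x - f x) + d * (w n x - g x)" for x
      by (simp add: algebra_simps)
    show "(\<integral>x. (c * u n x + d * w n x - (c * f x + d * g x))\<^sup>2 \<partial>M)
     \<le> 2 * c\<^sup>2 * (\<integral>x. (u n x - f x)\<^sup>2 \<partial>M) + 2 * d\<^sup>2 * (\<integral>x. (w n x - g x)\<^sup>2 \<partial>M)"
      unfolding eq
      using L2_triangle[OF L2_cmult[OF L2_diff[OF assms(2,3)], of c n] L2_cmult[OF L2_diff[OF assms(5,6)], of d n]]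
      by (simp add: power_mult_distrib)
  qed
  have "(\<lambda>n. 2 * c\<^sup>2 * (\<integral>x. (u n x - f x)\<^sup>2 \<partial>M) + 2 * d\<^sup>2 * (\<integral>x. (w n x - g x)\<^sup>2 \<partial>M)) \<longlonglongrightarrow> 2 * c\<^sup>2 * 0 + 2 * d\<^sup>2 * 0"
    using assms(1,4) unfolding L2conv_def by (intro tendsto_intros)
  then show "(\<lambda>n. 2 * c\<^sup>2 * (\<integral>x. (u n x - f x)\<^sup>2 \<partial>M) + 2 * d\<^sup>2 * (\<integral>x. (w n x - g x)\<^sup>2 \<partial>M)) \<longlonglongrightarrow> 0"
    by simp
qed

lemma L2conv_const: "L2conv M (\<lambda>n. f) f"
  by (simp add: L2conv_def)

lemma L2conv_cong_AE:
  assumes "L2conv M u f" "\<And>n. L2 M (u n)" "L2 M f" "g \<in> borel_measurable M" "AE x in M. g x = f x"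
  shows "L2conv M u g"
proof -
  have "(\<integral>x. (u n x - g x)\<^sup>2 \<partial>M) = (\<integral>x. (u n x - f x)\<^sup>2 \<partial>M)" for n
    using assms(2)[of n] assms(3-5) by (intro integral_cong_AE) (auto simp: L2_def)
  then show ?thesis using assms(1) by (simp add: L2conv_def)
qed

lemma L2conv_inner_const:
  assumes "L2conv M u f" "\<And>n. L2 M (u n)" "L2 M f" "L2 M g"
  shows "(\<lambda>n. \<integral>x. u n x * g x \<partial>M) \<longlonglongrightarrow> (\<integral>x. f x * g x \<partial>M)"
proof -
  have "(\<lambda>n. ((\<integral>x. u n x * g x \<partial>M) - (\<integral>x. f x * g x \<partial>M))\<^sup>2) \<longlonglongrightarrow> 0"
  proof (rule tendsto_sandwich[OF always_eventually always_eventually tendsto_const])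
    show "\<forall>n. ((\<integral>x. u n x * g x \<partial>M) - (\<integral>x. f x * g x \<partial>M))\<^sup>2 \<le> (\<integral>x. (u n x - f x)\<^sup>2 \<partial>M) * (\<integral>x. (g x)\<^sup>2 \<partial>M)"
    proof
      fix n
      have "(\<integral>x. u n x * g x \<partial>M) - (\<integral>x. f x * g x \<partial>M) = (\<integral>x. (u n x - f x) * g x \<partial>M)"
        using L2_mult[OF assms(2)[of n] assms(4)] L2_mult[OF assms(3,4)] by (simp add: left_diff_distrib)
      then show "((\<integral>x. u n x * g x \<partial>M) - (\<integral>x. f x * g x \<partial>M))\<^sup>2 \<le> (\<integral>x. (u n x - f x)\<^sup>2 \<partial>M) * (\<integral>x. (g x)\<^sup>2 \<partial>M)"
        using L2_CS[OF L2_diff[OF assms(2,3)] assms(4), of n] by simp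
    qed
    show "(\<lambda>n. (\<integral>x. (u n x - f x)\<^sup>2 \<partial>M) * (\<integral>x. (g x)\<^sup>2 \<partial>M)) \<longlonglongrightarrow> 0"
      using assms(1) unfolding L2conv_def by (rule tendsto_mult_left_zero)
  qed simp
  then have "(\<lambda>n. (\<integral>x. u n x * g x \<partial>M) - (\<integral>x. f x * g x \<partial>M)) \<longlonglongrightarrow> 0" by simp
  then show ?thesis by (simp add: LIM_zero_iff)
qed

lemma L2conv_norm:
  assumes "L2conv M u f" "\<And>n. L2 M (u n)" "L2 M f"
  shows "(\<lambda>n. \<integral>x. (u n x)\<^sup>2 \<partial>M) \<longlonglongrightarrow> (\<integral>x. (f x)\<^sup>2 \<partial>M)"
proof -
  have eq: "(\<integral>x. (u n x)\<^sup>2 \<partial>M) = (\<integral>x. (u n x - f x)\<^sup>2 \<partial>M) + 2 * (\<integral>x. u n x * f x \<partial>M) - (\<integral>x. (f x)\<^sup>2 \<partial>M)" for n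
  proof -
    have i: "integrable M (\<lambda>x. (u n x - f x)\<^sup>2)" "integrable M (\<lambda>x. u n x * f x)" "integrable M (\<lambda>x. (f x)\<^sup>2)"
      using L2_diff[OF assms(2,3)] L2_mult[OF assms(2,3)] assms(3) by (auto simp: L2_def)
    have "(\<integral>x. (u n x)\<^sup>2 \<partial>M) = (\<integral>x. (u n x - f x)\<^sup>2 + 2 * (u n x * f x) - (f x)\<^sup>2 \<partial>M)"
      by (intro Bochner_Integration.integral_cong) (auto simp: power2_eq_square algebra_simps)
    then show ?thesis using i by simp
  qed
  have "(\<lambda>n. (\<integral>x. (u n x - f x)\<^sup>2 \<partial>M) + 2 * (\<integral>x. u n x * f x \<partial>M) - (\<integral>x. (f x)\<^sup>2 \<partial>M))
     \<longlonglongrightarrow> 0 + 2 * (\<integral>x. f x * f x \<partial>M) - (\<integral>x. (f x)\<^sup>2 \<partial>M)"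
    using assms(1) unfolding L2conv_def
    by (intro tendsto_intros L2conv_inner_const[OF assms assms(3)])
  then show ?thesis unfolding eq by (simp add: power2_eq_square)
qed

text \<open>Polarization reduces the product to the convergence of norms.\<close>

lemma L2conv_inner:
  assumes "L2conv M u f" "\<And>n. L2 M (u n)" "L2 M f" "L2conv M w g" "\<And>n. L2 M (w n)" "L2 M g"
  shows "(\<lambda>n. \<integral>x. u n x * w n x \<partial>M) \<longlonglongrightarrow> (\<integral>x. f x * g x \<partial>M)"
proof -
  have pol: "(\<integral>x. a x * b x \<partial>M) = ((\<integral>x. (1 * a x + 1 * b x)\<^sup>2 \<partial>M) - (\<integral>x. (1 * a x + (-1) * b x)\<^sup>2 \<partial>M)) / 4"
    if "L2 M a" "L2 M b" for a b
  proof -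
    have "integrable M (\<lambda>x. (1 * a x + 1 * b x)\<^sup>2)" "integrable M (\<lambda>x. (1 * a x + (-1) * b x)\<^sup>2)"
      using L2_lincomb[OF that, of 1 1] L2_lincomb[OF that, of 1 "-1"] by (simp_all add: L2_def)
    then have "(\<integral>x. (1 * a x + 1 * b x)\<^sup>2 \<partial>M) - (\<integral>x. (1 * a x + (-1) * b x)\<^sup>2 \<partial>M)
       = (\<integral>x. (1 * a x + 1 * b x)\<^sup>2 - (1 * a x + (-1) * b x)\<^sup>2 \<partial>M)" by simp
    also have "\<dots> = (\<integral>x. 4 * (a x * b x) \<partial>M)"
      by (intro Bochner_Integration.integral_cong) (auto simp: power2_eq_square algebra_simps)
    finally show ?thesis by simp
  qed
  show ?thesis
    unfolding pol[OF assms(2,5)] pol[OF assms(3,6)]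
    by (intro tendsto_intros L2conv_norm L2conv_lincomb L2_lincomb assms) simp
qed

lemma L2conv_inner_weight:
  assumes "L2conv M u f" "\<And>n. L2 M (u n)" "L2 M f" "L2conv M w g" "\<And>n. L2 M (w n)" "L2 M g"
    "b \<in> borel_measurable M" "\<And>x. x \<in> space M \<Longrightarrow> \<bar>b x\<bar> \<le> K"
  shows "(\<lambda>n. \<integral>x. b x * u n x * w n x \<partial>M) \<longlonglongrightarrow> (\<integral>x. b x * f x * g x \<partial>M)"
  by (rule L2conv_inner[OF L2conv_bmult[OF assms(1-3,8)] _ _ assms(4-6)])
    (auto intro: L2_bmult assms)

lemma L2conv_approx:
  assumes "L2conv M u f" "\<And>n. L2 M (u n)" "L2 M f" "\<And>n. L2 M (w n)"
    "(\<lambda>n. \<integral>x. (w n x - u n x)\<^sup>2 \<partial>M) \<longlonglongrightarrow> 0"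
  shows "L2conv M w f"
  unfolding L2conv_def
proof (rule tendsto_sandwich[OF always_eventually always_eventually tendsto_const])
  show "\<forall>n. (\<integral>x. (w n x - f x)\<^sup>2 \<partial>M) \<le> 2 * (\<integral>x. (w n x - u n x)\<^sup>2 \<partial>M) + 2 * (\<integral>x. (u n x - f x)\<^sup>2 \<partial>M)"
  proof
    fix n
    show "(\<integral>x. (w n x - f x)\<^sup>2 \<partial>M) \<le> 2 * (\<integral>x. (w n x - u n x)\<^sup>2 \<partial>M) + 2 * (\<integral>x. (u n x - f x)\<^sup>2 \<partial>M)"
      using L2_triangle[OF L2_diff[OF assms(4)[of n] assms(2)[of n]] L2_diff[OF assms(2)[of n] assms(3)]] by simp
  qed
  have "(\<lambda>n. 2 * (\<integral>x. (w n x - u n x)\<^sup>2 \<partial>M) + 2 * (\<integral>x. (u n x - f x)\<^sup>2 \<partial>M)) \<longlonglongrightarrow> 2 * 0 + 2 * 0"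
    using assms(1,5) unfolding L2conv_def by (intro tendsto_intros)
  then show "(\<lambda>n. 2 * (\<integral>x. (w n x - u n x)\<^sup>2 \<partial>M) + 2 * (\<integral>x. (u n x - f x)\<^sup>2 \<partial>M)) \<longlonglongrightarrow> 0" by simp
qed (auto intro!: Bochner_Integration.integral_nonneg)

text \<open>The Riesz-Fischer argument. For a subsequence whose consecutive differences
  \<open>d k\<close> have squared norm below 4^-k, the series of 2^k (\<open>d k\<close>)^2 is
  integrable, hence finite almost everywhere. Since |\<open>d k\<close>| is at most 2^-k + 2^k
  (\<open>d k\<close>)^2, the telescoping series converges pointwise, and Fatou's lemma turns the
  pointwise limit into a limit in the mean.\<close>

theorem L2_complete:
  assumes u: "\<And>n. L2 M (u n)"
    and cauchy: "\<And>e. e > 0 \<Longrightarrow> \<exists>N. \<forall>m\<ge>N. \<forall>n\<ge>N. (\<integral>x. (u m x - u n x)\<^sup>2 \<partial>M) < e"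
  shows "\<exists>f. L2 M f \<and> L2conv M u f"
proof -
  have um[measurable]: "u n \<in> borel_measurable M" for n using u by (simp add: L2_def)
  have "\<exists>N. \<forall>m\<ge>N. \<forall>n\<ge>N. (\<integral>x. (u m x - u n x)\<^sup>2 \<partial>M) < (1/4)^k" for k :: nat
    by (rule cauchy) simp
  then obtain N where N: "\<And>k m n. m \<ge> N k \<Longrightarrow> n \<ge> N k \<Longrightarrow> (\<integral>x. (u m x - u n x)\<^sup>2 \<partial>M) < (1/4)^k"
    by metis
  \<comment> \<open>The sum makes both \<open>r k\<close> and \<open>r (Suc k)\<close> at least
    \<open>N k\<close>, as is wanted for consecutive differences; the summand \<open>k\<close> makes
    \<open>r\<close> unbounded.\<close>
  define r where "r k = (\<Sum>i\<le>k. N i) + k" for k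
  have rN: "r k \<ge> N k" for k
    using member_le_sum[of k "{..k}" N] by (simp add: r_def)
  have rS: "r (Suc k) \<ge> N k" for k
    using member_le_sum[of k "{..Suc k}" N] by (simp add: r_def)
  have rk: "r k \<ge> k" for k by (simp add: r_def)
  define d where "d k x = u (r (Suc k)) x - u (r k) x" for k x
  have dm[measurable]: "d k \<in> borel_measurable M" for k unfolding d_def by measurable
  have nn: "(\<integral>\<^sup>+x. ennreal ((u m x - u n x)\<^sup>2) \<partial>M) = ennreal (\<integral>x. (u m x - u n x)\<^sup>2 \<partial>M)" for m n
    using L2_diff[OF u u, of m n] by (intro nn_integral_eq_integral) (auto simp: L2_def)
  have "(\<integral>\<^sup>+x. (\<Sum>k. ennreal (2^k * (d k x)\<^sup>2)) \<partial>M) = (\<Sum>k. \<integral>\<^sup>+x. ennreal (2^k * (d k x)\<^sup>2) \<partial>M)"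
    by (rule nn_integral_suminf) measurable
  also have "\<dots> \<le> (\<Sum>k. ennreal ((1/2)^k))"
  proof (rule suminf_le)
    fix k
    have "(\<integral>\<^sup>+x. ennreal (2^k * (d k x)\<^sup>2) \<partial>M) = ennreal (2^k) * (\<integral>\<^sup>+x. ennreal ((d k x)\<^sup>2) \<partial>M)"
      by (subst nn_integral_cmult[symmetric]) (auto simp: ennreal_mult)
    also have "\<dots> = ennreal (2^k * (\<integral>x. (d k x)\<^sup>2 \<partial>M))"
      unfolding d_def nn by (subst ennreal_mult) (auto intro!: Bochner_Integration.integral_nonneg)
    also have "\<dots> \<le> ennreal (2^k * (1/4)^k)"
      unfolding d_def using N[OF rS rN, of k] by (intro ennreal_leI mult_left_mono) auto
    also have "(2::real)^k * (1/4)^k = (1/2)^k" by (simp flip: power_mult_distrib)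
    finally show "(\<integral>\<^sup>+x. ennreal (2^k * (d k x)\<^sup>2) \<partial>M) \<le> ennreal ((1/2)^k)" .
  qed auto
  also have "\<dots> = ennreal (\<Sum>k. (1/2)^k)"
    by (intro suminf_ennreal2) auto
  finally have fin: "(\<integral>\<^sup>+x. (\<Sum>k. ennreal (2^k * (d k x)\<^sup>2)) \<partial>M) \<noteq> \<infinity>"
    by (metis ennreal_less_top infinity_ennreal_def leD top.extremum_unique order_refl)
  have "AE x in M. (\<Sum>k. ennreal (2^k * (d k x)\<^sup>2)) \<noteq> \<infinity>"
    by (rule nn_integral_noteq_infinite[OF _ fin]) measurable
  then have conv: "AE x in M. convergent (\<lambda>k. u (r k) x)"
  proof eventually_elim
    case (elim x)
    have s: "summable (\<lambda>k. 2^k * (d k x)\<^sup>2)"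
      by (rule summable_suminf_not_top) (use elim in auto)
    have "summable (\<lambda>k. d k x)"
    proof (rule summable_comparison_test[of _ "\<lambda>k. (1/2)^k + 2^k * (d k x)\<^sup>2"])
      have "\<bar>d k x\<bar> \<le> (1/2)^k + 2^k * (d k x)\<^sup>2" for k
      proof -
        let ?t = "(2::real)^k"
        have "0 \<le> (?t * \<bar>d k x\<bar> - 1)\<^sup>2" by simp
        then have "2 * (?t * \<bar>d k x\<bar>) \<le> 1 + ?t\<^sup>2 * (d k x)\<^sup>2" by (simp add: power2_eq_square algebra_simps)
        moreover have "0 \<le> ?t * \<bar>d k x\<bar>" by simp
        ultimately have "?t * \<bar>d k x\<bar> \<le> 1 + ?t\<^sup>2 * (d k x)\<^sup>2"
          by linarith
        then have "\<bar>d k x\<bar> \<le> (1 + ?t\<^sup>2 * (d k x)\<^sup>2) / ?t" by (simp add: pos_le_divide_eq mult.commute)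
        then show ?thesis by (simp add: power2_eq_square add_divide_distrib power_one_over)
      qed
      then show "\<exists>N. \<forall>n\<ge>N. norm (d n x) \<le> (1/2)^n + 2^n * (d n x)\<^sup>2" by auto
      show "summable (\<lambda>k. (1/2)^k + 2^k * (d k x)\<^sup>2)" by (intro summable_add s) simp
    qed
    then have "convergent (\<lambda>n. \<Sum>k<n. d k x)" by (simp add: summable_iff_convergent)
    moreover have "(\<Sum>k<n. d k x) = u (r n) x - u (r 0) x" for n
      unfolding d_def by (rule sum_lessThan_telescope)
    ultimately have "convergent (\<lambda>n. u (r n) x - u (r 0) x)" by simp
    then show ?case
      using convergent_add[OF _ convergent_const[of "u (r 0) x"], of "\<lambda>n. u (r n) x - u (r 0) x"] by simp
  qed
  define f where "f x = lim (\<lambda>k. u (r k) x)" for x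
  have fm[measurable]: "f \<in> borel_measurable M" unfolding f_def by measurable
  \<comment> \<open>Fatou's lemma along the subsequence: \<open>u n\<close> is compared with members
    whose index is eventually at least \<open>N0\<close>, and the limit inherits the bound
    \<open>e\<close>.\<close>
  have small: "(\<integral>\<^sup>+x. ennreal ((u n x - f x)\<^sup>2) \<partial>M) \<le> ennreal e"
    if e: "e \<ge> 0" and n: "\<forall>m\<ge>N0. (\<integral>x. (u n x - u m x)\<^sup>2 \<partial>M) < e" for n N0 e
  proof -
    have "AE x in M. liminf (\<lambda>k. ennreal ((u n x - u (r k) x)\<^sup>2)) = ennreal ((u n x - f x)\<^sup>2)"
      using conv
    proof eventually_elim
      case (elim x)
      then have l: "(\<lambda>k. u (r k) x) \<longlonglongrightarrow> f x" by (simp add: f_def convergent_LIMSEQ_iff)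
      show ?case by (intro lim_imp_Liminf tendsto_intros l) simp
    qed
    then have "(\<integral>\<^sup>+x. ennreal ((u n x - f x)\<^sup>2) \<partial>M) = (\<integral>\<^sup>+x. liminf (\<lambda>k. ennreal ((u n x - u (r k) x)\<^sup>2)) \<partial>M)"
      by (intro nn_integral_cong_AE) auto
    also have "\<dots> \<le> liminf (\<lambda>k. \<integral>\<^sup>+x. ennreal ((u n x - u (r k) x)\<^sup>2) \<partial>M)"
      by (rule nn_integral_liminf) measurable
    also have "\<dots> \<le> liminf (\<lambda>k. ennreal e)"
    proof (rule Liminf_mono)
      have "ennreal (\<integral>x. (u n x - u (r k) x)\<^sup>2 \<partial>M) \<le> ennreal e" if "k \<ge> N0" for k
        using n rk[of k] that by (intro ennreal_leI less_imp_le) auto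
      then show "\<forall>\<^sub>F k in sequentially. (\<integral>\<^sup>+x. ennreal ((u n x - u (r k) x)\<^sup>2) \<partial>M) \<le> ennreal e"
        unfolding nn by (auto simp: eventually_sequentially)
    qed
    also have "\<dots> = ennreal e" by (simp add: Liminf_const)
    finally show ?thesis .
  qed
  have L2d: "L2 M (\<lambda>x. u n x - f x)" "(\<integral>x. (u n x - f x)\<^sup>2 \<partial>M) \<le> e"
    if e: "e \<ge> 0" and n: "\<forall>m\<ge>N0. (\<integral>x. (u n x - u m x)\<^sup>2 \<partial>M) < e" for n N0 e
  proof -
    note s = small[OF e n]
    have "(\<integral>\<^sup>+x. ennreal (norm ((u n x - f x)\<^sup>2)) \<partial>M) < \<infinity>"
      using s by (simp add: le_less_trans[OF _ ennreal_less_top])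
    then show "L2 M (\<lambda>x. u n x - f x)" by (simp add: L2_def integrable_iff_bounded)
    then have "(\<integral>\<^sup>+x. ennreal ((u n x - f x)\<^sup>2) \<partial>M) = ennreal (\<integral>x. (u n x - f x)\<^sup>2 \<partial>M)"
      by (intro nn_integral_eq_integral) (auto simp: L2_def)
    then show "(\<integral>x. (u n x - f x)\<^sup>2 \<partial>M) \<le> e" using s e by simp
  qed
  have "L2 M f"
  proof -
    obtain N0 where "\<forall>m\<ge>N0. \<forall>n\<ge>N0. (\<integral>x. (u m x - u n x)\<^sup>2 \<partial>M) < 1" using cauchy[of 1] by auto
    then have "L2 M (\<lambda>x. u N0 x - f x)" by (intro L2d(1)[of 1 N0]) auto
    from L2_diff[OF u[of N0] this] show ?thesis by simp
  qed
  moreover have "L2conv M u f"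
    unfolding L2conv_def
  proof (rule LIMSEQ_I)
    fix e :: real assume e: "e > 0"
    then obtain N0 where N0: "\<forall>m\<ge>N0. \<forall>n\<ge>N0. (\<integral>x. (u m x - u n x)\<^sup>2 \<partial>M) < e / 2" using cauchy[of "e/2"] by auto
    have "norm ((\<integral>x. (u n x - f x)\<^sup>2 \<partial>M) - 0) < e" if "n \<ge> N0" for n
    proof -
      have "(\<integral>x. (u n x - f x)\<^sup>2 \<partial>M) \<le> e / 2" using e N0 that by (intro L2d(2)[of _ N0]) auto
      moreover have "0 \<le> (\<integral>x. (u n x - f x)\<^sup>2 \<partial>M)" by (intro Bochner_Integration.integral_nonneg) auto
      ultimately show ?thesis using e by simp
    qed
    then show "\<exists>no. \<forall>n\<ge>no. norm ((\<integral>x. (u n x - f x)\<^sup>2 \<partial>M) - 0) < e" by blast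
  qed
  ultimately show ?thesis by blast
qed

section \<open>Test functions and weak derivatives\<close>

abbreviation dd :: "('a::real_normed_vector \<Rightarrow> real) \<Rightarrow> 'a \<Rightarrow> 'a \<Rightarrow> real" where
  "dd f v x \<equiv> frechet_derivative f (at x) v"

abbreviation supp :: "('a::topological_space \<Rightarrow> real) \<Rightarrow> 'a set" where
  "supp f \<equiv> closure {x. f x \<noteq> 0}"

text \<open>The regularity part of \<open>C1c\<close>, separated from the support condition so that
  products with polynomials and compositions can be formed first.\<close>

definition C1 :: "('a::real_normed_vector \<Rightarrow> real) \<Rightarrow> bool" where
  "C1 f \<longleftrightarrow> (\<forall>x. f differentiable (at x)) \<and> (\<forall>v. continuous_on UNIV (dd f v))"

lemma C1I:
  assumes "\<And>x. (f has_derivative f' x) (at x)" "\<And>v. continuous_on UNIV (\<lambda>x. f' x v)"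
  shows "C1 f" and "dd f v x = f' x v"
proof -
  have eq: "frechet_derivative f (at x) = f' x" for x
    using frechet_derivative_at[OF assms(1)] by simp
  show "dd f v x = f' x v" by (simp add: eq)
  show "C1 f" using assms by (auto simp: C1_def eq differentiable_def)
qed

lemma C1_has_derivative: "C1 f \<Longrightarrow> (f has_derivative (\<lambda>v. dd f v x)) (at x)"
  by (simp add: C1_def frechet_derivative_works[symmetric])

lemma C1_continuous: "C1 f \<Longrightarrow> continuous_on S f"
  by (meson C1_has_derivative continuous_at_imp_continuous_on has_derivative_continuous)

lemma C1_dd_continuous: "C1 f \<Longrightarrow> continuous_on S (dd f v)"
  unfolding C1_def by (meson continuous_on_subset subset_UNIV)

lemma C1_linear_dd: "C1 f \<Longrightarrow> linear (\<lambda>v. dd f v x)"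
  by (rule has_derivative_linear[OF C1_has_derivative])

lemma C1_line:
  assumes "C1 f"
  shows "((\<lambda>t. f (x + t *\<^sub>R v)) has_real_derivative dd f v (x + t *\<^sub>R v)) (at t)"
proof -
  have "((\<lambda>t. x + t *\<^sub>R v) has_derivative (\<lambda>s. s *\<^sub>R v)) (at t)"
    by (auto intro!: derivative_eq_intros)
  from has_derivative_compose[OF this C1_has_derivative[OF assms]]
  have "((\<lambda>t. f (x + t *\<^sub>R v)) has_derivative (\<lambda>s. dd f (s *\<^sub>R v) (x + t *\<^sub>R v))) (at t)" .
  moreover have "(\<lambda>s. dd f (s *\<^sub>R v) (x + t *\<^sub>R v)) = (*) (dd f v (x + t *\<^sub>R v))"
    using linear_scale[OF C1_linear_dd[OF assms]] by (simp add: fun_eq_iff)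
  ultimately show ?thesis by (simp add: has_field_derivative_def)
qed

lemma C1c_iff: "C1c U f \<longleftrightarrow> C1 f \<and> compact (supp f) \<and> supp f \<subseteq> U"
  by (auto simp: C1c_def C1_def)

lemma C1c_C1: "C1c U f \<Longrightarrow> C1 f"
  by (simp add: C1c_iff)

lemma C1_mult:
  assumes "C1 f" "C1 g"
  shows "C1 (\<lambda>x. f x * g x)" and "dd (\<lambda>x. f x * g x) v x = f x * dd g v x + dd f v x * g x"
proof -
  have d: "((\<lambda>x. f x * g x) has_derivative (\<lambda>v. f x * dd g v x + dd f v x * g x)) (at x)" for x
    by (rule has_derivative_mult[OF C1_has_derivative[OF assms(1)] C1_has_derivative[OF assms(2)]])
  have c: "continuous_on UNIV (\<lambda>x. f x * dd g v x + dd f v x * g x)" for v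
    by (intro continuous_intros C1_continuous C1_dd_continuous assms)
  show "C1 (\<lambda>x. f x * g x)" by (rule C1I(1)[OF d c])
  show "dd (\<lambda>x. f x * g x) v x = f x * dd g v x + dd f v x * g x" by (rule C1I(2)[OF d c])
qed

lemma C1_add:
  assumes "C1 f" "C1 g"
  shows "C1 (\<lambda>x. f x + g x)" and "dd (\<lambda>x. f x + g x) v x = dd f v x + dd g v x"
proof -
  have d: "((\<lambda>x. f x + g x) has_derivative (\<lambda>v. dd f v x + dd g v x)) (at x)" for x
    by (rule has_derivative_add[OF C1_has_derivative[OF assms(1)] C1_has_derivative[OF assms(2)]])
  have c: "continuous_on UNIV (\<lambda>x. dd f v x + dd g v x)" for v
    by (intro continuous_intros C1_dd_continuous assms)
  show "C1 (\<lambda>x. f x + g x)" by (rule C1I(1)[OF d c])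
  show "dd (\<lambda>x. f x + g x) v x = dd f v x + dd g v x" by (rule C1I(2)[OF d c])
qed

lemma C1_const: "C1 (\<lambda>x. c)" and dd_const: "dd (\<lambda>x. c) v x = 0"
  using C1I[of "\<lambda>x. c" "\<lambda>x v. 0"] by (auto intro: derivative_intros)

lemma C1_linear:
  assumes "bounded_linear l"
  shows "C1 l" and "dd l v x = l v"
  using C1I[of l "\<lambda>x. l"] bounded_linear_imp_has_derivative[OF assms] by auto

lemma C1_compose_linear:
  assumes "C1 f" "bounded_linear L"
  shows "C1 (\<lambda>z. f (L z))" and "dd (\<lambda>z. f (L z)) v z = dd f (L v) (L z)"
proof -
  have d: "((\<lambda>z. f (L z)) has_derivative (\<lambda>v. dd f (L v) (L z))) (at z)" for z
    using has_derivative_compose[OF bounded_linear_imp_has_derivative[OF assms(2)] C1_has_derivative[OF assms(1)]] .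
  have c: "continuous_on UNIV (\<lambda>z. dd f (L v) (L z))" for v
    by (rule continuous_on_compose2[OF C1_dd_continuous[OF assms(1), of UNIV] linear_continuous_on[OF assms(2)]]) auto
  show "C1 (\<lambda>z. f (L z))" by (rule C1I(1)[OF d c])
  show "dd (\<lambda>z. f (L z)) v z = dd f (L v) (L z)" by (rule C1I(2)[OF d c])
qed

lemma C1_compose_real:
  assumes "C1 f" "\<And>t. (k has_real_derivative k' t) (at t)" "continuous_on UNIV k'"
  shows "C1 (\<lambda>x. k (f x))" and "dd (\<lambda>x. k (f x)) v x = k' (f x) * dd f v x"
proof -
  have d: "((\<lambda>x. k (f x)) has_derivative (\<lambda>v. k' (f x) * dd f v x)) (at x)" for x
    using has_derivative_compose[OF C1_has_derivative[OF assms(1)] assms(2)[unfolded has_field_derivative_def]] .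
  have c: "continuous_on UNIV (\<lambda>x. k' (f x) * dd f v x)" for v
    by (intro continuous_intros C1_dd_continuous assms continuous_on_compose2[OF assms(3) C1_continuous[OF assms(1)]]) auto
  show "C1 (\<lambda>x. k (f x))" by (rule C1I(1)[OF d c])
  show "dd (\<lambda>x. k (f x)) v x = k' (f x) * dd f v x" by (rule C1I(2)[OF d c])
qed

lemma C1_prod:
  assumes "finite I" "\<And>i. i \<in> I \<Longrightarrow> C1 (f i)"
  shows "C1 (\<lambda>x. \<Prod>i\<in>I. f i x)"
  using assms by (induction I rule: finite_induct) (simp_all add: C1_const C1_mult(1))

lemma notin_supp: "x \<notin> supp f \<Longrightarrow> f x = 0"
  using closure_subset[of "{x. f x \<noteq> 0}"] by blast

lemma dd_notin_supp:
  fixes f :: "'a::real_normed_vector \<Rightarrow> real"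
  assumes "x \<notin> supp f"
  shows "dd f v x = 0"
proof -
  have "(f has_derivative (\<lambda>v. 0)) (at x)"
  proof (rule has_derivative_transform_within_open)
    show "((\<lambda>x. 0) has_derivative (\<lambda>v. 0)) (at x)" by simp
    show "open (- supp f)" by (rule open_Compl[OF closed_closure])
    show "x \<in> - supp f" using assms by simp
    show "0 = f y" if "y \<in> - supp f" for y using notin_supp[of y f] that by (metis ComplD)
  qed
  then have "frechet_derivative f (at x) = (\<lambda>v. 0)" by (rule frechet_derivative_at[symmetric])
  then show ?thesis by simp
qed

lemma C1c_subset_supp:
  assumes "C1 g" "C1c U f" "\<And>x. f x = 0 \<Longrightarrow> g x = 0"
  shows "C1c U g" "supp g \<subseteq> supp f"
proof -
  show s: "supp g \<subseteq> supp f" using assms(3) by (intro closure_mono) auto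
  then have "compact (supp g)" using assms(2)
    by (metis C1c_iff closed_closure compact_Int_closed inf.absorb_iff2)
  then show "C1c U g" using assms s by (auto simp: C1c_iff)
qed

lemma C1c_mult_right: "C1 f \<Longrightarrow> C1c U g \<Longrightarrow> C1c U (\<lambda>x. f x * g x)"
  by (rule C1c_subset_supp(1)[of _ U g]) (auto intro: C1_mult C1c_C1)

lemma compact_support_integrable:
  fixes f :: "'a::euclidean_space \<Rightarrow> real"
  assumes "continuous_on UNIV f" "compact K" "\<And>x. x \<notin> K \<Longrightarrow> f x = 0"
  shows "integrable lborel f"
proof -
  have "integrable lborel (\<lambda>x. indicator K x *\<^sub>R f x)"
    using assms by (intro borel_integrable_compact) (auto intro: continuous_on_subset)
  also have "(\<lambda>x. indicator K x *\<^sub>R f x) = f" using assms(3) by (force simp: indicator_def)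
  finally show ?thesis .
qed

lemma compact_support_bounded:
  fixes f :: "'a::euclidean_space \<Rightarrow> real"
  assumes "continuous_on UNIV f" "compact K" "\<And>x. x \<notin> K \<Longrightarrow> f x = 0"
  obtains C where "C \<ge> 0" "\<And>x. \<bar>f x\<bar> \<le> C"
proof -
  have "bounded (f ` K)"
    using assms by (intro compact_imp_bounded compact_continuous_image) (auto intro: continuous_on_subset)
  then obtain C where "\<forall>y\<in>f ` K. norm y \<le> C" by (auto simp: bounded_iff)
  then have "\<bar>f x\<bar> \<le> max C 0" for x using assms(3)[of x] by (cases "x \<in> K") force+
  then show thesis using that[of "max C 0"] by auto
qed

lemma C1c_bounded:
  fixes f :: "'a::euclidean_space \<Rightarrow> real"
  assumes "C1c U f"
  obtains C where "C \<ge> 0" "\<And>x. \<bar>f x\<bar> \<le> C"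
proof -
  have "compact (supp f)" "continuous_on UNIV f" using assms by (auto simp: C1c_iff C1_continuous)
  from compact_support_bounded[OF this(2,1) notin_supp[of _ f]] that show thesis by blast
qed

lemma C1c_dd_bounded:
  fixes f :: "'a::euclidean_space \<Rightarrow> real"
  assumes "C1c U f"
  obtains C where "C \<ge> 0" "\<And>x. \<bar>dd f v x\<bar> \<le> C"
proof -
  have "compact (supp f)" "continuous_on UNIV (dd f v)" using assms by (auto simp: C1c_iff C1_dd_continuous)
  from compact_support_bounded[OF this(2,1) dd_notin_supp[of _ f v]] that show thesis by blast
qed

section \<open>Integration over a set through the restricted Lebesgue measure\<close>

abbreviation Lb :: "'a::euclidean_space set \<Rightarrow> 'a measure" where
  "Lb U \<equiv> restrict_space lborel U"

lemma Lb_measurable: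
  fixes f :: "'a::euclidean_space \<Rightarrow> real"
  assumes "f \<in> borel_measurable borel"
  shows "f \<in> borel_measurable (Lb U)"
  using assms by (simp add: measurable_restrict_space1)

lemma Lb_integrable_iff:
  fixes f :: "'a::euclidean_space \<Rightarrow> real"
  assumes "U \<in> sets borel"
  shows "integrable (Lb U) f \<longleftrightarrow> set_integrable lborel U f"
  using assms by (simp add: integrable_restrict_space set_integrable_def)

lemma Lb_integrable:
  fixes f :: "'a::euclidean_space \<Rightarrow> real"
  assumes "U \<in> sets borel" "integrable lborel f"
  shows "integrable (Lb U) f"
  using assms integrable_mult_indicator[of U lborel f] by (simp add: integrable_restrict_space)

lemma Lb_integral:
  fixes f :: "'a::euclidean_space \<Rightarrow> real"
  assumes "U \<in> sets borel"
  shows "(LINT x:U|lborel. f x) = (\<integral>x. f x \<partial>Lb U)"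
  using assms by (simp add: integral_restrict_space set_lebesgue_integral_def)

lemma L2_on_iff:
  assumes "U \<in> sets borel"
  shows "L2_on U f \<longleftrightarrow> L2 (Lb U) f"
  using assms by (simp add: L2_on_def L2_def Lb_integrable_iff set_borel_measurable_def borel_measurable_restrict_space_iff)

lemma compact_support_L2:
  fixes f :: "'a::euclidean_space \<Rightarrow> real"
  assumes "U \<in> sets borel" "continuous_on UNIV f" "compact K" "\<And>x. x \<notin> K \<Longrightarrow> f x = 0"
  shows "L2 (Lb U) f"
proof -
  have "integrable lborel (\<lambda>x. (f x)\<^sup>2)"
    using assms by (intro compact_support_integrable[of _ K] continuous_intros) auto
  moreover have "f \<in> borel_measurable borel" using assms(2) by (rule borel_measurable_continuous_onI)
  ultimately show ?thesis using assms(1) by (simp add: L2_def Lb_integrable Lb_measurable)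
qed

lemma C1c_L2:
  fixes f :: "'a::euclidean_space \<Rightarrow> real"
  assumes "U \<in> sets borel" "C1c V f"
  shows "L2 (Lb U) f" "L2 (Lb U) (dd f v)"
proof -
  have c: "C1 f" "compact (supp f)" using assms(2) by (auto simp: C1c_iff)
  show "L2 (Lb U) f" by (rule compact_support_L2[OF assms(1) C1_continuous[OF c(1)] c(2) notin_supp[of _ f]])
  show "L2 (Lb U) (dd f v)" by (rule compact_support_L2[OF assms(1) C1_dd_continuous[OF c(1)] c(2) dd_notin_supp[of _ f v]])
qed

lemma integral_lborel_translate:
  fixes f :: "'a::euclidean_space \<Rightarrow> real"
  assumes "f \<in> borel_measurable borel"
  shows "(\<integral>x. f (a + x) \<partial>lborel) = (\<integral>x. f x \<partial>lborel)"
proof -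
  have "(\<integral>x. f x \<partial>lborel) = (\<integral>x. f x \<partial>distr lborel borel ((+) a))" by (simp add: lborel_distr_plus)
  also have "\<dots> = (\<integral>x. f (a + x) \<partial>lborel)" using assms by (intro integral_distr) auto
  finally show ?thesis by simp
qed

text \<open>By translation invariance all difference quotients have integral zero.\<close>

lemma integral_dd_eq_0:
  fixes f :: "'a::euclidean_space \<Rightarrow> real"
  assumes f: "C1c U f"
  shows "(\<integral>x. dd f v x \<partial>lborel) = 0"
proof -
  obtain C where C: "C \<ge> 0" "\<And>x. \<bar>dd f v x\<bar> \<le> C" using C1c_dd_bounded[OF f] by blast
  have C1f: "C1 f" using f by (rule C1c_C1)
  have cf: "continuous_on UNIV f" using C1f by (rule C1_continuous)
  have fb: "f \<in> borel_measurable borel" using cf by (rule borel_measurable_continuous_onI)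
  obtain R where R: "R > 0" "\<And>x. x \<in> supp f \<Longrightarrow> norm x \<le> R"
    using f compact_imp_bounded[of "supp f"] by (auto simp: C1c_iff bounded_pos)
  define D where "D n x = real (Suc n) * (f ((1 / real (Suc n)) *\<^sub>R v + x) - f x)" for n x
  have lim: "(\<lambda>n. D n x) \<longlonglongrightarrow> dd f v x" for x
  proof -
    let ?h = "\<lambda>n. 1 / real (Suc n)"
    have "((\<lambda>t. f (x + t *\<^sub>R v)) has_real_derivative dd f v x) (at 0)"
      using C1_line[OF C1f, of x v 0] by simp
    then have A: "(\<lambda>t. (f (x + t *\<^sub>R v) - f x) / t) \<midarrow>0\<rightarrow> dd f v x"
      by (simp add: DERIV_def)
    have "?h \<longlonglongrightarrow> 0" using LIMSEQ_inverse_real_of_nat by (simp add: inverse_eq_divide)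
    then have "filterlim ?h (at 0) sequentially" by (simp add: filterlim_at)
    from filterlim_compose[OF A this]
    have "(\<lambda>n. (f (x + ?h n *\<^sub>R v) - f x) / ?h n) \<longlonglongrightarrow> dd f v x" .
    then show ?thesis unfolding D_def by (simp add: mult.commute add.commute)
  qed
  \<comment> \<open>Inside the enlarged ball the mean value theorem replaces the quotient by a
    derivative. Outside it the step is at most \<open>norm v\<close>, so both points lie off the
    support and the quotient is 0.\<close>
  have bound: "\<bar>D n x\<bar> \<le> C * indicator (cball 0 (R + norm v)) x" for n x
  proof (cases "x \<in> cball 0 (R + norm v)")
    case True
    let ?h = "1 / real (Suc n)"
    define F where "F = (\<lambda>t. f (x + t *\<^sub>R v))"
    define F' where "F' = (\<lambda>t. dd f v (x + t *\<^sub>R v))"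
    have "(F has_real_derivative F' t) (at t)" for t
      unfolding F_def F'_def by (rule C1_line[OF C1f])
    then have "\<exists>z>0. z < ?h \<and> F ?h - F 0 = (?h - 0) * F' z"
      by (intro MVT2) auto
    then obtain z where z: "F ?h - F 0 = ?h * F' z" by auto
    then have "D n x = dd f v (x + z *\<^sub>R v)" by (simp add: D_def F_def F'_def add.commute)
    then show ?thesis using C True by simp
  next
    case False
    let ?h = "1 / real (Suc n)"
    have n: "norm x > R + norm v" using False by simp
    have "?h * norm v \<le> 1 * norm v" by (intro mult_right_mono) auto
    then have "norm (?h *\<^sub>R v) \<le> norm v" by simp
    moreover have "norm x - norm (?h *\<^sub>R v) \<le> norm (?h *\<^sub>R v + x)"
      using norm_diff_ineq[of x "?h *\<^sub>R v"] by (simp only: add.commute)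
    ultimately have "\<not> norm (?h *\<^sub>R v + x) \<le> R" using n by linarith
    then have "?h *\<^sub>R v + x \<notin> supp f" using R(2) by blast
    then have "f (?h *\<^sub>R v + x) = 0" by (rule notin_supp)
    moreover have "f x = 0"
    proof -
      have "\<not> norm x \<le> R" using n norm_ge_zero[of v] by linarith
      then have "x \<notin> supp f" using R(2) by blast
      then show ?thesis by (rule notin_supp)
    qed
    ultimately show ?thesis using C(1) by (simp add: D_def)
  qed
  have fi: "integrable lborel f"
    using f compact_support_integrable[OF cf _ notin_supp[of _ f]] unfolding C1c_iff by blast
  have fti: "integrable lborel (\<lambda>x. f (a + x))" for a
  proof -
    have m: "(+) a \<in> lborel \<rightarrow>\<^sub>M borel" by simp
    have "integrable (distr lborel borel ((+) a)) f" using fi by (simp add: lborel_distr_plus)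
    then show ?thesis by (rule integrable_distr[OF m])
  qed
  have z: "(\<integral>x. D n x \<partial>lborel) = 0" for n
  proof -
    let ?a = "(1 / real (Suc n)) *\<^sub>R v"
    have "(\<integral>x. f (?a + x) - f x \<partial>lborel) = 0"
      using Bochner_Integration.integral_diff[OF fti[of ?a] fi] integral_lborel_translate[OF fb, of ?a] by simp
    then show ?thesis unfolding D_def by (simp only: integral_mult_right_zero mult_zero_right)
  qed
  have "(\<lambda>n. \<integral>x. D n x \<partial>lborel) \<longlonglongrightarrow> (\<integral>x. dd f v x \<partial>lborel)"
  proof (rule integral_dominated_convergence[where w="\<lambda>x. C * indicator (cball 0 (R + norm v)) x"])
    show "dd f v \<in> borel_measurable lborel"
      using C1_dd_continuous[OF C1f] by (simp add: borel_measurable_continuous_onI)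
    show "D n \<in> borel_measurable lborel" for n
      unfolding D_def using fb by measurable
    show "integrable lborel (\<lambda>x. C * indicator (cball 0 (R + norm v)) x)"
      by (intro integrable_mult_right integrable_real_indicator) (simp_all add: emeasure_bounded_finite[unfolded infinity_ennreal_def])
  qed (use lim bound in auto)
  then have "(\<lambda>n. 0) \<longlonglongrightarrow> (\<integral>x. dd f v x \<partial>lborel)" unfolding z .
  from LIMSEQ_unique[OF this tendsto_const] show ?thesis .
qed

text \<open>Integration by parts: the product with a test function has compact support in
  \<open>U\<close>, and the integral of its derivative vanishes.\<close>

lemma C1_weak_deriv:
  assumes U: "U \<in> sets borel" and f: "C1 f"
  shows "weak_deriv U e f (dd f e)"
  unfolding weak_deriv_def
proof (intro allI impI)
  fix \<phi> assume p: "C1c U \<phi>"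
  have "C1c U (\<lambda>x. f x * \<phi> x)" by (rule C1c_mult_right[OF f p])
  from integral_dd_eq_0[OF this, of e]
  have 0: "(\<integral>x. f x * dd \<phi> e x + dd f e x * \<phi> x \<partial>lborel) = 0"
    using C1_mult(2)[OF f C1c_C1[OF p]] by simp
  have K: "compact (supp \<phi>)" "supp \<phi> \<subseteq> U" "C1 \<phi>" using p by (auto simp: C1c_iff)
  have i1: "integrable lborel (\<lambda>x. f x * dd \<phi> e x)"
    using dd_notin_supp[of _ \<phi> e]
    by (intro compact_support_integrable[OF continuous_on_mult[OF C1_continuous[OF f] C1_dd_continuous[OF K(3)]] K(1)]) simp
  have i2: "integrable lborel (\<lambda>x. dd f e x * \<phi> x)"
  proof (rule compact_support_integrable[OF continuous_on_mult[OF C1_dd_continuous[OF f] C1_continuous[OF K(3)]] K(1)])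
    fix x assume "x \<notin> supp \<phi>"
    then have "\<phi> x = 0" by (rule notin_supp)
    then show "dd f e x * \<phi> x = 0" by simp
  qed
  have "(\<integral>x. f x * dd \<phi> e x \<partial>lborel) = - (\<integral>x. dd f e x * \<phi> x \<partial>lborel)"
    using 0 unfolding Bochner_Integration.integral_add[OF i1 i2] by linarith
  moreover have "(LINT x:U|lborel. f x * dd \<phi> e x) = (\<integral>x. f x * dd \<phi> e x \<partial>lborel)"
    unfolding set_lebesgue_integral_def
  proof (rule Bochner_Integration.integral_cong[OF refl])
    fix x show "indicator U x *\<^sub>R (f x * dd \<phi> e x) = f x * dd \<phi> e x"
    proof (cases "x \<in> supp \<phi>")
      case False
      then show ?thesis using dd_notin_supp[of x \<phi> e] by simp
    next
      case True
      then have "x \<in> U" using K(2) by blast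
      then show ?thesis by simp
    qed
  qed
  moreover have "(LINT x:U|lborel. dd f e x * \<phi> x) = (\<integral>x. dd f e x * \<phi> x \<partial>lborel)"
    unfolding set_lebesgue_integral_def
  proof (rule Bochner_Integration.integral_cong[OF refl])
    fix x show "indicator U x *\<^sub>R (dd f e x * \<phi> x) = dd f e x * \<phi> x"
    proof (cases "x \<in> supp \<phi>")
      case False
      then have "\<phi> x = 0" by (rule notin_supp)
      then show ?thesis by simp
    next
      case True
      then have "x \<in> U" using K(2) by blast
      then show ?thesis by simp
    qed
  qed
  ultimately show "(LINT x:U|lborel. f x * dd \<phi> e x) = - (LINT x:U|lborel. dd f e x * \<phi> x)"
    by (simp only:)
qed

text \<open>\<open>bump eps\<close> is a C1 function that increases to the indicator of the positive half-line as
  \<open>eps\<close> tends to 0.\<close>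

definition bump :: "real \<Rightarrow> real \<Rightarrow> real" where
  "bump eps s = (max 0 s)\<^sup>2 / (eps + (max 0 s)\<^sup>2)"

definition bump' :: "real \<Rightarrow> real \<Rightarrow> real" where
  "bump' eps s = 2 * eps * max 0 s / (eps + (max 0 s)\<^sup>2)\<^sup>2"

text \<open>Squaring removes the kink of the positive part at 0. This is the source of C1 regularity
  both for \<open>bump\<close> and for the longitudinal cutoff \<open>plateau\<close>.\<close>

lemma has_derivative_max_square:
  "((\<lambda>s. (max 0 s)\<^sup>2) has_real_derivative 2 * max 0 s) (at s)" for s :: real
proof -
  consider "s < 0" | "s = 0" | "s > 0" by linarith
  then show ?thesis
  proof cases
    case 1
    have "((\<lambda>s. 0) has_real_derivative 0) (at s)" by simp
    then have "((\<lambda>s. (max 0 s)\<^sup>2) has_real_derivative 0) (at s)"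
      by (rule has_field_derivative_transform_within_open[of _ _ _ "{..<0}"]) (use 1 in auto)
    then show ?thesis using 1 by simp
  next
    case 2
    have "(\<lambda>h. ((max 0 (0 + h))\<^sup>2 - (max 0 0)\<^sup>2) / h) \<midarrow>0\<rightarrow> (0::real)"
    proof (rule LIM_I)
      fix r :: real assume r: "r > 0"
      have "norm (((max 0 (0 + h))\<^sup>2 - (max 0 0)\<^sup>2) / h - 0) < r" if "h \<noteq> 0" "norm (h - 0) < r" for h :: real
        using that r by (cases "h > 0") (auto simp: max_def power2_eq_square)
      then show "\<exists>s>0. \<forall>x. x \<noteq> 0 \<and> norm (x - 0) < s \<longrightarrow> norm (((max 0 (0 + x))\<^sup>2 - (max 0 0)\<^sup>2) / x - (0::real)) < r"
        using r by blast
    qed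
    then show ?thesis using 2 by (simp add: DERIV_def)
  next
    case 3
    have "((\<lambda>s. s\<^sup>2) has_real_derivative 2 * s) (at s)" by (auto intro!: derivative_eq_intros)
    then have "((\<lambda>s. (max 0 s)\<^sup>2) has_real_derivative 2 * s) (at s)"
      by (rule has_field_derivative_transform_within_open[of _ _ _ "{0<..}"]) (use 3 in auto)
    then show ?thesis using 3 by simp
  qed
qed

lemma bump_deriv:
  assumes "eps > 0"
  shows "(bump eps has_real_derivative bump' eps s) (at s)"
proof -
  have p: "eps + (max 0 s)\<^sup>2 \<noteq> 0"
    using assms zero_le_power2[of "max 0 s"] by linarith
  show ?thesis
    unfolding bump_def[abs_def] bump'_def
    by (rule derivative_eq_intros has_derivative_max_square p refl)+
      (simp add: power2_eq_square algebra_simps)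
qed

lemma bump'_cont: "eps > 0 \<Longrightarrow> continuous_on UNIV (bump' eps)"
proof -
  assume e: "eps > 0"
  have "eps + (max 0 s)\<^sup>2 \<noteq> 0" for s :: real
    using e zero_le_power2[of "max 0 s"] by linarith
  then show ?thesis unfolding bump'_def[abs_def] by (intro continuous_intros) auto
qed

lemma bump_range: "eps > 0 \<Longrightarrow> 0 \<le> bump eps s \<and> bump eps s \<le> 1"
  by (simp add: bump_def divide_le_eq add_pos_nonneg)

lemma bump_eq_0: "eps > 0 \<Longrightarrow> bump eps s = 0 \<longleftrightarrow> s \<le> 0"
  using add_pos_nonneg[of eps "(max 0 s)\<^sup>2"] by (auto simp: bump_def max_def)

lemma bump_tendsto: "(\<lambda>n. bump (1 / real (Suc n)) s) \<longlonglongrightarrow> indicator {0<..} s"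
proof (cases "s > 0")
  case True
  have "(\<lambda>n. s\<^sup>2 / (1 / real (Suc n) + s\<^sup>2)) \<longlonglongrightarrow> s\<^sup>2 / (0 + s\<^sup>2)"
    using True LIMSEQ_inverse_real_of_nat by (intro tendsto_intros) (auto simp: inverse_eq_divide)
  then show ?thesis using True by (simp add: bump_def max_def)
next
  case False
  then show ?thesis by (simp add: bump_def max_def)
qed

definition box_bump :: "'a::euclidean_space \<Rightarrow> 'a \<Rightarrow> real \<Rightarrow> 'a \<Rightarrow> real" where
  "box_bump a b eps x = (\<Prod>i\<in>Basis. bump eps ((x - a) \<bullet> i) * bump eps ((b - x) \<bullet> i))"

lemma box_bump_C1c:
  assumes e: "eps > 0" and ab: "cbox a b \<subseteq> U"
  shows "C1c U (box_bump a b eps)"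
proof -
  have "C1 (\<lambda>x. bump eps ((x - a) \<bullet> i) * bump eps ((b - x) \<bullet> i))" for i
  proof -
    have 1: "C1 (\<lambda>x. (x - a) \<bullet> i)"
      by (rule C1I(1)[where f'="\<lambda>x v. v \<bullet> i"]) (auto intro!: derivative_eq_intros)
    have 2: "C1 (\<lambda>x. (b - x) \<bullet> i)"
      by (rule C1I(1)[where f'="\<lambda>x v. - (v \<bullet> i)"]) (auto intro!: derivative_eq_intros simp: inner_diff_left)
    show ?thesis
      by (intro C1_mult(1) C1_compose_real(1)[OF 1 bump_deriv[OF e] bump'_cont[OF e]]
          C1_compose_real(1)[OF 2 bump_deriv[OF e] bump'_cont[OF e]])
  qed
  then have C: "C1 (box_bump a b eps)"
    unfolding box_bump_def[abs_def] by (intro C1_prod) auto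
  have "{x. box_bump a b eps x \<noteq> 0} \<subseteq> cbox a b"
  proof
    fix x assume "x \<in> {x. box_bump a b eps x \<noteq> 0}"
    then have "\<forall>i\<in>Basis. (x - a) \<bullet> i > 0 \<and> (b - x) \<bullet> i > 0"
      by (auto simp: box_bump_def bump_eq_0[OF e] not_le)
    then show "x \<in> cbox a b" by (auto simp: mem_box inner_diff_left less_imp_le)
  qed
  then have s: "supp (box_bump a b eps) \<subseteq> cbox a b" by (intro closure_minimal closed_cbox)
  then have "compact (supp (box_bump a b eps))"
    by (metis closed_closure compact_Int_closed compact_cbox inf.absorb_iff2)
  then show ?thesis using C s ab by (auto simp: C1c_iff)
qed

lemma box_bump_range:
  assumes "eps > 0"
  shows "0 \<le> box_bump a b eps x \<and> box_bump a b eps x \<le> 1"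
  unfolding box_bump_def using bump_range[OF assms]
  by (auto intro!: prod_nonneg prod_le_1 mult_le_one)

lemma box_bump_tendsto: "(\<lambda>n. box_bump a b (1 / real (Suc n)) x) \<longlonglongrightarrow> indicator (box a b) x"
proof -
  have "(\<lambda>n. box_bump a b (1 / real (Suc n)) x) \<longlonglongrightarrow>
      (\<Prod>i\<in>Basis. indicator {0<..} ((x - a) \<bullet> i) * indicator {0<..} ((b - x) \<bullet> i))"
    unfolding box_bump_def by (intro tendsto_prod tendsto_mult bump_tendsto)
  also have "(\<Prod>i\<in>Basis. indicator {0<..} ((x - a) \<bullet> i) * indicator {0<..} ((b - x) \<bullet> i)) = (indicator (box a b) x :: real)"
  proof (cases "x \<in> box a b")
    case True
    then show ?thesis by (auto simp: mem_box inner_diff_left intro!: prod.neutral)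
  next
    case False
    then obtain i where i: "i \<in> Basis" "\<not> (a \<bullet> i < x \<bullet> i \<and> x \<bullet> i < b \<bullet> i)" by (auto simp: mem_box)
    then have "(\<Prod>i\<in>Basis. indicator {0<..} ((x - a) \<bullet> i) * indicator {0<..} ((b - x) \<bullet> i)) = (0::real)"
      by (intro prod_zero) (auto intro!: bexI[of _ i] simp: inner_diff_left indicator_def)
    then show ?thesis using False by simp
  qed
  finally show ?thesis .
qed

text \<open>Boxes are stable under intersection and generate the Borel sets, so the integral
  vanishes over every Borel set; \<open>tot\<close> serves the step to complements. The sets where
  \<open>f\<close> is positive and where it is negative then yield the claim.\<close>

lemma AE_zero_if_box_integrals_zero:
  fixes f :: "'a::euclidean_space \<Rightarrow> real"
  assumes f: "integrable lborel f" and z: "\<And>a b. (LINT x:box a b|lborel. f x) = 0"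
    and tot: "(\<integral>x. f x \<partial>lborel) = 0"
  shows "AE x in lborel. f x = 0"
proof -
  have si: "set_integrable lborel A f" if "A \<in> sets borel" for A
    using f that integrable_mult_indicator[of A lborel f] by (simp add: set_integrable_def)
  have all: "(LINT x:A|lborel. f x) = 0" if "A \<in> sets borel" for A
  proof -
    have "Int_stable (range (\<lambda>(a, b). box a b :: 'a set))"
      by (auto simp: Int_stable_def box_Int_box)
    moreover have "range (\<lambda>(a, b). box a b :: 'a set) \<subseteq> Pow UNIV" by simp
    moreover have "A \<in> sigma_sets UNIV (range (\<lambda>(a, b). box a b :: 'a set))"
      using that by (simp add: borel_eq_box)
    ultimately show ?thesis
    proof (induction rule: sigma_sets_induct_disjoint)
      case (basic A)
      then show ?case using z by auto
    next
      case empty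
      then show ?case by (simp add: set_lebesgue_integral_def)
    next
      case (compl A)
      then have A: "A \<in> sets borel" by (simp add: borel_eq_box)
      have "(LINT x:UNIV - A|lborel. f x) + (LINT x:A|lborel. f x) = (LINT x:(UNIV - A) \<union> A|lborel. f x)"
        using A by (intro set_integral_Un[symmetric] si) auto
      then show ?case using compl tot by (simp add: set_lebesgue_integral_def)
    next
      case (union A)
      then have A: "A i \<in> sets borel" for i by (simp add: borel_eq_box image_subset_iff)
      then have "(LINT x:(\<Union>i. A i)|lborel. f x) = (\<Sum>i. (LINT x:(A i)|lborel. f x))"
        using union(1) by (intro lebesgue_integral_countable_add si) (auto simp: disjoint_family_on_def)
      then show ?case using union by simp
    qed
  qed
  have fm[measurable]: "f \<in> borel_measurable borel" using f by auto
  have p: "AE x in lborel. indicator {x. f x > 0} x * f x = 0"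
  proof (subst integral_nonneg_eq_0_iff_AE[symmetric])
    show "integrable lborel (\<lambda>x. indicator {x. f x > 0} x * f x)"
      using si[of "{x. f x > 0}"] by (simp add: set_integrable_def)
    show "(\<integral>x. indicator {x. f x > 0} x * f x \<partial>lborel) = 0"
      using all[of "{x. f x > 0}"] by (simp add: set_lebesgue_integral_def)
  qed (auto simp: indicator_def)
  have n: "AE x in lborel. indicator {x. f x < 0} x * - f x = 0"
  proof (subst integral_nonneg_eq_0_iff_AE[symmetric])
    show "integrable lborel (\<lambda>x. indicator {x. f x < 0} x * - f x)"
      using si[of "{x. f x < 0}"] by (simp add: set_integrable_def)
    show "(\<integral>x. indicator {x. f x < 0} x * - f x \<partial>lborel) = 0"
      using all[of "{x. f x < 0}"] by (simp add: set_lebesgue_integral_def)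
  qed (auto simp: indicator_def)
  from p n show ?thesis
    by eventually_elim (auto simp: indicator_def split: if_splits)
qed

text \<open>C1 bumps take the place of mollifiers: by dominated convergence the integral of
  \<open>h\<close> vanishes over each open box whose closure lies in \<open>U\<close>. Vanishing on
  these boxes extends to their closures, whose faces are null sets, and countably many closed boxes
  cover \<open>U\<close>.\<close>

lemma fundamental_lemma:
  fixes h :: "'a::euclidean_space \<Rightarrow> real"
  assumes U: "open U" and h: "L2 (Lb U) h"
    and z: "\<And>\<phi>. C1c U \<phi> \<Longrightarrow> (\<integral>x. h x * \<phi> x \<partial>Lb U) = 0"
  shows "AE x in Lb U. h x = 0"
proof -
  have Ub: "U \<in> sets borel" using U by simp
  have hm: "(\<lambda>x. indicator U x * h x) \<in> borel_measurable borel"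
    using h Ub by (simp add: L2_def borel_measurable_restrict_space_iff)
  have int_box: "integrable lborel (\<lambda>x. indicator (cbox a b) x * h x)" if ab: "cbox a b \<subseteq> U" for a b
  proof -
    have "L2 (Lb U) (indicator (cbox a b))"
      unfolding L2_def
    proof
      show "integrable (Lb U) (\<lambda>x. (indicator (cbox a b) x)\<^sup>2 :: real)"
        using emeasure_bounded_finite[OF bounded_cbox, of a b]
        by (intro Lb_integrable Ub) (simp add: power2_eq_square indicator_inter_arith[symmetric])
    qed (intro Lb_measurable, simp)
    from L2_mult[OF this h] have "integrable lborel (\<lambda>x. indicator U x *\<^sub>R (indicator (cbox a b) x * h x))"
      using Ub by (simp add: integrable_restrict_space)
    also have "(\<lambda>x. indicator U x *\<^sub>R (indicator (cbox a b) x * h x)) = (\<lambda>x. indicator (cbox a b) x * h x)"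
      using ab by (auto simp: indicator_def fun_eq_iff)
    finally show ?thesis .
  qed
  have box0: "(LINT x:box a b|lborel. h x) = 0" if ab: "cbox a b \<subseteq> U" for a b
  proof -
    have "(\<lambda>n. \<integral>x. h x * box_bump a b (1 / real (Suc n)) x \<partial>Lb U) \<longlonglongrightarrow> (\<integral>x. h x * indicator (box a b) x \<partial>Lb U)"
    proof (rule integral_dominated_convergence[where w="\<lambda>x. \<bar>indicator (cbox a b) x * h x\<bar>"])
      have hU: "h \<in> borel_measurable (Lb U)" using h by (simp add: L2_def)
      show "(\<lambda>x. h x * indicator (box a b) x) \<in> borel_measurable (Lb U)"
        by (intro borel_measurable_times hU Lb_measurable) simp
      show "(\<lambda>x. h x * box_bump a b (1 / real (Suc n)) x) \<in> borel_measurable (Lb U)" for n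
        using C1c_L2(1)[OF Ub box_bump_C1c[OF _ ab], of "1 / real (Suc n)"]
        by (intro borel_measurable_times hU) (simp add: L2_def)
      show "integrable (Lb U) (\<lambda>x. \<bar>indicator (cbox a b) x * h x\<bar>)"
        by (intro Lb_integrable Ub integrable_abs int_box ab)
      show "AE x in Lb U. (\<lambda>n. h x * box_bump a b (1 / real (Suc n)) x) \<longlonglongrightarrow> h x * indicator (box a b) x"
        by (intro AE_I2 tendsto_mult tendsto_const box_bump_tendsto)
      show "AE x in Lb U. norm (h x * box_bump a b (1 / real (Suc n)) x) \<le> \<bar>indicator (cbox a b) x * h x\<bar>" for n
      proof (rule AE_I2)
        fix x
        have e: "1 / real (Suc n) > 0" by simp
        show "norm (h x * box_bump a b (1 / real (Suc n)) x) \<le> \<bar>indicator (cbox a b) x * h x\<bar>"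
        proof (cases "x \<in> cbox a b")
          case True
          then show ?thesis using box_bump_range[OF e, of a b x] by (auto simp: abs_mult mult_left_le)
        next
          case False
          have "box_bump a b (1 / real (Suc n)) x = 0"
          proof (rule ccontr)
            assume "box_bump a b (1 / real (Suc n)) x \<noteq> 0"
            then have "x \<in> supp (box_bump a b (1 / real (Suc n)))" using notin_supp by blast
            then show False using False box_bump_C1c[OF e order_refl, of a b] by (auto simp: C1c_iff)
          qed
          then show ?thesis by simp
        qed
      qed
    qed
    moreover have "(\<integral>x. h x * box_bump a b (1 / real (Suc n)) x \<partial>Lb U) = 0" for n
      by (rule z[OF box_bump_C1c[OF _ ab]]) simp
    ultimately have "(\<lambda>n. 0) \<longlonglongrightarrow> (\<integral>x. h x * indicator (box a b) x \<partial>Lb U)" by simp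
    from LIMSEQ_unique[OF this tendsto_const]
    have "(\<integral>x. h x * indicator (box a b) x \<partial>Lb U) = 0" .
    moreover have "(\<integral>x. h x * indicator (box a b) x \<partial>Lb U) = (LINT x:box a b|lborel. h x)"
      unfolding Lb_integral[OF Ub, symmetric] set_lebesgue_integral_def
    proof (rule Bochner_Integration.integral_cong[OF refl])
      fix x
      have "x \<in> box a b \<Longrightarrow> x \<in> U" using ab box_subset_cbox by blast
      then show "indicator U x *\<^sub>R (h x * indicator (box a b) x) = indicator (box a b) x *\<^sub>R h x"
        by (auto simp: indicator_def)
    qed
    ultimately show ?thesis by simp
  qed
  have AEbox: "AE x in lborel. x \<in> cbox a b \<longrightarrow> h x = 0" if ab: "cbox a b \<subseteq> U" for a b
  proof -
    have ib: "integrable lborel (\<lambda>x. indicator (box a b) x * h x)"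
    proof -
      have "integrable lborel (\<lambda>x. indicator (box a b) x *\<^sub>R (indicator (cbox a b) x * h x))"
        by (rule integrable_mult_indicator[OF _ int_box[OF ab]]) simp
      also have "(\<lambda>x. indicator (box a b) x *\<^sub>R (indicator (cbox a b) x * h x)) = (\<lambda>x. indicator (box a b) x * h x)"
        using box_subset_cbox[of a b] by (auto simp: indicator_def fun_eq_iff)
      finally show ?thesis .
    qed
    have "AE x in lborel. indicator (box a b) x * h x = 0"
    proof (rule AE_zero_if_box_integrals_zero[OF ib])
      fix c d :: 'a
      let ?l = "\<Sum>i\<in>Basis. max (c\<bullet>i) (a\<bullet>i) *\<^sub>R i" and ?u = "\<Sum>i\<in>Basis. min (d\<bullet>i) (b\<bullet>i) *\<^sub>R i"
      \<comment> \<open>The intersection of the two boxes, whose closure still lies in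
        \<open>cbox a b\<close> and hence in \<open>U\<close>.\<close>
      have "cbox ?l ?u \<subseteq> U" using ab Int_interval[of c d a b] by auto
      from box0[OF this] have "(LINT x:box c d \<inter> box a b|lborel. h x) = 0" by (simp add: box_Int_box)
      moreover have "(LINT x:box c d|lborel. indicator (box a b) x * h x) = (LINT x:box c d \<inter> box a b|lborel. h x)"
        unfolding set_lebesgue_integral_def by (intro Bochner_Integration.integral_cong) (auto simp: indicator_def)
      ultimately show "(LINT x:box c d|lborel. indicator (box a b) x * h x) = 0" by simp
    next
      show "(\<integral>x. indicator (box a b) x * h x \<partial>lborel) = 0"
        using box0[OF ab] by (simp add: set_lebesgue_integral_def)
    qed
    moreover have "AE x in lborel. x \<notin> cbox a b - box a b"
      using AE_not_in[of "cbox a b - box a b" lborel] emeasure_lborel_cbox_eq[of a b] emeasure_lborel_box_eq[of a b]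
        emeasure_Diff[of lborel "box a b" "cbox a b"] box_subset_cbox[of a b]
      by (auto simp: null_sets_def)
    ultimately show ?thesis by eventually_elim (auto simp: indicator_def split: if_splits)
  qed
  obtain D where D: "countable D" "D \<subseteq> Pow U" "\<And>X. X \<in> D \<Longrightarrow> \<exists>a b. X = cbox a b" "\<Union>D = U"
    using open_countable_Union_open_cbox[OF U] by blast
  have "AE x in lborel. \<forall>X\<in>D. x \<in> X \<longrightarrow> h x = 0"
    unfolding AE_ball_countable[OF D(1)] using D(2,3) AEbox by (metis PowD subsetD)
  then have "AE x in lborel. x \<in> U \<longrightarrow> h x = 0"
    by eventually_elim (use D(4) in auto)
  then show ?thesis using Ub by (simp add: AE_restrict_space_iff)
qed

section \<open>Weak derivatives: uniqueness and stability under limits\<close>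

lemma weak_deriv_iff:
  assumes "U \<in> sets borel"
  shows "weak_deriv U e f h \<longleftrightarrow> (\<forall>\<phi>. C1c U \<phi> \<longrightarrow>
      (\<integral>x. f x * dd \<phi> e x \<partial>Lb U) = - (\<integral>x. h x * \<phi> x \<partial>Lb U))"
  unfolding weak_deriv_def Lb_integral[OF assms] ..

lemma weak_deriv_unique:
  assumes U: "open U" and h: "L2 (Lb U) h1" "L2 (Lb U) h2" and w: "weak_deriv U e f h1" "weak_deriv U e f h2"
  shows "AE x in Lb U. h1 x = h2 x"
proof -
  have Ub: "U \<in> sets borel" using U by simp
  have "AE x in Lb U. h1 x - h2 x = 0"
  proof (rule fundamental_lemma[OF U L2_diff[OF h]])
    fix \<phi> assume p: "C1c U \<phi>"
    note p2 = C1c_L2(1)[OF Ub p]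
    have "(\<integral>x. h1 x * \<phi> x \<partial>Lb U) = (\<integral>x. h2 x * \<phi> x \<partial>Lb U)"
      using w p unfolding weak_deriv_iff[OF Ub] by fastforce
    then show "(\<integral>x. (h1 x - h2 x) * \<phi> x \<partial>Lb U) = 0"
      using L2_mult[OF h(1) p2] L2_mult[OF h(2) p2] by (simp add: left_diff_distrib)
  qed
  then show ?thesis by eventually_elim simp
qed

lemma weak_deriv_lim:
  assumes U: "U \<in> sets borel" and w: "\<And>n. weak_deriv U e (f n) (h n)"
    and f: "L2conv (Lb U) f f0" "\<And>n. L2 (Lb U) (f n)" "L2 (Lb U) f0"
    and h: "L2conv (Lb U) h h0" "\<And>n. L2 (Lb U) (h n)" "L2 (Lb U) h0"
  shows "weak_deriv U e f0 h0"
  unfolding weak_deriv_iff[OF U]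
proof (intro allI impI)
  fix \<phi> assume p: "C1c U \<phi>"
  have 1: "(\<lambda>n. \<integral>x. f n x * dd \<phi> e x \<partial>Lb U) \<longlonglongrightarrow> (\<integral>x. f0 x * dd \<phi> e x \<partial>Lb U)"
    by (rule L2conv_inner_const[OF f C1c_L2(2)[OF U p]])
  have 2: "(\<lambda>n. - (\<integral>x. h n x * \<phi> x \<partial>Lb U)) \<longlonglongrightarrow> - (\<integral>x. h0 x * \<phi> x \<partial>Lb U)"
    by (intro tendsto_minus L2conv_inner_const[OF h C1c_L2(1)[OF U p]])
  have "(\<integral>x. f n x * dd \<phi> e x \<partial>Lb U) = - (\<integral>x. h n x * \<phi> x \<partial>Lb U)" for n
    using w[of n] p unfolding weak_deriv_iff[OF U] by blast
  then show "(\<integral>x. f0 x * dd \<phi> e x \<partial>Lb U) = - (\<integral>x. h0 x * \<phi> x \<partial>Lb U)"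
    using LIMSEQ_unique[OF 1] 2 by simp
qed

text \<open>Explicit gradients for the closure of the test functions vanishing near \<open>G\<close>.\<close>

definition hasgrad :: "'a::euclidean_space set \<Rightarrow> 'a set \<Rightarrow> ('a \<Rightarrow> real) \<Rightarrow> ('a \<Rightarrow> 'a \<Rightarrow> real) \<Rightarrow> bool" where
  "hasgrad U G u h \<longleftrightarrow> L2 (Lb U) u \<and> (\<forall>e\<in>Basis. L2 (Lb U) (h e)) \<and>
     (\<exists>\<phi>. (\<forall>n. C1c UNIV (\<phi> n) \<and> supp (\<phi> n) \<inter> G = {}) \<and> L2conv (Lb U) \<phi> u
        \<and> (\<forall>e\<in>Basis. L2conv (Lb U) (\<lambda>n. dd (\<phi> n) e) (h e)))"

lemma hasgrad_L2: "hasgrad U G u h \<Longrightarrow> L2 (Lb U) u" "hasgrad U G u h \<Longrightarrow> e \<in> Basis \<Longrightarrow> L2 (Lb U) (h e)"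
  by (auto simp: hasgrad_def)

lemma hasgrad_approx:
  assumes "hasgrad U G u h"
  obtains \<phi> where "\<And>n. C1c UNIV (\<phi> n)" "\<And>n. supp (\<phi> n) \<inter> G = {}" "L2conv (Lb U) \<phi> u"
    "\<And>e. e \<in> Basis \<Longrightarrow> L2conv (Lb U) (\<lambda>n. dd (\<phi> n) e) (h e)"
  using assms unfolding hasgrad_def by blast

lemma hasgrad_weak_deriv:
  assumes U: "open U" and g: "hasgrad U G u h" and e: "e \<in> Basis"
  shows "weak_deriv U e u (h e)"
proof -
  obtain \<phi> where p: "\<And>n. C1c UNIV (\<phi> n)" "\<And>n. supp (\<phi> n) \<inter> G = {}" "L2conv (Lb U) \<phi> u"
    "\<And>e. e \<in> Basis \<Longrightarrow> L2conv (Lb U) (\<lambda>n. dd (\<phi> n) e) (h e)"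
    using hasgrad_approx[OF g] by blast
  have Ub: "U \<in> sets borel" using U by simp
  show ?thesis
    by (rule weak_deriv_lim[OF Ub C1_weak_deriv[OF Ub C1c_C1[OF p(1)]] p(3) C1c_L2(1)[OF Ub p(1)] hasgrad_L2(1)[OF g]
          p(4)[OF e] C1c_L2(2)[OF Ub p(1)] hasgrad_L2(2)[OF g e]])
qed

lemma wd_works:
  assumes U: "open U" and "H1_on U u" "e \<in> Basis"
  shows "L2 (Lb U) (wd U e u)" "weak_deriv U e u (wd U e u)"
proof -
  have "\<exists>h. L2_on U h \<and> weak_deriv U e u h" using assms by (auto simp: H1_on_def)
  from someI_ex[OF this] have "L2_on U (wd U e u) \<and> weak_deriv U e u (wd U e u)" unfolding wd_def .
  then show "L2 (Lb U) (wd U e u)" "weak_deriv U e u (wd U e u)" using U by (auto simp: L2_on_iff)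
qed

text \<open>The limits of the classical derivatives are weak derivatives, and these are unique
  almost everywhere. All integrals can thus be computed with whichever gradient is at hand.\<close>

lemma hasgrad_H1:
  assumes U: "open U" and g: "hasgrad U G u h"
  shows "H1_on U u" "e \<in> Basis \<Longrightarrow> AE x in Lb U. wd U e u x = h e x"
proof -
  have Ub: "U \<in> sets borel" using U by simp
  show H: "H1_on U u"
    unfolding H1_on_def L2_on_iff[OF Ub]
    using hasgrad_weak_deriv[OF U g] hasgrad_L2[OF g] by blast
  show "AE x in Lb U. wd U e u x = h e x" if e: "e \<in> Basis"
    by (rule weak_deriv_unique[OF U wd_works(1)[OF U H e] hasgrad_L2(2)[OF g e] wd_works(2)[OF U H e] hasgrad_weak_deriv[OF U g e]])
qed

lemma hasgrad_cong_AE: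
  assumes "hasgrad U G u h" "\<And>e. e \<in> Basis \<Longrightarrow> L2 (Lb U) (k e)" "\<And>e. e \<in> Basis \<Longrightarrow> AE x in Lb U. k e x = h e x"
    "open U"
  shows "hasgrad U G u k"
proof -
  obtain \<phi> where p: "\<And>n. C1c UNIV (\<phi> n)" "\<And>n. supp (\<phi> n) \<inter> G = {}" "L2conv (Lb U) \<phi> u"
    "\<And>e. e \<in> Basis \<Longrightarrow> L2conv (Lb U) (\<lambda>n. dd (\<phi> n) e) (h e)"
    using hasgrad_approx[OF assms(1)] by blast
  have "L2conv (Lb U) (\<lambda>n. dd (\<phi> n) e) (k e)" if e: "e \<in> Basis" for e
    by (rule L2conv_cong_AE[OF p(4)[OF e] C1c_L2(2)[OF borel_open[OF assms(4)] p(1)] hasgrad_L2(2)[OF assms(1) e] L2_measurable[OF assms(2)[OF e]] assms(3)[OF e]])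
  then show ?thesis unfolding hasgrad_def using p assms(2) hasgrad_L2(1)[OF assms(1)] by blast
qed

lemma H1_0_hasgrad:
  assumes U: "open U" and u: "H1_0_on U G u"
  shows "hasgrad U G u (\<lambda>e. wd U e u)"
proof -
  have Ub: "U \<in> sets borel" using U by simp
  have H: "H1_on U u" using u by (simp add: H1_0_on_def)
  obtain \<phi> where p: "\<And>n. C1c UNIV (\<phi> n)" "\<And>n. supp (\<phi> n) \<inter> G = {}"
    and lim: "(\<lambda>n. (\<integral>x. (\<phi> n x - u x)\<^sup>2 \<partial>Lb U) + (\<Sum>e\<in>Basis. \<integral>x. (dd (\<phi> n) e x - wd U e u x)\<^sup>2 \<partial>Lb U)) \<longlonglongrightarrow> 0"
    using u unfolding H1_0_on_def Lb_integral[OF Ub] by blast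
  have 1: "L2conv (Lb U) \<phi> u"
    unfolding L2conv_def
    by (rule tendsto_sandwich[OF always_eventually always_eventually tendsto_const lim])
      (auto intro!: Bochner_Integration.integral_nonneg sum_nonneg)
  have 2: "L2conv (Lb U) (\<lambda>n. dd (\<phi> n) e) (wd U e u)" if e: "e \<in> Basis" for e
    unfolding L2conv_def
  proof (rule tendsto_sandwich[OF always_eventually always_eventually tendsto_const lim])
    show "\<forall>n. (\<integral>x. (dd (\<phi> n) e x - wd U e u x)\<^sup>2 \<partial>Lb U)
       \<le> (\<integral>x. (\<phi> n x - u x)\<^sup>2 \<partial>Lb U) + (\<Sum>e\<in>Basis. \<integral>x. (dd (\<phi> n) e x - wd U e u x)\<^sup>2 \<partial>Lb U)"
    proof
      fix n
      have "(\<integral>x. (dd (\<phi> n) e x - wd U e u x)\<^sup>2 \<partial>Lb U) \<le> (\<Sum>e\<in>Basis. \<integral>x. (dd (\<phi> n) e x - wd U e u x)\<^sup>2 \<partial>Lb U)"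
        by (rule member_le_sum[OF e]) (auto intro!: Bochner_Integration.integral_nonneg)
      moreover have "0 \<le> (\<integral>x. (\<phi> n x - u x)\<^sup>2 \<partial>Lb U)" by (intro Bochner_Integration.integral_nonneg) auto
      ultimately show "(\<integral>x. (dd (\<phi> n) e x - wd U e u x)\<^sup>2 \<partial>Lb U)
       \<le> (\<integral>x. (\<phi> n x - u x)\<^sup>2 \<partial>Lb U) + (\<Sum>e\<in>Basis. \<integral>x. (dd (\<phi> n) e x - wd U e u x)\<^sup>2 \<partial>Lb U)" by linarith
    qed
  qed (auto intro!: Bochner_Integration.integral_nonneg)
  have "L2 (Lb U) u" using H by (simp add: H1_on_def L2_on_iff[OF Ub])
  then show ?thesis unfolding hasgrad_def using p 1 2 wd_works(1)[OF U H] by blast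
qed

lemma hasgrad_H1_0:
  assumes U: "open U" and g: "hasgrad U G u h"
  shows "H1_0_on U G u"
proof -
  have Ub: "U \<in> sets borel" using U by simp
  note H = hasgrad_H1[OF U g]
  have "hasgrad U G u (\<lambda>e. wd U e u)"
    by (rule hasgrad_cong_AE[OF g wd_works(1)[OF U H(1)] H(2) U])
  then obtain \<phi> where p: "\<And>n. C1c UNIV (\<phi> n)" "\<And>n. supp (\<phi> n) \<inter> G = {}" "L2conv (Lb U) \<phi> u"
    "\<And>e. e \<in> Basis \<Longrightarrow> L2conv (Lb U) (\<lambda>n. dd (\<phi> n) e) (wd U e u)"
    using hasgrad_approx by blast
  have "(\<lambda>n. (\<integral>x. (\<phi> n x - u x)\<^sup>2 \<partial>Lb U) + (\<Sum>e\<in>Basis. \<integral>x. (dd (\<phi> n) e x - wd U e u x)\<^sup>2 \<partial>Lb U))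
     \<longlonglongrightarrow> 0 + (\<Sum>e\<in>(Basis::'a set). 0)"
    using p(3,4) unfolding L2conv_def by (intro tendsto_add tendsto_sum) auto
  then show ?thesis
    unfolding H1_0_on_def Lb_integral[OF Ub] using H(1) p(1,2) by auto
qed

lemma hasgrad_C1c:
  assumes "open U" "C1c UNIV \<phi>" "supp \<phi> \<inter> G = {}"
  shows "hasgrad U G \<phi> (\<lambda>e. dd \<phi> e)"
  unfolding hasgrad_def using assms C1c_L2[OF borel_open[OF assms(1)] assms(2)]
  by (intro conjI exI[of _ "\<lambda>n. \<phi>"]) (auto simp: L2conv_const)

lemma hasgrad_lincomb:
  assumes U: "open U" and "hasgrad U G u h" "hasgrad U G w k"
  shows "hasgrad U G (lincomb c u d w) (\<lambda>e. lincomb c (h e) d (k e))"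
proof -
  have Ub: "U \<in> sets borel" using U by simp
  obtain \<phi> where p: "\<And>n. C1c UNIV (\<phi> n)" "\<And>n. supp (\<phi> n) \<inter> G = {}" "L2conv (Lb U) \<phi> u"
    "\<And>e. e \<in> Basis \<Longrightarrow> L2conv (Lb U) (\<lambda>n. dd (\<phi> n) e) (h e)"
    using hasgrad_approx[OF assms(2)] by blast
  obtain \<psi> where q: "\<And>n. C1c UNIV (\<psi> n)" "\<And>n. supp (\<psi> n) \<inter> G = {}" "L2conv (Lb U) \<psi> w"
    "\<And>e. e \<in> Basis \<Longrightarrow> L2conv (Lb U) (\<lambda>n. dd (\<psi> n) e) (k e)"
    using hasgrad_approx[OF assms(3)] by blast
  let ?f = "\<lambda>n. lincomb c (\<phi> n) d (\<psi> n)"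
  have C1: "C1 (?f n)" and D: "dd (?f n) v x = c * dd (\<phi> n) v x + d * dd (\<psi> n) v x" for n v x
    unfolding lincomb_def
    using C1_add[OF C1_mult(1)[OF C1_const[of c] C1c_C1[OF p(1)[of n]]] C1_mult(1)[OF C1_const[of d] C1c_C1[OF q(1)[of n]]]]
      C1_mult(2)[OF C1_const[of c] C1c_C1[OF p(1)[of n]]] C1_mult(2)[OF C1_const[of d] C1c_C1[OF q(1)[of n]]]
    by (simp_all add: dd_const)
  have D': "(\<lambda>n. dd (?f n) v) = (\<lambda>n x. c * dd (\<phi> n) v x + d * dd (\<psi> n) v x)" for v
    by (intro ext D)
  have s: "supp (?f n) \<subseteq> supp (\<phi> n) \<union> supp (\<psi> n)" for n
    unfolding closure_Un[symmetric] by (intro closure_mono) (auto simp: lincomb_def)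
  have "C1c UNIV (?f n)" for n
  proof -
    have "compact (supp (\<phi> n) \<union> supp (\<psi> n))" using p(1) q(1) unfolding C1c_iff by blast
    then have "compact (supp (?f n))" using s[of n]
      by (metis closed_closure compact_Int_closed inf.absorb_iff2)
    then show ?thesis using C1 by (simp add: C1c_iff)
  qed
  moreover have "supp (?f n) \<inter> G = {}" for n using s[of n] p(2)[of n] q(2)[of n] by blast
  moreover have "L2conv (Lb U) ?f (lincomb c u d w)"
    unfolding lincomb_def
    by (rule L2conv_lincomb[OF p(3) C1c_L2(1)[OF Ub p(1)] hasgrad_L2(1)[OF assms(2)] q(3) C1c_L2(1)[OF Ub q(1)] hasgrad_L2(1)[OF assms(3)]])
  moreover have "L2conv (Lb U) (\<lambda>n. dd (?f n) e) (lincomb c (h e) d (k e))" if e: "e \<in> Basis" for e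
    unfolding D'[of e] unfolding lincomb_def
    by (rule L2conv_lincomb[OF p(4)[OF e] C1c_L2(2)[OF Ub p(1)] hasgrad_L2(2)[OF assms(2) e] q(4)[OF e] C1c_L2(2)[OF Ub q(1)] hasgrad_L2(2)[OF assms(3) e]])
  moreover have "L2 (Lb U) (lincomb c u d w)" "e \<in> Basis \<Longrightarrow> L2 (Lb U) (lincomb c (h e) d (k e))" for e
    unfolding lincomb_def using hasgrad_L2[OF assms(2)] hasgrad_L2[OF assms(3)] by (auto intro!: L2_lincomb)
  ultimately show ?thesis unfolding hasgrad_def by (intro conjI exI[of _ ?f]) blast+
qed

lemma tendsto_0_of_less_inverse:
  fixes f :: "nat \<Rightarrow> real"
  assumes "\<And>n. 0 \<le> f n" "\<And>n. f n < inverse (real (Suc n))"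
  shows "f \<longlonglongrightarrow> 0"
proof (rule tendsto_sandwich[OF always_eventually always_eventually tendsto_const LIMSEQ_inverse_real_of_nat])
  show "\<forall>n. 0 \<le> f n" using assms(1) by blast
  show "\<forall>n. f n \<le> inverse (real (Suc n))" using less_imp_le[OF assms(2)] by blast
qed

text \<open>A diagonal choice: for each \<open>n\<close> a test function within 1/(n+1) of
  \<open>u n\<close>, simultaneously in the function and in its finitely many partial
  derivatives.\<close>

lemma hasgrad_lim:
  fixes U :: "'a::euclidean_space set"
  assumes U: "open U" and g: "\<And>n. hasgrad U G (u n) (h n)"
    and u: "L2conv (Lb U) u f" "L2 (Lb U) f"
    and h: "\<And>e. e \<in> Basis \<Longrightarrow> L2conv (Lb U) (\<lambda>n. h n e) (k e)" "\<And>e. e \<in> Basis \<Longrightarrow> L2 (Lb U) (k e)"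
  shows "hasgrad U G f k"
proof -
  have Ub: "U \<in> sets borel" using U by simp
  define P where "P n \<phi> \<longleftrightarrow>  C1c UNIV \<phi> \<and> supp \<phi> \<inter> G = {} \<and> (\<integral>x. (\<phi> x - u n x)\<^sup>2 \<partial>Lb U) < inverse (real (Suc n))
     \<and> (\<forall>e\<in>Basis. (\<integral>x. (dd \<phi> e x - h n e x)\<^sup>2 \<partial>Lb U) < inverse (real (Suc n)))" for n \<phi>
  have ex: "\<exists>\<phi>. P n \<phi>" for n
  proof -
    obtain \<phi> where p: "\<And>n. C1c UNIV (\<phi> n)" "\<And>n. supp (\<phi> n) \<inter> G = {}" "L2conv (Lb U) \<phi> (u n)"
      "\<And>e. e \<in> Basis \<Longrightarrow> L2conv (Lb U) (\<lambda>n. dd (\<phi> n) e) (h n e)"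
      using hasgrad_approx[OF g[of n]] by blast
    have e: "inverse (real (Suc n)) > 0" by simp
    have "\<forall>\<^sub>F i in sequentially. (\<integral>x. (\<phi> i x - u n x)\<^sup>2 \<partial>Lb U) < inverse (real (Suc n))"
      using p(3) e unfolding L2conv_def by (rule order_tendstoD)
    moreover have "\<forall>\<^sub>F i in sequentially. \<forall>e\<in>Basis. (\<integral>x. (dd (\<phi> i) e x - h n e x)\<^sup>2 \<partial>Lb U) < inverse (real (Suc n))"
    proof (rule eventually_ball_finite)
      show "\<forall>b\<in>Basis. \<forall>\<^sub>F i in sequentially. (\<integral>x. (dd (\<phi> i) b x - h n b x)\<^sup>2 \<partial>Lb U) < inverse (real (Suc n))"
      proof
        fix b :: 'a assume "b \<in> Basis"
        from p(4)[OF this] e show "\<forall>\<^sub>F i in sequentially. (\<integral>x. (dd (\<phi> i) b x - h n b x)\<^sup>2 \<partial>Lb U) < inverse (real (Suc n))"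
          unfolding L2conv_def by (rule order_tendstoD)
      qed
    qed simp
    ultimately have "\<forall>\<^sub>F i in sequentially. (\<integral>x. (\<phi> i x - u n x)\<^sup>2 \<partial>Lb U) < inverse (real (Suc n))
      \<and> (\<forall>e\<in>Basis. (\<integral>x. (dd (\<phi> i) e x - h n e x)\<^sup>2 \<partial>Lb U) < inverse (real (Suc n)))"
      by (rule eventually_conj)
    then obtain i where "(\<integral>x. (\<phi> i x - u n x)\<^sup>2 \<partial>Lb U) < inverse (real (Suc n))
      \<and> (\<forall>e\<in>Basis. (\<integral>x. (dd (\<phi> i) e x - h n e x)\<^sup>2 \<partial>Lb U) < inverse (real (Suc n)))"
      unfolding eventually_sequentially by blast
    then show ?thesis using p(1,2) unfolding P_def by blast
  qed
  obtain \<phi> where P: "\<And>n. P n (\<phi> n)"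
    using choice[of P] ex by blast
  have p: "C1c UNIV (\<phi> n)" "supp (\<phi> n) \<inter> G = {}"
    "(\<integral>x. (\<phi> n x - u n x)\<^sup>2 \<partial>Lb U) < inverse (real (Suc n))"
    "e \<in> Basis \<Longrightarrow> (\<integral>x. (dd (\<phi> n) e x - h n e x)\<^sup>2 \<partial>Lb U) < inverse (real (Suc n))" for n e
    using P[of n] unfolding P_def by blast+
  have "(\<lambda>n. \<integral>x. (\<phi> n x - u n x)\<^sup>2 \<partial>Lb U) \<longlonglongrightarrow> 0"
    by (rule tendsto_0_of_less_inverse[OF _ p(3)]) simp
  then have 1: "L2conv (Lb U) \<phi> f"
    by (rule L2conv_approx[OF u(1) hasgrad_L2(1)[OF g] u(2) C1c_L2(1)[OF Ub p(1)]])
  have 2: "L2conv (Lb U) (\<lambda>n. dd (\<phi> n) e) (k e)" if e: "e \<in> Basis" for e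
  proof -
    have "(\<lambda>n. \<integral>x. (dd (\<phi> n) e x - h n e x)\<^sup>2 \<partial>Lb U) \<longlonglongrightarrow> 0"
      by (rule tendsto_0_of_less_inverse[OF _ p(4)[OF e]]) simp
    then show ?thesis
      by (rule L2conv_approx[OF h(1)[OF e] hasgrad_L2(2)[OF g e] h(2)[OF e] C1c_L2(2)[OF Ub p(1)]])
  qed
  show ?thesis unfolding hasgrad_def using 1 2 p(1,2) u(2) h(2) by blast
qed

lemma hasgrad_complete:
  fixes U :: "'a::euclidean_space set"
  assumes U: "open U" and g: "\<And>n. hasgrad U G (u n) (h n)"
    and c0: "\<And>\<epsilon>. \<epsilon> > 0 \<Longrightarrow> \<exists>N. \<forall>m\<ge>N. \<forall>n\<ge>N. (\<integral>x. (u m x - u n x)\<^sup>2 \<partial>Lb U) < \<epsilon>"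
    and c1: "\<And>\<epsilon> e. \<epsilon> > 0 \<Longrightarrow> e \<in> Basis \<Longrightarrow> \<exists>N. \<forall>m\<ge>N. \<forall>n\<ge>N. (\<integral>x. (h m e x - h n e x)\<^sup>2 \<partial>Lb U) < \<epsilon>"
  obtains f k where "hasgrad U G f k" "L2conv (Lb U) u f" "\<And>e. e \<in> Basis \<Longrightarrow> L2conv (Lb U) (\<lambda>n. h n e) (k e)"
proof -
  obtain f where f: "L2 (Lb U) f" "L2conv (Lb U) u f"
    using L2_complete[of "Lb U" u] hasgrad_L2(1)[OF g] c0 by blast
  have "\<exists>k. L2 (Lb U) k \<and> L2conv (Lb U) (\<lambda>n. h n e) k" if e: "e \<in> Basis" for e
    by (rule L2_complete[OF hasgrad_L2(2)[OF g e] c1[OF _ e]])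
  then obtain k where k: "\<And>e. e \<in> Basis \<Longrightarrow> L2 (Lb U) (k e)" "\<And>e. e \<in> Basis \<Longrightarrow> L2conv (Lb U) (\<lambda>n. h n e) (k e)"
    by metis
  have "hasgrad U G f k" by (rule hasgrad_lim[OF U g f(2,1) k(2,1)])
  then show thesis using that f k by blast
qed

section \<open>Local compactness: boundary strips and small boxes\<close>

definition gradsq :: "('a::euclidean_space \<Rightarrow> real) \<Rightarrow> 'a \<Rightarrow> real" where
  "gradsq f x = (\<Sum>e\<in>Basis. (dd f e x)\<^sup>2)"

lemma gradsq_nonneg: "0 \<le> gradsq f x"
  by (auto simp: gradsq_def intro: sum_nonneg)

lemma gradsq_continuous: "C1 f \<Longrightarrow> continuous_on S (gradsq f)"
  unfolding gradsq_def[abs_def] by (intro continuous_intros C1_dd_continuous)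

lemma gradsq_measurable: "C1 f \<Longrightarrow> gradsq f \<in> borel_measurable borel"
  using gradsq_continuous by (rule borel_measurable_continuous_onI)

lemma dd_square_le:
  fixes f :: "'a::euclidean_space \<Rightarrow> real"
  assumes "C1 f"
  shows "(dd f w x)\<^sup>2 \<le> (norm w)\<^sup>2 * gradsq f x"
proof -
  define g where "g = (\<Sum>e\<in>Basis. dd f e x *\<^sub>R e)"
  have ge: "g \<bullet> e = dd f e x" if "e \<in> Basis" for e
    using that by (simp add: g_def inner_sum_left inner_Basis if_distrib cong: if_cong)
  have "dd f w x = dd f (\<Sum>e\<in>Basis. (w \<bullet> e) *\<^sub>R e) x" by (simp add: euclidean_representation)
  also have "\<dots> = (\<Sum>e\<in>Basis. (w \<bullet> e) * dd f e x)"
    using linear_sum[OF C1_linear_dd[OF assms, of x], of "\<lambda>e. (w \<bullet> e) *\<^sub>R e" Basis]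
      linear_scale[OF C1_linear_dd[OF assms, of x]] by simp
  also have "\<dots> = w \<bullet> g" by (simp add: euclidean_inner[of w g] ge)
  finally have "(dd f w x)\<^sup>2 = (w \<bullet> g)\<^sup>2" by simp
  also have "\<dots> \<le> (w \<bullet> w) * (g \<bullet> g)" by (rule Cauchy_Schwarz_ineq)
  also have "\<dots> = (norm w)\<^sup>2 * gradsq f x"
    unfolding power2_norm_eq_inner euclidean_inner[of g g] by (simp add: ge gradsq_def power2_eq_square)
  finally show ?thesis .
qed

text \<open>An inequality with a nonnegative integral on the right, so that the later exchanges of
  integration order require measurability alone.\<close>

lemma FTC_le_nn_integral:
  assumes ab: "a \<le> b" and F: "\<And>t. (F has_real_derivative F' t) (at t)" and c: "continuous_on UNIV F'"
    and le: "\<And>t. a \<le> t \<Longrightarrow> t \<le> b \<Longrightarrow> F' t \<le> g t"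
  shows "ennreal (F b - F a) \<le> (\<integral>\<^sup>+t. ennreal (g t) * indicator {a..b} t \<partial>lborel)"
proof -
  have i: "integrable lborel (\<lambda>t. F' t * indicator {a..b} t)"
    using borel_integrable_compact[of "{a..b}" F'] c continuous_on_subset by (fastforce simp: mult.commute)
  have "(\<integral>t. F' t * indicator {a..b} t \<partial>lborel) = F b - F a"
    using F c ab by (intro integral_FTC_Icc_real) (auto simp: continuous_on_eq_continuous_at)
  then have "F b - F a \<le> (\<integral>t. max 0 (F' t * indicator {a..b} t) \<partial>lborel)"
    using integral_mono[OF i Bochner_Integration.integrable_max[OF integrable_zero i]] by simp
  then have "ennreal (F b - F a) \<le> ennreal (\<integral>t. max 0 (F' t * indicator {a..b} t) \<partial>lborel)"
    by (rule ennreal_leI)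
  also have "\<dots> = (\<integral>\<^sup>+t. ennreal (max 0 (F' t * indicator {a..b} t)) \<partial>lborel)"
    using i by (intro nn_integral_eq_integral[symmetric]) auto
  also have "\<dots> \<le> (\<integral>\<^sup>+t. ennreal (g t) * indicator {a..b} t \<partial>lborel)"
  proof (rule nn_integral_mono)
    fix t
    show "ennreal (max 0 (F' t * indicator {a..b} t)) \<le> ennreal (g t) * indicator {a..b} t"
    proof (cases "t \<in> {a..b}")
      case True
      then have "ennreal (F' t) \<le> ennreal (g t)" using le[of t] by (intro ennreal_leI) auto
      then show ?thesis using True by (simp add: max_def ennreal_neg)
    qed simp
  qed
  finally show ?thesis .
qed

text \<open>The derivative of (t - h) f(x + t w)^2 is integrated over [0, h]. The boundary term
  vanishes at h and equals h f(x)^2 at 0, so a point value is controlled by the energy along the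
  segment.\<close>

lemma line_estimate:
  fixes f :: "'a::euclidean_space \<Rightarrow> real"
  assumes f: "C1 f" and h: "0 \<le> h" "h \<le> 1" and w: "norm w = 1"
  shows "ennreal (h * (f x)\<^sup>2) \<le> 2 * (\<integral>\<^sup>+t. ennreal ((f (x + t *\<^sub>R w))\<^sup>2 + gradsq f (x + t *\<^sub>R w)) * indicator {0..h} t \<partial>lborel)"
proof -
  let ?f = "\<lambda>t. f (x + t *\<^sub>R w)" and ?d = "\<lambda>t. dd f w (x + t *\<^sub>R w)"
  have cl: "continuous_on UNIV (\<lambda>t. x + t *\<^sub>R w)" by (intro continuous_intros)
  have cf: "continuous_on UNIV ?f" "continuous_on UNIV ?d"
    by (rule continuous_on_compose2[OF C1_continuous[OF f, of UNIV] cl] continuous_on_compose2[OF C1_dd_continuous[OF f, of UNIV] cl]; simp)+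
  have "ennreal ((h - h) * (?f h)\<^sup>2 - (0 - h) * (?f 0)\<^sup>2)
      \<le> (\<integral>\<^sup>+t. ennreal (2 * ((?f t)\<^sup>2 + gradsq f (x + t *\<^sub>R w))) * indicator {0..h} t \<partial>lborel)"
  proof (rule FTC_le_nn_integral[where F="\<lambda>t. (t - h) * (?f t)\<^sup>2" and F'="\<lambda>t. (?f t)\<^sup>2 + (t - h) * (2 * ?f t * ?d t)"])
    show "((\<lambda>t. (t - h) * (?f t)\<^sup>2) has_real_derivative (?f t)\<^sup>2 + (t - h) * (2 * ?f t * ?d t)) (at t)" for t
      by (rule derivative_eq_intros C1_line[OF f] refl)+ (simp add: algebra_simps)
    show "continuous_on UNIV (\<lambda>t. (?f t)\<^sup>2 + (t - h) * (2 * ?f t * ?d t))"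
      by (intro continuous_intros cf)
    fix t assume t: "0 \<le> t" "t \<le> h"
    have "(t - h) * (2 * ?f t * ?d t) \<le> \<bar>t - h\<bar> * \<bar>2 * ?f t * ?d t\<bar>"
      by (metis abs_ge_self abs_mult)
    also have "\<dots> \<le> 1 * ((?f t)\<^sup>2 + (?d t)\<^sup>2)"
    proof (rule mult_mono)
      have "0 \<le> (\<bar>?f t\<bar> - \<bar>?d t\<bar>)\<^sup>2" by simp
      then show "\<bar>2 * ?f t * ?d t\<bar> \<le> (?f t)\<^sup>2 + (?d t)\<^sup>2" by (simp add: power2_diff abs_mult)
    qed (use t h in auto)
    also have "(?d t)\<^sup>2 \<le> gradsq f (x + t *\<^sub>R w)" using dd_square_le[OF f, where w=w and x="x + t *\<^sub>R w"] w by simp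
    finally show "(?f t)\<^sup>2 + (t - h) * (2 * ?f t * ?d t) \<le> 2 * ((?f t)\<^sup>2 + gradsq f (x + t *\<^sub>R w))"
      using gradsq_nonneg[of f "x + t *\<^sub>R w"] by simp
  qed (use h in auto)
  also have "\<dots> = (\<integral>\<^sup>+t. 2 * (ennreal ((?f t)\<^sup>2 + gradsq f (x + t *\<^sub>R w)) * indicator {0..h} t) \<partial>lborel)"
    by (intro nn_integral_cong) (auto simp: indicator_def ennreal_mult' gradsq_nonneg distrib_left)
  also have "\<dots> = 2 * (\<integral>\<^sup>+t. ennreal ((?f t)\<^sup>2 + gradsq f (x + t *\<^sub>R w)) * indicator {0..h} t \<partial>lborel)"
  proof (rule nn_integral_cmult)
    have "(\<lambda>t. (?f t)\<^sup>2 + gradsq f (x + t *\<^sub>R w)) \<in> borel_measurable borel"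
      by (intro borel_measurable_continuous_onI continuous_intros cf continuous_on_compose2[OF gradsq_continuous[OF f, of UNIV] cl]) simp
    then show "(\<lambda>t. ennreal ((?f t)\<^sup>2 + gradsq f (x + t *\<^sub>R w)) * indicator {0..h} t) \<in> borel_measurable lborel"
      by (intro borel_measurable_times_ennreal measurable_compose[OF _ measurable_ennreal] borel_measurable_indicator) auto
  qed
  finally show ?thesis by simp
qed

text \<open>With c = f x - f y, the function 2 c f - c^2 t has increment c^2 along the segment, and
  its derivative 2 c f' - c^2 is at most f'^2. This gives the Cauchy-Schwarz bound pointwise, before
  integration.\<close>

lemma segment_estimate:
  fixes f :: "'a::euclidean_space \<Rightarrow> real"
  assumes f: "C1 f"
  shows "ennreal ((f x - f y)\<^sup>2) \<le> (\<integral>\<^sup>+t. ennreal ((norm (x - y))\<^sup>2 * gradsq f (y + t *\<^sub>R (x - y))) * indicator {0..1} t \<partial>lborel)"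
proof -
  define c where "c = f x - f y"
  let ?f = "\<lambda>t. f (y + t *\<^sub>R (x - y))" and ?d = "\<lambda>t. dd f (x - y) (y + t *\<^sub>R (x - y))"
  have A: "ennreal ((2 * c * ?f 1 - c\<^sup>2 * 1) - (2 * c * ?f 0 - c\<^sup>2 * 0))
     \<le> (\<integral>\<^sup>+t. ennreal ((norm (x - y))\<^sup>2 * gradsq f (y + t *\<^sub>R (x - y))) * indicator {0..1} t \<partial>lborel)"
  proof (rule FTC_le_nn_integral[where F="\<lambda>t. 2 * c * ?f t - c\<^sup>2 * t" and F'="\<lambda>t. 2 * c * ?d t - c\<^sup>2"])
    show "((\<lambda>t. 2 * c * ?f t - c\<^sup>2 * t) has_real_derivative 2 * c * ?d t - c\<^sup>2) (at t)" for t
      by (rule derivative_eq_intros C1_line[OF f] refl)+ simp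
    have "continuous_on UNIV (\<lambda>t. y + t *\<^sub>R (x - y))" by (intro continuous_intros)
    then have "continuous_on UNIV ?d"
      by (rule continuous_on_compose2[OF C1_dd_continuous[OF f, of UNIV]]) simp
    then show "continuous_on UNIV (\<lambda>t. 2 * c * ?d t - c\<^sup>2)" by (intro continuous_intros)
    fix t :: real
    have "0 \<le> (c - ?d t)\<^sup>2" by simp
    then have "2 * c * ?d t - c\<^sup>2 \<le> (?d t)\<^sup>2" by (simp add: power2_diff)
    also have "\<dots> \<le> (norm (x - y))\<^sup>2 * gradsq f (y + t *\<^sub>R (x - y))" by (rule dd_square_le[OF f])
    finally show "2 * c * ?d t - c\<^sup>2 \<le> (norm (x - y))\<^sup>2 * gradsq f (y + t *\<^sub>R (x - y))" .
  qed simp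
  have eq: "(2 * c * ?f 1 - c\<^sup>2 * 1) - (2 * c * ?f 0 - c\<^sup>2 * 0) = c\<^sup>2"
    unfolding c_def by (simp add: power2_eq_square algebra_simps)
  show ?thesis using A unfolding eq by (simp only: c_def)
qed

lemma nn_integral_lborel_affine:
  fixes f :: "'a::euclidean_space \<Rightarrow> ennreal"
  assumes [measurable]: "f \<in> borel_measurable borel" and c: "c \<noteq> 0"
  shows "(\<integral>\<^sup>+x. f x \<partial>lborel) = ennreal (\<bar>c\<bar> ^ DIM('a)) * (\<integral>\<^sup>+x. f (a + c *\<^sub>R x) \<partial>lborel)"
proof -
  have "(\<integral>\<^sup>+x. f x \<partial>lborel) = (\<integral>\<^sup>+x. f x \<partial>density (distr lborel borel (\<lambda>x. a + c *\<^sub>R x)) (\<lambda>_. ennreal (\<bar>c\<bar>^DIM('a))))"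
    using lborel_affine[OF c, of a] by simp
  also have "\<dots> = (\<integral>\<^sup>+x. ennreal (\<bar>c\<bar>^DIM('a)) * f x \<partial>distr lborel borel (\<lambda>x. a + c *\<^sub>R x))"
    by (rule nn_integral_density) auto
  also have "\<dots> = (\<integral>\<^sup>+x. ennreal (\<bar>c\<bar>^DIM('a)) * f (a + c *\<^sub>R x) \<partial>lborel)"
    by (rule nn_integral_distr) auto
  also have "\<dots> = ennreal (\<bar>c\<bar> ^ DIM('a)) * (\<integral>\<^sup>+x. f (a + c *\<^sub>R x) \<partial>lborel)"
    by (rule nn_integral_cmult) measurable
  finally show ?thesis .
qed

lemma nn_integral_lborel_translate:
  fixes f :: "'a::euclidean_space \<Rightarrow> ennreal"
  assumes "f \<in> borel_measurable borel"
  shows "(\<integral>\<^sup>+x. f (x + a) \<partial>lborel) = (\<integral>\<^sup>+x. f x \<partial>lborel)"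
  using nn_integral_lborel_affine[OF assms, of 1 a] by (simp add: add.commute)

text \<open>The lower bound on \<open>c\<close> keeps the Jacobian of the substitution below 2^DIM.
  In the Poincare estimate one of the weights t and 1 - t always qualifies.\<close>

lemma nn_integral_lborel_shrink:
  fixes f :: "'a::euclidean_space \<Rightarrow> ennreal"
  assumes "f \<in> borel_measurable borel" and c: "1/2 \<le> c"
  shows "(\<integral>\<^sup>+x. f (a + c *\<^sub>R x) \<partial>lborel) \<le> ennreal (2 ^ DIM('a)) * (\<integral>\<^sup>+x. f x \<partial>lborel)"
proof -
  have "(\<integral>\<^sup>+x. f (a + c *\<^sub>R x) \<partial>lborel) = 1 * (\<integral>\<^sup>+x. f (a + c *\<^sub>R x) \<partial>lborel)" by simp
  also have "\<dots> \<le> ennreal ((2 * c) ^ DIM('a)) * (\<integral>\<^sup>+x. f (a + c *\<^sub>R x) \<partial>lborel)"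
  proof (rule mult_right_mono)
    have "1 \<le> (2 * c) ^ DIM('a)" using c by (intro one_le_power) simp
    then show "1 \<le> ennreal ((2 * c) ^ DIM('a))" by (metis ennreal_1 ennreal_leI)
  qed simp
  also have "ennreal ((2 * c) ^ DIM('a)) = ennreal (2 ^ DIM('a)) * ennreal (\<bar>c\<bar> ^ DIM('a))"
    using c by (simp add: power_mult_distrib ennreal_mult)
  also have "\<dots> * (\<integral>\<^sup>+x. f (a + c *\<^sub>R x) \<partial>lborel) = ennreal (2 ^ DIM('a)) * (\<integral>\<^sup>+x. f x \<partial>lborel)"
    using nn_integral_lborel_affine[OF assms(1), of c a] c by (simp add: mult.assoc)
  finally show ?thesis .
qed

lemma emeasure_le_of_diameter:
  fixes T :: "real set"
  assumes "\<And>s t. s \<in> T \<Longrightarrow> t \<in> T \<Longrightarrow> \<bar>s - t\<bar> \<le> D" "D \<ge> 0"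
  shows "emeasure lborel T \<le> ennreal (2 * D)"
proof (cases "T = {}")
  case False
  then obtain t0 where t0: "t0 \<in> T" by blast
  then have "T \<subseteq> {t0 - D..t0 + D}" using assms(1)[OF _ t0] by fastforce
  then have "emeasure lborel T \<le> emeasure lborel {t0 - D..t0 + D}" by (intro emeasure_mono) auto
  also have "\<dots> = ennreal (2 * D)" using assms(2) by simp
  finally show ?thesis .
qed simp

definition energy :: "('a::euclidean_space \<Rightarrow> real) \<Rightarrow> 'a \<Rightarrow> real" where
  "energy f x = (f x)\<^sup>2 + gradsq f x"

lemma energy_measurable: "C1 f \<Longrightarrow> energy f \<in> borel_measurable borel"
  unfolding energy_def[abs_def]
  by (intro borel_measurable_continuous_onI continuous_intros C1_continuous gradsq_continuous)

lemma energy_nonneg: "0 \<le> energy f x"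
  by (simp add: energy_def gradsq_nonneg)

text \<open>Averaging over the segment \<open>[0, h]\<close> in direction \<open>w\<close> and exchanging the integrals leaves, for
  each \<open>y\<close>, only the length of the line through \<open>y\<close> inside \<open>S\<close>.\<close>

lemma sliding_estimate:
  fixes G :: "'a::euclidean_space \<Rightarrow> real"
  assumes G[measurable]: "G \<in> borel_measurable borel" and S[measurable]: "S \<in> sets borel"
    and D: "D \<ge> 0" "\<And>y s t. y - s *\<^sub>R w \<in> S \<Longrightarrow> y - t *\<^sub>R w \<in> S \<Longrightarrow> \<bar>s - t\<bar> \<le> D"
    and U[measurable]: "U \<in> sets borel"
  shows "(\<integral>\<^sup>+x. (\<integral>\<^sup>+t. ennreal (G (x + t *\<^sub>R w)) * indicator U (x + t *\<^sub>R w) * indicator {0..h} t \<partial>lborel) * indicator S x \<partial>lborel)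
    \<le> ennreal (2 * D) * (\<integral>\<^sup>+x. ennreal (G x) * indicator U x \<partial>lborel)"
proof -
  let ?H = "\<lambda>x. ennreal (G x) * indicator U x"
  have Hm[measurable]: "?H \<in> borel_measurable borel" by measurable
  have "(\<integral>\<^sup>+x. (\<integral>\<^sup>+t. ?H (x + t *\<^sub>R w) * indicator {0..h} t \<partial>lborel) * indicator S x \<partial>lborel)
      = (\<integral>\<^sup>+x. (\<integral>\<^sup>+t. ?H (x + t *\<^sub>R w) * indicator {0..h} t * indicator S x \<partial>lborel) \<partial>lborel)"
    by (intro nn_integral_cong nn_integral_multc[symmetric]) measurable
  also have "\<dots> = (\<integral>\<^sup>+t. (\<integral>\<^sup>+x. ?H (x + t *\<^sub>R w) * indicator {0..h} t * indicator S x \<partial>lborel) \<partial>lborel)"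
    by (rule lborel_pair.Fubini') measurable
  also have "\<dots> \<le> (\<integral>\<^sup>+t. (\<integral>\<^sup>+y. ?H y * indicator S (y - t *\<^sub>R w) \<partial>lborel) \<partial>lborel)"
  proof (rule nn_integral_mono)
    fix t :: real
    have "(\<integral>\<^sup>+x. ?H (x + t *\<^sub>R w) * indicator {0..h} t * indicator S x \<partial>lborel)
        \<le> (\<integral>\<^sup>+x. ?H (x + t *\<^sub>R w) * indicator S ((x + t *\<^sub>R w) - t *\<^sub>R w) \<partial>lborel)"
      by (intro nn_integral_mono) (auto simp: indicator_def)
    also have "\<dots> = (\<integral>\<^sup>+y. ?H y * indicator S (y - t *\<^sub>R w) \<partial>lborel)"
      by (rule nn_integral_lborel_translate[where f="\<lambda>y. ?H y * indicator S (y - t *\<^sub>R w)"]) measurable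
    finally show "(\<integral>\<^sup>+x. ?H (x + t *\<^sub>R w) * indicator {0..h} t * indicator S x \<partial>lborel)
        \<le> (\<integral>\<^sup>+y. ?H y * indicator S (y - t *\<^sub>R w) \<partial>lborel)" .
  qed
  also have "\<dots> = (\<integral>\<^sup>+y. (\<integral>\<^sup>+t. ?H y * indicator S (y - t *\<^sub>R w) \<partial>lborel) \<partial>lborel)"
    by (rule lborel_pair.Fubini') measurable
  also have "\<dots> \<le> (\<integral>\<^sup>+y. ennreal (2 * D) * ?H y \<partial>lborel)"
  proof (rule nn_integral_mono)
    fix y :: 'a
    have T: "{t. y - t *\<^sub>R w \<in> S} \<in> sets lborel" by measurable
    have "(\<integral>\<^sup>+t. ?H y * indicator S (y - t *\<^sub>R w) \<partial>lborel) = ?H y * (\<integral>\<^sup>+t. indicator S (y - t *\<^sub>R w) \<partial>lborel)"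
      by (rule nn_integral_cmult) measurable
    also have "(\<integral>\<^sup>+t. indicator S (y - t *\<^sub>R w) \<partial>lborel) = (\<integral>\<^sup>+t. indicator {t. y - t *\<^sub>R w \<in> S} t \<partial>lborel)"
      by (intro nn_integral_cong) (auto simp: indicator_def)
    also have "\<dots> = emeasure lborel {t. y - t *\<^sub>R w \<in> S}" by (rule nn_integral_indicator[OF T])
    also have "?H y * \<dots> \<le> ?H y * ennreal (2 * D)"
      by (intro mult_left_mono emeasure_le_of_diameter D) (use D(2) in auto)
    finally show "(\<integral>\<^sup>+t. ?H y * indicator S (y - t *\<^sub>R w) \<partial>lborel) \<le> ennreal (2 * D) * ?H y" by (simp add: mult.commute)
  qed
  also have "\<dots> = ennreal (2 * D) * (\<integral>\<^sup>+x. ?H x \<partial>lborel)" by (rule nn_integral_cmult) measurable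
  finally show ?thesis .
qed

text \<open>The cone condition prevents a line in direction \<open>w\<close> from meeting the boundary near \<open>p\<close> twice,
  so from each point near \<open>p\<close> one of the two directions stays inside.\<close>

lemma local_strip:
  fixes \<omega> :: "'a::euclidean_space set"
  assumes op: "open \<omega>" and r: "r > 0" and vw: "norm v = 1" "norm w = 1" "w \<bullet> v = 0" and L: "L \<ge> 0"
    and cone: "\<And>q q'. q \<in> frontier \<omega> \<inter> ball p r \<Longrightarrow> q' \<in> frontier \<omega> \<inter> ball p r \<Longrightarrow> norm (q - q') \<le> L * \<bar>(q - q') \<bullet> v\<bar>"
  shows "\<exists>C\<ge>0. \<forall>\<delta> f. 0 < \<delta> \<longrightarrow> \<delta> \<le> r / 4 \<longrightarrow> C1 f \<longrightarrow>
     (\<integral>\<^sup>+x. ennreal ((f x)\<^sup>2) * indicator (\<omega> \<inter> ball p (r/4) \<inter> (\<Union>q\<in>frontier \<omega>. ball q \<delta>)) x \<partial>lborel)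
       \<le> ennreal (C * \<delta>) * (\<integral>\<^sup>+x. ennreal (energy f x) * indicator \<omega> x \<partial>lborel)"
proof -
  \<comment> \<open>\<open>line_estimate\<close> asks for \<open>h \<le> 1\<close>;
    \<open>h \<le> r / 4\<close> keeps segments of length \<open>h\<close> from
    \<open>ball p (r/4)\<close> inside \<open>ball p r\<close>, where the cone condition
    holds.\<close>
  define h where "h = min 1 (r / 4)"
  have h: "0 < h" "h \<le> 1" "h \<le> r / 4" using r by (auto simp: h_def)
  have om[measurable]: "\<omega> \<in> sets borel" using op by simp
  have dich: "(\<forall>t\<in>{0..h}. x + t *\<^sub>R w \<in> \<omega>) \<or> (\<forall>t\<in>{0..h}. x + t *\<^sub>R (- w) \<in> \<omega>)" if x: "x \<in> \<omega>" "x \<in> ball p (r/4)" for x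
  proof (rule ccontr)
    assume "\<not> ?thesis"
    then obtain t1 t2 where t: "t1 \<in> {0..h}" "x + t1 *\<^sub>R w \<notin> \<omega>" "t2 \<in> {0..h}" "x + t2 *\<^sub>R (- w) \<notin> \<omega>" by blast
    have hit: "\<exists>s. 0 < s \<and> s \<le> h \<and> x + s *\<^sub>R u \<in> frontier \<omega> \<inter> ball p r"
      if u: "norm u = 1" and t: "t \<in> {0..h}" "x + t *\<^sub>R u \<notin> \<omega>" for t u
    proof -
      have "closed_segment x (x + t *\<^sub>R u) \<inter> frontier \<omega> \<noteq> {}"
        by (rule connected_Int_frontier) (use x t in auto)
      then obtain z where z: "z \<in> closed_segment x (x + t *\<^sub>R u)" "z \<in> frontier \<omega>" by blast
      then obtain k where k: "0 \<le> k" "k \<le> 1" "z = (1 - k) *\<^sub>R x + k *\<^sub>R (x + t *\<^sub>R u)" by (auto simp: closed_segment_def)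
      then have zk: "z = x + (k * t) *\<^sub>R u" by (simp add: algebra_simps)
      have "x \<notin> frontier \<omega>" using x(1) op by (simp add: frontier_def interior_open)
      then have "k * t \<noteq> 0" using z(2) zk by auto
      moreover have "0 \<le> k * t" "k * t \<le> h" using k t mult_left_le_one_le[of t k] by auto
      moreover have "dist p z < r"
      proof -
        have "dist p z \<le> dist p x + dist x z" by (rule dist_triangle)
        also have "dist x z = k * t" using zk u \<open>0 \<le> k * t\<close> by (simp add: dist_norm)
        finally show ?thesis using x(2) h \<open>k * t \<le> h\<close> by simp
      qed
      ultimately have "0 < k * t \<and> k * t \<le> h \<and> x + (k * t) *\<^sub>R u \<in> frontier \<omega> \<inter> ball p r"
        using z(2) zk by (simp add: less_le)
      then show ?thesis by blast
    qed
    obtain s1 where s1: "0 < s1" "x + s1 *\<^sub>R w \<in> frontier \<omega> \<inter> ball p r" using hit[OF vw(2) t(1,2)] by blast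
    have "norm (- w) = 1" using vw by simp
    from hit[OF this t(3,4)] obtain s2 where s2: "0 < s2" "x + s2 *\<^sub>R (- w) \<in> frontier \<omega> \<inter> ball p r" by blast
    \<comment> \<open>The two boundary points differ by a multiple of \<open>w\<close>, which is
      orthogonal to \<open>v\<close>; the cone condition would force their distance to be 0.\<close>
    have eq: "(x + s1 *\<^sub>R w) - (x + s2 *\<^sub>R (- w)) = (s1 + s2) *\<^sub>R w" by (simp add: algebra_simps)
    have "norm ((s1 + s2) *\<^sub>R w) \<le> L * \<bar>((s1 + s2) *\<^sub>R w) \<bullet> v\<bar>"
      using cone[OF s1(2) s2(2)] unfolding eq .
    then show False using s1 s2 vw by simp
  qed
  \<comment> \<open>Two directions, a factor 2 from the line estimate and \<open>2 * D\<close> from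
    the sliding estimate give \<open>8 * D / h\<close>, with
    \<open>D = 2 * \<delta> * (1 + L)\<close> as below.\<close>
  define C where "C = 16 * (1 + L) / h"
  have C: "C \<ge> 0" using L h by (simp add: C_def)
  have main: "(\<integral>\<^sup>+x. ennreal ((f x)\<^sup>2) * indicator (\<omega> \<inter> ball p (r/4) \<inter> (\<Union>q\<in>frontier \<omega>. ball q \<delta>)) x \<partial>lborel)
       \<le> ennreal (C * \<delta>) * (\<integral>\<^sup>+x. ennreal (energy f x) * indicator \<omega> x \<partial>lborel)"
    if d: "0 < \<delta>" "\<delta> \<le> r / 4" and f: "C1 f" for \<delta> f
  proof -
    define S where "S = \<omega> \<inter> ball p (r/4) \<inter> (\<Union>q\<in>frontier \<omega>. ball q \<delta>)"
    have "open S" unfolding S_def using op by (intro open_Int open_UN) auto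
    then have S[measurable]: "S \<in> sets borel" by simp
    have E[measurable]: "energy f \<in> borel_measurable borel" by (rule energy_measurable[OF f])
    have fb[measurable]: "f \<in> borel_measurable borel" using C1_continuous[OF f] by (rule borel_measurable_continuous_onI)
    \<comment> \<open>Two points of the strip on one line parallel to \<open>w\<close> lie within
      \<open>\<delta>\<close> of boundary points whose components along \<open>v\<close> differ by
      at most \<open>2 * \<delta>\<close>. The cone condition puts these at distance at most
      \<open>2 * L * \<delta>\<close>, and the two displacements add
      \<open>2 * \<delta>\<close>.\<close>
    define D where "D = 2 * \<delta> * (1 + L)"
    have D0: "D \<ge> 0" using d L by (simp add: D_def)
    have diam: "\<bar>s - t\<bar> \<le> D" if u: "norm u = 1" "u \<bullet> v = 0" and st: "y - s *\<^sub>R u \<in> S" "y - t *\<^sub>R u \<in> S" for y s t u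
    proof -
      have near: "\<exists>q\<in>frontier \<omega> \<inter> ball p r. norm (z - q) \<le> \<delta>" if "z \<in> S" for z
      proof -
        have "z \<in> ball p (r / 4)" "z \<in> (\<Union>q\<in>frontier \<omega>. ball q \<delta>)" using that unfolding S_def by blast+
        then obtain q where q: "q \<in> frontier \<omega>" "dist q z < \<delta>" "dist p z < r / 4" unfolding mem_ball UN_iff by blast
        have "dist p q \<le> dist p z + dist q z" by (rule dist_triangle2)
        then have "dist p q < r" using q d r by simp
        then show ?thesis using q by (intro bexI[of _ q]) (auto simp: dist_norm norm_minus_commute)
      qed
      obtain q q' where q: "q \<in> frontier \<omega> \<inter> ball p r" "norm (y - s *\<^sub>R u - q) \<le> \<delta>"
        "q' \<in> frontier \<omega> \<inter> ball p r" "norm (y - t *\<^sub>R u - q') \<le> \<delta>" using near[OF st(1)] near[OF st(2)] by blast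
      let ?a = "y - s *\<^sub>R u - q" and ?b = "y - t *\<^sub>R u - q'"
      have eq: "q - q' = ?b - ?a + (t - s) *\<^sub>R u" by (simp add: algebra_simps)
      have ab: "norm (?b - ?a) \<le> 2 * \<delta>" using norm_triangle_ineq4[of ?b ?a] q by linarith
      have "(q - q') \<bullet> v = (?b - ?a) \<bullet> v" unfolding eq using u by (simp add: inner_add_left)
      also have "\<bar>\<dots>\<bar> \<le> norm (?b - ?a) * norm v" by (rule Cauchy_Schwarz_ineq2)
      finally have "\<bar>(q - q') \<bullet> v\<bar> \<le> 2 * \<delta>" using ab vw by simp
      then have "norm (q - q') \<le> L * (2 * \<delta>)"
        using cone[OF q(1,3)] L by (meson mult_left_mono order_trans)
      moreover have "(t - s) *\<^sub>R u = (q - q') - (?b - ?a)" unfolding eq by simp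
      then have "norm ((t - s) *\<^sub>R u) \<le> norm (q - q') + norm (?b - ?a)" by (metis norm_triangle_ineq4)
      ultimately have "\<bar>t - s\<bar> \<le> L * (2 * \<delta>) + 2 * \<delta>" using ab u by simp
      then show ?thesis by (simp add: D_def algebra_simps)
    qed
    let ?G = "\<lambda>x. ennreal (energy f x) * indicator \<omega> x"
    let ?I = "\<lambda>u x. \<integral>\<^sup>+t. ennreal (energy f (x + t *\<^sub>R u)) * indicator \<omega> (x + t *\<^sub>R u) * indicator {0..h} t \<partial>lborel"
    have Im[measurable]: "?I u \<in> borel_measurable borel" for u
    proof -
      have "(\<lambda>x. \<integral>\<^sup>+t. ennreal (energy f (x + t *\<^sub>R u)) * indicator \<omega> (x + t *\<^sub>R u) * indicator {0..h} t \<partial>lborel) \<in> borel_measurable lborel"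
        by measurable
      then show ?thesis by simp
    qed
    have pt: "ennreal (h * (f x)\<^sup>2) * indicator S x \<le> 2 * (?I w x * indicator S x) + 2 * (?I (- w) x * indicator S x)" for x
    proof (cases "x \<in> S")
      case True
      have half: "ennreal (h * (f x)\<^sup>2) \<le> 2 * ?I u x" if u: "norm u = 1" "\<forall>t\<in>{0..h}. x + t *\<^sub>R u \<in> \<omega>" for u
      proof -
        have "ennreal (h * (f x)\<^sup>2) \<le> 2 * (\<integral>\<^sup>+t. ennreal (energy f (x + t *\<^sub>R u)) * indicator {0..h} t \<partial>lborel)"
          using line_estimate[OF f _ h(2) u(1)] h(1) by (simp add: energy_def)
        also have "(\<integral>\<^sup>+t. ennreal (energy f (x + t *\<^sub>R u)) * indicator {0..h} t \<partial>lborel) = ?I u x"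
          using u(2) by (intro nn_integral_cong) (auto simp: indicator_def)
        finally show ?thesis .
      qed
      have "x \<in> \<omega>" "x \<in> ball p (r/4)" using True by (auto simp: S_def)
      then consider "\<forall>t\<in>{0..h}. x + t *\<^sub>R w \<in> \<omega>" | "\<forall>t\<in>{0..h}. x + t *\<^sub>R (- w) \<in> \<omega>" using dich by blast
      then have "ennreal (h * (f x)\<^sup>2) \<le> 2 * ?I w x + 2 * ?I (- w) x"
      proof cases
        case 1
        then show ?thesis using half[OF vw(2)] by (meson add_increasing2 zero_le order_trans)
      next
        case 2
        have "norm (- w) = 1" using vw by simp
        from half[OF this 2] show ?thesis by (meson add_increasing zero_le order_trans)
      qed
      then show ?thesis using True by simp
    qed simp
    have "ennreal h * (\<integral>\<^sup>+x. ennreal ((f x)\<^sup>2) * indicator S x \<partial>lborel) = (\<integral>\<^sup>+x. ennreal (h * (f x)\<^sup>2) * indicator S x \<partial>lborel)"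
      using h by (subst nn_integral_cmult[symmetric]) (auto simp: ennreal_mult mult.assoc)
    also have "\<dots> \<le> (\<integral>\<^sup>+x. 2 * (?I w x * indicator S x) + 2 * (?I (- w) x * indicator S x) \<partial>lborel)"
      by (intro nn_integral_mono pt)
    also have "\<dots> = 2 * (\<integral>\<^sup>+x. ?I w x * indicator S x \<partial>lborel) + 2 * (\<integral>\<^sup>+x. ?I (- w) x * indicator S x \<partial>lborel)"
    proof -
      have m: "(\<lambda>x. ?I u x * indicator S x) \<in> borel_measurable lborel" for u
        using Im[of u] S by (intro borel_measurable_times_ennreal borel_measurable_indicator) auto
      show ?thesis
        by (subst nn_integral_add) (use m in \<open>auto simp: nn_integral_cmult\<close>)
    qed
    also have "\<dots> \<le> 2 * (ennreal (2 * D) * (\<integral>\<^sup>+x. ?G x \<partial>lborel)) + 2 * (ennreal (2 * D) * (\<integral>\<^sup>+x. ?G x \<partial>lborel))"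
    proof (intro add_mono mult_left_mono)
      show "(\<integral>\<^sup>+x. ?I w x * indicator S x \<partial>lborel) \<le> ennreal (2 * D) * (\<integral>\<^sup>+x. ?G x \<partial>lborel)"
        by (rule sliding_estimate[OF E S D0 _ om]) (rule diam[OF vw(2,3)])
      have u: "norm (- w) = 1" "(- w) \<bullet> v = 0" using vw by simp_all
      show "(\<integral>\<^sup>+x. ?I (- w) x * indicator S x \<partial>lborel) \<le> ennreal (2 * D) * (\<integral>\<^sup>+x. ?G x \<partial>lborel)"
        by (rule sliding_estimate[OF E S D0 _ om]) (rule diam[OF u])
    qed auto
    also have "\<dots> = ennreal (8 * D) * (\<integral>\<^sup>+x. ?G x \<partial>lborel)"
    proof -
      have "ennreal (8 * D) = (4::ennreal) * ennreal (2 * D)"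
        using D0 ennreal_mult[of 4 "2 * D"] by simp
      then show ?thesis by (simp add: mult.assoc flip: distrib_right)
    qed
    finally have A: "ennreal h * (\<integral>\<^sup>+x. ennreal ((f x)\<^sup>2) * indicator S x \<partial>lborel) \<le> ennreal (8 * D) * (\<integral>\<^sup>+x. ?G x \<partial>lborel)" .
    have "(\<integral>\<^sup>+x. ennreal ((f x)\<^sup>2) * indicator S x \<partial>lborel)
       = ennreal (1 / h) * (ennreal h * (\<integral>\<^sup>+x. ennreal ((f x)\<^sup>2) * indicator S x \<partial>lborel))"
      using h by (simp add: mult.assoc[symmetric] ennreal_mult[symmetric])
    also have "\<dots> \<le> ennreal (1 / h) * (ennreal (8 * D) * (\<integral>\<^sup>+x. ?G x \<partial>lborel))"
      by (intro mult_left_mono A) simp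
    also have "\<dots> = ennreal (C * \<delta>) * (\<integral>\<^sup>+x. ?G x \<partial>lborel)"
    proof -
      have "(1 / h) * (8 * D) = C * \<delta>" by (simp add: C_def D_def field_simps)
      then show ?thesis using h D0 by (simp add: mult.assoc[symmetric] ennreal_mult[symmetric])
    qed
    finally show ?thesis unfolding S_def .
  qed
  show ?thesis using C main by blast
qed

text \<open>The compact boundary is covered by balls of radius \<open>r p / 8\<close>, while the
  local estimate holds on radius \<open>r p / 4\<close>. The difference is the room left for the
  strip: a point closer than \<open>r p / 8\<close> to the boundary inside a small ball stays in the
  large one.\<close>

lemma boundary_strip:
  fixes \<omega> :: "'a::euclidean_space set"
  assumes op: "open \<omega>" and bd: "bounded \<omega>"
    and cone: "\<And>p. p \<in> frontier \<omega> \<Longrightarrow> \<exists>r>0. \<exists>v w. \<exists>L\<ge>0. norm v = 1 \<and> norm w = 1 \<and> w \<bullet> v = 0 \<and>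
       (\<forall>q\<in>frontier \<omega> \<inter> ball p r. \<forall>q'\<in>frontier \<omega> \<inter> ball p r. norm (q - q') \<le> L * \<bar>(q - q') \<bullet> v\<bar>)"
  shows "\<exists>C\<ge>0. \<exists>\<delta>0>0. \<forall>\<delta> f. 0 < \<delta> \<longrightarrow> \<delta> \<le> \<delta>0 \<longrightarrow> C1 f \<longrightarrow>
     (\<integral>\<^sup>+x. ennreal ((f x)\<^sup>2) * indicator (\<omega> \<inter> (\<Union>q\<in>frontier \<omega>. ball q \<delta>)) x \<partial>lborel)
       \<le> ennreal (C * \<delta>) * (\<integral>\<^sup>+x. ennreal (energy f x) * indicator \<omega> x \<partial>lborel)"
proof -
  define Q where "Q p r C \<longleftrightarrow> (\<forall>\<delta> f. 0 < \<delta> \<longrightarrow> \<delta> \<le> r / 4 \<longrightarrow> C1 f \<longrightarrow>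
     (\<integral>\<^sup>+x. ennreal ((f x)\<^sup>2) * indicator (\<omega> \<inter> ball p (r/4) \<inter> (\<Union>q\<in>frontier \<omega>. ball q \<delta>)) x \<partial>lborel)
       \<le> ennreal (C * \<delta>) * (\<integral>\<^sup>+x. ennreal (energy f x) * indicator \<omega> x \<partial>lborel))" for p r C
  have ex: "\<exists>r C. r > 0 \<and> C \<ge> 0 \<and> Q p r C" if p: "p \<in> frontier \<omega>" for p
  proof -
    obtain r v w L where rvwL: "r > 0" "L \<ge> 0" "norm v = 1" "norm w = 1" "w \<bullet> v = 0"
       "\<forall>q\<in>frontier \<omega> \<inter> ball p r. \<forall>q'\<in>frontier \<omega> \<inter> ball p r. norm (q - q') \<le> L * \<bar>(q - q') \<bullet> v\<bar>"
      using cone[OF p] by blast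
    have "\<exists>C\<ge>0. Q p r C"
      unfolding Q_def by (rule local_strip[OF op rvwL(1,3,4,5,2)]) (use rvwL(6) in blast)
    then show ?thesis using rvwL(1) by blast
  qed
  obtain r C where rC: "\<And>p. p \<in> frontier \<omega> \<Longrightarrow> r p > 0" "\<And>p. p \<in> frontier \<omega> \<Longrightarrow> C p \<ge> 0"
    and Q: "\<And>p. p \<in> frontier \<omega> \<Longrightarrow> Q p (r p) (C p)"
    using ex by metis
  have est: "(\<integral>\<^sup>+x. ennreal ((f x)\<^sup>2) * indicator (\<omega> \<inter> ball p (r p/4) \<inter> (\<Union>q\<in>frontier \<omega>. ball q \<delta>)) x \<partial>lborel)
       \<le> ennreal (C p * \<delta>) * (\<integral>\<^sup>+x. ennreal (energy f x) * indicator \<omega> x \<partial>lborel)"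
    if "p \<in> frontier \<omega>" "0 < \<delta>" "\<delta> \<le> r p / 4" "C1 f" for p \<delta> f
    using Q[OF that(1)] that(2-4) unfolding Q_def by blast
  have cp: "compact (frontier \<omega>)" using bd by (rule compact_frontier_bounded)
  have "frontier \<omega> \<subseteq> (\<Union>p\<in>frontier \<omega>. ball p (r p / 8))" using rC(1) by force
  from compactE_image[OF cp _ this] obtain F where F: "F \<subseteq> frontier \<omega>" "finite F" "frontier \<omega> \<subseteq> (\<Union>p\<in>F. ball p (r p / 8))"
    by auto
  define \<delta>0 where "\<delta>0 = Min (insert 1 ((\<lambda>p. r p / 8) ` F))"
  have d0: "\<delta>0 > 0" unfolding \<delta>0_def using F rC(1) by (subst Min_gr_iff) auto
  have d0F: "\<delta>0 \<le> r p / 8" if "p \<in> F" for p unfolding \<delta>0_def using F that by (intro Min_le) auto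
  have "(\<integral>\<^sup>+x. ennreal ((f x)\<^sup>2) * indicator (\<omega> \<inter> (\<Union>q\<in>frontier \<omega>. ball q \<delta>)) x \<partial>lborel)
       \<le> ennreal (sum C F * \<delta>) * (\<integral>\<^sup>+x. ennreal (energy f x) * indicator \<omega> x \<partial>lborel)"
    if d: "0 < \<delta>" "\<delta> \<le> \<delta>0" and f: "C1 f" for \<delta> f
  proof -
    let ?S = "\<lambda>p. \<omega> \<inter> ball p (r p/4) \<inter> (\<Union>q\<in>frontier \<omega>. ball q \<delta>)"
    let ?E = "\<integral>\<^sup>+x. ennreal (energy f x) * indicator \<omega> x \<partial>lborel"
    have cov: "\<exists>p\<in>F. x \<in> ?S p" if x: "x \<in> \<omega> \<inter> (\<Union>q\<in>frontier \<omega>. ball q \<delta>)" for x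
    proof -
      obtain q where q: "q \<in> frontier \<omega>" "dist q x < \<delta>"
        using x unfolding mem_ball UN_iff Int_iff by blast
      then obtain p where p: "p \<in> F" "dist p q < r p / 8"
        using F(3) unfolding subset_iff mem_ball UN_iff by blast
      have "dist p x \<le> dist p q + dist q x" by (rule dist_triangle)
      then have "dist p x < r p / 4" using p q d d0F[OF p(1)] by linarith
      then have "x \<in> ball p (r p / 4)" by simp
      then show ?thesis using x p(1) by blast
    qed
    have fb: "f \<in> borel_measurable borel" using C1_continuous[OF f] by (rule borel_measurable_continuous_onI)
    have So: "?S p \<in> sets borel" for p using op by (intro borel_open open_Int open_UN) auto
    have "(\<integral>\<^sup>+x. ennreal ((f x)\<^sup>2) * indicator (\<omega> \<inter> (\<Union>q\<in>frontier \<omega>. ball q \<delta>)) x \<partial>lborel)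
       \<le> (\<integral>\<^sup>+x. (\<Sum>p\<in>F. ennreal ((f x)\<^sup>2) * indicator (?S p) x) \<partial>lborel)"
    proof (rule nn_integral_mono)
      fix x
      show "ennreal ((f x)\<^sup>2) * indicator (\<omega> \<inter> (\<Union>q\<in>frontier \<omega>. ball q \<delta>)) x
         \<le> (\<Sum>p\<in>F. ennreal ((f x)\<^sup>2) * indicator (?S p) x)"
      proof (cases "x \<in> \<omega> \<inter> (\<Union>q\<in>frontier \<omega>. ball q \<delta>)")
        case True
        then obtain p where p: "p \<in> F" "x \<in> ?S p" using cov by blast
        have "ennreal ((f x)\<^sup>2) * indicator (?S p) x \<le> (\<Sum>p\<in>F. ennreal ((f x)\<^sup>2) * indicator (?S p) x)"
          by (rule member_le_sum[OF p(1)]) (use F in auto)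
        then show ?thesis using True p(2) by simp
      qed simp
    qed
    also have "\<dots> = (\<Sum>p\<in>F. \<integral>\<^sup>+x. ennreal ((f x)\<^sup>2) * indicator (?S p) x \<partial>lborel)"
      using fb So by (intro nn_integral_sum borel_measurable_times_ennreal borel_measurable_indicator) auto
    also have "\<dots> \<le> (\<Sum>p\<in>F. ennreal (C p * \<delta>) * ?E)"
    proof (rule sum_mono)
      fix p assume p: "p \<in> F"
      then have pf: "p \<in> frontier \<omega>" using F by auto
      have "\<delta> \<le> r p / 4" using d d0F[OF p] rC(1)[OF pf] by linarith
      from est[OF pf d(1) this f] show "(\<integral>\<^sup>+x. ennreal ((f x)\<^sup>2) * indicator (?S p) x \<partial>lborel) \<le> ennreal (C p * \<delta>) * ?E" .
    qed
    also have "\<dots> = ennreal (\<Sum>p\<in>F. C p * \<delta>) * ?E"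
      using F rC(2) d by (subst sum_ennreal[symmetric]) (auto simp: sum_distrib_right)
    also have "(\<Sum>p\<in>F. C p * \<delta>) = sum C F * \<delta>" by (simp add: sum_distrib_right)
    finally show ?thesis .
  qed
  moreover have "sum C F \<ge> 0" using F rC(2) by (intro sum_nonneg) auto
  ultimately show ?thesis using d0 by blast
qed

section \<open>The Poincare inequality on convex sets and its use on small boxes\<close>

lemma poincare_double_integral:
  fixes f :: "'a::euclidean_space \<Rightarrow> real"
  assumes f: "C1 f" and P: "convex P" and Pb[measurable]: "P \<in> sets borel"
    and d: "\<And>x y. x \<in> P \<Longrightarrow> y \<in> P \<Longrightarrow> norm (x - y) \<le> d"
  shows "(\<integral>\<^sup>+x. (\<integral>\<^sup>+y. ennreal ((f x - f y)\<^sup>2) * indicator P y \<partial>lborel) * indicator P x \<partial>lborel)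
     \<le> ennreal (d\<^sup>2) * (emeasure lborel P * (ennreal (2 ^ DIM('a)) * (\<integral>\<^sup>+z. ennreal (gradsq f z) * indicator P z \<partial>lborel)))"
proof -
  have g[measurable]: "gradsq f \<in> borel_measurable borel" by (rule gradsq_measurable[OF f])
  \<comment> \<open>Extended by zero outside \<open>P\<close>, so that the affine substitutions
    below may be carried out on the whole space.\<close>
  define H where "H z = ennreal (gradsq f z) * indicator P z" for z
  have H[measurable]: "H \<in> borel_measurable borel" unfolding H_def[abs_def] by measurable
  let ?N = "ennreal (2 ^ DIM('a)) * (\<integral>\<^sup>+z. H z \<partial>lborel)"
  have pt: "ennreal ((f x - f y)\<^sup>2) * indicator P y * indicator P x
     \<le> ennreal (d\<^sup>2) * (\<integral>\<^sup>+t. H (y + t *\<^sub>R (x - y)) * indicator {0..1} t * (indicator P y * indicator P x) \<partial>lborel)" for x y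
  proof (cases "x \<in> P \<and> y \<in> P")
    case True
    have "ennreal ((f x - f y)\<^sup>2) \<le> (\<integral>\<^sup>+t. ennreal ((norm (x - y))\<^sup>2 * gradsq f (y + t *\<^sub>R (x - y))) * indicator {0..1} t \<partial>lborel)"
      by (rule segment_estimate[OF f])
    also have "\<dots> \<le> (\<integral>\<^sup>+t. ennreal (d\<^sup>2) * (H (y + t *\<^sub>R (x - y)) * indicator {0..1} t) \<partial>lborel)"
    proof (rule nn_integral_mono)
      fix t :: real
      show "ennreal ((norm (x - y))\<^sup>2 * gradsq f (y + t *\<^sub>R (x - y))) * indicator {0..1} t
        \<le> ennreal (d\<^sup>2) * (H (y + t *\<^sub>R (x - y)) * indicator {0..1} t)"
      proof (cases "t \<in> {0..1}")
        case t: True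
        have "y + t *\<^sub>R (x - y) = (1 - t) *\<^sub>R y + t *\<^sub>R x" by (simp add: algebra_simps)
        also have "\<dots> \<in> P" using P True t by (intro convexD) auto
        finally have "H (y + t *\<^sub>R (x - y)) = ennreal (gradsq f (y + t *\<^sub>R (x - y)))" by (simp add: H_def)
        moreover have "(norm (x - y))\<^sup>2 * gradsq f (y + t *\<^sub>R (x - y)) \<le> d\<^sup>2 * gradsq f (y + t *\<^sub>R (x - y))"
          using d[of x y] True by (intro mult_right_mono power_mono gradsq_nonneg) auto
        ultimately show ?thesis using t by (simp add: ennreal_leI flip: ennreal_mult' ennreal_mult'')
      qed simp
    qed
    also have "\<dots> = ennreal (d\<^sup>2) * (\<integral>\<^sup>+t. H (y + t *\<^sub>R (x - y)) * indicator {0..1} t \<partial>lborel)"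
      by (rule nn_integral_cmult) measurable
    finally show ?thesis using True by simp
  qed auto
  \<comment> \<open>For fixed \<open>t\<close> the larger of \<open>t\<close> and
    \<open>1 - t\<close> is at least 1/2. Substituting in the variable that carries it costs at most
    2^DIM, and the other variable contributes the measure of \<open>P\<close>; the two cases differ
    by the order of integration.\<close>
  have inner: "(\<integral>\<^sup>+x. (\<integral>\<^sup>+y. H (y + t *\<^sub>R (x - y)) * indicator {0..1} t * (indicator P y * indicator P x) \<partial>lborel) \<partial>lborel)
     \<le> emeasure lborel P * ?N * indicator {0..1} t" for t :: real
  proof (cases "t \<in> {0..1}")
    case True
    have shrink: "(\<integral>\<^sup>+y. H (a + c *\<^sub>R y) * indicator P y \<partial>lborel) \<le> ?N" if "c \<ge> 1/2" for a c
    proof -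
      have "(\<integral>\<^sup>+y. H (a + c *\<^sub>R y) * indicator P y \<partial>lborel) \<le> (\<integral>\<^sup>+y. H (a + c *\<^sub>R y) \<partial>lborel)"
        by (intro nn_integral_mono) (auto simp: indicator_def)
      also have "\<dots> \<le> ?N" by (rule nn_integral_lborel_shrink[OF H that])
      finally show ?thesis .
    qed
    have outer: "(\<integral>\<^sup>+x. (\<integral>\<^sup>+y. H (s *\<^sub>R x + c *\<^sub>R y) * indicator P y \<partial>lborel) * indicator P x \<partial>lborel) \<le> emeasure lborel P * ?N"
      if "c \<ge> 1/2" for s c
    proof -
      have "(\<integral>\<^sup>+x. (\<integral>\<^sup>+y. H (s *\<^sub>R x + c *\<^sub>R y) * indicator P y \<partial>lborel) * indicator P x \<partial>lborel)
          \<le> (\<integral>\<^sup>+x. ?N * indicator P x \<partial>lborel)"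
        by (intro nn_integral_mono mult_right_mono shrink that) simp
      also have "\<dots> = emeasure lborel P * ?N" by (subst nn_integral_cmult_indicator) (simp_all add: mult.commute)
      finally show ?thesis .
    qed
    show ?thesis
    proof (cases "t \<le> 1/2")
      case t: True
      have "(\<integral>\<^sup>+x. (\<integral>\<^sup>+y. H (y + t *\<^sub>R (x - y)) * indicator {0..1} t * (indicator P y * indicator P x) \<partial>lborel) \<partial>lborel)
         = (\<integral>\<^sup>+x. (\<integral>\<^sup>+y. H (t *\<^sub>R x + (1 - t) *\<^sub>R y) * indicator P y \<partial>lborel) * indicator P x \<partial>lborel)"
      proof (rule nn_integral_cong)
        fix x :: 'a
        have eq: "y + t *\<^sub>R (x - y) = t *\<^sub>R x + (1 - t) *\<^sub>R y" for y :: 'a by (simp add: algebra_simps)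
        show "(\<integral>\<^sup>+y. H (y + t *\<^sub>R (x - y)) * indicator {0..1} t * (indicator P y * indicator P x) \<partial>lborel)
           = (\<integral>\<^sup>+y. H (t *\<^sub>R x + (1 - t) *\<^sub>R y) * indicator P y \<partial>lborel) * indicator P x"
          unfolding eq using True by (cases "x \<in> P") simp_all
      qed
      also have "\<dots> \<le> emeasure lborel P * ?N" by (rule outer) (use t in simp)
      finally show ?thesis using True by simp
    next
      case t: False
      have "(\<integral>\<^sup>+x. (\<integral>\<^sup>+y. H (y + t *\<^sub>R (x - y)) * indicator {0..1} t * (indicator P y * indicator P x) \<partial>lborel) \<partial>lborel)
         = (\<integral>\<^sup>+y. (\<integral>\<^sup>+x. H (y + t *\<^sub>R (x - y)) * indicator {0..1} t * (indicator P y * indicator P x) \<partial>lborel) \<partial>lborel)"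
        by (rule lborel_pair.Fubini'[symmetric]) measurable
      also have "\<dots> = (\<integral>\<^sup>+y. (\<integral>\<^sup>+x. H ((1 - t) *\<^sub>R y + t *\<^sub>R x) * indicator P x \<partial>lborel) * indicator P y \<partial>lborel)"
      proof (rule nn_integral_cong)
        fix y :: 'a
        have eq: "y + t *\<^sub>R (x - y) = (1 - t) *\<^sub>R y + t *\<^sub>R x" for x :: 'a by (simp add: algebra_simps)
        show "(\<integral>\<^sup>+x. H (y + t *\<^sub>R (x - y)) * indicator {0..1} t * (indicator P y * indicator P x) \<partial>lborel)
           = (\<integral>\<^sup>+x. H ((1 - t) *\<^sub>R y + t *\<^sub>R x) * indicator P x \<partial>lborel) * indicator P y"
          unfolding eq using True by (cases "y \<in> P") simp_all
      qed
      also have "\<dots> \<le> emeasure lborel P * ?N" by (rule outer) (use t in simp)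
      finally show ?thesis using True by simp
    qed
  qed simp
  have fb[measurable]: "f \<in> borel_measurable borel" using C1_continuous[OF f] by (rule borel_measurable_continuous_onI)
  have "(\<integral>\<^sup>+x. (\<integral>\<^sup>+y. ennreal ((f x - f y)\<^sup>2) * indicator P y \<partial>lborel) * indicator P x \<partial>lborel)
      = (\<integral>\<^sup>+x. (\<integral>\<^sup>+y. ennreal ((f x - f y)\<^sup>2) * indicator P y * indicator P x \<partial>lborel) \<partial>lborel)"
    by (intro nn_integral_cong nn_integral_multc[symmetric]) measurable
  also have "\<dots> \<le> (\<integral>\<^sup>+x. (\<integral>\<^sup>+y. ennreal (d\<^sup>2) * (\<integral>\<^sup>+t. H (y + t *\<^sub>R (x - y)) * indicator {0..1} t * (indicator P y * indicator P x) \<partial>lborel) \<partial>lborel) \<partial>lborel)"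
    by (intro nn_integral_mono pt)
  also have "\<dots> = ennreal (d\<^sup>2) * (\<integral>\<^sup>+x. (\<integral>\<^sup>+y. (\<integral>\<^sup>+t. H (y + t *\<^sub>R (x - y)) * indicator {0..1} t * (indicator P y * indicator P x) \<partial>lborel) \<partial>lborel) \<partial>lborel)"
    by (subst nn_integral_cmult, measurable, subst nn_integral_cmult, measurable)
  also have "(\<integral>\<^sup>+x. (\<integral>\<^sup>+y. (\<integral>\<^sup>+t. H (y + t *\<^sub>R (x - y)) * indicator {0..1} t * (indicator P y * indicator P x) \<partial>lborel) \<partial>lborel) \<partial>lborel)
     = (\<integral>\<^sup>+x. (\<integral>\<^sup>+t. (\<integral>\<^sup>+y. H (y + t *\<^sub>R (x - y)) * indicator {0..1} t * (indicator P y * indicator P x) \<partial>lborel) \<partial>lborel) \<partial>lborel)"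
    by (intro nn_integral_cong lborel_pair.Fubini'[symmetric]) measurable
  also have "\<dots> = (\<integral>\<^sup>+t. (\<integral>\<^sup>+x. (\<integral>\<^sup>+y. H (y + t *\<^sub>R (x - y)) * indicator {0..1} t * (indicator P y * indicator P x) \<partial>lborel) \<partial>lborel) \<partial>lborel)"
    by (rule lborel_pair.Fubini'[symmetric]) measurable
  also have "\<dots> \<le> (\<integral>\<^sup>+t. emeasure lborel P * ?N * indicator {0..1::real} t \<partial>lborel)"
    by (intro nn_integral_mono inner)
  also have "\<dots> = emeasure lborel P * ?N" by (subst nn_integral_cmult_indicator) simp_all
  finally show ?thesis unfolding H_def by (simp add: mult_left_mono)
qed

lemma continuous_integrable_bounded:
  fixes f :: "'a::euclidean_space \<Rightarrow> real"
  assumes f: "continuous_on UNIV f" and P: "bounded P" "P \<in> sets borel"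
  shows "integrable (Lb P) f"
proof -
  have "integrable lborel (\<lambda>x. indicator (closure P) x *\<^sub>R f x)"
    using P f by (intro borel_integrable_compact) (auto intro: continuous_on_subset)
  then have "integrable (Lb P) (\<lambda>x. indicator (closure P) x *\<^sub>R f x)" by (rule Lb_integrable[OF P(2)])
  moreover have "indicator (closure P) x *\<^sub>R f x = f x" if "x \<in> space (Lb P)" for x
    using that closure_subset[of P] by (auto simp: space_restrict_space)
  ultimately show ?thesis by (metis (no_types, lifting) Bochner_Integration.integrable_cong)
qed

text \<open>Expanding the square, the double integral of (f x - f y)^2 over \<open>P\<close> equals
  twice the measure times the square norm, minus twice the squared integral of \<open>f\<close>.
  Solving for the square norm gives the estimate, with a factor 1/2 in front of the gradient term
  given away.\<close>

lemma poincare: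
  fixes f :: "'a::euclidean_space \<Rightarrow> real"
  assumes f: "C1 f" and P: "convex P" "P \<in> sets borel" "bounded P"
    and d: "\<And>x y. x \<in> P \<Longrightarrow> y \<in> P \<Longrightarrow> norm (x - y) \<le> d" "d > 0" and p: "measure lborel P > 0"
  shows "(\<integral>\<^sup>+x. ennreal ((f x)\<^sup>2) * indicator P x \<partial>lborel)
    \<le> ennreal ((1 / measure lborel P) * (LINT x:P|lborel. f x)\<^sup>2)
      + ennreal (2 ^ DIM('a) * d\<^sup>2) * (\<integral>\<^sup>+x. ennreal (gradsq f x) * indicator P x \<partial>lborel)"
proof -
  let ?p = "measure lborel P" and ?M = "Lb P"
  have em: "emeasure lborel P = ennreal ?p"
    using emeasure_bounded_finite[OF P(3)] by (intro emeasure_eq_ennreal_measure) (auto simp: less_top)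
  define I where "I = (\<integral>x. f x \<partial>?M)"
  define J where "J = (\<integral>x. (f x)\<^sup>2 \<partial>?M)"
  have cf: "continuous_on UNIV f" by (rule C1_continuous[OF f])
  have fi: "integrable ?M f" "integrable ?M (\<lambda>x. (f x)\<^sup>2)"
    using P cf by (auto intro!: continuous_integrable_bounded continuous_intros)
  have fin: "finite_measure ?M"
    using P em by (intro finite_measureI) (simp add: emeasure_restrict_space space_restrict_space)
  interpret finite_measure ?M by (rule fin)
  have pM: "measure ?M (space ?M) = ?p"
    using P by (simp add: measure_restrict_space space_restrict_space)
  have J0: "J \<ge> 0" unfolding J_def by (intro Bochner_Integration.integral_nonneg) simp
  have in_int: "(\<integral>y. (c - f y)\<^sup>2 \<partial>?M) = ?p * c\<^sup>2 - 2 * c * I + J" "integrable ?M (\<lambda>y. (c - f y)\<^sup>2)" for c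
  proof -
    have eq: "(\<lambda>y. (c - f y)\<^sup>2) = (\<lambda>y. c\<^sup>2 - (2 * c) * f y + (f y)\<^sup>2)"
      by (auto simp: power2_eq_square algebra_simps)
    show "integrable ?M (\<lambda>y. (c - f y)\<^sup>2)" unfolding eq using fi by auto
    show "(\<integral>y. (c - f y)\<^sup>2 \<partial>?M) = ?p * c\<^sup>2 - 2 * c * I + J"
      unfolding eq I_def J_def using fi by (simp add: pM)
  qed
  have nn_in: "(\<integral>\<^sup>+y. ennreal ((c - f y)\<^sup>2) \<partial>?M) = ennreal (?p * c\<^sup>2 - 2 * c * I + J)" for c
    using in_int[of c] by (subst nn_integral_eq_integral) auto
  have nonneg: "0 \<le> ?p * c\<^sup>2 - 2 * c * I + J" for c
    unfolding in_int(1)[of c, symmetric] by (intro Bochner_Integration.integral_nonneg) simp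
  have out: "(\<integral>\<^sup>+x. (\<integral>\<^sup>+y. ennreal ((f x - f y)\<^sup>2) \<partial>?M) \<partial>?M) = ennreal (2 * ?p * J - 2 * I\<^sup>2)"
  proof -
    have "(\<integral>\<^sup>+x. ennreal (?p * (f x)\<^sup>2 - 2 * f x * I + J) \<partial>?M) = ennreal (\<integral>x. ?p * (f x)\<^sup>2 - 2 * f x * I + J \<partial>?M)"
      using fi nonneg by (intro nn_integral_eq_integral) auto
    also have "(\<integral>x. ?p * (f x)\<^sup>2 - 2 * f x * I + J \<partial>?M) = ?p * J - 2 * I * I + J * ?p"
      using fi by (simp add: pM I_def J_def)
    finally show ?thesis unfolding nn_in by (simp add: power2_eq_square algebra_simps)
  qed
  have restr: "(\<integral>\<^sup>+x. g x \<partial>?M) = (\<integral>\<^sup>+x. g x * indicator P x \<partial>lborel)" for g :: "'a \<Rightarrow> ennreal"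
    using P by (intro nn_integral_restrict_space) simp
  define G where "G = (\<integral>\<^sup>+x. ennreal (gradsq f x) * indicator P x \<partial>lborel)"
  have A: "ennreal (2 * ?p * J - 2 * I\<^sup>2) \<le> ennreal (d\<^sup>2) * (ennreal ?p * (ennreal (2 ^ DIM('a)) * G))"
    using poincare_double_integral[OF f P(1,2) d(1)] unfolding out[symmetric] restr G_def em .
  have LI: "(LINT x:P|lborel. f x) = I" unfolding I_def by (rule Lb_integral[OF P(2)])
  have LJ: "(\<integral>\<^sup>+x. ennreal ((f x)\<^sup>2) * indicator P x \<partial>lborel) = ennreal J"
    unfolding restr[symmetric] J_def using fi by (intro nn_integral_eq_integral) auto
  show ?thesis
  proof (cases "G = top")
    case True
    have "ennreal (2 ^ DIM('a) * d\<^sup>2) * G = top" using d(2) True by (simp add: ennreal_mult_top)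
    then show ?thesis unfolding G_def[symmetric] by simp
  next
    case False
    then obtain \<gamma> where g: "\<gamma> \<ge> 0" "G = ennreal \<gamma>" by (cases G) auto
    have "ennreal (2 * ?p * J - 2 * I\<^sup>2) \<le> ennreal (d\<^sup>2 * (?p * (2 ^ DIM('a) * \<gamma>)))"
      using A g p by (simp add: ennreal_mult)
    then have "2 * ?p * J - 2 * I\<^sup>2 \<le> d\<^sup>2 * (?p * (2 ^ DIM('a) * \<gamma>))"
      using g p by (subst (asm) ennreal_le_iff) auto
    moreover have "0 \<le> d\<^sup>2 * (?p * (2 ^ DIM('a) * \<gamma>))" using g p by simp
    ultimately have "?p * J \<le> I\<^sup>2 + d\<^sup>2 * (?p * (2 ^ DIM('a) * \<gamma>))" by linarith
    then have "J \<le> (I\<^sup>2 + d\<^sup>2 * (?p * (2 ^ DIM('a) * \<gamma>))) / ?p" using p by (simp add: pos_le_divide_eq mult.commute)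
    also have "\<dots> = (1 / ?p) * I\<^sup>2 + (2 ^ DIM('a) * d\<^sup>2) * \<gamma>" using p by (simp add: field_simps)
    finally have "ennreal J \<le> ennreal ((1 / ?p) * I\<^sup>2) + ennreal (2 ^ DIM('a) * d\<^sup>2) * ennreal \<gamma>"
      using g p by (simp add: ennreal_leI flip: ennreal_mult ennreal_plus)
    then show ?thesis unfolding LI LJ G_def[symmetric] g .
  qed
qed

lemma cbox_minus_box_null: "cbox a b - box a b \<in> null_sets lborel"
  for a b :: "'a::euclidean_space"
  using emeasure_lborel_cbox_eq[of a b] emeasure_lborel_box_eq[of a b]
    emeasure_Diff[of lborel "box a b" "cbox a b"] box_subset_cbox[of a b]
  by (auto simp: null_sets_def)

text \<open>A division into cells of small diameter, of which the interiors of those meeting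
  \<open>K\<close> are kept. The cell boundaries are null sets, so \<open>K\<close> is covered
  almost everywhere; cells with empty interior are discarded because the Poincare inequality divides
  by the measure.\<close>

lemma box_partition:
  fixes K :: "'a::euclidean_space set"
  assumes K: "compact K" "K \<subseteq> U" and U: "open U" and \<eta>: "\<eta> > 0"
  obtains \<P> where "finite \<P>" "\<And>P. P \<in> \<P> \<Longrightarrow> \<exists>c d. P = box c d" "\<And>P. P \<in> \<P> \<Longrightarrow> P \<noteq> {}"
    "\<And>P. P \<in> \<P> \<Longrightarrow> P \<subseteq> U" "\<And>P x y. P \<in> \<P> \<Longrightarrow> x \<in> P \<Longrightarrow> y \<in> P \<Longrightarrow> norm (x - y) \<le> \<eta>"
    "disjoint \<P>" "AE x in lborel. x \<in> K \<longrightarrow> x \<in> \<Union>\<P>"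
proof -
  obtain e where e: "e > 0" "(\<Union>x\<in>K. ball x e) \<subseteq> U"
    using compact_subset_open_imp_ball_epsilon_subset[OF K(1) U K(2)] by blast
  obtain a b where ab: "K \<subseteq> cbox a b" using bounded_subset_cbox_symmetric[OF compact_imp_bounded[OF K(1)]] by blast
  \<comment> \<open>Cells get diameter below \<open>2 * r\<close>: at most \<open>\<eta>\<close> for
    the Poincare constant, and at most \<open>e\<close> so that a cell meeting \<open>K\<close>
    stays in \<open>U\<close>.\<close>
  define r where "r = min \<eta> e / 2"
  have r: "r > 0" "2 * r \<le> \<eta>" "2 * r \<le> e" using e \<eta> by (auto simp: r_def)
  have "gauge (\<lambda>x::'a. ball x r)" using r by (simp add: gauge_def)
  then obtain p where p: "p tagged_division_of cbox a b" "(\<lambda>x. ball x r) fine p" by (rule fine_division_exists)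
  define D where "D = snd ` p"
  have D: "D division_of cbox a b" unfolding D_def by (rule division_of_tagged_division[OF p(1)])
  have diam: "norm (x - y) < 2 * r" if kxy: "k \<in> D" "x \<in> k" "y \<in> k" for k x y
  proof -
    obtain z where "(z, k) \<in> p" using kxy by (auto simp: D_def)
    then have "k \<subseteq> ball z r" using p(2) by (auto simp: fine_def)
    then have "dist z x < r" "dist z y < r" using kxy by auto
    then show ?thesis using dist_triangle2[of x y z] by (simp add: dist_norm norm_minus_commute)
  qed
  define \<P> where "\<P> = interior ` {k \<in> D. k \<inter> K \<noteq> {} \<and> interior k \<noteq> {}}"
  show thesis
  proof
    show "finite \<P>" using division_ofD(1)[OF D] by (simp add: \<P>_def)
    fix P assume "P \<in> \<P>"
    then obtain k where k: "P = interior k" "k \<in> D" "k \<inter> K \<noteq> {}" "interior k \<noteq> {}" by (auto simp: \<P>_def)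
    obtain c d where "k = cbox c d" using division_ofD(4)[OF D k(2)] by blast
    then have "P = box c d" using k(1) by (simp add: interior_cbox)
    then show "\<exists>c d. P = box c d" by blast
    show "P \<noteq> {}" using k by simp
    show "P \<subseteq> U"
    proof
      fix x assume "x \<in> P"
      then have x: "x \<in> k" using k interior_subset by blast
      obtain y where y: "y \<in> k" "y \<in> K" using k by blast
      have "x \<in> ball y e" using diam[OF k(2) y(1) x] r by (simp add: dist_norm)
      then show "x \<in> U" using e y by blast
    qed
    show "norm (x - y) \<le> \<eta>" if "x \<in> P" "y \<in> P" for x y
      using diam[OF k(2), of x y] that k interior_subset[of k] r by fastforce
  next
    show "disjoint \<P>"
    proof (rule disjointI)
      fix P Q assume "P \<in> \<P>" "Q \<in> \<P>" "P \<noteq> Q"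
      then obtain k l where "P = interior k" "Q = interior l" "k \<in> D" "l \<in> D" "k \<noteq> l" by (auto simp: \<P>_def)
      then show "P \<inter> Q = {}" using division_ofD(5)[OF D] by simp
    qed
    have "AE x in lborel. \<forall>k\<in>D. x \<notin> k - interior k"
    proof (rule AE_finite_allI[OF division_ofD(1)[OF D]])
      fix k assume "k \<in> D"
      then obtain c d where "k = cbox c d" using division_ofD(4)[OF D] by blast
      then show "AE x in lborel. x \<notin> k - interior k"
        using AE_not_in[OF cbox_minus_box_null[of c d]] by (simp add: interior_cbox)
    qed
    then show "AE x in lborel. x \<in> K \<longrightarrow> x \<in> \<Union>\<P>"
    proof eventually_elim
      case (elim x)
      show ?case
      proof
        assume x: "x \<in> K"
        then have "x \<in> \<Union>D" using ab division_ofD(6)[OF D] by auto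
        then obtain k where k: "k \<in> D" "x \<in> k" by blast
        then have "x \<in> interior k" using elim by blast
        then show "x \<in> \<Union>\<P>" using k x by (auto simp: \<P>_def)
      qed
    qed
  qed
qed

text \<open>A quantitative substitute for Rellich's theorem. Boxes of diameter \<open>\<eta>\<close>
  with 2^DIM \<eta>^2 = \<epsilon> make the gradient term cost exactly \<epsilon>, and the integrals
  over the finitely many boxes are the functionals of finite rank.\<close>

lemma interior_compactness:
  fixes K :: "'a::euclidean_space set"
  assumes K: "compact K" "K \<subseteq> U" and U: "open U" and \<epsilon>: "\<epsilon> > 0"
  obtains \<P> c where "finite \<P>" "\<And>P. P \<in> \<P> \<Longrightarrow> P \<in> sets borel \<and> bounded P \<and> P \<subseteq> U" "c \<ge> 0"
    "\<And>f. C1 f \<Longrightarrow> (\<integral>\<^sup>+x. ennreal ((f x)\<^sup>2) * indicator K x \<partial>lborel)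
       \<le> ennreal (c * (\<Sum>P\<in>\<P>. (LINT x:P|lborel. f x)\<^sup>2)) + ennreal \<epsilon> * (\<integral>\<^sup>+x. ennreal (gradsq f x) * indicator U x \<partial>lborel)"
proof -
  define \<eta> where "\<eta> = sqrt (\<epsilon> / 2 ^ DIM('a))"
  have \<eta>: "\<eta> > 0" "2 ^ DIM('a) * \<eta>\<^sup>2 = \<epsilon>" using \<epsilon> by (auto simp: \<eta>_def)
  obtain \<P> where P: "finite \<P>" "\<And>P. P \<in> \<P> \<Longrightarrow> \<exists>c d. P = box c d" "\<And>P. P \<in> \<P> \<Longrightarrow> P \<noteq> {}"
    "\<And>P. P \<in> \<P> \<Longrightarrow> P \<subseteq> U" "\<And>P x y. P \<in> \<P> \<Longrightarrow> x \<in> P \<Longrightarrow> y \<in> P \<Longrightarrow> norm (x - y) \<le> \<eta>"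
    "disjoint \<P>" "AE x in lborel. x \<in> K \<longrightarrow> x \<in> \<Union>\<P>"
    using box_partition[OF K U \<eta>(1)] by blast
  have Pp: "P \<in> sets borel" "bounded P" "convex P" "measure lborel P > 0" if PP: "P \<in> \<P>" for P
  proof -
    obtain c d where cd: "P = box c d" using P(2)[OF PP] by blast
    show "P \<in> sets borel" "bounded P" "convex P" using cd by (auto simp: convex_box)
    have "\<forall>i\<in>Basis. c \<bullet> i < d \<bullet> i" using P(3)[OF PP] cd by (simp add: box_ne_empty)
    then show "measure lborel P > 0"
      unfolding cd by (auto simp: measure_lborel_box_eq less_imp_le inner_diff_left intro!: prod_pos)
  qed
  define c where "c = (\<Sum>P\<in>\<P>. 1 / measure lborel P)"
  have c: "1 / measure lborel P \<le> c" if "P \<in> \<P>" for P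
    unfolding c_def by (rule member_le_sum[OF that]) (use P(1) in auto)
  have c0: "c \<ge> 0" unfolding c_def by (intro sum_nonneg) auto
  show thesis
  proof (rule that[OF P(1) _ c0])
    show "P \<in> sets borel \<and> bounded P \<and> P \<subseteq> U" if "P \<in> \<P>" for P using Pp P(4) that by blast
    fix f :: "'a \<Rightarrow> real" assume f: "C1 f"
    have fb[measurable]: "f \<in> borel_measurable borel" using C1_continuous[OF f] by (rule borel_measurable_continuous_onI)
    have gb[measurable]: "gradsq f \<in> borel_measurable borel" by (rule gradsq_measurable[OF f])
    have "(\<integral>\<^sup>+x. ennreal ((f x)\<^sup>2) * indicator K x \<partial>lborel) \<le> (\<integral>\<^sup>+x. (\<Sum>P\<in>\<P>. ennreal ((f x)\<^sup>2) * indicator P x) \<partial>lborel)"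
    proof (rule nn_integral_mono_AE)
      show "AE x in lborel. ennreal ((f x)\<^sup>2) * indicator K x \<le> (\<Sum>P\<in>\<P>. ennreal ((f x)\<^sup>2) * indicator P x)"
        using P(7)
      proof eventually_elim
        case (elim x)
        show ?case
        proof (cases "x \<in> K")
          case True
          then obtain P where p: "P \<in> \<P>" "x \<in> P" using elim by blast
          have "ennreal ((f x)\<^sup>2) * indicator P x \<le> (\<Sum>P\<in>\<P>. ennreal ((f x)\<^sup>2) * indicator P x)"
            by (rule member_le_sum[OF p(1)]) (use P(1) in auto)
          then show ?thesis using True p by simp
        qed simp
      qed
    qed
    also have "\<dots> = (\<Sum>P\<in>\<P>. \<integral>\<^sup>+x. ennreal ((f x)\<^sup>2) * indicator P x \<partial>lborel)"
      using Pp(1) by (intro nn_integral_sum borel_measurable_times_ennreal borel_measurable_indicator) auto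
    also have "\<dots> \<le> (\<Sum>P\<in>\<P>. ennreal (c * (LINT x:P|lborel. f x)\<^sup>2) + ennreal \<epsilon> * (\<integral>\<^sup>+x. ennreal (gradsq f x) * indicator P x \<partial>lborel))"
    proof (rule sum_mono)
      fix P assume p: "P \<in> \<P>"
      have "(\<integral>\<^sup>+x. ennreal ((f x)\<^sup>2) * indicator P x \<partial>lborel)
        \<le> ennreal ((1 / measure lborel P) * (LINT x:P|lborel. f x)\<^sup>2)
          + ennreal (2 ^ DIM('a) * \<eta>\<^sup>2) * (\<integral>\<^sup>+x. ennreal (gradsq f x) * indicator P x \<partial>lborel)"
        by (rule poincare[OF f Pp(3)[OF p] Pp(1)[OF p] Pp(2)[OF p] P(5)[OF p] \<eta>(1) Pp(4)[OF p]])
      also have "ennreal ((1 / measure lborel P) * (LINT x:P|lborel. f x)\<^sup>2) \<le> ennreal (c * (LINT x:P|lborel. f x)\<^sup>2)"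
        by (intro ennreal_leI mult_right_mono c p) simp
      finally show "(\<integral>\<^sup>+x. ennreal ((f x)\<^sup>2) * indicator P x \<partial>lborel)
        \<le> ennreal (c * (LINT x:P|lborel. f x)\<^sup>2) + ennreal \<epsilon> * (\<integral>\<^sup>+x. ennreal (gradsq f x) * indicator P x \<partial>lborel)"
        unfolding \<eta>(2) by (simp add: add_mono)
    qed
    also have "\<dots> = ennreal (c * (\<Sum>P\<in>\<P>. (LINT x:P|lborel. f x)\<^sup>2)) + ennreal \<epsilon> * (\<Sum>P\<in>\<P>. \<integral>\<^sup>+x. ennreal (gradsq f x) * indicator P x \<partial>lborel)"
      using c0 by (simp add: sum.distrib sum_distrib_left)
    also have "(\<Sum>P\<in>\<P>. \<integral>\<^sup>+x. ennreal (gradsq f x) * indicator P x \<partial>lborel) = (\<integral>\<^sup>+x. (\<Sum>P\<in>\<P>. ennreal (gradsq f x) * indicator P x) \<partial>lborel)"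
      using Pp(1) by (intro nn_integral_sum[symmetric] borel_measurable_times_ennreal borel_measurable_indicator) auto
    also have "\<dots> \<le> (\<integral>\<^sup>+x. ennreal (gradsq f x) * indicator U x \<partial>lborel)"
    proof (rule nn_integral_mono)
      fix x
      show "(\<Sum>P\<in>\<P>. ennreal (gradsq f x) * indicator P x) \<le> ennreal (gradsq f x) * indicator U x"
      proof (cases "\<exists>P\<in>\<P>. x \<in> P")
        case True
        then obtain P where p: "P \<in> \<P>" "x \<in> P" by blast
        have "x \<notin> Q" if "Q \<in> \<P> - {P}" for Q using disjointD[OF P(6) p(1), of Q] p(2) that by blast
        then have "(\<Sum>Q\<in>\<P> - {P}. ennreal (gradsq f x) * indicator Q x) = 0" by (intro sum.neutral) auto
        then have "(\<Sum>P\<in>\<P>. ennreal (gradsq f x) * indicator P x) = ennreal (gradsq f x)"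
          using sum.remove[OF P(1) p(1), of "\<lambda>P. ennreal (gradsq f x) * indicator P x"] p by simp
        then show ?thesis using P(4)[OF p(1)] p by auto
      next
        case False
        then have "(\<Sum>P\<in>\<P>. ennreal (gradsq f x) * indicator P x) = 0" by (intro sum.neutral) auto
        then show ?thesis by simp
      qed
    qed
    finally show "(\<integral>\<^sup>+x. ennreal ((f x)\<^sup>2) * indicator K x \<partial>lborel)
       \<le> ennreal (c * (\<Sum>P\<in>\<P>. (LINT x:P|lborel. f x)\<^sup>2)) + ennreal \<epsilon> * (\<integral>\<^sup>+x. ennreal (gradsq f x) * indicator U x \<partial>lborel)"
      by (simp add: add_left_mono mult_left_mono)
  qed
qed

section \<open>The cone condition for piecewise C2 curves without cusps\<close>

text \<open>The mean value theorem used twice: for the component along \<open>v\<close>, which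
  bounds the advance from below, and in norm form, which bounds the chord from above.\<close>

lemma curve_piece_bounds:
  fixes c :: "real \<Rightarrow> 'a::euclidean_space"
  assumes c: "continuous_on {a..b} c" and D: "\<And>t. t \<in> {a<..<b} \<Longrightarrow> (c has_vector_derivative D t) (at t)"
    and bd: "\<And>t. t \<in> {a<..<b} \<Longrightarrow> \<mu> \<le> D t \<bullet> v \<and> norm (D t) \<le> M"
    and st: "a \<le> s" "s \<le> t" "t \<le> b"
  shows "\<mu> * (t - s) \<le> (c t - c s) \<bullet> v" "norm (c t - c s) \<le> M * (t - s)"
proof -
  have "\<mu> * (t - s) \<le> (c t - c s) \<bullet> v \<and> norm (c t - c s) \<le> M * (t - s)"
  proof (cases "s = t")
    case False
    then have lt: "s < t" using st by simp
    have cs: "continuous_on {s..t} c" by (rule continuous_on_subset[OF c]) (use st in auto)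
    have der: "(c has_derivative (\<lambda>h. h *\<^sub>R D x)) (at x)" if "x \<in> {s<..<t}" for x
      using D[of x] that st by (simp add: has_vector_derivative_def)
    have der2: "((\<lambda>x. c x \<bullet> v) has_derivative (\<lambda>h. (h *\<^sub>R D x) \<bullet> v)) (at x)" if "s < x" "x < t" for x
      using has_derivative_inner_left[OF der] that by simp
    obtain x where x: "s < x" "x < t" "c t \<bullet> v - c s \<bullet> v = ((t - s) *\<^sub>R D x) \<bullet> v"
      using mvt[OF lt continuous_on_inner[OF cs continuous_on_const, of v] der2] by blast
    have "\<mu> * (t - s) \<le> (D x \<bullet> v) * (t - s)"
      using bd[of x] x(1,2) st lt by (intro mult_right_mono) auto
    then have 1: "\<mu> * (t - s) \<le> (c t - c s) \<bullet> v" using x(3) by (simp add: inner_diff_left mult.commute)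
    obtain y where y: "y \<in> {s<..<t}" "norm (c t - c s) \<le> norm ((t - s) *\<^sub>R D y)"
      using mvt_general[OF lt cs der] by auto
    have "norm (D y) * (t - s) \<le> M * (t - s)"
      using bd[of y] y(1) st lt by (intro mult_right_mono) auto
    moreover have "norm ((t - s) *\<^sub>R D y) = norm (D y) * (t - s)" using lt by simp
    ultimately have "norm (c t - c s) \<le> M * (t - s)" using y(2) by linarith
    then show ?thesis using 1 by simp
  qed simp
  then show "\<mu> * (t - s) \<le> (c t - c s) \<bullet> v" "norm (c t - c s) \<le> M * (t - s)" by auto
qed

lemma one_sided_nbhd:
  fixes D :: "real \<Rightarrow> 'a::euclidean_space"
  assumes D: "continuous_on {a..b} D" and e: "e \<in> {a..b}" "D e \<bullet> v > 0"
  obtains \<delta> \<mu> M where "\<delta> > 0" "\<mu> > 0" "\<And>t. t \<in> {a..b} \<Longrightarrow> \<bar>t - e\<bar> < \<delta> \<Longrightarrow> \<mu> \<le> D t \<bullet> v \<and> norm (D t) \<le> M"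
proof -
  define \<mu> where "\<mu> = (D e \<bullet> v) / 2"
  have m: "\<mu> > 0" using e by (simp add: \<mu>_def)
  have "continuous_on {a..b} (\<lambda>t. D t \<bullet> v)" by (intro continuous_intros D)
  then obtain \<delta> where d: "\<delta> > 0" "\<And>t. t \<in> {a..b} \<Longrightarrow> dist t e < \<delta> \<Longrightarrow> dist (D t \<bullet> v) (D e \<bullet> v) < \<mu>"
    using e(1) m unfolding continuous_on_iff by metis
  have "bounded (D ` {a..b})" by (intro compact_imp_bounded compact_continuous_image D) auto
  then obtain M where "\<forall>y\<in>D ` {a..b}. norm y \<le> M" unfolding bounded_iff by blast
  then have M: "norm (D t) \<le> M" if "t \<in> {a..b}" for t using that by blast
  show thesis
  proof (rule that[OF d(1) m])
    fix t assume t: "t \<in> {a..b}" "\<bar>t - e\<bar> < \<delta>"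
    then have "\<bar>D t \<bullet> v - D e \<bullet> v\<bar> < \<mu>" using d(2)[of t] by (simp add: dist_real_def)
    then have "\<mu> \<le> D t \<bullet> v" unfolding \<mu>_def by linarith
    then show "\<mu> \<le> D t \<bullet> v \<and> norm (D t) \<le> M" using M t by blast
  qed
qed

text \<open>At a corner the sum of the two unit tangents is a direction along which the curve advances on
  both sides; it is nonzero because the tangents are not opposite.\<close>

lemma bisector:
  fixes x y :: "'a::euclidean_space"
  assumes "x \<noteq> 0" "y \<noteq> 0" and no: "\<not> (\<exists>r>0. x = - r *\<^sub>R y)"
  obtains v where "norm v = 1" "x \<bullet> v > 0" "y \<bullet> v > 0"
proof -
  define a where "a = x /\<^sub>R norm x"
  define b where "b = y /\<^sub>R norm y"
  have ab: "a \<bullet> a = 1" "b \<bullet> b = 1" "x = norm x *\<^sub>R a" "y = norm y *\<^sub>R b"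
    using assms by (simp_all add: a_def b_def dot_square_norm power2_eq_square)
  have ne: "a + b \<noteq> 0"
  proof
    assume "a + b = 0"
    then have "a = - b" by (simp add: eq_neg_iff_add_eq_0)
    then have "x = - (norm x / norm y) *\<^sub>R y" using ab(3) assms by (simp add: b_def divide_inverse)
    moreover have "norm x / norm y > 0" using assms by simp
    ultimately show False using no by blast
  qed
  have "(a + b) \<bullet> (a + b) > 0" using ne by simp
  then have p: "1 + a \<bullet> b > 0" using ab(1,2) by (simp add: inner_add_left inner_add_right inner_commute)
  let ?v = "(a + b) /\<^sub>R norm (a + b)"
  have xa: "x \<bullet> (a + b) = norm x * (1 + a \<bullet> b)"
    using ab by (metis inner_add_right inner_scaleR_left)
  have yb: "y \<bullet> (a + b) = norm y * (1 + a \<bullet> b)"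
    using ab by (metis add.commute inner_add_right inner_commute inner_scaleR_left)
  show thesis
  proof
    show "norm ?v = 1" using ne by simp
    show "x \<bullet> ?v > 0" using xa p assms ne by simp
    show "y \<bullet> ?v > 0" using yb p assms ne by simp
  qed
qed

text \<open>In the direction of the bisector both branches advance with speed at least
  \<open>m\<close>, while their speed is at most \<open>M\<close>. A chord across the corner is the
  sum of a chord on each side, and both components along \<open>v\<close> have the same sign, so
  nothing cancels and \<open>M / m\<close> is a cone constant.\<close>

lemma two_sided_cone:
  fixes c :: "real \<Rightarrow> 'a::euclidean_space"
  assumes c: "continuous_on UNIV c" and ab: "a < t0" "t0 < b"
    and Dl: "continuous_on {a..t0} Dl" "\<And>t. t \<in> {a<..<t0} \<Longrightarrow> (c has_vector_derivative Dl t) (at t)"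
    and Dr: "continuous_on {t0..b} Dr" "\<And>t. t \<in> {t0<..<b} \<Longrightarrow> (c has_vector_derivative Dr t) (at t)"
    and nz: "Dl t0 \<noteq> 0" "Dr t0 \<noteq> 0" "\<not> (\<exists>r>0. Dl t0 = - r *\<^sub>R Dr t0)"
  obtains v L \<delta> where "norm v = 1" "L \<ge> 0" "\<delta> > 0"
    "\<And>s t. \<bar>s - t0\<bar> < \<delta> \<Longrightarrow> \<bar>t - t0\<bar> < \<delta> \<Longrightarrow> norm (c t - c s) \<le> L * \<bar>(c t - c s) \<bullet> v\<bar>"
proof -
  obtain v where v: "norm v = 1" "Dl t0 \<bullet> v > 0" "Dr t0 \<bullet> v > 0" using bisector[OF nz] .
  obtain d1 m1 M1 where 1: "d1 > 0" "m1 > 0" "\<And>t. t \<in> {a..t0} \<Longrightarrow> \<bar>t - t0\<bar> < d1 \<Longrightarrow> m1 \<le> Dl t \<bullet> v \<and> norm (Dl t) \<le> M1"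
    using one_sided_nbhd[OF Dl(1) _ v(2)] ab by auto
  obtain d2 m2 M2 where 2: "d2 > 0" "m2 > 0" "\<And>t. t \<in> {t0..b} \<Longrightarrow> \<bar>t - t0\<bar> < d2 \<Longrightarrow> m2 \<le> Dr t \<bullet> v \<and> norm (Dr t) \<le> M2"
    using one_sided_nbhd[OF Dr(1) _ v(3)] ab by auto
  define \<delta> where "\<delta> = Min {d1, d2, t0 - a, b - t0}"
  have d: "\<delta> > 0" "\<delta> \<le> d1" "\<delta> \<le> d2" "\<delta> \<le> t0 - a" "\<delta> \<le> b - t0" using 1 2 ab by (auto simp: \<delta>_def)
  define m where "m = min m1 m2"
  define M where "M = max (max M1 M2) 0"
  have m: "m > 0" "M \<ge> 0" using 1 2 by (auto simp: m_def M_def)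
  have left: "m * (t - s) \<le> (c t - c s) \<bullet> v" "norm (c t - c s) \<le> M * (t - s)"
    if "t0 - \<delta> \<le> s" "s \<le> t" "t \<le> t0" for s t
  proof -
    have "continuous_on {t0 - \<delta>..t0} c" by (rule continuous_on_subset[OF c]) simp
    moreover have "(c has_vector_derivative Dl t) (at t)" if "t \<in> {t0 - \<delta><..<t0}" for t using that d by (intro Dl(2)) auto
    moreover have "m \<le> Dl t \<bullet> v \<and> norm (Dl t) \<le> M" if "t \<in> {t0 - \<delta><..<t0}" for t
      using 1(3)[of t] that d by (auto simp: m_def M_def)
    ultimately show "m * (t - s) \<le> (c t - c s) \<bullet> v" "norm (c t - c s) \<le> M * (t - s)"
      using curve_piece_bounds[of "t0 - \<delta>" t0 c Dl m v M s t] that by auto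
  qed
  have right: "m * (t - s) \<le> (c t - c s) \<bullet> v" "norm (c t - c s) \<le> M * (t - s)"
    if "t0 \<le> s" "s \<le> t" "t \<le> t0 + \<delta>" for s t
  proof -
    have "continuous_on {t0..t0 + \<delta>} c" by (rule continuous_on_subset[OF c]) simp
    moreover have "(c has_vector_derivative Dr t) (at t)" if "t \<in> {t0<..<t0 + \<delta>}" for t using that d by (intro Dr(2)) auto
    moreover have "m \<le> Dr t \<bullet> v \<and> norm (Dr t) \<le> M" if "t \<in> {t0<..<t0 + \<delta>}" for t
      using 2(3)[of t] that d by (auto simp: m_def M_def)
    ultimately show "m * (t - s) \<le> (c t - c s) \<bullet> v" "norm (c t - c s) \<le> M * (t - s)"
      using curve_piece_bounds[of t0 "t0 + \<delta>" c Dr m v M s t] that by auto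
  qed
  have ord: "norm (c t - c s) \<le> (M / m) * \<bar>(c t - c s) \<bullet> v\<bar>" if "\<bar>s - t0\<bar> < \<delta>" "\<bar>t - t0\<bar> < \<delta>" "s \<le> t" for s t
  proof -
    have both: "m * (t - s) \<le> (c t - c s) \<bullet> v \<and> norm (c t - c s) \<le> M * (t - s)"
    proof -
      consider "t \<le> t0" | "t0 \<le> s" | "s \<le> t0" "t0 \<le> t" by linarith
      then show ?thesis
      proof cases
        case 1 then show ?thesis using left[of s t] that by auto
      next
        case 2 then show ?thesis using right[of s t] that by auto
      next
        case 3
        have eq: "c t - c s = (c t - c t0) + (c t0 - c s)" by simp
        have "m * (t - t0) \<le> (c t - c t0) \<bullet> v" "norm (c t - c t0) \<le> M * (t - t0)" using right[of t0 t] that 3 by auto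
        moreover have "m * (t0 - s) \<le> (c t0 - c s) \<bullet> v" "norm (c t0 - c s) \<le> M * (t0 - s)" using left[of s t0] that 3 by auto
        moreover have "(c t - c s) \<bullet> v = (c t - c t0) \<bullet> v + (c t0 - c s) \<bullet> v" by (simp add: inner_diff_left)
        moreover have "norm (c t - c s) \<le> norm (c t - c t0) + norm (c t0 - c s)" unfolding eq by (rule norm_triangle_ineq)
        ultimately show ?thesis by (simp add: algebra_simps)
      qed
    qed
    then have "t - s \<le> (c t - c s) \<bullet> v / m" using m by (simp add: pos_le_divide_eq mult.commute)
    then have "M * (t - s) \<le> M * ((c t - c s) \<bullet> v / m)" using m by (intro mult_left_mono) auto
    also have "\<dots> \<le> M * (\<bar>(c t - c s) \<bullet> v\<bar> / m)" using m by (intro mult_left_mono divide_right_mono) auto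
    finally show ?thesis using both by simp
  qed
  have "norm (c t - c s) \<le> (M / m) * \<bar>(c t - c s) \<bullet> v\<bar>" if "\<bar>s - t0\<bar> < \<delta>" "\<bar>t - t0\<bar> < \<delta>" for s t
  proof (cases "s \<le> t")
    case True
    then show ?thesis using ord that by blast
  next
    case False
    then have "norm (c s - c t) \<le> (M / m) * \<bar>(c s - c t) \<bullet> v\<bar>" using ord[of t s] that by simp
    then show ?thesis by (simp add: norm_minus_commute inner_diff_left abs_minus_commute)
  qed
  then show thesis using that[OF v(1) _ d(1), of "M / m"] m by simp
qed

lemma partition_index:
  fixes ts :: "nat \<Rightarrow> real"
  assumes "ts 0 \<le> t" "t < ts m"
  shows "\<exists>i<m. ts i \<le> t \<and> t < ts (Suc i)"
  using assms
proof (induction m)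
  case (Suc m)
  then show ?case
    by (cases "t < ts m") (auto simp: less_Suc_eq)
qed simp

text \<open>Three positions of \<open>t0\<close>: inside a piece, where the left and right tangents
  coincide and are trivially not opposite; at an inner corner; and at the base point, where the last
  piece meets the first one.\<close>

lemma closed_curve_cone:
  assumes c: "pw_C2_closed_curve c" and t0: "0 \<le> t0" "t0 < 1"
  obtains v L \<delta> where "norm v = 1" "L \<ge> 0" "\<delta> > 0"
    "\<And>s t. \<bar>s - t0\<bar> < \<delta> \<Longrightarrow> \<bar>t - t0\<bar> < \<delta> \<Longrightarrow> norm (c t - c s) \<le> L * \<bar>(c t - c s) \<bullet> v\<bar>"
proof -
  have cc: "continuous_on UNIV c" and per: "\<And>t. c (t + 1) = c t"
    using c by (auto simp: pw_C2_closed_curve_def)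
  obtain m :: nat and ts Ds where m: "m \<ge> 1" "ts 0 = 0" "ts m = 1"
    and pc: "\<And>i. i < m \<Longrightarrow> C2_piece c (ts i) (ts (Suc i)) (Ds i)"
    and corner: "\<And>i. i \<in> {1..<m} \<Longrightarrow> \<not> (\<exists>r>0. Ds (i - 1) (ts i) = - r *\<^sub>R Ds i (ts i))"
    and corner0: "\<not> (\<exists>r>0. Ds (m - 1) 1 = - r *\<^sub>R Ds 0 0)"
    using c unfolding pw_C2_closed_curve_def by blast
  have lt: "ts i < ts (Suc i)" and Dc: "continuous_on {ts i..ts (Suc i)} (Ds i)"
    and Dd: "\<And>t. t \<in> {ts i<..<ts (Suc i)} \<Longrightarrow> (c has_vector_derivative Ds i t) (at t)"
    and Dn: "\<And>t. t \<in> {ts i..ts (Suc i)} \<Longrightarrow> Ds i t \<noteq> 0" if "i < m" for i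
    using pc[OF that] unfolding C2_piece_def by blast+
  obtain i where i: "i < m" "ts i \<le> t0" "t0 < ts (Suc i)" using partition_index[of ts t0 m] m t0 by auto
  have r1: "continuous_on {t0..ts (Suc i)} (Ds i)" by (rule continuous_on_subset[OF Dc[OF i(1)]]) (use i in auto)
  have r2: "(c has_vector_derivative Ds i t) (at t)" if "t \<in> {t0<..<ts (Suc i)}" for t
    by (rule Dd[OF i(1)]) (use i that in auto)
  have r3: "Ds i t0 \<noteq> 0" by (rule Dn[OF i(1)]) (use i in auto)
  consider "ts i < t0" | "ts i = t0" "i \<ge> 1" | "ts i = t0" "i = 0" using i by linarith
  then show thesis
  proof cases
    case 1
    have l1: "continuous_on {ts i..t0} (Ds i)" by (rule continuous_on_subset[OF Dc[OF i(1)]]) (use i in auto)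
    have l2: "(c has_vector_derivative Ds i t) (at t)" if "t \<in> {ts i<..<t0}" for t
      by (rule Dd[OF i(1)]) (use i that in auto)
    have no: "\<not> (\<exists>r>0. Ds i t0 = - r *\<^sub>R Ds i t0)"
    proof
      assume "\<exists>r>0. Ds i t0 = - r *\<^sub>R Ds i t0"
      then obtain r where r: "r > 0" "Ds i t0 = - r *\<^sub>R Ds i t0" by blast
      then have "Ds i t0 + r *\<^sub>R Ds i t0 = 0" by (metis eq_neg_iff_add_eq_0 scaleR_minus_left)
      then have "(1 + r) *\<^sub>R Ds i t0 = 0" by (simp add: scaleR_add_left)
      then show False using r(1) r3 by simp
    qed
    show thesis by (rule two_sided_cone[OF cc 1 i(3) l1 l2 r1 r2 r3 r3 no]) (assumption | rule that | blast)+
  next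
    case 2
    then obtain j where j: "i = Suc j" by (cases i) auto
    have jm: "j < m" using i j by simp
    have l1: "continuous_on {ts j..t0} (Ds j)" using Dc[OF jm] 2 j by simp
    have l2: "(c has_vector_derivative Ds j t) (at t)" if "t \<in> {ts j<..<t0}" for t
      by (rule Dd[OF jm]) (use 2 j that in auto)
    have l3: "Ds j t0 \<noteq> 0" by (rule Dn[OF jm]) (use 2 j lt[OF jm] in auto)
    have l4: "ts j < t0" using lt[OF jm] 2 j by simp
    have no: "\<not> (\<exists>r>0. Ds j t0 = - r *\<^sub>R Ds i t0)" using corner[of i] 2 j i by simp
    show thesis by (rule two_sided_cone[OF cc l4 i(3) l1 l2 r1 r2 l3 r3 no]) (assumption | rule that | blast)+
  next
    case 3
    then have t00: "t0 = 0" using m by simp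
    define j where "j = m - 1"
    have jm: "j < m" "Suc j = m" using m by (auto simp: j_def)
    \<comment> \<open>The tangent of the last piece, moved back by one period so that it ends at
      parameter 0.\<close>
    let ?D = "\<lambda>t. Ds j (t + 1)"
    have l1: "continuous_on {ts j - 1..t0} ?D"
      by (rule continuous_on_compose2[OF Dc[OF jm(1)]]) (use jm m t00 in \<open>auto intro!: continuous_intros\<close>)
    have l2: "(c has_vector_derivative ?D t) (at t)" if t: "t \<in> {ts j - 1<..<t0}" for t
    proof -
      have "(c has_vector_derivative ?D t) (at (t + 1))"
        by (rule Dd[OF jm(1)]) (use t t00 jm m in auto)
      moreover have "((\<lambda>t. t + 1) has_vector_derivative 1) (at t)"
        by (auto intro!: derivative_eq_intros)
      ultimately have "((c \<circ> (\<lambda>t. t + 1)) has_vector_derivative 1 *\<^sub>R ?D t) (at t)"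
        by (intro vector_diff_chain_at) auto
      then show ?thesis using per by (simp add: o_def)
    qed
    have l3: "?D t0 \<noteq> 0" by (rule Dn[OF jm(1)]) (use t00 jm m lt[OF jm(1)] in auto)
    have l4: "ts j - 1 < t0" using lt[OF jm(1)] jm m t00 by simp
    have no: "\<not> (\<exists>r>0. ?D t0 = - r *\<^sub>R Ds i t0)" using corner0 3 t00 by (simp add: j_def)
    show thesis by (rule two_sided_cone[OF cc l4 i(3) l1 l2 r1 r2 l3 r3 no]) (assumption | rule that | blast)+
  qed
qed

text \<open>Near \<open>p\<close> the boundary consists only of the arc around \<open>t0\<close>:
  injectivity keeps the rest of the same closed curve away from \<open>p\<close>, disjointness keeps
  the other curves away, and both remainders are compact. In the plane \<open>w\<close> is
  \<open>v\<close> turned by a right angle.\<close>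

lemma cross_section_cone:
  assumes cs: "cross_section \<omega> \<gamma>D" and p: "p \<in> frontier \<omega>"
  shows "\<exists>r>0. \<exists>v w. \<exists>L\<ge>0. norm v = 1 \<and> norm w = 1 \<and> w \<bullet> v = 0 \<and>
       (\<forall>q\<in>frontier \<omega> \<inter> ball p r. \<forall>q'\<in>frontier \<omega> \<inter> ball p r. norm (q - q') \<le> L * \<bar>(q - q') \<bullet> v\<bar>)"
proof -
  obtain cs where cs0: "\<forall>c\<in>set cs. pw_C2_closed_curve c"
    "\<forall>i<length cs. \<forall>j<length cs. i \<noteq> j \<longrightarrow> (cs!i) ` {0..1} \<inter> (cs!j) ` {0..1} = {}"
    "frontier \<omega> = (\<Union>c\<in>set cs. c ` {0..1})"
    using cs unfolding cross_section_def by (elim conjE exE) (rule that, assumption+)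
  have cs: "c \<in> set cs \<Longrightarrow> pw_C2_closed_curve c"
    "i < length cs \<Longrightarrow> j < length cs \<Longrightarrow> i \<noteq> j \<Longrightarrow> (cs!i) ` {0..1} \<inter> (cs!j) ` {0..1} = {}"
    "frontier \<omega> = (\<Union>c\<in>set cs. c ` {0..1})" for c i j
    using cs0 by simp_all
  obtain k t where k: "k < length cs" "t \<in> {0..1}" "p = (cs!k) t" using p cs(3) by (auto simp: in_set_conv_nth)
  define c where "c = cs!k"
  have c: "pw_C2_closed_curve c" using cs(1) k by (simp add: c_def)
  have cc: "continuous_on UNIV c" and per: "\<And>t. c (t + 1) = c t" and inj: "inj_on c {0..<1}"
    using c by (auto simp: pw_C2_closed_curve_def)
  obtain t0 where t0: "0 \<le> t0" "t0 < 1" "p = c t0"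
  proof (cases "t = 1")
    case True
    then have "p = c 0" using k per[of 0] by (simp add: c_def)
    then show thesis using that[of 0] by simp
  next
    case False
    then show thesis using that[of t] k by (simp add: c_def)
  qed
  obtain v L \<delta>' where vL: "norm v = 1" "L \<ge> 0" "\<delta>' > 0"
    "\<And>s t. \<bar>s - t0\<bar> < \<delta>' \<Longrightarrow> \<bar>t - t0\<bar> < \<delta>' \<Longrightarrow> norm (c t - c s) \<le> L * \<bar>(c t - c s) \<bullet> v\<bar>"
    using closed_curve_cone[OF c t0(1,2)] by blast
  \<comment> \<open>Parameters up to \<open>t0 - \<delta>\<close> will be moved up by one period;
    \<open>\<delta> \<le> 1 - t0\<close> places them at \<open>t0 + \<delta>\<close> or later, in
    the complementary arc \<open>A\<close>.\<close>
  define \<delta> where "\<delta> = Min {\<delta>', 1/3, 1 - t0}"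
  have d: "\<delta> > 0" "\<delta> \<le> \<delta>'" "\<delta> \<le> 1/3" "\<delta> \<le> 1 - t0"
  proof -
    have f: "finite {\<delta>', 1/3, 1 - t0}" by simp
    show "\<delta> > 0" unfolding \<delta>_def using vL(3) t0 by simp
    show "\<delta> \<le> \<delta>'" "\<delta> \<le> 1/3" "\<delta> \<le> 1 - t0" unfolding \<delta>_def by (rule Min_le[OF f], simp)+
  qed
  define A where "A = c ` {t0 + \<delta>..t0 + 1 - \<delta>}"
  have pA: "p \<notin> A"
  proof
    assume "p \<in> A"
    then obtain s where s: "t0 + \<delta> \<le> s" "s \<le> t0 + 1 - \<delta>" "c s = c t0" using t0(3) by (auto simp: A_def)
    show False
    proof (cases "s < 1")
      case True
      then have "s = t0" using inj_onD[OF inj s(3)] s t0 d by auto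
      then show False using s d by simp
    next
      case False
      have "c (s - 1) = c t0" using per[of "s - 1"] s(3) by simp
      then have "s - 1 = t0" using inj_onD[OF inj, of "s - 1" t0] s t0 d False by auto
      then show False using s d by simp
    qed
  qed
  have cover: "c ` {0..1} \<subseteq> c ` {t0 - \<delta><..<t0 + \<delta>} \<union> A"
  proof
    fix q assume "q \<in> c ` {0..1}"
    then obtain t where t: "0 \<le> t" "t \<le> 1" "q = c t" by auto
    consider "t0 - \<delta> < t" "t < t0 + \<delta>" | "t0 + \<delta> \<le> t" "t \<le> t0 + 1 - \<delta>" | "t0 + 1 - \<delta> < t" | "t \<le> t0 - \<delta>" by linarith
    then show "q \<in> c ` {t0 - \<delta><..<t0 + \<delta>} \<union> A"
    proof cases
      case 1 then show ?thesis using t by auto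
    next
      case 2 then show ?thesis using t by (auto simp: A_def)
    next
      case 3
      then have "q = c (t - 1)" "t - 1 \<in> {t0 - \<delta><..<t0 + \<delta>}" using t per[of "t - 1"] t0 d by auto
      then show ?thesis by blast
    next
      case 4
      then have "q = c (t + 1)" "t + 1 \<in> {t0 + \<delta>..t0 + 1 - \<delta>}" using t per[of t] t0 d by auto
      then show ?thesis unfolding A_def by blast
    qed
  qed
  define Oth where "Oth = (\<Union>j\<in>{..<length cs} - {k}. (cs!j) ` {0..1})"
  have "compact ((cs!j) ` {0..1})" if "j < length cs" for j
    using cs(1)[of "cs!j"] that
    by (intro compact_continuous_image) (auto simp: pw_C2_closed_curve_def intro: continuous_on_subset)
  then have "compact Oth" unfolding Oth_def by (intro compact_UN) auto
  moreover have "compact A" unfolding A_def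
    by (intro compact_continuous_image) (auto intro: continuous_on_subset[OF cc])
  ultimately have "closed (A \<union> Oth)" by (intro compact_imp_closed compact_Un)
  moreover have "p \<notin> Oth"
  proof
    assume "p \<in> Oth"
    then obtain j where j: "j < length cs" "j \<noteq> k" "p \<in> (cs!j) ` {0..1}" by (auto simp: Oth_def)
    have "p \<in> (cs!k) ` {0..1}" using k by blast
    then show False using cs(2)[OF j(1) k(1) j(2)] j(3) by blast
  qed
  ultimately obtain r where r: "r > 0" "ball p r \<subseteq> - (A \<union> Oth)"
    using pA by (metis ComplI UnE open_Compl open_contains_ball)
  have fr: "\<exists>s. \<bar>s - t0\<bar> < \<delta>' \<and> q = c s" if q: "q \<in> frontier \<omega> \<inter> ball p r" for q
  proof -
    obtain j where j: "j < length cs" "q \<in> (cs!j) ` {0..1}" using q cs(3) by (auto simp: in_set_conv_nth)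
    have nq: "q \<notin> A" "q \<notin> Oth" using q r(2) by blast+
    have "j = k"
    proof (rule ccontr)
      assume "j \<noteq> k"
      then have "q \<in> Oth" using j unfolding Oth_def by blast
      then show False using nq by blast
    qed
    then have "q \<in> c ` {0..1}" using j by (simp add: c_def)
    then have "q \<in> c ` {t0 - \<delta><..<t0 + \<delta>}" using cover nq by blast
    then obtain s where "t0 - \<delta> < s" "s < t0 + \<delta>" "q = c s" by auto
    then show ?thesis using d by (intro exI[of _ s]) auto
  qed
  define w where "w = (- snd v, fst v)"
  have w: "norm w = 1" "w \<bullet> v = 0" using vL(1) by (auto simp: w_def norm_prod_def inner_prod_def add.commute)
  have "norm (q - q') \<le> L * \<bar>(q - q') \<bullet> v\<bar>" if "q \<in> frontier \<omega> \<inter> ball p r" "q' \<in> frontier \<omega> \<inter> ball p r" for q q'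
    using fr[OF that(1)] fr[OF that(2)] vL(4) by blast
  then show ?thesis using r(1) vL(1,2) w by blast
qed

section \<open>The lower bound given by a positive eigenfunction\<close>

lemma square_add_le: "(a + b)\<^sup>2 \<le> 2 * a\<^sup>2 + 2 * b\<^sup>2" for a b :: real
  using sum_squares_ge_zero[of "a - b" 0] by (simp add: power2_eq_square algebra_simps)

lemma L2_abs: "L2 M f \<Longrightarrow> L2 M (\<lambda>x. \<bar>f x\<bar>)"
  by (rule L2_dom[where K=1 and f=f]) (auto intro: borel_measurable_abs L2_measurable)

definition reg_abs :: "real \<Rightarrow> real \<Rightarrow> real" where
  "reg_abs \<epsilon> t = sqrt (t\<^sup>2 + \<epsilon>\<^sup>2)"

text \<open>This equals \<open>1 / (reg_abs \<epsilon> t + t)\<close>, a C1 substitute for \<open>1 / (2 * t)\<close> on the positive half-line that is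
  defined on the whole line.\<close>

definition reg_inverse :: "real \<Rightarrow> real \<Rightarrow> real" where
  "reg_inverse \<epsilon> t = (reg_abs \<epsilon> t - t) / \<epsilon>\<^sup>2"

lemma reg_abs_norm: "reg_abs \<epsilon> t = norm (t, \<epsilon>)"
  by (simp add: reg_abs_def norm_Pair)

lemma reg_abs_lipschitz: "\<bar>reg_abs \<epsilon> t - reg_abs \<epsilon> u\<bar> \<le> \<bar>t - u\<bar>"
proof -
  have "\<bar>norm (t, \<epsilon>) - norm (u, \<epsilon>)\<bar> \<le> norm ((t, \<epsilon>) - (u, \<epsilon>))" by (rule norm_triangle_ineq3)
  then show ?thesis by (simp add: reg_abs_norm norm_Pair)
qed

lemma reg_abs_ge: "\<bar>t\<bar> \<le> reg_abs \<epsilon> t" "0 < \<epsilon> \<Longrightarrow> \<epsilon> \<le> reg_abs \<epsilon> t"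
  unfolding reg_abs_def by (auto intro!: real_le_rsqrt)

lemma reg_abs_pos: "0 < \<epsilon> \<Longrightarrow> 0 < reg_abs \<epsilon> t"
  using reg_abs_ge(2)[of \<epsilon> t] by linarith

lemma reg_abs_le: "0 < \<epsilon> \<Longrightarrow> reg_abs \<epsilon> t \<le> \<bar>t\<bar> + \<epsilon>"
  unfolding reg_abs_norm using norm_Pair_le[of t \<epsilon>] by simp

lemma reg_inverse_nonneg: "0 \<le> reg_inverse \<epsilon> t"
  using reg_abs_ge(1)[of t \<epsilon>] by (simp add: reg_inverse_def)

text \<open>The approximating test functions may change sign, so the substitute for the inverse must
  be Lipschitz on the whole line. The constant blows up as \<epsilon> tends to 0, which is harmless
  because that limit is taken last.\<close>

lemma reg_inverse_lipschitz: "\<bar>reg_inverse \<epsilon> t - reg_inverse \<epsilon> u\<bar> \<le> (2 / \<epsilon>\<^sup>2) * \<bar>t - u\<bar>"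
proof -
  have "reg_inverse \<epsilon> t - reg_inverse \<epsilon> u = ((reg_abs \<epsilon> t - reg_abs \<epsilon> u) - (t - u)) / \<epsilon>\<^sup>2" by (simp add: reg_inverse_def diff_divide_distrib)
  then have "\<bar>reg_inverse \<epsilon> t - reg_inverse \<epsilon> u\<bar> = \<bar>(reg_abs \<epsilon> t - reg_abs \<epsilon> u) - (t - u)\<bar> / \<epsilon>\<^sup>2" by simp
  also have "\<dots> \<le> (2 * \<bar>t - u\<bar>) / \<epsilon>\<^sup>2"
  proof (rule divide_right_mono)
    show "\<bar>(reg_abs \<epsilon> t - reg_abs \<epsilon> u) - (t - u)\<bar> \<le> 2 * \<bar>t - u\<bar>" using abs_triangle_ineq4[of "reg_abs \<epsilon> t - reg_abs \<epsilon> u" "t - u"] reg_abs_lipschitz[of \<epsilon> t u] by simp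
  qed simp
  finally show ?thesis by simp
qed

lemma reg_inverse_eq: "0 < \<epsilon> \<Longrightarrow> reg_inverse \<epsilon> t * (reg_abs \<epsilon> t + t) = 1"
proof -
  assume e: "0 < \<epsilon>"
  have "(reg_abs \<epsilon> t - t) * (reg_abs \<epsilon> t + t) = (reg_abs \<epsilon> t)\<^sup>2 - t\<^sup>2" by (simp add: power2_eq_square algebra_simps)
  also have "\<dots> = \<epsilon>\<^sup>2" by (simp add: reg_abs_def)
  finally show ?thesis using e by (simp add: reg_inverse_def)
qed

lemma reg_inverse_le: "0 < \<epsilon> \<Longrightarrow> 0 < t \<Longrightarrow> reg_inverse \<epsilon> t \<le> 1 / \<epsilon>"
proof -
  assume e: "0 < \<epsilon>" "0 < t"
  have "reg_inverse \<epsilon> t * \<epsilon> \<le> reg_inverse \<epsilon> t * (reg_abs \<epsilon> t + t)"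
    using reg_abs_ge(2)[OF e(1), of t] e reg_inverse_nonneg by (intro mult_left_mono) auto
  then show ?thesis using reg_inverse_eq[OF e(1), of t] e by (simp add: field_simps)
qed

lemma reg_inverse_rs_bound: "0 < \<epsilon> \<Longrightarrow> reg_inverse \<epsilon> t / reg_abs \<epsilon> t \<le> 2 / \<epsilon>\<^sup>2"
proof -
  assume e: "0 < \<epsilon>"
  have "reg_abs \<epsilon> t - t \<le> 2 * reg_abs \<epsilon> t" using reg_abs_ge(1)[of t \<epsilon>] by linarith
  then have "reg_inverse \<epsilon> t \<le> 2 / \<epsilon>\<^sup>2 * reg_abs \<epsilon> t" unfolding reg_inverse_def using e by (simp add: divide_right_mono)
  then show ?thesis using reg_abs_pos[OF e, of t] by (simp add: pos_divide_le_eq)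
qed

lemma reg_abs_deriv: "0 < \<epsilon> \<Longrightarrow> (reg_abs \<epsilon> has_real_derivative t / reg_abs \<epsilon> t) (at t)"
proof -
  assume e: "0 < \<epsilon>"
  have "t\<^sup>2 + \<epsilon>\<^sup>2 > 0" using e by (simp add: add_nonneg_pos)
  then show ?thesis unfolding reg_abs_def[abs_def]
    by (auto intro!: derivative_eq_intros simp: divide_simps)
qed

lemma reg_inverse_deriv: "0 < \<epsilon> \<Longrightarrow> (reg_inverse \<epsilon> has_real_derivative - (reg_inverse \<epsilon> t / reg_abs \<epsilon> t)) (at t)"
proof -
  assume e: "0 < \<epsilon>"
  have "((\<lambda>t. (reg_abs \<epsilon> t - t) / \<epsilon>\<^sup>2) has_real_derivative (t / reg_abs \<epsilon> t - 1) / \<epsilon>\<^sup>2) (at t)"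
    by (rule DERIV_cdivide[OF DERIV_diff[OF reg_abs_deriv[OF e] DERIV_ident]])
  moreover have "(t / reg_abs \<epsilon> t - 1) / \<epsilon>\<^sup>2 = - (reg_inverse \<epsilon> t / reg_abs \<epsilon> t)"
    using reg_abs_pos[OF e, of t] e by (simp add: reg_inverse_def field_simps)
  ultimately show ?thesis by (simp add: reg_inverse_def[abs_def])
qed

lemma reg_abs_cont: "continuous_on S (reg_abs \<epsilon>)"
  unfolding reg_abs_def[abs_def] by (intro continuous_intros)

lemma reg_inverse_cont: "0 < \<epsilon> \<Longrightarrow> continuous_on S (reg_inverse \<epsilon>)"
  unfolding reg_inverse_def[abs_def] by (intro continuous_intros reg_abs_cont) auto

text \<open>A regularized form of Picone's inequality: the two sides differ by the nonnegative term
  \<open>(reg_inverse \<epsilon> t / reg_abs \<epsilon> t)\<close> times the square of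
  \<open>reg_abs \<epsilon> t * a - v * b\<close>. Here \<open>a\<close> and \<open>b\<close> stand
  for a partial derivative of \<open>v\<close> and of the approximant of the eigenfunction.\<close>

lemma ground_state_substitution:
  assumes e: "0 < \<epsilon>"
  shows "b * (2 * v * a * reg_inverse \<epsilon> t + v\<^sup>2 * (- (reg_inverse \<epsilon> t / reg_abs \<epsilon> t) * b)) \<le> a\<^sup>2 * (reg_inverse \<epsilon> t * reg_abs \<epsilon> t)"
proof -
  have "0 \<le> (reg_inverse \<epsilon> t / reg_abs \<epsilon> t) * (reg_abs \<epsilon> t * a - v * b)\<^sup>2"
    using reg_inverse_nonneg[of \<epsilon> t] reg_abs_pos[OF e, of t] by simp
  also have "\<dots> = a\<^sup>2 * (reg_inverse \<epsilon> t * reg_abs \<epsilon> t) - b * (2 * v * a * reg_inverse \<epsilon> t + v\<^sup>2 * (- (reg_inverse \<epsilon> t / reg_abs \<epsilon> t) * b))"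
    using reg_abs_pos[OF e, of t] by (simp add: power2_eq_square field_simps)
  finally show ?thesis by simp
qed

text \<open>Testing the equation for the positive eigenfunction against v^2 / psi gives the lower bound
  without any compactness; here 1 / psi is replaced by the regularization above.\<close>

lemma barta_regularized:
  fixes U :: "'a::euclidean_space set"
  assumes U: "open U" and g: "hasgrad U G \<psi> h" and pos: "\<And>x. x \<in> U \<Longrightarrow> \<psi> x > 0"
    and eq: "\<And>w. C1c UNIV w \<Longrightarrow> supp w \<inter> G = {} \<Longrightarrow>
       (\<Sum>e\<in>Basis. \<integral>x. h e x * dd w e x \<partial>Lb U) = lam * (\<integral>x. \<psi> x * w x \<partial>Lb U)"
    and v: "C1c UNIV v" "supp v \<inter> G = {}" and \<epsilon>: "0 < \<epsilon>"
  shows "lam * (\<integral>x. (v x)\<^sup>2 * (\<psi> x * reg_inverse \<epsilon> (\<psi> x)) \<partial>Lb U)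
     \<le> (\<Sum>e\<in>Basis. \<integral>x. (dd v e x)\<^sup>2 * (reg_inverse \<epsilon> (\<psi> x) * reg_abs \<epsilon> (\<psi> x)) \<partial>Lb U)"
proof -
  have Ub: "U \<in> sets borel" using U by simp
  have sp: "space (Lb U) = U" by (simp add: space_restrict_space)
  obtain \<phi> where p: "\<And>n. C1c UNIV (\<phi> n)" "\<And>n. supp (\<phi> n) \<inter> G = {}" "L2conv (Lb U) \<phi> \<psi>"
    "\<And>e. e \<in> Basis \<Longrightarrow> L2conv (Lb U) (\<lambda>n. dd (\<phi> n) e) (h e)"
    using hasgrad_approx[OF g] by blast
  have pL: "L2 (Lb U) (\<phi> n)" "L2 (Lb U) (dd (\<phi> n) e)" for n e using C1c_L2[OF Ub p(1)] by auto
  have psL: "L2 (Lb U) \<psi>" "e \<in> Basis \<Longrightarrow> L2 (Lb U) (h e)" for e using hasgrad_L2[OF g] by auto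
  have vC1: "C1 v" and vK: "compact (supp v)" using v by (auto simp: C1c_iff)
  obtain Cv where Cv: "Cv \<ge> 0" "\<And>x. \<bar>v x\<bar> \<le> Cv" using C1c_bounded[OF v(1)] by blast
  have "\<exists>C\<ge>0. \<forall>x. \<bar>dd v e x\<bar> \<le> C" for e using C1c_dd_bounded[OF v(1)] by metis
  then obtain Cd where Cd: "\<And>e. Cd e \<ge> 0" "\<And>e x. \<bar>dd v e x\<bar> \<le> Cd e" by metis
  have pm: "\<psi> \<in> borel_measurable (Lb U)" by (rule L2_measurable[OF psL(1)])
  have km: "(\<lambda>x. reg_inverse \<epsilon> (\<psi> x)) \<in> borel_measurable (Lb U)" "(\<lambda>x. reg_abs \<epsilon> (\<psi> x)) \<in> borel_measurable (Lb U)"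
    by (rule measurable_compose[OF pm borel_measurable_continuous_onI[OF reg_inverse_cont[OF \<epsilon>]]]
        measurable_compose[OF pm borel_measurable_continuous_onI[OF reg_abs_cont]])+
  have vL: "L2 (Lb U) v" "L2 (Lb U) (dd v e)" for e using C1c_L2[OF Ub v(1)] by auto
  have C1p: "C1 (\<phi> n)" for n by (rule C1c_C1[OF p(1)])
  have C1k: "C1 (\<lambda>x. reg_inverse \<epsilon> (\<phi> n x))" and Dk: "dd (\<lambda>x. reg_inverse \<epsilon> (\<phi> n x)) e x = - (reg_inverse \<epsilon> (\<phi> n x) / reg_abs \<epsilon> (\<phi> n x)) * dd (\<phi> n) e x" for n e x
  proof -
    have c: "continuous_on UNIV (\<lambda>t. - (reg_inverse \<epsilon> t / reg_abs \<epsilon> t))"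
      using reg_abs_pos[OF \<epsilon>] by (intro continuous_intros reg_inverse_cont \<epsilon> reg_abs_cont) (auto simp: less_imp_neq[symmetric])
    show "C1 (\<lambda>x. reg_inverse \<epsilon> (\<phi> n x))" "dd (\<lambda>x. reg_inverse \<epsilon> (\<phi> n x)) e x = - (reg_inverse \<epsilon> (\<phi> n x) / reg_abs \<epsilon> (\<phi> n x)) * dd (\<phi> n) e x"
      using C1_compose_real[OF C1p reg_inverse_deriv[OF \<epsilon>] c] by auto
  qed
  \<comment> \<open>The regularized v^2 / psi, formed with a C1 approximant of psi so that it is
    itself an admissible test function; its support lies in that of \<open>v\<close>.\<close>
  define w where "w n x = v x * v x * reg_inverse \<epsilon> (\<phi> n x)" for n x
  have wC: "C1c UNIV (w n)" "supp (w n) \<subseteq> supp v" and Dw: "dd (w n) e x = 2 * v x * dd v e x * reg_inverse \<epsilon> (\<phi> n x) + (v x)\<^sup>2 * (- (reg_inverse \<epsilon> (\<phi> n x) / reg_abs \<epsilon> (\<phi> n x)) * dd (\<phi> n) e x)" for n e x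
  proof -
    have C: "C1 (w n)" unfolding w_def[abs_def] by (intro C1_mult(1) vC1 C1k)
    show "C1c UNIV (w n)" "supp (w n) \<subseteq> supp v"
      by (rule C1c_subset_supp[OF C v(1)]; simp add: w_def)+
    show "dd (w n) e x = 2 * v x * dd v e x * reg_inverse \<epsilon> (\<phi> n x) + (v x)\<^sup>2 * (- (reg_inverse \<epsilon> (\<phi> n x) / reg_abs \<epsilon> (\<phi> n x)) * dd (\<phi> n) e x)"
      unfolding w_def[abs_def] C1_mult(2)[OF C1_mult(1)[OF vC1 vC1] C1k] C1_mult(2)[OF vC1 vC1] Dk
      by (simp add: power2_eq_square algebra_simps)
  qed
  have wL: "L2 (Lb U) (w n)" "L2 (Lb U) (dd (w n) e)" for n e using C1c_L2[OF Ub wC(1)] by auto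
  have wG: "supp (w n) \<inter> G = {}" for n using wC(2) v(2) by blast
  have kcont: "continuous_on UNIV (\<lambda>x. reg_inverse \<epsilon> (\<phi> n x))" "continuous_on UNIV (\<lambda>x. reg_abs \<epsilon> (\<phi> n x))" for n
    using continuous_on_compose2[OF reg_inverse_cont[OF \<epsilon>, of UNIV] C1_continuous[OF C1p]]
      continuous_on_compose2[OF reg_abs_cont[of UNIV] C1_continuous[OF C1p]] by auto
  have cL: "L2 (Lb U) (\<lambda>x. b x * q x)" if "continuous_on UNIV b" "continuous_on UNIV q" "\<And>x. x \<notin> supp v \<Longrightarrow> b x = 0" for b q
    by (rule compact_support_L2[OF Ub continuous_on_mult[OF that(1,2)] vK]) (simp add: that(3))
  have L1: "L2 (Lb U) (\<lambda>x. v x * reg_inverse \<epsilon> (\<phi> n x))" for n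
    by (rule cL[OF C1_continuous[OF vC1] kcont(1) notin_supp[of _ v]])
  have L2': "L2 (Lb U) (\<lambda>x. dd v e x * reg_inverse \<epsilon> (\<phi> n x))" for n e
    by (rule cL[OF C1_dd_continuous[OF vC1] kcont(1) dd_notin_supp[of _ v e]])
  have L3: "L2 (Lb U) (\<lambda>x. dd v e x * reg_abs \<epsilon> (\<phi> n x))" for n e
    by (rule cL[OF C1_dd_continuous[OF vC1] kcont(2) dd_notin_supp[of _ v e]])
  have kb: "\<bar>reg_inverse \<epsilon> (\<psi> x)\<bar> \<le> 1 / \<epsilon>" if "x \<in> space (Lb U)" for x
    using reg_inverse_nonneg[of \<epsilon> "\<psi> x"] reg_inverse_le[OF \<epsilon> pos, of x] that sp by simp
  have L1l: "L2 (Lb U) (\<lambda>x. v x * reg_inverse \<epsilon> (\<psi> x))" and L2l: "L2 (Lb U) (\<lambda>x. dd v e x * reg_inverse \<epsilon> (\<psi> x))" for e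
    using L2_bmult[OF vL(1) km(1) kb] L2_bmult[OF vL(2) km(1) kb] by (simp_all add: mult.commute)
  have L3l: "L2 (Lb U) (\<lambda>x. dd v e x * reg_abs \<epsilon> (\<psi> x))" for e
  proof (rule L2_dom[where K=1])
    have "L2 (Lb U) (\<lambda>x. dd v e x * \<psi> x)"
      by (rule L2_bmult[OF psL(1) L2_measurable[OF vL(2)] Cd(2)])
    then have "L2 (Lb U) (\<lambda>x. \<bar>dd v e x * \<psi> x\<bar>)" by (rule L2_abs)
    moreover have "L2 (Lb U) (\<lambda>x. \<bar>dd v e x\<bar>)" by (rule L2_abs[OF vL(2)])
    ultimately show "L2 (Lb U) (\<lambda>x. \<bar>dd v e x * \<psi> x\<bar> + \<epsilon> * \<bar>dd v e x\<bar>)" by (intro L2_add L2_cmult)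
    show "(\<lambda>x. dd v e x * reg_abs \<epsilon> (\<psi> x)) \<in> borel_measurable (Lb U)"
      by (intro borel_measurable_times km L2_measurable[OF vL(2)])
    show "\<bar>dd v e x * reg_abs \<epsilon> (\<psi> x)\<bar> \<le> 1 * \<bar>\<bar>dd v e x * \<psi> x\<bar> + \<epsilon> * \<bar>dd v e x\<bar>\<bar>" for x
    proof -
      have "\<bar>dd v e x * reg_abs \<epsilon> (\<psi> x)\<bar> = \<bar>dd v e x\<bar> * reg_abs \<epsilon> (\<psi> x)" using reg_abs_pos[OF \<epsilon>, of "\<psi> x"] by (simp add: abs_mult)
      also have "\<dots> \<le> \<bar>dd v e x\<bar> * (\<bar>\<psi> x\<bar> + \<epsilon>)" by (intro mult_left_mono reg_abs_le[OF \<epsilon>]) simp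
      finally show ?thesis using \<epsilon> by (simp add: abs_mult algebra_simps)
    qed
  qed
  have c1: "L2conv (Lb U) (\<lambda>n x. v x * reg_inverse \<epsilon> (\<phi> n x)) (\<lambda>x. v x * reg_inverse \<epsilon> (\<psi> x))"
  proof (rule L2conv_dom[OF p(3) pL(1) psL(1), where K="Cv * (2 / \<epsilon>\<^sup>2)"])
    fix n x
    have "\<bar>v x * reg_inverse \<epsilon> (\<phi> n x) - v x * reg_inverse \<epsilon> (\<psi> x)\<bar> = \<bar>v x\<bar> * \<bar>reg_inverse \<epsilon> (\<phi> n x) - reg_inverse \<epsilon> (\<psi> x)\<bar>"
      by (simp flip: abs_mult right_diff_distrib)
    also have "\<dots> \<le> Cv * ((2 / \<epsilon>\<^sup>2) * \<bar>\<phi> n x - \<psi> x\<bar>)" by (intro mult_mono Cv reg_inverse_lipschitz) auto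
    finally show "\<bar>v x * reg_inverse \<epsilon> (\<phi> n x) - v x * reg_inverse \<epsilon> (\<psi> x)\<bar> \<le> Cv * (2 / \<epsilon>\<^sup>2) * \<bar>\<phi> n x - \<psi> x\<bar>" by (simp add: mult.assoc)
  qed
  have c2: "L2conv (Lb U) (\<lambda>n x. dd v e x * reg_inverse \<epsilon> (\<phi> n x)) (\<lambda>x. dd v e x * reg_inverse \<epsilon> (\<psi> x))" for e
  proof (rule L2conv_dom[OF p(3) pL(1) psL(1), where K="Cd e * (2 / \<epsilon>\<^sup>2)"])
    fix n x
    have "\<bar>dd v e x * reg_inverse \<epsilon> (\<phi> n x) - dd v e x * reg_inverse \<epsilon> (\<psi> x)\<bar> = \<bar>dd v e x\<bar> * \<bar>reg_inverse \<epsilon> (\<phi> n x) - reg_inverse \<epsilon> (\<psi> x)\<bar>"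
      by (simp flip: abs_mult right_diff_distrib)
    also have "\<dots> \<le> Cd e * ((2 / \<epsilon>\<^sup>2) * \<bar>\<phi> n x - \<psi> x\<bar>)" by (intro mult_mono Cd reg_inverse_lipschitz) auto
    finally show "\<bar>dd v e x * reg_inverse \<epsilon> (\<phi> n x) - dd v e x * reg_inverse \<epsilon> (\<psi> x)\<bar> \<le> Cd e * (2 / \<epsilon>\<^sup>2) * \<bar>\<phi> n x - \<psi> x\<bar>" by (simp add: mult.assoc)
  qed
  have c3: "L2conv (Lb U) (\<lambda>n x. dd v e x * reg_abs \<epsilon> (\<phi> n x)) (\<lambda>x. dd v e x * reg_abs \<epsilon> (\<psi> x))" for e
  proof (rule L2conv_dom[OF p(3) pL(1) psL(1), where K="Cd e"])
    fix n x
    have "\<bar>dd v e x * reg_abs \<epsilon> (\<phi> n x) - dd v e x * reg_abs \<epsilon> (\<psi> x)\<bar> = \<bar>dd v e x\<bar> * \<bar>reg_abs \<epsilon> (\<phi> n x) - reg_abs \<epsilon> (\<psi> x)\<bar>"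
      by (simp flip: abs_mult right_diff_distrib)
    also have "\<dots> \<le> Cd e * \<bar>\<phi> n x - \<psi> x\<bar>" by (intro mult_mono Cd reg_abs_lipschitz) auto
    finally show "\<bar>dd v e x * reg_abs \<epsilon> (\<phi> n x) - dd v e x * reg_abs \<epsilon> (\<psi> x)\<bar> \<le> Cd e * \<bar>\<phi> n x - \<psi> x\<bar>" .
  qed
  \<comment> \<open>The error of replacing the gradient of psi by that of the approximant. It
    vanishes by Cauchy-Schwarz, since the derivatives of \<open>w n\<close> have square norms
    dominated by convergent sequences.\<close>
  define R where "R n = (\<Sum>e\<in>Basis. \<integral>x. (h e x - dd (\<phi> n) e x) * dd (w n) e x \<partial>Lb U)" for n
  have R0: "R \<longlonglongrightarrow> 0"
  proof -
    have "(\<lambda>n. \<integral>x. (h e x - dd (\<phi> n) e x) * dd (w n) e x \<partial>Lb U) \<longlonglongrightarrow> 0" if e: "e \<in> Basis" for e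
    proof -
      have bd: "(\<integral>x. (dd (w n) e x)\<^sup>2 \<partial>Lb U) \<le> 2 * ((2 * Cd e)\<^sup>2 * (\<integral>x. (v x * reg_inverse \<epsilon> (\<phi> n x))\<^sup>2 \<partial>Lb U)) + 2 * ((Cv\<^sup>2 * (2 / \<epsilon>\<^sup>2))\<^sup>2 * (\<integral>x. (dd (\<phi> n) e x)\<^sup>2 \<partial>Lb U))" for n
      proof -
        have "(\<integral>x. (dd (w n) e x)\<^sup>2 \<partial>Lb U) \<le> (\<integral>x. 2 * ((2 * Cd e)\<^sup>2 * (v x * reg_inverse \<epsilon> (\<phi> n x))\<^sup>2) + 2 * ((Cv\<^sup>2 * (2 / \<epsilon>\<^sup>2))\<^sup>2 * (dd (\<phi> n) e x)\<^sup>2) \<partial>Lb U)"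
        proof (rule integral_mono)
          show "integrable (Lb U) (\<lambda>x. (dd (w n) e x)\<^sup>2)" by (rule L2_square[OF wL(2)])
          show "integrable (Lb U) (\<lambda>x. 2 * ((2 * Cd e)\<^sup>2 * (v x * reg_inverse \<epsilon> (\<phi> n x))\<^sup>2) + 2 * ((Cv\<^sup>2 * (2 / \<epsilon>\<^sup>2))\<^sup>2 * (dd (\<phi> n) e x)\<^sup>2))"
            using L2_square[OF L1] L2_square[OF pL(2)] by (intro Bochner_Integration.integrable_add integrable_mult_right)
          fix x
          let ?a = "2 * v x * dd v e x * reg_inverse \<epsilon> (\<phi> n x)" and ?b = "(v x)\<^sup>2 * (- (reg_inverse \<epsilon> (\<phi> n x) / reg_abs \<epsilon> (\<phi> n x)) * dd (\<phi> n) e x)"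
          have "\<bar>?a\<bar> = 2 * \<bar>dd v e x\<bar> * \<bar>v x * reg_inverse \<epsilon> (\<phi> n x)\<bar>" by (simp add: abs_mult)
          also have "\<dots> \<le> 2 * Cd e * \<bar>v x * reg_inverse \<epsilon> (\<phi> n x)\<bar>" by (intro mult_right_mono mult_left_mono Cd) auto
          finally have "\<bar>?a\<bar>\<^sup>2 \<le> (2 * Cd e * \<bar>v x * reg_inverse \<epsilon> (\<phi> n x)\<bar>)\<^sup>2" by (intro power_mono) auto
          then have a: "?a\<^sup>2 \<le> (2 * Cd e)\<^sup>2 * (v x * reg_inverse \<epsilon> (\<phi> n x))\<^sup>2" by (simp only: power2_abs power_mult_distrib)
          have "\<bar>?b\<bar> = (\<bar>v x\<bar>\<^sup>2 * \<bar>reg_inverse \<epsilon> (\<phi> n x) / reg_abs \<epsilon> (\<phi> n x)\<bar>) * \<bar>dd (\<phi> n) e x\<bar>" by (simp add: abs_mult power_abs)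
          also have "\<dots> \<le> (Cv\<^sup>2 * (2 / \<epsilon>\<^sup>2)) * \<bar>dd (\<phi> n) e x\<bar>"
            using reg_inverse_rs_bound[OF \<epsilon>, of "\<phi> n x"] reg_inverse_nonneg[of \<epsilon> "\<phi> n x"] reg_abs_pos[OF \<epsilon>, of "\<phi> n x"]
            by (intro mult_right_mono mult_mono power_mono Cv) auto
          finally have "\<bar>?b\<bar>\<^sup>2 \<le> ((Cv\<^sup>2 * (2 / \<epsilon>\<^sup>2)) * \<bar>dd (\<phi> n) e x\<bar>)\<^sup>2" by (intro power_mono) auto
          then have b: "?b\<^sup>2 \<le> (Cv\<^sup>2 * (2 / \<epsilon>\<^sup>2))\<^sup>2 * (dd (\<phi> n) e x)\<^sup>2" by (simp only: power2_abs power_mult_distrib)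
          have "(?a + ?b)\<^sup>2 \<le> 2 * ?a\<^sup>2 + 2 * ?b\<^sup>2" by (rule square_add_le)
          then show "(dd (w n) e x)\<^sup>2 \<le> 2 * ((2 * Cd e)\<^sup>2 * (v x * reg_inverse \<epsilon> (\<phi> n x))\<^sup>2) + 2 * ((Cv\<^sup>2 * (2 / \<epsilon>\<^sup>2))\<^sup>2 * (dd (\<phi> n) e x)\<^sup>2)"
            unfolding Dw using a b by linarith
        qed
        then show ?thesis using L2_square[OF L1] L2_square[OF pL(2)] by simp
      qed
      have "(\<lambda>n. (\<integral>x. (h e x - dd (\<phi> n) e x) * dd (w n) e x \<partial>Lb U)\<^sup>2) \<longlonglongrightarrow> 0"
      proof (rule tendsto_sandwich[OF always_eventually always_eventually tendsto_const])
        let ?B = "\<lambda>n. 2 * ((2 * Cd e)\<^sup>2 * (\<integral>x. (v x * reg_inverse \<epsilon> (\<phi> n x))\<^sup>2 \<partial>Lb U)) + 2 * ((Cv\<^sup>2 * (2 / \<epsilon>\<^sup>2))\<^sup>2 * (\<integral>x. (dd (\<phi> n) e x)\<^sup>2 \<partial>Lb U))"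
        show "\<forall>n. 0 \<le> (\<integral>x. (h e x - dd (\<phi> n) e x) * dd (w n) e x \<partial>Lb U)\<^sup>2" by simp
        show "\<forall>n. (\<integral>x. (h e x - dd (\<phi> n) e x) * dd (w n) e x \<partial>Lb U)\<^sup>2 \<le> (\<integral>x. (dd (\<phi> n) e x - h e x)\<^sup>2 \<partial>Lb U) * ?B n"
        proof
          fix n
          have "(\<integral>x. (h e x - dd (\<phi> n) e x) * dd (w n) e x \<partial>Lb U)\<^sup>2
             \<le> (\<integral>x. (h e x - dd (\<phi> n) e x)\<^sup>2 \<partial>Lb U) * (\<integral>x. (dd (w n) e x)\<^sup>2 \<partial>Lb U)"
            by (rule L2_CS[OF L2_diff[OF psL(2)[OF e] pL(2)] wL(2)])
          also have "\<dots> \<le> (\<integral>x. (h e x - dd (\<phi> n) e x)\<^sup>2 \<partial>Lb U) * ?B n"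
            by (intro mult_left_mono bd Bochner_Integration.integral_nonneg) simp
          finally show "(\<integral>x. (h e x - dd (\<phi> n) e x) * dd (w n) e x \<partial>Lb U)\<^sup>2 \<le> (\<integral>x. (dd (\<phi> n) e x - h e x)\<^sup>2 \<partial>Lb U) * ?B n"
            by (simp only: power2_commute[of "h e _"])
        qed
        have "(\<lambda>n. (\<integral>x. (dd (\<phi> n) e x - h e x)\<^sup>2 \<partial>Lb U) * ?B n)
          \<longlonglongrightarrow> 0 * (2 * ((2 * Cd e)\<^sup>2 * (\<integral>x. (v x * reg_inverse \<epsilon> (\<psi> x))\<^sup>2 \<partial>Lb U)) + 2 * ((Cv\<^sup>2 * (2 / \<epsilon>\<^sup>2))\<^sup>2 * (\<integral>x. (h e x)\<^sup>2 \<partial>Lb U)))"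
          using p(4)[OF e] unfolding L2conv_def
          by (intro tendsto_mult tendsto_add tendsto_const L2conv_norm[OF c1 L1 L1l] L2conv_norm[OF p(4)[OF e] pL(2) psL(2)[OF e]])
        then show "(\<lambda>n. (\<integral>x. (dd (\<phi> n) e x - h e x)\<^sup>2 \<partial>Lb U) * ?B n) \<longlonglongrightarrow> 0" by simp
      qed
      then show ?thesis by simp
    qed
    then have "(\<lambda>n. \<Sum>e\<in>Basis. \<integral>x. (h e x - dd (\<phi> n) e x) * dd (w n) e x \<partial>Lb U) \<longlonglongrightarrow> (\<Sum>e\<in>(Basis::'a set). 0)"
      by (intro tendsto_sum)
    then show ?thesis unfolding R_def by simp
  qed
  have main: "lam * (\<integral>x. (\<psi> x * v x) * (v x * reg_inverse \<epsilon> (\<phi> n x)) \<partial>Lb U)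
     \<le> (\<Sum>e\<in>Basis. \<integral>x. (dd v e x * reg_inverse \<epsilon> (\<phi> n x)) * (dd v e x * reg_abs \<epsilon> (\<phi> n x)) \<partial>Lb U) + R n" for n
  proof -
    have "lam * (\<integral>x. (\<psi> x * v x) * (v x * reg_inverse \<epsilon> (\<phi> n x)) \<partial>Lb U) = lam * (\<integral>x. \<psi> x * w n x \<partial>Lb U)"
      by (simp add: w_def mult.assoc)
    also have "\<dots> = (\<Sum>e\<in>Basis. \<integral>x. h e x * dd (w n) e x \<partial>Lb U)" using eq[OF wC(1) wG] by simp
    also have "\<dots> = (\<Sum>e\<in>Basis. (\<integral>x. dd (\<phi> n) e x * dd (w n) e x \<partial>Lb U) + (\<integral>x. (h e x - dd (\<phi> n) e x) * dd (w n) e x \<partial>Lb U))"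
      using L2_mult[OF psL(2) wL(2)] L2_mult[OF pL(2) wL(2)] by (intro sum.cong refl) (simp add: left_diff_distrib)
    also have "\<dots> = (\<Sum>e\<in>Basis. (\<integral>x. dd (\<phi> n) e x * dd (w n) e x \<partial>Lb U)) + R n"
      by (simp add: sum.distrib R_def)
    also have "(\<Sum>e\<in>Basis. (\<integral>x. dd (\<phi> n) e x * dd (w n) e x \<partial>Lb U))
       \<le> (\<Sum>e\<in>Basis. \<integral>x. (dd v e x * reg_inverse \<epsilon> (\<phi> n x)) * (dd v e x * reg_abs \<epsilon> (\<phi> n x)) \<partial>Lb U)"
    proof (intro sum_mono integral_mono)
      fix e :: 'a and x
      show "integrable (Lb U) (\<lambda>x. dd (\<phi> n) e x * dd (w n) e x)" by (rule L2_mult[OF pL(2) wL(2)])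
      show "integrable (Lb U) (\<lambda>x. (dd v e x * reg_inverse \<epsilon> (\<phi> n x)) * (dd v e x * reg_abs \<epsilon> (\<phi> n x)))" by (rule L2_mult[OF L2' L3])
      have "dd (\<phi> n) e x * dd (w n) e x \<le> (dd v e x)\<^sup>2 * (reg_inverse \<epsilon> (\<phi> n x) * reg_abs \<epsilon> (\<phi> n x))"
        unfolding Dw by (rule ground_state_substitution[OF \<epsilon>])
      then show "dd (\<phi> n) e x * dd (w n) e x \<le> (dd v e x * reg_inverse \<epsilon> (\<phi> n x)) * (dd v e x * reg_abs \<epsilon> (\<phi> n x))"
        by (simp add: power2_eq_square mult_ac)
    qed
    finally show ?thesis by simp
  qed
  have pvL: "L2 (Lb U) (\<lambda>x. \<psi> x * v x)"
    using L2_bmult[OF psL(1) L2_measurable[OF vL(1)] Cv(2)] by (simp add: mult.commute)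
  have lim1: "(\<lambda>n. lam * (\<integral>x. (\<psi> x * v x) * (v x * reg_inverse \<epsilon> (\<phi> n x)) \<partial>Lb U)) \<longlonglongrightarrow> lam * (\<integral>x. (\<psi> x * v x) * (v x * reg_inverse \<epsilon> (\<psi> x)) \<partial>Lb U)"
    by (intro tendsto_mult tendsto_const L2conv_inner[OF L2conv_const pvL pvL c1 L1 L1l])
  have lim2: "(\<lambda>n. (\<Sum>e\<in>Basis. \<integral>x. (dd v e x * reg_inverse \<epsilon> (\<phi> n x)) * (dd v e x * reg_abs \<epsilon> (\<phi> n x)) \<partial>Lb U) + R n)
     \<longlonglongrightarrow> (\<Sum>e\<in>Basis. \<integral>x. (dd v e x * reg_inverse \<epsilon> (\<psi> x)) * (dd v e x * reg_abs \<epsilon> (\<psi> x)) \<partial>Lb U) + 0"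
    by (intro tendsto_add tendsto_sum R0 L2conv_inner[OF c2 L2' L2l c3 L3 L3l])
  have "lam * (\<integral>x. (\<psi> x * v x) * (v x * reg_inverse \<epsilon> (\<psi> x)) \<partial>Lb U)
     \<le> (\<Sum>e\<in>Basis. \<integral>x. (dd v e x * reg_inverse \<epsilon> (\<psi> x)) * (dd v e x * reg_abs \<epsilon> (\<psi> x)) \<partial>Lb U) + 0"
    by (rule LIMSEQ_le[OF lim1 lim2]) (use main in blast)
  then show ?thesis by (simp add: power2_eq_square mult_ac)
qed

text \<open>Removes the regularization. The weights
  \<open>\<psi> x * reg_inverse \<epsilon> (\<psi> x)\<close> and \<open>reg_inverse \<epsilon>
  (\<psi> x) * reg_abs \<epsilon> (\<psi> x)\<close> are nonnegative with sum 1, which gives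
  domination, and where psi is positive both tend to 1/2; the common factor cancels.\<close>

theorem barta:
  fixes U :: "'a::euclidean_space set"
  assumes U: "open U" and g: "hasgrad U G \<psi> h" and pos: "\<And>x. x \<in> U \<Longrightarrow> \<psi> x > 0"
    and eq: "\<And>w. C1c UNIV w \<Longrightarrow> supp w \<inter> G = {} \<Longrightarrow>
       (\<Sum>e\<in>Basis. \<integral>x. h e x * dd w e x \<partial>Lb U) = lam * (\<integral>x. \<psi> x * w x \<partial>Lb U)"
    and v: "C1c UNIV v" "supp v \<inter> G = {}"
  shows "lam * (\<integral>x. (v x)\<^sup>2 \<partial>Lb U) \<le> (\<Sum>e\<in>Basis. \<integral>x. (dd v e x)\<^sup>2 \<partial>Lb U)"
proof -
  have Ub: "U \<in> sets borel" using U by simp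
  have sp: "space (Lb U) = U" by (simp add: space_restrict_space)
  let ?e = "\<lambda>n. 1 / real (Suc n)"
  have e0: "0 < ?e n" for n by simp
  have vL: "L2 (Lb U) v" "L2 (Lb U) (dd v e)" for e using C1c_L2[OF Ub v(1)] by auto
  have pm: "\<psi> \<in> borel_measurable (Lb U)" using hasgrad_L2(1)[OF g] by (rule L2_measurable)
  have km: "(\<lambda>x. reg_inverse (?e n) (\<psi> x)) \<in> borel_measurable (Lb U)" "(\<lambda>x. reg_abs (?e n) (\<psi> x)) \<in> borel_measurable (Lb U)" for n
    by (rule measurable_compose[OF pm borel_measurable_continuous_onI[OF reg_inverse_cont[OF e0]]]
        measurable_compose[OF pm borel_measurable_continuous_onI[OF reg_abs_cont]])+
  have bnd: "0 \<le> \<psi> x * reg_inverse \<epsilon> (\<psi> x)" "\<psi> x * reg_inverse \<epsilon> (\<psi> x) \<le> 1" "0 \<le> reg_inverse \<epsilon> (\<psi> x) * reg_abs \<epsilon> (\<psi> x)" "reg_inverse \<epsilon> (\<psi> x) * reg_abs \<epsilon> (\<psi> x) \<le> 1"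
    if "x \<in> U" "\<epsilon> > 0" for x \<epsilon>
  proof -
    have eq1: "reg_inverse \<epsilon> (\<psi> x) * reg_abs \<epsilon> (\<psi> x) + \<psi> x * reg_inverse \<epsilon> (\<psi> x) = 1"
      using reg_inverse_eq[OF that(2), of "\<psi> x"] by (simp add: algebra_simps)
    show 1: "0 \<le> \<psi> x * reg_inverse \<epsilon> (\<psi> x)" "0 \<le> reg_inverse \<epsilon> (\<psi> x) * reg_abs \<epsilon> (\<psi> x)"
      using pos[OF that(1)] reg_inverse_nonneg[of \<epsilon> "\<psi> x"] reg_abs_pos[OF that(2), of "\<psi> x"] by simp_all
    show "\<psi> x * reg_inverse \<epsilon> (\<psi> x) \<le> 1" "reg_inverse \<epsilon> (\<psi> x) * reg_abs \<epsilon> (\<psi> x) \<le> 1" using eq1 1 by linarith+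
  qed
  have lim: "(\<lambda>n. \<psi> x * reg_inverse (?e n) (\<psi> x)) \<longlonglongrightarrow> 1/2" "(\<lambda>n. reg_inverse (?e n) (\<psi> x) * reg_abs (?e n) (\<psi> x)) \<longlonglongrightarrow> 1/2" if x: "x \<in> U" for x
  proof -
    have e: "?e \<longlonglongrightarrow> 0" using LIMSEQ_inverse_real_of_nat by (simp add: inverse_eq_divide)
    have p: "\<psi> x > 0" by (rule pos[OF x])
    have rl: "(\<lambda>n. reg_abs (?e n) (\<psi> x)) \<longlonglongrightarrow> sqrt ((\<psi> x)\<^sup>2 + 0\<^sup>2)" unfolding reg_abs_def by (intro tendsto_intros e)
    then have rl: "(\<lambda>n. reg_abs (?e n) (\<psi> x)) \<longlonglongrightarrow> \<psi> x" using p by simp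
    have keq: "reg_inverse (?e n) (\<psi> x) = 1 / (reg_abs (?e n) (\<psi> x) + \<psi> x)" for n
      using reg_inverse_eq[OF e0, of n "\<psi> x"] reg_abs_pos[OF e0, of n "\<psi> x"] p by (simp add: field_simps)
    have "(\<lambda>n. \<psi> x * (1 / (reg_abs (?e n) (\<psi> x) + \<psi> x))) \<longlonglongrightarrow> \<psi> x * (1 / (\<psi> x + \<psi> x))"
      using p by (intro tendsto_intros rl) simp
    then show 1: "(\<lambda>n. \<psi> x * reg_inverse (?e n) (\<psi> x)) \<longlonglongrightarrow> 1/2" using p unfolding keq by simp
    have "(\<lambda>n. (1 / (reg_abs (?e n) (\<psi> x) + \<psi> x)) * reg_abs (?e n) (\<psi> x)) \<longlonglongrightarrow> (1 / (\<psi> x + \<psi> x)) * \<psi> x"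
      using p by (intro tendsto_intros rl) simp
    then show "(\<lambda>n. reg_inverse (?e n) (\<psi> x) * reg_abs (?e n) (\<psi> x)) \<longlonglongrightarrow> 1/2" using p unfolding keq by simp
  qed
  have dc: "(\<lambda>n. \<integral>x. (f x)\<^sup>2 * q n x \<partial>Lb U) \<longlonglongrightarrow> (\<integral>x. (f x)\<^sup>2 * (1/2) \<partial>Lb U)"
    if f: "L2 (Lb U) f" and q: "\<And>n. q n \<in> borel_measurable (Lb U)" "\<And>n x. x \<in> U \<Longrightarrow> 0 \<le> q n x \<and> q n x \<le> 1" "\<And>x. x \<in> U \<Longrightarrow> (\<lambda>n. q n x) \<longlonglongrightarrow> 1/2" for f q
  proof (rule integral_dominated_convergence[where w="\<lambda>x. (f x)\<^sup>2"])
    have fm: "f \<in> borel_measurable (Lb U)" by (rule L2_measurable[OF f])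
    show "(\<lambda>x. (f x)\<^sup>2 * (1/2)) \<in> borel_measurable (Lb U)" using fm by (intro borel_measurable_times borel_measurable_power) auto
    show "(\<lambda>x. (f x)\<^sup>2 * q n x) \<in> borel_measurable (Lb U)" for n using fm q(1) by (intro borel_measurable_times borel_measurable_power) auto
    show "integrable (Lb U) (\<lambda>x. (f x)\<^sup>2)" by (rule L2_square[OF f])
    show "AE x in Lb U. (\<lambda>n. (f x)\<^sup>2 * q n x) \<longlonglongrightarrow> (f x)\<^sup>2 * (1/2)"
      using q(3) sp by (intro AE_I2 tendsto_mult tendsto_const) auto
    show "AE x in Lb U. norm ((f x)\<^sup>2 * q n x) \<le> (f x)\<^sup>2" for n
      using q(2) sp by (intro AE_I2) (auto simp: abs_mult mult_left_le)
  qed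
  have 1: "(\<lambda>n. lam * (\<integral>x. (v x)\<^sup>2 * (\<psi> x * reg_inverse (?e n) (\<psi> x)) \<partial>Lb U)) \<longlonglongrightarrow> lam * (\<integral>x. (v x)\<^sup>2 * (1/2) \<partial>Lb U)"
    by (intro tendsto_mult tendsto_const dc vL borel_measurable_times pm km lim(1) conjI bnd e0)
  have 2: "(\<lambda>n. \<Sum>e\<in>Basis. \<integral>x. (dd v e x)\<^sup>2 * (reg_inverse (?e n) (\<psi> x) * reg_abs (?e n) (\<psi> x)) \<partial>Lb U)
     \<longlonglongrightarrow> (\<Sum>e\<in>Basis. \<integral>x. (dd v e x)\<^sup>2 * (1/2) \<partial>Lb U)"
    by (intro tendsto_sum dc vL borel_measurable_times km lim(2) conjI bnd e0)
  have "lam * (\<integral>x. (v x)\<^sup>2 * (1/2) \<partial>Lb U) \<le> (\<Sum>e\<in>Basis. \<integral>x. (dd v e x)\<^sup>2 * (1/2) \<partial>Lb U)"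
    by (rule LIMSEQ_le[OF 1 2]) (use barta_regularized[OF U g pos eq v e0] in blast)
  then show ?thesis by (simp add: sum_divide_distrib[symmetric])
qed

section \<open>Weighted Dirichlet forms\<close>

text \<open>One weight for the inner product and one for each coordinate direction, all between
  positive constants, so that the graph norm is equivalent to the H1 norm. The cross-section is the
  instance with unit weights; the tube has weight \<open>g\<close> transversally and
  \<open>1 / g\<close> longitudinally.\<close>

locale weighted_form =
  fixes U G :: "'a::euclidean_space set" and b :: "'a \<Rightarrow> real" and W :: "'a \<Rightarrow> 'a \<Rightarrow> real" and m0 M0 :: real
  assumes U: "open U" and m0: "0 < m0"
    and b_meas: "b \<in> borel_measurable (Lb U)" and b_bd: "x \<in> U \<Longrightarrow> m0 \<le> b x \<and> b x \<le> M0"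
    and W_meas: "e \<in> Basis \<Longrightarrow> W e \<in> borel_measurable (Lb U)"
    and W_bd: "e \<in> Basis \<Longrightarrow> x \<in> U \<Longrightarrow> m0 \<le> W e x \<and> W e x \<le> M0"
begin

definition "H = {f. L2_on U f}"
definition "D = {u. H1_0_on U G u}"
definition "ipw u v = (\<integral>x. b x * u x * v x \<partial>Lb U)"
definition "aw u v = (\<integral>x. (\<Sum>e\<in>Basis. W e x * wd U e u x * wd U e v x) \<partial>Lb U)"

lemma Ub: "U \<in> sets borel" using U by simp

lemma sp: "space (Lb U) = U" by (simp add: space_restrict_space)

lemma H_iff: "f \<in> H \<longleftrightarrow> L2 (Lb U) f"
  by (simp add: H_def L2_on_iff[OF Ub])

lemma D_hasgrad: "u \<in> D \<Longrightarrow> hasgrad U G u (\<lambda>e. wd U e u)"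
  by (simp add: D_def H1_0_hasgrad[OF U])

lemma hasgrad_D: "hasgrad U G u h \<Longrightarrow> u \<in> D"
  by (simp add: D_def hasgrad_H1_0[OF U])

lemma D_H: "u \<in> D \<Longrightarrow> u \<in> H"
  using hasgrad_L2(1)[OF D_hasgrad] by (simp add: H_iff)

lemma b_abs: "x \<in> space (Lb U) \<Longrightarrow> \<bar>b x\<bar> \<le> M0"
  using b_bd[of x] m0 sp by auto

lemma W_abs: "e \<in> Basis \<Longrightarrow> x \<in> space (Lb U) \<Longrightarrow> \<bar>W e x\<bar> \<le> M0"
  using W_bd[of e x] m0 sp by auto

lemma b_nonneg: "x \<in> U \<Longrightarrow> 0 \<le> b x"
  using b_bd[of x] m0 by linarith

lemma W_nonneg: "e \<in> Basis \<Longrightarrow> x \<in> U \<Longrightarrow> 0 \<le> W e x"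
  using W_bd[of e x] m0 by linarith

lemma weight_integrable:
  assumes "w \<in> borel_measurable (Lb U)" "\<And>x. x \<in> space (Lb U) \<Longrightarrow> \<bar>w x\<bar> \<le> M0" "L2 (Lb U) f" "L2 (Lb U) g"
  shows "integrable (Lb U) (\<lambda>x. w x * f x * g x)"
  by (rule L2_mult[OF L2_bmult[OF assms(3,1,2)] assms(4)])

text \<open>Explicit gradients agree almost everywhere with the chosen weak derivatives, so the form
  can be evaluated on trial functions and limits without unfolding the choice.\<close>

lemma aw_hasgrad:
  assumes g: "hasgrad U G u h" "hasgrad U G v k"
  shows "aw u v = (\<Sum>e\<in>Basis. \<integral>x. W e x * h e x * k e x \<partial>Lb U)"
proof -
  note hu = D_hasgrad[OF hasgrad_D[OF g(1)]] and hv = D_hasgrad[OF hasgrad_D[OF g(2)]]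
  have "aw u v = (\<Sum>e\<in>Basis. \<integral>x. W e x * wd U e u x * wd U e v x \<partial>Lb U)"
    unfolding aw_def
    by (intro Bochner_Integration.integral_sum weight_integrable W_meas W_abs hasgrad_L2(2)[OF hu] hasgrad_L2(2)[OF hv])
  also have "\<dots> = (\<Sum>e\<in>Basis. \<integral>x. W e x * h e x * k e x \<partial>Lb U)"
  proof (intro sum.cong refl integral_cong_AE)
    fix e :: 'a assume e: "e \<in> Basis"
    show "(\<lambda>x. W e x * wd U e u x * wd U e v x) \<in> borel_measurable (Lb U)"
      by (intro borel_measurable_times W_meas e L2_measurable[OF hasgrad_L2(2)[OF hu e]] L2_measurable[OF hasgrad_L2(2)[OF hv e]])
    show "(\<lambda>x. W e x * h e x * k e x) \<in> borel_measurable (Lb U)"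
      by (intro borel_measurable_times W_meas e L2_measurable[OF hasgrad_L2(2)[OF g(1) e]] L2_measurable[OF hasgrad_L2(2)[OF g(2) e]])
    show "AE x in Lb U. W e x * wd U e u x * wd U e v x = W e x * h e x * k e x"
      using hasgrad_H1(2)[OF U g(1) e] hasgrad_H1(2)[OF U g(2) e] by eventually_elim simp
  qed
  finally show ?thesis .
qed

lemma ipw_semi_inner: "semi_inner H ipw"
proof
  fix u v :: "'a \<Rightarrow> real" and c d assume "u \<in> H" "v \<in> H"
  then show "lincomb c u d v \<in> H" by (simp add: H_iff lincomb_def L2_lincomb)
next
  fix u v w :: "'a \<Rightarrow> real" and c d assume "u \<in> H" "v \<in> H" "w \<in> H"
  then have i: "integrable (Lb U) (\<lambda>x. b x * u x * w x)" "integrable (Lb U) (\<lambda>x. b x * v x * w x)"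
    by (auto simp: H_iff intro!: weight_integrable b_meas b_abs)
  have "ipw (lincomb c u d v) w = (\<integral>x. c * (b x * u x * w x) + d * (b x * v x * w x) \<partial>Lb U)"
    unfolding ipw_def lincomb_def by (intro Bochner_Integration.integral_cong) (auto simp: algebra_simps)
  also have "\<dots> = c * ipw u w + d * ipw v w"
    using i by (simp add: ipw_def)
  finally show "ipw (lincomb c u d v) w = c * ipw u w + d * ipw v w" .
next
  fix u v :: "'a \<Rightarrow> real"
  show "ipw u v = ipw v u" by (simp add: ipw_def mult_ac)
next
  fix u :: "'a \<Rightarrow> real"
  show "0 \<le> ipw u u"
    unfolding ipw_def using b_nonneg sp
    by (intro Bochner_Integration.integral_nonneg) (auto simp: mult.assoc)
qed

lemma aw_semi_inner: "semi_inner D aw"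
proof
  fix u v :: "'a \<Rightarrow> real" and c d assume "u \<in> D" "v \<in> D"
  then show "lincomb c u d v \<in> D"
    using hasgrad_D[OF hasgrad_lincomb[OF U D_hasgrad D_hasgrad]] by blast
next
  fix u v w :: "'a \<Rightarrow> real" and c d assume D: "u \<in> D" "v \<in> D" "w \<in> D"
  note g = D_hasgrad[OF D(1)] D_hasgrad[OF D(2)] D_hasgrad[OF D(3)]
  have "aw (lincomb c u d v) w = (\<Sum>e\<in>Basis. \<integral>x. W e x * lincomb c (wd U e u) d (wd U e v) x * wd U e w x \<partial>Lb U)"
    by (rule aw_hasgrad[OF hasgrad_lincomb[OF U g(1,2)] g(3)])
  also have "\<dots> = (\<Sum>e\<in>Basis. c * (\<integral>x. W e x * wd U e u x * wd U e w x \<partial>Lb U) + d * (\<integral>x. W e x * wd U e v x * wd U e w x \<partial>Lb U))"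
  proof (intro sum.cong refl)
    fix e :: 'a assume e: "e \<in> Basis"
    have i: "integrable (Lb U) (\<lambda>x. W e x * wd U e u x * wd U e w x)" "integrable (Lb U) (\<lambda>x. W e x * wd U e v x * wd U e w x)"
      by (intro weight_integrable W_meas W_abs e hasgrad_L2(2)[OF g(1)] hasgrad_L2(2)[OF g(2)] hasgrad_L2(2)[OF g(3)]; assumption)+
    have "(\<integral>x. W e x * lincomb c (wd U e u) d (wd U e v) x * wd U e w x \<partial>Lb U)
      = (\<integral>x. c * (W e x * wd U e u x * wd U e w x) + d * (W e x * wd U e v x * wd U e w x) \<partial>Lb U)"
      by (intro Bochner_Integration.integral_cong) (auto simp: lincomb_def algebra_simps)
    then show "(\<integral>x. W e x * lincomb c (wd U e u) d (wd U e v) x * wd U e w x \<partial>Lb U)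
      = c * (\<integral>x. W e x * wd U e u x * wd U e w x \<partial>Lb U) + d * (\<integral>x. W e x * wd U e v x * wd U e w x \<partial>Lb U)"
      using i by simp
  qed
  also have "\<dots> = c * aw u w + d * aw v w"
    unfolding aw_hasgrad[OF g(1,3)] aw_hasgrad[OF g(2,3)] by (simp add: sum.distrib sum_distrib_left)
  finally show "aw (lincomb c u d v) w = c * aw u w + d * aw v w" .
next
  fix u v :: "'a \<Rightarrow> real"
  show "aw u v = aw v u" by (simp add: aw_def mult_ac)
next
  fix u :: "'a \<Rightarrow> real"
  show "0 \<le> aw u u"
    unfolding aw_def using W_nonneg sp
    by (intro Bochner_Integration.integral_nonneg sum_nonneg) (auto simp: mult.assoc)
qed

lemma weighted_square_bounds:
  assumes "w \<in> borel_measurable (Lb U)" "\<And>x. x \<in> U \<Longrightarrow> m0 \<le> w x \<and> w x \<le> M0" "L2 (Lb U) f"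
  shows "m0 * (\<integral>x. (f x)\<^sup>2 \<partial>Lb U) \<le> (\<integral>x. w x * f x * f x \<partial>Lb U)"
    and "(\<integral>x. w x * f x * f x \<partial>Lb U) \<le> M0 * (\<integral>x. (f x)\<^sup>2 \<partial>Lb U)"
proof -
  have ab: "\<bar>w x\<bar> \<le> M0" if "x \<in> space (Lb U)" for x using assms(2)[of x] that m0 sp by auto
  note i = weight_integrable[OF assms(1) ab assms(3,3)] L2_square[OF assms(3)]
  have "(\<integral>x. m0 * (f x)\<^sup>2 \<partial>Lb U) \<le> (\<integral>x. w x * f x * f x \<partial>Lb U)"
    using i assms(2) sp by (intro integral_mono) (auto simp: power2_eq_square mult.assoc intro!: mult_right_mono)
  then show "m0 * (\<integral>x. (f x)\<^sup>2 \<partial>Lb U) \<le> (\<integral>x. w x * f x * f x \<partial>Lb U)" by simp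
  have "(\<integral>x. w x * f x * f x \<partial>Lb U) \<le> (\<integral>x. M0 * (f x)\<^sup>2 \<partial>Lb U)"
    using i assms(2) sp by (intro integral_mono) (auto simp: power2_eq_square mult.assoc intro!: mult_right_mono)
  then show "(\<integral>x. w x * f x * f x \<partial>Lb U) \<le> M0 * (\<integral>x. (f x)\<^sup>2 \<partial>Lb U)" by simp
qed

lemma energy_lower:
  assumes "hasgrad U G u h"
  shows "m0 * (\<integral>x. (u x)\<^sup>2 \<partial>Lb U) \<le> ipw u u" "m0 * (\<Sum>e\<in>Basis. \<integral>x. (h e x)\<^sup>2 \<partial>Lb U) \<le> aw u u"
  unfolding ipw_def aw_hasgrad[OF assms assms] sum_distrib_left
  by (intro sum_mono weighted_square_bounds(1) b_meas b_bd W_meas W_bd hasgrad_L2[OF assms]; assumption)+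

text \<open>The lower bound of the weights makes the functions and all partial derivatives Cauchy in
  L2; the upper bound carries their limits back to the form.\<close>

lemma D_complete: "form_complete D (\<lambda>u v. aw u v + ipw u v)"
  unfolding form_complete_def
proof (intro allI impI, elim conjE)
  fix u :: "nat \<Rightarrow> 'a \<Rightarrow> real"
  assume u: "\<forall>n. u n \<in> D"
    and c: "\<forall>\<epsilon>>0. \<exists>N. \<forall>m\<ge>N. \<forall>n\<ge>N. aw (fdiff (u m) (u n)) (fdiff (u m) (u n)) + ipw (fdiff (u m) (u n)) (fdiff (u m) (u n)) < \<epsilon>"
  have g: "hasgrad U G (u n) (\<lambda>e. wd U e (u n))" for n using u D_hasgrad by blast
  note gd = hasgrad_lincomb[OF U g g, of 1 _ "-1"]
  have fd: "fdiff p q x = p x - q x" for p q :: "'a \<Rightarrow> real" and x by (simp add: lincomb_def)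
  have nn: "0 \<le> ipw (fdiff (u m) (u n)) (fdiff (u m) (u n))" "0 \<le> aw (fdiff (u m) (u n)) (fdiff (u m) (u n))" for m n
    using semi_inner.B_nonneg[OF ipw_semi_inner D_H[OF hasgrad_D[OF gd]]] semi_inner.B_nonneg[OF aw_semi_inner hasgrad_D[OF gd]] by auto
  have c0: "\<exists>N. \<forall>m\<ge>N. \<forall>n\<ge>N. (\<integral>x. (u m x - u n x)\<^sup>2 \<partial>Lb U) < \<epsilon>" if "\<epsilon> > 0" for \<epsilon>
  proof -
    obtain N where N: "\<And>m n. m \<ge> N \<Longrightarrow> n \<ge> N \<Longrightarrow> aw (fdiff (u m) (u n)) (fdiff (u m) (u n)) + ipw (fdiff (u m) (u n)) (fdiff (u m) (u n)) < m0 * \<epsilon>"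
      using c m0 \<open>\<epsilon> > 0\<close> by (metis mult_pos_pos)
    have "(\<integral>x. (u m x - u n x)\<^sup>2 \<partial>Lb U) < \<epsilon>" if "m \<ge> N" "n \<ge> N" for m n
    proof -
      have "m0 * (\<integral>x. (fdiff (u m) (u n) x)\<^sup>2 \<partial>Lb U) < m0 * \<epsilon>"
        using energy_lower(1)[OF gd, of m n] N[OF that] nn(2)[of m n] by linarith
      then show ?thesis using m0 by (simp add: fd)
    qed
    then show ?thesis by blast
  qed
  have c1: "\<exists>N. \<forall>m\<ge>N. \<forall>n\<ge>N. (\<integral>x. (wd U e (u m) x - wd U e (u n) x)\<^sup>2 \<partial>Lb U) < \<epsilon>" if "\<epsilon> > 0" and e: "e \<in> Basis" for \<epsilon> e
  proof -
    obtain N where N: "\<And>m n. m \<ge> N \<Longrightarrow> n \<ge> N \<Longrightarrow> aw (fdiff (u m) (u n)) (fdiff (u m) (u n)) + ipw (fdiff (u m) (u n)) (fdiff (u m) (u n)) < m0 * \<epsilon>"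
      using c m0 \<open>\<epsilon> > 0\<close> by (metis mult_pos_pos)
    have "(\<integral>x. (wd U e (u m) x - wd U e (u n) x)\<^sup>2 \<partial>Lb U) < \<epsilon>" if "m \<ge> N" "n \<ge> N" for m n
    proof -
      have "(\<integral>x. (fdiff (wd U e (u m)) (wd U e (u n)) x)\<^sup>2 \<partial>Lb U) \<le> (\<Sum>e\<in>Basis. \<integral>x. (fdiff (wd U e (u m)) (wd U e (u n)) x)\<^sup>2 \<partial>Lb U)"
        by (rule member_le_sum[OF e]) (auto intro!: Bochner_Integration.integral_nonneg)
      then have "m0 * (\<integral>x. (fdiff (wd U e (u m)) (wd U e (u n)) x)\<^sup>2 \<partial>Lb U) \<le> m0 * (\<Sum>e\<in>Basis. \<integral>x. (fdiff (wd U e (u m)) (wd U e (u n)) x)\<^sup>2 \<partial>Lb U)"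
        using m0 by (intro mult_left_mono) auto
      then have "m0 * (\<integral>x. (fdiff (wd U e (u m)) (wd U e (u n)) x)\<^sup>2 \<partial>Lb U) < m0 * \<epsilon>"
        using energy_lower(2)[OF gd, of m n] N[OF that] nn(1)[of m n] by linarith
      then show ?thesis using m0 by (simp add: fd)
    qed
    then show ?thesis by blast
  qed
  obtain f k where fk: "hasgrad U G f k" "L2conv (Lb U) u f" "\<And>e. e \<in> Basis \<Longrightarrow> L2conv (Lb U) (\<lambda>n. wd U e (u n)) (k e)"
    using hasgrad_complete[OF U g c0 c1] by blast
  note gl = hasgrad_lincomb[OF U g fk(1), of 1 _ "-1"]
  have "(\<lambda>n. aw (fdiff (u n) f) (fdiff (u n) f) + ipw (fdiff (u n) f) (fdiff (u n) f)) \<longlonglongrightarrow> 0"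
  proof (rule tendsto_sandwich[OF always_eventually always_eventually tendsto_const])
    show "\<forall>n. 0 \<le> aw (fdiff (u n) f) (fdiff (u n) f) + ipw (fdiff (u n) f) (fdiff (u n) f)"
      using semi_inner.B_nonneg[OF ipw_semi_inner D_H[OF hasgrad_D[OF gl]]] semi_inner.B_nonneg[OF aw_semi_inner hasgrad_D[OF gl]]
      by (simp add: add_nonneg_nonneg)
    show "\<forall>n. aw (fdiff (u n) f) (fdiff (u n) f) + ipw (fdiff (u n) f) (fdiff (u n) f)
      \<le> (\<Sum>e\<in>Basis. M0 * (\<integral>x. (fdiff (wd U e (u n)) (k e) x)\<^sup>2 \<partial>Lb U)) + M0 * (\<integral>x. (fdiff (u n) f x)\<^sup>2 \<partial>Lb U)"
      unfolding ipw_def aw_hasgrad[OF gl gl]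
      by (intro allI add_mono sum_mono weighted_square_bounds(2) b_meas b_bd W_meas W_bd hasgrad_L2[OF gl]; assumption)
    have "(\<lambda>n. (\<Sum>e\<in>Basis. M0 * (\<integral>x. (fdiff (wd U e (u n)) (k e) x)\<^sup>2 \<partial>Lb U)) + M0 * (\<integral>x. (fdiff (u n) f x)\<^sup>2 \<partial>Lb U))
       \<longlonglongrightarrow> (\<Sum>e\<in>(Basis::'a set). M0 * 0) + M0 * 0"
      unfolding fd using fk(2,3) unfolding L2conv_def by (intro tendsto_add tendsto_sum tendsto_mult tendsto_const)
    then show "(\<lambda>n. (\<Sum>e\<in>Basis. M0 * (\<integral>x. (fdiff (wd U e (u n)) (k e) x)\<^sup>2 \<partial>Lb U)) + M0 * (\<integral>x. (fdiff (u n) f x)\<^sup>2 \<partial>Lb U)) \<longlonglongrightarrow> 0"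
      by simp
  qed
  then show "\<exists>l\<in>D. (\<lambda>n. aw (fdiff (u n) l) (fdiff (u n) l) + ipw (fdiff (u n) l) (fdiff (u n) l)) \<longlonglongrightarrow> 0"
    using hasgrad_D[OF fk(1)] by blast
qed

lemma D_ne: "D \<noteq> {}"
proof -
  have "hasgrad U G (\<lambda>x. 0) (\<lambda>e. dd (\<lambda>x. 0) e)"
    by (rule hasgrad_C1c[OF U]) (simp_all add: C1c_iff C1_const)
  then show ?thesis using hasgrad_D by blast
qed

sublocale nonneg_form H D aw ipw
  by (intro nonneg_form.intro nonneg_form_axioms.intro ipw_semi_inner aw_semi_inner D_complete D_ne)
    (use D_H in blast)

lemma test_in_D:
  assumes "C1c UNIV \<phi>" "supp \<phi> \<inter> G = {}"
  shows "\<phi> \<in> D" "aw \<phi> \<phi> = (\<Sum>e\<in>Basis. \<integral>x. W e x * dd \<phi> e x * dd \<phi> e x \<partial>Lb U)"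
  using hasgrad_C1c[OF U assms] hasgrad_D aw_hasgrad by auto

text \<open>Both sides converge along test functions approximating \<open>u\<close> with their
  gradients. The finite-rank inequality can thus be proved for classical functions vanishing near
  the Dirichlet part.\<close>

lemma inequality_by_density:
  assumes test: "\<And>\<phi>. C1c UNIV \<phi> \<Longrightarrow> supp \<phi> \<inter> G = {} \<Longrightarrow>
      \<alpha> * ipw \<phi> \<phi> \<le> \<gamma> * aw \<phi> \<phi> + C * (\<Sum>i<k::nat. (ipw (f i) \<phi>)\<^sup>2)"
    and f: "\<And>i. i < k \<Longrightarrow> f i \<in> H" and u: "u \<in> D"
  shows "\<alpha> * ipw u u \<le> \<gamma> * aw u u + C * (\<Sum>i<k. (ipw (f i) u)\<^sup>2)"
proof -
  note g = D_hasgrad[OF u]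
  obtain \<phi> where p: "\<And>n. C1c UNIV (\<phi> n)" "\<And>n. supp (\<phi> n) \<inter> G = {}" "L2conv (Lb U) \<phi> u"
    "\<And>e. e \<in> Basis \<Longrightarrow> L2conv (Lb U) (\<lambda>n. dd (\<phi> n) e) (wd U e u)"
    using hasgrad_approx[OF g] by blast
  have pL: "L2 (Lb U) (\<phi> n)" "L2 (Lb U) (dd (\<phi> n) e)" for n e using C1c_L2[OF Ub p(1)] by auto
  have l1: "(\<lambda>n. ipw (\<phi> n) (\<phi> n)) \<longlonglongrightarrow> ipw u u"
    unfolding ipw_def
    by (rule L2conv_inner_weight[OF p(3) pL(1) hasgrad_L2(1)[OF g] p(3) pL(1) hasgrad_L2(1)[OF g] b_meas b_abs])
  have l2: "(\<lambda>n. aw (\<phi> n) (\<phi> n)) \<longlonglongrightarrow> aw u u"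
    unfolding test_in_D(2)[OF p(1,2)] aw_hasgrad[OF g g]
  proof (rule tendsto_sum)
    fix e :: 'a assume e: "e \<in> Basis"
    show "(\<lambda>n. \<integral>x. W e x * dd (\<phi> n) e x * dd (\<phi> n) e x \<partial>Lb U) \<longlonglongrightarrow> (\<integral>x. W e x * wd U e u x * wd U e u x \<partial>Lb U)"
      by (rule L2conv_inner_weight[OF p(4)[OF e] pL(2) hasgrad_L2(2)[OF g e] p(4)[OF e] pL(2) hasgrad_L2(2)[OF g e] W_meas[OF e] W_abs[OF e]])
  qed
  have l3: "(\<lambda>n. ipw (f i) (\<phi> n)) \<longlonglongrightarrow> ipw (f i) u" if "i < k" for i
  proof -
    have fi: "L2 (Lb U) (f i)" using f[OF that] by (simp add: H_iff)
    show ?thesis unfolding ipw_def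
      by (rule L2conv_inner_weight[OF L2conv_const fi fi p(3) pL(1) hasgrad_L2(1)[OF g] b_meas b_abs])
  qed
  have L: "(\<lambda>n. \<alpha> * ipw (\<phi> n) (\<phi> n)) \<longlonglongrightarrow> \<alpha> * ipw u u"
    by (intro tendsto_intros l1)
  have R: "(\<lambda>n. \<gamma> * aw (\<phi> n) (\<phi> n) + C * (\<Sum>i<k. (ipw (f i) (\<phi> n))\<^sup>2)) \<longlonglongrightarrow> \<gamma> * aw u u + C * (\<Sum>i<k. (ipw (f i) u)\<^sup>2)"
    by (intro tendsto_intros l2 l3) auto
  show ?thesis by (rule LIMSEQ_le[OF L R]) (use test[OF p(1,2)] in blast)
qed

text \<open>The bottom is the infimum of the Rayleigh quotients over elements of nonzero norm. The
  strict inequality for \<open>v\<close> forces its norm to be positive, since \<open>aw v v\<close>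
  is nonnegative, so \<open>v\<close> itself puts the infimum below \<open>L\<close>.\<close>

lemma exists_bottom:
  assumes v: "v \<in> D" "aw v v < L * ipw v v"
  shows "\<exists>m<L. form_bottom H D aw ipw m"
proof -
  have vv: "ipw v v > 0"
  proof -
    have "0 \<le> aw v v" by (rule D.B_nonneg[OF v(1)])
    then have "0 < L * ipw v v" using v by simp
    then show ?thesis using H.B_nonneg[OF D_H[OF v(1)]] by (cases "ipw v v = 0") auto
  qed
  define R where "R = {aw u u / ipw u u |u. u \<in> D \<and> ipw u u \<noteq> 0}"
  define m where "m = Inf R"
  have R0: "0 \<le> r" if "r \<in> R" for r
    using that D.B_nonneg H.B_nonneg D_H by (auto simp: R_def)
  then have bdd: "bdd_below R" by (intro bdd_belowI[of R 0])
  have vR: "aw v v / ipw v v \<in> R" using v vv by (auto simp: R_def)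
  have mle: "m \<le> r" if "r \<in> R" for r unfolding m_def by (rule cInf_lower[OF that bdd])
  have "m \<le> aw v v / ipw v v" by (rule mle[OF vR])
  also have "\<dots> < L" using v vv by (simp add: pos_divide_less_eq)
  finally have ml: "m < L" .
  have m0': "0 \<le> m" unfolding m_def using vR R0 by (intro cInf_greatest) auto
  have "form_bottom H D aw ipw m"
  proof
    show "0 \<le> m" by (rule m0')
    fix u assume u: "u \<in> D"
    show "m * ipw u u \<le> aw u u"
    proof (cases "ipw u u = 0")
      case True
      then show ?thesis using D.B_nonneg[OF u] by simp
    next
      case False
      then have p: "ipw u u > 0" using H.B_nonneg[OF D_H[OF u]] by simp
      have "m \<le> aw u u / ipw u u" using u False by (intro mle) (auto simp: R_def)
      then show ?thesis using p by (simp add: pos_le_divide_eq)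
    qed
  next
    fix e :: real assume "e > 0"
    then have "\<exists>r\<in>R. r < m + e" unfolding m_def using vR by (intro cInf_lessD) auto
    then obtain u where u: "u \<in> D" "ipw u u \<noteq> 0" "aw u u / ipw u u < m + e" by (auto simp: R_def)
    have p: "ipw u u > 0" using u H.B_nonneg[OF D_H[OF u(1)]] by simp
    define c where "c = 1 / sqrt (ipw u u)"
    have c: "c\<^sup>2 = 1 / ipw u u" using p by (simp add: c_def power_divide)
    let ?w = "lincomb c u 0 u"
    have "?w \<in> D" by (rule D.lincomb_in[OF u(1) u(1)])
    moreover have "ipw ?w ?w = 1" "aw ?w ?w = aw u u / ipw u u"
      using u p D_H by (simp_all add: H.B_square D.B_square c)
    ultimately show "\<exists>u\<in>D. ipw u u = 1 \<and> aw u u < m + e" using u(3) by metis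
  qed
  then show ?thesis using ml by blast
qed

end

section \<open>Fubini and product functions on the cylinder over the cross-section\<close>

lemma cylinder_borel: "\<omega> \<in> sets borel \<Longrightarrow> \<omega> \<times> (UNIV :: real set) \<in> sets borel"
  for \<omega> :: "'a::euclidean_space set"
  by (simp add: borel_Times)

lemma cylinder_Fubini:
  fixes F :: "'a::euclidean_space \<times> real \<Rightarrow> real"
  assumes om: "\<omega> \<in> sets borel" and F: "integrable (Lb (\<omega> \<times> UNIV)) F"
  shows "AE s in lborel. integrable (Lb \<omega>) (\<lambda>x. F (x, s))"
    and "integrable lborel (\<lambda>s. \<integral>x. F (x, s) \<partial>Lb \<omega>)"
    and "(\<integral>z. F z \<partial>Lb (\<omega> \<times> UNIV)) = (\<integral>s. (\<integral>x. F (x, s) \<partial>Lb \<omega>) \<partial>lborel)"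
proof -
  define f where "f x s = indicator \<omega> x *\<^sub>R F (x, s)" for x s
  have eq: "(\<lambda>z. indicator (\<omega> \<times> UNIV) z * F z) = case_prod f"
    by (auto simp: f_def indicator_def fun_eq_iff)
  have i: "integrable (lborel \<Otimes>\<^sub>M lborel) (case_prod f)"
    using F cylinder_borel[OF om] by (simp add: integrable_restrict_space eq lborel_prod)
  have om': "\<omega> \<inter> space lborel \<in> sets lborel" using om by simp
  have s: "integrable (Lb \<omega>) (\<lambda>x. F (x, s)) \<longleftrightarrow> integrable lborel (\<lambda>x. f x s)"
    "(\<integral>x. F (x, s) \<partial>Lb \<omega>) = (\<integral>x. f x s \<partial>lborel)" for s
    unfolding f_def by (rule integrable_restrict_space[OF om'] integral_restrict_space[OF om'])+
  show "AE s in lborel. integrable (Lb \<omega>) (\<lambda>x. F (x, s))"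
    unfolding s by (rule lborel_pair.AE_integrable_snd[OF i])
  show "integrable lborel (\<lambda>s. \<integral>x. F (x, s) \<partial>Lb \<omega>)"
    unfolding s by (rule lborel_pair.integrable_snd[OF i])
  have "(\<integral>z. F z \<partial>Lb (\<omega> \<times> UNIV)) = integral\<^sup>L (lborel \<Otimes>\<^sub>M lborel) (case_prod f)"
    using cylinder_borel[OF om] by (simp add: integral_restrict_space eq lborel_prod)
  then show "(\<integral>z. F z \<partial>Lb (\<omega> \<times> UNIV)) = (\<integral>s. (\<integral>x. F (x, s) \<partial>Lb \<omega>) \<partial>lborel)"
    unfolding s using lborel_pair.integral_snd[OF i] by simp
qed

lemma cylinder_nn_Fubini:
  fixes F :: "'a::euclidean_space \<times> real \<Rightarrow> ennreal"
  assumes "F \<in> borel_measurable borel"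
  shows "(\<integral>\<^sup>+z. F z \<partial>lborel) = (\<integral>\<^sup>+s. (\<integral>\<^sup>+x. F (x, s) \<partial>lborel) \<partial>lborel)"
  using lborel_pair.nn_integral_snd[of F] assms by (simp add: lborel_prod)

lemma cylinder_product_measurable:
  fixes f :: "'a::euclidean_space \<Rightarrow> real" and k :: "real \<Rightarrow> real"
  assumes om: "\<omega> \<in> sets borel" and f: "f \<in> borel_measurable (Lb \<omega>)" and k: "k \<in> borel_measurable lborel"
  shows "(\<lambda>z. f (fst z) * k (snd z)) \<in> borel_measurable (Lb (\<omega> \<times> UNIV))"
proof -
  have fm[measurable]: "(\<lambda>x. indicator \<omega> x *\<^sub>R f x) \<in> borel_measurable borel"
    using f om by (simp add: borel_measurable_restrict_space_iff)
  have km[measurable]: "k \<in> borel_measurable borel" using k by simp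
  have "(\<lambda>z::'a \<times> real. (indicator \<omega> (fst z) *\<^sub>R f (fst z)) * k (snd z)) \<in> borel_measurable (borel \<Otimes>\<^sub>M borel)"
    by measurable
  then have "(\<lambda>z::'a \<times> real. (indicator \<omega> (fst z) *\<^sub>R f (fst z)) * k (snd z)) \<in> borel_measurable borel"
    by (simp add: borel_prod)
  also have "(\<lambda>z::'a \<times> real. (indicator \<omega> (fst z) *\<^sub>R f (fst z)) * k (snd z)) = (\<lambda>z. indicator (\<omega> \<times> UNIV) z *\<^sub>R (f (fst z) * k (snd z)))"
    by (auto simp: indicator_def fun_eq_iff)
  finally show ?thesis using cylinder_borel[OF om] by (simp add: borel_measurable_restrict_space_iff)
qed

lemma cylinder_product_integrable:
  fixes f :: "'a::euclidean_space \<Rightarrow> real" and k :: "real \<Rightarrow> real"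
  assumes om: "\<omega> \<in> sets borel" and f: "integrable (Lb \<omega>) f" and k: "integrable lborel k"
  shows "integrable (Lb (\<omega> \<times> UNIV)) (\<lambda>z. f (fst z) * k (snd z))"
    and "(\<integral>z. f (fst z) * k (snd z) \<partial>Lb (\<omega> \<times> UNIV)) = (\<integral>x. f x \<partial>Lb \<omega>) * (\<integral>s. k s \<partial>lborel)"
proof -
  define F where "F z = indicator \<omega> (fst z) *\<^sub>R f (fst z) * k (snd z)" for z :: "'a \<times> real"
  have eq: "(\<lambda>z. indicator (\<omega> \<times> UNIV) z * (f (fst z) * k (snd z))) = F"
    by (auto simp: F_def indicator_def fun_eq_iff)
  have m: "F \<in> borel_measurable (lborel \<Otimes>\<^sub>M lborel)"
    using cylinder_product_measurable[OF om, of f k] f k cylinder_borel[OF om]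
    by (simp add: borel_measurable_restrict_space_iff eq lborel_prod)
  have fi: "integrable lborel (\<lambda>x. indicator \<omega> x *\<^sub>R f x)" using f om by (simp add: integrable_restrict_space)
  have "integrable (lborel \<Otimes>\<^sub>M lborel) F"
  proof (rule lborel_pair.Fubini_integrable[OF m])
    have eq2: "(\<lambda>x. \<integral>s. norm (F (x, s)) \<partial>lborel) = (\<lambda>x. norm (indicator \<omega> x *\<^sub>R f x) * (\<integral>s. norm (k s) \<partial>lborel))"
      by (simp add: F_def abs_mult)
    show "integrable lborel (\<lambda>x. \<integral>s. norm (F (x, s)) \<partial>lborel)"
      unfolding eq2 by (intro integrable_mult_left integrable_norm fi)
    show "AE x in lborel. integrable lborel (\<lambda>s. F (x, s))"
      unfolding F_def using k by simp
  qed
  then show i: "integrable (Lb (\<omega> \<times> UNIV)) (\<lambda>z. f (fst z) * k (snd z))"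
    using cylinder_borel[OF om] by (simp add: integrable_restrict_space eq lborel_prod)
  show "(\<integral>z. f (fst z) * k (snd z) \<partial>Lb (\<omega> \<times> UNIV)) = (\<integral>x. f x \<partial>Lb \<omega>) * (\<integral>s. k s \<partial>lborel)"
    using cylinder_Fubini(3)[OF om i] by simp
qed

lemma cylinder_product_L2:
  fixes f :: "'a::euclidean_space \<Rightarrow> real" and k :: "real \<Rightarrow> real"
  assumes om: "\<omega> \<in> sets borel" and f: "L2 (Lb \<omega>) f" and k: "L2 lborel k"
  shows "L2 (Lb (\<omega> \<times> UNIV)) (\<lambda>z. f (fst z) * k (snd z))"
    and "(\<integral>z. (f (fst z) * k (snd z))\<^sup>2 \<partial>Lb (\<omega> \<times> UNIV)) = (\<integral>x. (f x)\<^sup>2 \<partial>Lb \<omega>) * (\<integral>s. (k s)\<^sup>2 \<partial>lborel)"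
  using cylinder_product_integrable[OF om L2_square[OF f] L2_square[OF k]]
    cylinder_product_measurable[OF om L2_measurable[OF f] L2_measurable[OF k]]
  by (auto simp: L2_def power_mult_distrib)

lemma cylinder_product_L2conv:
  fixes f :: "'a::euclidean_space \<Rightarrow> real" and k :: "real \<Rightarrow> real"
  assumes om: "\<omega> \<in> sets borel" and c: "L2conv (Lb \<omega>) u f" and u: "\<And>n. L2 (Lb \<omega>) (u n)" and f: "L2 (Lb \<omega>) f" and k: "L2 lborel k"
  shows "L2conv (Lb (\<omega> \<times> UNIV)) (\<lambda>n z. u n (fst z) * k (snd z)) (\<lambda>z. f (fst z) * k (snd z))"
proof -
  have "(\<integral>z. (u n (fst z) * k (snd z) - f (fst z) * k (snd z))\<^sup>2 \<partial>Lb (\<omega> \<times> UNIV))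
     = (\<integral>x. (u n x - f x)\<^sup>2 \<partial>Lb \<omega>) * (\<integral>s. (k s)\<^sup>2 \<partial>lborel)" for n
    using cylinder_product_L2(2)[OF om L2_diff[OF u f] k, of n] by (simp add: left_diff_distrib)
  then show ?thesis
    using c unfolding L2conv_def by (simp add: tendsto_mult_left_zero)
qed

lemma Lb_UNIV: "Lb UNIV = lborel"
  by (rule measure_eqI) (auto simp: sets_restrict_space emeasure_restrict_space)

text \<open>Approximants of \<open>f\<close> multiplied by the fixed \<open>k\<close> approximate
  the product and still vanish near the lateral Dirichlet part. The test on \<open>snd e\<close>
  separates the transverse basis vectors \<open>(i, 0)\<close> from the longitudinal one
  \<open>(0, 1)\<close>.\<close>

lemma hasgrad_product:
  fixes \<omega> :: "'a::euclidean_space set" and k :: "real \<Rightarrow> real"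
  assumes om: "open \<omega>" and g: "hasgrad \<omega> G f h" and k: "C1c UNIV k"
  shows "hasgrad (\<omega> \<times> UNIV) (G \<times> UNIV) (\<lambda>z. f (fst z) * k (snd z))
     (\<lambda>e z. if snd e = 0 then h (fst e) (fst z) * k (snd z) else f (fst z) * dd k (snd e) (snd z))"
proof -
  have omb: "\<omega> \<in> sets borel" using om by simp
  obtain \<phi> where p: "\<And>n. C1c UNIV (\<phi> n)" "\<And>n. supp (\<phi> n) \<inter> G = {}" "L2conv (Lb \<omega>) \<phi> f"
    "\<And>e. e \<in> Basis \<Longrightarrow> L2conv (Lb \<omega>) (\<lambda>n. dd (\<phi> n) e) (h e)"
    using hasgrad_approx[OF g] by blast
  have kL: "L2 lborel k" "L2 lborel (dd k v)" for v using C1c_L2[of UNIV UNIV k] k by (simp_all add: Lb_UNIV)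
  have pL: "L2 (Lb \<omega>) (\<phi> n)" "L2 (Lb \<omega>) (dd (\<phi> n) e)" for n e using C1c_L2[OF omb p(1)] by auto
  note fL = hasgrad_L2[OF g]
  define \<Phi> where "\<Phi> n z = \<phi> n (fst z) * k (snd z)" for n and z :: "'a \<times> real"
  have C: "C1 (\<Phi> n)" and D: "dd (\<Phi> n) e z = \<phi> n (fst z) * dd k (snd e) (snd z) + dd (\<phi> n) (fst e) (fst z) * k (snd z)" for n e z
  proof -
    note a = C1_compose_linear[OF C1c_C1[OF p(1)] bounded_linear_fst, of n]
    note b = C1_compose_linear[OF C1c_C1[OF k] bounded_linear_snd]
    show "C1 (\<Phi> n)" unfolding \<Phi>_def[abs_def] by (rule C1_mult(1)[OF a(1) b(1)])
    show "dd (\<Phi> n) e z = \<phi> n (fst z) * dd k (snd e) (snd z) + dd (\<phi> n) (fst e) (fst z) * k (snd z)"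
      unfolding \<Phi>_def[abs_def] C1_mult(2)[OF a(1) b(1)] a(2) b(2) ..
  qed
  have s: "supp (\<Phi> n) \<subseteq> supp (\<phi> n) \<times> supp k" for n
  proof -
    have "{z. \<Phi> n z \<noteq> 0} \<subseteq> {x. \<phi> n x \<noteq> 0} \<times> {x. k x \<noteq> 0}" by (auto simp: \<Phi>_def)
    then show ?thesis unfolding closure_Times[symmetric] by (rule closure_mono)
  qed
  have "C1c UNIV (\<Phi> n)" for n
  proof -
    have "compact (supp (\<phi> n) \<times> supp k)" using p(1) k unfolding C1c_iff by (intro compact_Times) blast+
    then have "compact (supp (\<Phi> n))" using s[of n] by (metis closed_closure compact_Int_closed inf.absorb_iff2)
    then show ?thesis using C by (simp add: C1c_iff)
  qed
  moreover have "supp (\<Phi> n) \<inter> (G \<times> UNIV) = {}" for n using s[of n] p(2)[of n] by blast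
  moreover have "L2conv (Lb (\<omega> \<times> UNIV)) \<Phi> (\<lambda>z. f (fst z) * k (snd z))"
    unfolding \<Phi>_def[abs_def] by (rule cylinder_product_L2conv[OF omb p(3) pL(1) fL(1) kL(1)])
  moreover have "L2conv (Lb (\<omega> \<times> UNIV)) (\<lambda>n. dd (\<Phi> n) e)
      (\<lambda>z. if snd e = 0 then h (fst e) (fst z) * k (snd z) else f (fst z) * dd k (snd e) (snd z))"
    and "L2 (Lb (\<omega> \<times> UNIV)) (\<lambda>z. if snd e = 0 then h (fst e) (fst z) * k (snd z) else f (fst z) * dd k (snd e) (snd z))"
    if e: "e \<in> Basis" for e
  proof -
    have lin0: "dd k 0 x = 0" "dd (\<phi> n) 0 y = 0" for n x y
      using linear_0[OF C1_linear_dd[OF C1c_C1[OF k]]] linear_0[OF C1_linear_dd[OF C1c_C1[OF p(1)]]] by auto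
    consider i where "i \<in> Basis" "e = (i, 0)" | "e = (0, 1)" using e by (auto simp: Basis_prod_def)
    then have "L2conv (Lb (\<omega> \<times> UNIV)) (\<lambda>n. dd (\<Phi> n) e)
      (\<lambda>z. if snd e = 0 then h (fst e) (fst z) * k (snd z) else f (fst z) * dd k (snd e) (snd z)) \<and>
      L2 (Lb (\<omega> \<times> UNIV)) (\<lambda>z. if snd e = 0 then h (fst e) (fst z) * k (snd z) else f (fst z) * dd k (snd e) (snd z))"
    proof cases
      case 1
      have "(\<lambda>n. dd (\<Phi> n) e) = (\<lambda>n z. dd (\<phi> n) i (fst z) * k (snd z))" by (intro ext) (simp add: D 1 lin0)
      then show ?thesis
        using cylinder_product_L2conv[OF omb p(4)[OF 1(1)] pL(2) fL(2)[OF 1(1)] kL(1)]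
          cylinder_product_L2(1)[OF omb fL(2)[OF 1(1)] kL(1)] by (simp add: 1)
    next
      case 2
      have "(\<lambda>n. dd (\<Phi> n) e) = (\<lambda>n z. \<phi> n (fst z) * dd k 1 (snd z))" by (intro ext) (simp add: D 2 lin0)
      then show ?thesis
        using cylinder_product_L2conv[OF omb p(3) pL(1) fL(1) kL(2), of 1]
          cylinder_product_L2(1)[OF omb fL(1) kL(2), of 1] by (simp add: 2)
    qed
    then show "L2conv (Lb (\<omega> \<times> UNIV)) (\<lambda>n. dd (\<Phi> n) e)
      (\<lambda>z. if snd e = 0 then h (fst e) (fst z) * k (snd z) else f (fst z) * dd k (snd e) (snd z))"
      "L2 (Lb (\<omega> \<times> UNIV)) (\<lambda>z. if snd e = 0 then h (fst e) (fst z) * k (snd z) else f (fst z) * dd k (snd e) (snd z))"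
      by auto
  qed
  moreover have "L2 (Lb (\<omega> \<times> UNIV)) (\<lambda>z. f (fst z) * k (snd z))"
    by (rule cylinder_product_L2(1)[OF omb fL(1) kL(1)])
  ultimately show ?thesis unfolding hasgrad_def by (intro conjI ballI exI[of _ \<Phi>]) auto
qed

text \<open>Makes a coordinate times the eigenfunction admissible in the eigenvalue equation. On a
  bounded set multiplication by a coordinate is continuous in L2 and preserves the vanishing near
  \<open>G\<close>.\<close>

lemma hasgrad_coordinate_mult:
  fixes U :: "'a::euclidean_space set"
  assumes U: "open U" "bounded U" and g: "hasgrad U G f h"
  shows "hasgrad U G (\<lambda>x. (x \<bullet> j) * f x) (\<lambda>e x. (e \<bullet> j) * f x + (x \<bullet> j) * h e x)"
proof -
  have Ub: "U \<in> sets borel" using U by simp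
  have sp: "space (Lb U) = U" by (simp add: space_restrict_space)
  obtain \<phi> where p: "\<And>n. C1c UNIV (\<phi> n)" "\<And>n. supp (\<phi> n) \<inter> G = {}" "L2conv (Lb U) \<phi> f"
    "\<And>e. e \<in> Basis \<Longrightarrow> L2conv (Lb U) (\<lambda>n. dd (\<phi> n) e) (h e)"
    using hasgrad_approx[OF g] by blast
  have pL: "L2 (Lb U) (\<phi> n)" "L2 (Lb U) (dd (\<phi> n) e)" for n e using C1c_L2[OF Ub p(1)] by auto
  note fL = hasgrad_L2[OF g]
  obtain R where R: "\<And>x. x \<in> U \<Longrightarrow> norm x \<le> R" using U(2) unfolding bounded_iff by blast
  have jb: "\<bar>x \<bullet> j\<bar> \<le> R * norm j" if "x \<in> space (Lb U)" for x
    using Cauchy_Schwarz_ineq2[of x j] R[of x] that sp mult_right_mono[of "norm x" R "norm j"] by force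
  have jm: "(\<lambda>x. x \<bullet> j) \<in> borel_measurable (Lb U)" by (intro Lb_measurable) simp
  have lin: "bounded_linear (\<lambda>x. x \<bullet> j)" by (rule bounded_linear_inner_left)
  let ?\<Phi> = "\<lambda>n x. (x \<bullet> j) * \<phi> n x"
  have D: "(\<lambda>n. dd (?\<Phi> n) e) = (\<lambda>n x. 1 * ((x \<bullet> j) * dd (\<phi> n) e x) + (e \<bullet> j) * \<phi> n x)" for e
    using C1_mult(2)[OF C1_linear(1)[OF lin] C1c_C1[OF p(1)]] C1_linear(2)[OF lin] by (intro ext) simp
  have "C1c UNIV (?\<Phi> n)" for n by (rule C1c_mult_right[OF C1_linear(1)[OF lin] p(1)])
  moreover have "supp (?\<Phi> n) \<inter> G = {}" for n
  proof -
    have "supp (?\<Phi> n) \<subseteq> supp (\<phi> n)" by (intro closure_mono) auto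
    then show ?thesis using p(2)[of n] by blast
  qed
  moreover have "L2conv (Lb U) ?\<Phi> (\<lambda>x. (x \<bullet> j) * f x)" by (rule L2conv_bmult[OF p(3) pL(1) fL(1) jb])
  moreover have "L2conv (Lb U) (\<lambda>n. dd (?\<Phi> n) e) (\<lambda>x. (e \<bullet> j) * f x + (x \<bullet> j) * h e x)" if e: "e \<in> Basis" for e
  proof -
    have "L2conv (Lb U) (\<lambda>n. dd (?\<Phi> n) e) (\<lambda>x. 1 * ((x \<bullet> j) * h e x) + (e \<bullet> j) * f x)"
      unfolding D
      by (rule L2conv_lincomb[OF L2conv_bmult[OF p(4)[OF e] pL(2) fL(2)[OF e] jb] L2_bmult[OF pL(2) jm jb] L2_bmult[OF fL(2)[OF e] jm jb] p(3) pL(1) fL(1)])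
    then show ?thesis by (simp add: add.commute)
  qed
  moreover have "L2 (Lb U) (\<lambda>x. (x \<bullet> j) * f x)" by (rule L2_bmult[OF fL(1) jm jb])
  moreover have "L2 (Lb U) (\<lambda>x. (e \<bullet> j) * f x + (x \<bullet> j) * h e x)" if e: "e \<in> Basis" for e
    by (rule L2_add[OF L2_cmult[OF fL(1)] L2_bmult[OF fL(2)[OF e] jm jb]])
  ultimately show ?thesis unfolding hasgrad_def by (intro conjI ballI exI[of _ ?\<Phi>]) auto
qed

section \<open>Longitudinal cutoffs of small energy\<close>

definition plateau :: "real \<Rightarrow> real \<Rightarrow> real" where
  "plateau n s = (max 0 (1 - (s / n)\<^sup>2))\<^sup>2"

text \<open>On [-n, n] the derivative is at most 4/n in modulus, and the interval has length 2n,
  whence the bound 16/n^2 times 2n. It tends to 0 while the cutoff itself tends to 1.\<close>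

lemma plateau:
  assumes n: "n > 0"
  shows "C1c UNIV (plateau n)" "0 \<le> plateau n s" "plateau n s \<le> 1"
    and "(\<integral>s. (dd (plateau n) 1 s)\<^sup>2 \<partial>lborel) \<le> 32 / n"
proof -
  have f: "C1 (\<lambda>s. 1 - (s / n)\<^sup>2)" and df: "dd (\<lambda>s. 1 - (s / n)\<^sup>2) v s = - 2 * s * v / n\<^sup>2" for v s :: real
  proof -
    have d: "((\<lambda>s. 1 - (s / n)\<^sup>2) has_derivative (\<lambda>v. - 2 * s * v / n\<^sup>2)) (at s)" for s
      using n by (auto intro!: derivative_eq_intros simp: power2_eq_square)
    have c: "continuous_on UNIV (\<lambda>s. - 2 * s * v / n\<^sup>2)" for v by (intro continuous_intros) (use n in auto)
    show "C1 (\<lambda>s. 1 - (s / n)\<^sup>2)" by (rule C1I(1)[OF d c])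
    show "dd (\<lambda>s. 1 - (s / n)\<^sup>2) v s = - 2 * s * v / n\<^sup>2" by (rule C1I(2)[OF d c])
  qed
  have cm: "continuous_on UNIV (\<lambda>t::real. 2 * max 0 t)" by (intro continuous_intros)
  have C: "C1 (plateau n)"
    unfolding plateau_def[abs_def] by (rule C1_compose_real(1)[OF f has_derivative_max_square cm])
  have D: "dd (plateau n) 1 s = 2 * max 0 (1 - (s / n)\<^sup>2) * (- 2 * s / n\<^sup>2)" for s
    using C1_compose_real(2)[OF f has_derivative_max_square cm, where v=1 and x=s] unfolding plateau_def[abs_def] df by simp
  have out: "1 - (s / n)\<^sup>2 \<le> 0" if "s \<notin> {-n..n}" for s
  proof -
    have "\<bar>n\<bar> \<le> \<bar>s\<bar>" using that n by auto
    then have "n\<^sup>2 \<le> s\<^sup>2" by (simp only: abs_le_square_iff)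
    then show ?thesis using n by (simp add: power_divide pos_le_divide_eq)
  qed
  have "{s. plateau n s \<noteq> 0} \<subseteq> {-n..n}"
  proof
    fix s assume "s \<in> {s. plateau n s \<noteq> 0}"
    then show "s \<in> {-n..n}"
      using max_absorb1[OF out, of s] by (cases "s \<in> {-n..n}") (simp_all add: plateau_def)
  qed
  then have "supp (plateau n) \<subseteq> {-n..n}" by (intro closure_minimal) auto
  then have "compact (supp (plateau n))"
    by (metis closed_closure compact_Icc compact_Int_closed inf.absorb_iff2)
  then show C1c: "C1c UNIV (plateau n)" using C by (simp add: C1c_iff)
  have m1: "0 \<le> max 0 (1 - (s / n)\<^sup>2)" "max 0 (1 - (s / n)\<^sup>2) \<le> 1" for s by auto
  show "0 \<le> plateau n s" "plateau n s \<le> 1" using m1[of s] by (auto simp: plateau_def power_le_one)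
  have sq: "(dd (plateau n) 1 s)\<^sup>2 \<le> (16 / n\<^sup>2) * indicator {-n..n} s" for s
  proof (cases "s \<in> {-n..n}")
    case True
    then have "\<bar>s\<bar> \<le> n" by auto
    have "\<bar>dd (plateau n) 1 s\<bar> = 2 * max 0 (1 - (s / n)\<^sup>2) * (2 * \<bar>s\<bar> / n\<^sup>2)"
      using m1(1)[of s] by (simp add: D abs_mult)
    also have "\<dots> \<le> 2 * 1 * (2 * n / n\<^sup>2)"
      using m1[of s] \<open>\<bar>s\<bar> \<le> n\<close> n by (intro mult_mono divide_right_mono) auto
    also have "\<dots> = 4 / n" using n by (simp add: power2_eq_square)
    finally have "\<bar>dd (plateau n) 1 s\<bar>\<^sup>2 \<le> (4 / n)\<^sup>2" by (intro power_mono) auto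
    then show ?thesis using True by (simp add: power_divide)
  next
    case False
    then show ?thesis using max_absorb1[OF out[OF False]] by (simp add: D)
  qed
  have "(\<integral>s. (dd (plateau n) 1 s)\<^sup>2 \<partial>lborel) \<le> (\<integral>s. (16 / n\<^sup>2) * indicator {-n..n} s \<partial>lborel)"
  proof (rule integral_mono)
    show "integrable lborel (\<lambda>s. (dd (plateau n) 1 s)\<^sup>2)"
      using L2_square[OF C1c_L2(2)[of UNIV UNIV "plateau n" 1]] C1c by (simp add: Lb_UNIV)
    show "integrable lborel (\<lambda>s. (16 / n\<^sup>2) * indicator {-n..n} s :: real)"
      by (intro integrable_mult_right integrable_real_indicator) (simp_all add: emeasure_bounded_finite[unfolded infinity_ennreal_def])
  qed (rule sq)
  also have "\<dots> = 32 / n" using n by (simp add: power2_eq_square)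
  finally show "(\<integral>s. (dd (plateau n) 1 s)\<^sup>2 \<partial>lborel) \<le> 32 / n" .
qed

lemma plateau_tendsto: "(\<lambda>n. plateau (real (Suc n)) s) \<longlonglongrightarrow> 1"
proof -
  have "(\<lambda>n. inverse (real (Suc n))) \<longlonglongrightarrow> 0" by (rule LIMSEQ_inverse_real_of_nat)
  then have "(\<lambda>n. (max 0 (1 - (s * inverse (real (Suc n)))\<^sup>2))\<^sup>2) \<longlonglongrightarrow> (max 0 (1 - (s * 0)\<^sup>2))\<^sup>2"
    by (intro tendsto_intros)
  then show ?thesis by (simp add: plateau_def divide_inverse)
qed

lemma sum_Basis_prod:
  fixes f :: "'a::euclidean_space \<times> 'b::euclidean_space \<Rightarrow> 'c::comm_monoid_add"
  shows "sum f Basis = (\<Sum>i\<in>Basis. f (i, 0)) + (\<Sum>i\<in>Basis. f (0, i))"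
proof -
  have "sum f Basis = sum f ((\<lambda>u. (u, 0)) ` Basis) + sum f ((\<lambda>v. (0, v)) ` Basis)"
    unfolding Basis_prod_def by (intro sum.union_disjoint) auto
  also have "\<dots> = (\<Sum>i\<in>Basis. f (i, 0)) + (\<Sum>i\<in>Basis. f (0, i))"
    by (simp add: sum.reindex inj_on_def)
  finally show ?thesis .
qed

lemma sum_Basis_R3: "(\<Sum>e\<in>(Basis :: ((real \<times> real) \<times> real) set). f e) = f e1 + f e2 + f e3"
  unfolding e1_def e2_def e3_def by (simp add: sum_Basis_prod zero_prod_def add_ac)

lemma sum_Basis_R2: "(\<Sum>e\<in>(Basis :: (real \<times> real) set). f e) = f (1, 0) + f (0, 1)"
  by (simp add: sum_Basis_prod)

lemma Basis_R2: "(1, 0) \<in> (Basis :: (real \<times> real) set)" "(0, 1) \<in> (Basis :: (real \<times> real) set)"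
  by (auto simp: Basis_prod_def)

definition tube_weight :: "(real \<Rightarrow> real) \<Rightarrow> (real \<Rightarrow> real) \<Rightarrow> (real \<times> real) \<times> real \<Rightarrow> (real \<times> real) \<times> real \<Rightarrow> real" where
  "tube_weight \<kappa> \<beta> e = (if snd e = 0 then gw \<kappa> \<beta> else (\<lambda>z. 1 / gw \<kappa> \<beta> z))"

section \<open>The bent tube\<close>

text \<open>The curve enters only through the curvature, the angle and the two-sided bound on the
  weight. Since \<open>gw\<close> is at most 2, its inverse is at least 1/2, so
  \<open>m0 \<le> 1/2\<close> makes \<open>m0\<close> a common lower bound for the weight and its
  inverse.\<close>

locale bent_tube =
  fixes \<omega> \<gamma>D :: "(real \<times> real) set" and lam :: real and psi :: "real \<times> real \<Rightarrow> real"
    and \<kappa> \<beta> :: "real \<Rightarrow> real" and m0 :: real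
  assumes om: "open \<omega>" and bd: "bounded \<omega>"
    and psi_dom: "H1_0_on \<omega> \<gamma>D psi"
    and psi_ef: "\<And>v. H1_0_on \<omega> \<gamma>D v \<Longrightarrow> cs_form \<omega> psi v = lam * cs_ip \<omega> psi v"
    and psi_pos: "\<And>x. x \<in> \<omega> \<Longrightarrow> psi x > 0"
    and psi_norm: "cs_ip \<omega> psi psi = 1"
    and kcont: "continuous_on UNIV \<kappa>" and bcont: "continuous_on UNIV \<beta>"
    and m0: "0 < m0" "m0 \<le> 1/2" and gw_bd: "\<And>x s. x \<in> \<omega> \<Longrightarrow> m0 \<le> gw \<kappa> \<beta> (x, s) \<and> gw \<kappa> \<beta> (x, s) \<le> 2"
begin

abbreviation "Q \<equiv> \<omega> \<times> (UNIV :: real set)"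
abbreviation "g \<equiv> gw \<kappa> \<beta>"

lemma g_eq: "g z = 1 - \<kappa> (snd z) * (cos (\<beta> (snd z)) * (fst z \<bullet> (1, 0)) + sin (\<beta> (snd z)) * (fst z \<bullet> (0, 1)))"
  by (cases z) (auto simp: gw_def algebra_simps)

lemma g_cont: "continuous_on UNIV g"
proof -
  have "continuous_on UNIV (\<lambda>z::(real\<times>real)\<times>real. \<kappa> (snd z))" "continuous_on UNIV (\<lambda>z::(real\<times>real)\<times>real. \<beta> (snd z))"
    using continuous_on_compose2[OF kcont continuous_on_snd[OF continuous_on_id]]
      continuous_on_compose2[OF bcont continuous_on_snd[OF continuous_on_id]] by auto
  then show ?thesis unfolding g_eq[abs_def] by (intro continuous_intros)
qed

lemma g_meas: "g \<in> borel_measurable borel"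
  by (rule borel_measurable_continuous_onI[OF g_cont])

lemma omb: "\<omega> \<in> sets borel" using om by simp

lemma Qo: "open Q" using om by (simp add: open_Times)

sublocale cs: weighted_form \<omega> \<gamma>D "\<lambda>_. 1" "\<lambda>_ _. 1" 1 1
  by unfold_locales (auto simp: om)

sublocale tf: weighted_form Q "\<gamma>D \<times> UNIV" g "tube_weight \<kappa> \<beta>" m0 "max 2 (1 / m0)"
proof
  fix z :: "(real \<times> real) \<times> real" and e :: "(real \<times> real) \<times> real"
  assume "e \<in> Basis"
  show "tube_weight \<kappa> \<beta> e \<in> borel_measurable (Lb Q)"
    unfolding tube_weight_def using g_meas by (auto intro!: Lb_measurable borel_measurable_divide)
  assume z: "z \<in> Q"
  then have b: "m0 \<le> g z" "g z \<le> 2" using gw_bd[of "fst z" "snd z"] by (cases z, auto)+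
  then have "1 / g z \<le> 1 / m0" using m0 by (intro divide_left_mono) auto
  moreover have "1 / 2 \<le> 1 / g z" using b m0 by (intro divide_left_mono) auto
  then have "m0 \<le> 1 / g z" using m0(2) by linarith
  ultimately show "m0 \<le> tube_weight \<kappa> \<beta> e z \<and> tube_weight \<kappa> \<beta> e z \<le> max 2 (1 / m0)"
    using b m0 by (auto simp: tube_weight_def)
next
  fix z :: "(real \<times> real) \<times> real" assume z: "z \<in> Q"
  then have "m0 \<le> g z \<and> g z \<le> 2" using gw_bd[of "fst z" "snd z"] by (cases z) auto
  then show "m0 \<le> g z \<and> g z \<le> max 2 (1 / m0)" by linarith
qed (use m0 g_meas Qo in \<open>auto intro: Lb_measurable\<close>)

lemma tube_form_eq: "tube_form \<omega> \<kappa> \<beta> = tf.aw"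
proof (intro ext)
  fix u v
  show "tube_form \<omega> \<kappa> \<beta> u v = tf.aw u v"
    unfolding tube_form_def tf.aw_def Lb_integral[OF tf.Ub] sum_Basis_R3 tube_weight_def
    by (intro Bochner_Integration.integral_cong) (auto simp: e1_def e2_def e3_def algebra_simps)
qed

lemma tube_ip_eq: "tube_ip \<omega> \<kappa> \<beta> = tf.ipw"
  unfolding tube_ip_def tf.ipw_def Lb_integral[OF tf.Ub] ..

lemma T_spectrum_eq: "T_spectrum \<omega> \<gamma>D \<kappa> \<beta> = form_spectrum tf.H tf.D tf.aw tf.ipw"
  "T_discrete_spectrum \<omega> \<gamma>D \<kappa> \<beta> = form_discrete_spectrum tf.H tf.D tf.aw tf.ipw"
  by (simp_all add: T_spectrum_def T_discrete_spectrum_def tube_form_eq tube_ip_eq tf.H_def tf.D_def)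

definition "h e = wd \<omega> e psi"

lemma psi_grad: "hasgrad \<omega> \<gamma>D psi h"
  unfolding h_def[abs_def] by (rule H1_0_hasgrad[OF om psi_dom])

lemma psi_L2: "L2 (Lb \<omega>) psi" and h_L2: "e \<in> Basis \<Longrightarrow> L2 (Lb \<omega>) (h e)"
  using hasgrad_L2[OF psi_grad] by auto

lemma psi_weak:
  assumes "hasgrad \<omega> \<gamma>D w k"
  shows "(\<Sum>e\<in>Basis. \<integral>x. h e x * k e x \<partial>Lb \<omega>) = lam * (\<integral>x. psi x * w x \<partial>Lb \<omega>)"
proof -
  have "cs_form \<omega> psi w = cs.aw psi w"
    by (simp add: cs_form_def cs.aw_def Lb_integral[OF omb])
  also have "\<dots> = (\<Sum>e\<in>Basis. \<integral>x. h e x * k e x \<partial>Lb \<omega>)"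
    using cs.aw_hasgrad[OF psi_grad assms] by simp
  finally have "(\<Sum>e\<in>Basis. \<integral>x. h e x * k e x \<partial>Lb \<omega>) = cs_form \<omega> psi w" by simp
  also have "\<dots> = lam * cs_ip \<omega> psi w" by (rule psi_ef[OF hasgrad_H1_0[OF om assms]])
  finally show ?thesis by (simp add: cs_ip_def Lb_integral[OF omb])
qed

lemma psi_norm': "(\<integral>x. (psi x)\<^sup>2 \<partial>Lb \<omega>) = 1"
  using psi_norm by (simp add: cs_ip_def Lb_integral[OF omb] power2_eq_square)

lemma lam_nonneg: "0 \<le> lam"
proof -
  have "lam = (\<Sum>e\<in>Basis. \<integral>x. h e x * h e x \<partial>Lb \<omega>)"
    using psi_weak[OF psi_grad] psi_norm' by (simp add: power2_eq_square)
  also have "\<dots> \<ge> 0" by (intro sum_nonneg Bochner_Integration.integral_nonneg) simp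
  finally show ?thesis .
qed

text \<open>The local surplus of the eigenfunction's energy over its eigenvalue share; it enters
  only through integrals against functions affine in x.\<close>

definition "excess x = (\<Sum>e\<in>Basis. (h e x)\<^sup>2) - lam * (psi x)\<^sup>2"

lemma excess_integrable: "integrable (Lb \<omega>) excess"
  unfolding excess_def[abs_def]
  by (intro Bochner_Integration.integrable_diff Bochner_Integration.integrable_sum integrable_mult_right L2_square psi_L2 h_L2)

lemma excess_integral: "(\<integral>x. excess x \<partial>Lb \<omega>) = 0"
  using psi_weak[OF psi_grad] L2_square[OF psi_L2] L2_square[OF h_L2]
  unfolding excess_def by (simp add: power2_eq_square)

lemma coord_bound: "\<exists>R. \<forall>x\<in>space (Lb \<omega>). \<bar>x \<bullet> j\<bar> \<le> R" for j :: "real \<times> real"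
proof -
  obtain R where R: "\<And>x. x \<in> \<omega> \<Longrightarrow> norm x \<le> R" using bd unfolding bounded_iff by blast
  have "\<bar>x \<bullet> j\<bar> \<le> R * norm j" if "x \<in> space (Lb \<omega>)" for x
    using Cauchy_Schwarz_ineq2[of x j] R[of x] that cs.sp mult_right_mono[of "norm x" R "norm j"] by force
  then show ?thesis by blast
qed

text \<open>The gradient of x_j psi has an extra term psi in direction j. Testing the eigenvalue
  equation with x_j psi therefore yields the first moment of the excess up to the integral of psi
  times the j-th derivative of psi.\<close>

lemma excess_moment:
  assumes j: "j \<in> Basis"
  shows "integrable (Lb \<omega>) (\<lambda>x. (x \<bullet> j) * excess x)" "(\<integral>x. (x \<bullet> j) * excess x \<partial>Lb \<omega>) = - (\<integral>x. psi x * h j x \<partial>Lb \<omega>)"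
proof -
  obtain R where R: "\<And>x. x \<in> space (Lb \<omega>) \<Longrightarrow> \<bar>x \<bullet> j\<bar> \<le> R" using coord_bound[of j] by blast
  have jm: "(\<lambda>x. x \<bullet> j) \<in> borel_measurable (Lb \<omega>)" by (intro Lb_measurable) simp
  have jL: "L2 (Lb \<omega>) (\<lambda>x. (x \<bullet> j) * f x)" if "L2 (Lb \<omega>) f" for f by (rule L2_bmult[OF that jm R])
  have i1: "integrable (Lb \<omega>) (\<lambda>x. (x \<bullet> j) * (f x)\<^sup>2)" if "L2 (Lb \<omega>) f" for f
    using L2_mult[OF jL[OF that] that] by (simp add: power2_eq_square mult.assoc)
  have eq_excess: "(x \<bullet> j) * excess x = (\<Sum>e\<in>Basis. (x \<bullet> j) * (h e x)\<^sup>2) - lam * ((x \<bullet> j) * (psi x)\<^sup>2)" for x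
    by (simp add: excess_def right_diff_distrib sum_distrib_left mult_ac)
  show "integrable (Lb \<omega>) (\<lambda>x. (x \<bullet> j) * excess x)"
    unfolding eq_excess by (intro Bochner_Integration.integrable_diff Bochner_Integration.integrable_sum integrable_mult_right i1 psi_L2 h_L2)
  have "(\<Sum>e\<in>Basis. \<integral>x. h e x * ((e \<bullet> j) * psi x + (x \<bullet> j) * h e x) \<partial>Lb \<omega>) = lam * (\<integral>x. psi x * ((x \<bullet> j) * psi x) \<partial>Lb \<omega>)"
    by (rule psi_weak[OF hasgrad_coordinate_mult[OF om bd psi_grad]])
  also have "(\<Sum>e\<in>Basis. \<integral>x. h e x * ((e \<bullet> j) * psi x + (x \<bullet> j) * h e x) \<partial>Lb \<omega>)
     = (\<Sum>e\<in>Basis. (e \<bullet> j) * (\<integral>x. psi x * h e x \<partial>Lb \<omega>) + (\<integral>x. (x \<bullet> j) * (h e x)\<^sup>2 \<partial>Lb \<omega>))"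
  proof (intro sum.cong refl)
    fix e :: "real \<times> real" assume e: "e \<in> Basis"
    have "(\<integral>x. h e x * ((e \<bullet> j) * psi x + (x \<bullet> j) * h e x) \<partial>Lb \<omega>) = (\<integral>x. (e \<bullet> j) * (psi x * h e x) + (x \<bullet> j) * (h e x)\<^sup>2 \<partial>Lb \<omega>)"
      by (intro Bochner_Integration.integral_cong) (auto simp: power2_eq_square algebra_simps)
    also have "\<dots> = (e \<bullet> j) * (\<integral>x. psi x * h e x \<partial>Lb \<omega>) + (\<integral>x. (x \<bullet> j) * (h e x)\<^sup>2 \<partial>Lb \<omega>)"
      using L2_mult[OF psi_L2 h_L2[OF e]] i1[OF h_L2[OF e]] by simp
    finally show "(\<integral>x. h e x * ((e \<bullet> j) * psi x + (x \<bullet> j) * h e x) \<partial>Lb \<omega>)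
       = (e \<bullet> j) * (\<integral>x. psi x * h e x \<partial>Lb \<omega>) + (\<integral>x. (x \<bullet> j) * (h e x)\<^sup>2 \<partial>Lb \<omega>)" .
  qed
  also have "\<dots> = (\<integral>x. psi x * h j x \<partial>Lb \<omega>) + (\<Sum>e\<in>Basis. \<integral>x. (x \<bullet> j) * (h e x)\<^sup>2 \<partial>Lb \<omega>)"
    using j by (simp add: sum.distrib inner_Basis if_distrib[of "\<lambda>c. c * _"] cong: if_cong)
  finally have "(\<Sum>e\<in>Basis. \<integral>x. (x \<bullet> j) * (h e x)\<^sup>2 \<partial>Lb \<omega>) - lam * (\<integral>x. (x \<bullet> j) * (psi x)\<^sup>2 \<partial>Lb \<omega>) = - (\<integral>x. psi x * h j x \<partial>Lb \<omega>)"
    by (simp add: power2_eq_square mult_ac)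
  moreover have "(\<integral>x. (x \<bullet> j) * excess x \<partial>Lb \<omega>) = (\<Sum>e\<in>Basis. \<integral>x. (x \<bullet> j) * (h e x)\<^sup>2 \<partial>Lb \<omega>) - lam * (\<integral>x. (x \<bullet> j) * (psi x)\<^sup>2 \<partial>Lb \<omega>)"
    unfolding eq_excess using i1[OF psi_L2] i1[OF h_L2] by simp
  ultimately show "(\<integral>x. (x \<bullet> j) * excess x \<partial>Lb \<omega>) = - (\<integral>x. psi x * h j x \<partial>Lb \<omega>)" by simp
qed

definition "A1 = (\<integral>x. psi x * h (1, 0) x \<partial>Lb \<omega>)"
definition "A2 = (\<integral>x. psi x * h (0, 1) x \<partial>Lb \<omega>)"
definition "bend s = \<kappa> s * (A1 * cos (\<beta> s) + A2 * sin (\<beta> s))"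

lemma bend_cont: "continuous_on UNIV bend"
  unfolding bend_def[abs_def] by (intro continuous_intros kcont bcont)

text \<open>For fixed \<open>s\<close> the weight is affine in \<open>x\<close>: its constant part
  integrates to 0 against the excess, and the two minus signs, from \<open>g\<close> and from the
  first moments, cancel.\<close>

lemma weighted_excess_slice: "(\<integral>x. g (x, s) * excess x \<partial>Lb \<omega>) = bend s"
proof -
  have "(\<integral>x. g (x, s) * excess x \<partial>Lb \<omega>)
     = (\<integral>x. excess x - \<kappa> s * cos (\<beta> s) * ((x \<bullet> (1, 0)) * excess x) - \<kappa> s * sin (\<beta> s) * ((x \<bullet> (0, 1)) * excess x) \<partial>Lb \<omega>)"
    by (intro Bochner_Integration.integral_cong) (auto simp: g_eq algebra_simps)
  also have "\<dots> = 0 - \<kappa> s * cos (\<beta> s) * (- A1) - \<kappa> s * sin (\<beta> s) * (- A2)"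
    using excess_integrable excess_moment[OF Basis_R2(1)] excess_moment[OF Basis_R2(2)] excess_integral
    by (simp add: A1_def A2_def)
  also have "\<dots> = bend s" by (simp add: bend_def algebra_simps)
  finally show ?thesis .
qed

text \<open>The transverse part is computed exactly, slice by slice, and produces the bending term.
  Only the longitudinal part is estimated, by \<open>1 / g \<le> 1 / m0\<close> and the
  normalization of \<open>psi\<close>.\<close>

lemma trial_form:
  assumes k: "C1c UNIV k"
  defines "u \<equiv> \<lambda>z. psi (fst z) * k (snd z)"
  shows "u \<in> tf.D" "tf.aw u u - lam * tf.ipw u u \<le> (\<integral>s. (k s)\<^sup>2 * bend s \<partial>lborel) + (1 / m0) * (\<integral>s. (dd k 1 s)\<^sup>2 \<partial>lborel)"
proof -
  note gr = hasgrad_product[OF om psi_grad k]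
  show "u \<in> tf.D" unfolding u_def by (rule tf.hasgrad_D[OF gr])
  have kL: "L2 lborel k" "L2 lborel (dd k v)" for v using C1c_L2[of UNIV UNIV k] k by (simp_all add: Lb_UNIV)
  have pk: "L2 (Lb Q) (\<lambda>z. f (fst z) * k (snd z))" if "L2 (Lb \<omega>) f" for f
    by (rule cylinder_product_L2(1)[OF omb that kL(1)])
  have gi: "integrable (Lb Q) (\<lambda>z. g z * (f (fst z) * k (snd z)) * (f (fst z) * k (snd z)))" if "L2 (Lb \<omega>) f" for f
    by (rule tf.weight_integrable[OF tf.b_meas tf.b_abs pk[OF that] pk[OF that]])
  have aw: "tf.aw u u = (\<integral>z. g z * (h (1, 0) (fst z) * k (snd z)) * (h (1, 0) (fst z) * k (snd z)) \<partial>Lb Q)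
     + (\<integral>z. g z * (h (0, 1) (fst z) * k (snd z)) * (h (0, 1) (fst z) * k (snd z)) \<partial>Lb Q)
     + (\<integral>z. 1 / g z * (psi (fst z) * dd k 1 (snd z)) * (psi (fst z) * dd k 1 (snd z)) \<partial>Lb Q)"
    unfolding u_def tf.aw_hasgrad[OF gr gr] sum_Basis_R3 by (simp add: e1_def e2_def e3_def tube_weight_def)
  have first: "(\<integral>z. g z * (h (1, 0) (fst z) * k (snd z)) * (h (1, 0) (fst z) * k (snd z)) \<partial>Lb Q)
     + (\<integral>z. g z * (h (0, 1) (fst z) * k (snd z)) * (h (0, 1) (fst z) * k (snd z)) \<partial>Lb Q) - lam * tf.ipw u u
     = (\<integral>s. (k s)\<^sup>2 * bend s \<partial>lborel)"
  proof -
    let ?F = "\<lambda>z. g z * (h (1, 0) (fst z) * k (snd z)) * (h (1, 0) (fst z) * k (snd z))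
       + g z * (h (0, 1) (fst z) * k (snd z)) * (h (0, 1) (fst z) * k (snd z))
       - lam * (g z * (psi (fst z) * k (snd z)) * (psi (fst z) * k (snd z)))"
    note i = gi[OF h_L2[OF Basis_R2(1)]] gi[OF h_L2[OF Basis_R2(2)]] gi[OF psi_L2]
    have Fi: "integrable (Lb Q) ?F" using i by (intro Bochner_Integration.integrable_diff Bochner_Integration.integrable_add integrable_mult_right)
    have eq: "?F z = (k (snd z))\<^sup>2 * (g z * excess (fst z))" for z
      unfolding excess_def sum_Basis_R2 by (simp add: power2_eq_square algebra_simps)
    have "(\<integral>z. ?F z \<partial>Lb Q) = (\<integral>s. (\<integral>x. (k s)\<^sup>2 * (g (x, s) * excess x) \<partial>Lb \<omega>) \<partial>lborel)"
      using cylinder_Fubini(3)[OF omb Fi] unfolding eq by simp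
    also have "\<dots> = (\<integral>s. (k s)\<^sup>2 * bend s \<partial>lborel)" by (simp add: weighted_excess_slice)
    finally show ?thesis using i by (simp add: tf.ipw_def u_def)
  qed
  have second: "(\<integral>z. 1 / g z * (psi (fst z) * dd k 1 (snd z)) * (psi (fst z) * dd k 1 (snd z)) \<partial>Lb Q)
    \<le> (1 / m0) * (\<integral>s. (dd k 1 s)\<^sup>2 \<partial>lborel)"
  proof -
    note pL = cylinder_product_L2[OF omb psi_L2 kL(2)[of 1]]
    have "(\<integral>z. 1 / g z * (psi (fst z) * dd k 1 (snd z)) * (psi (fst z) * dd k 1 (snd z)) \<partial>Lb Q)
       \<le> (\<integral>z. (1 / m0) * (psi (fst z) * dd k 1 (snd z))\<^sup>2 \<partial>Lb Q)"
    proof (rule integral_mono')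
      show "integrable (Lb Q) (\<lambda>z. (1 / m0) * (psi (fst z) * dd k 1 (snd z))\<^sup>2)" using L2_square[OF pL(1)] by simp
      fix z assume "z \<in> space (Lb Q)"
      then have b: "m0 \<le> g z" using tf.sp tf.b_bd by auto
      then have "1 / g z \<le> 1 / m0" using m0 by (auto intro!: divide_left_mono)
      then show "1 / g z * (psi (fst z) * dd k 1 (snd z)) * (psi (fst z) * dd k 1 (snd z)) \<le> (1 / m0) * (psi (fst z) * dd k 1 (snd z))\<^sup>2"
        unfolding power2_eq_square mult.assoc[of "1 / g z"] by (intro mult_right_mono) auto
      show "0 \<le> (1 / m0) * (psi (fst z) * dd k 1 (snd z))\<^sup>2" using m0 by simp
    qed
    also have "\<dots> = (1 / m0) * (\<integral>s. (dd k 1 s)\<^sup>2 \<partial>lborel)" using pL(2) psi_norm' by simp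
    finally show ?thesis .
  qed
  show "tf.aw u u - lam * tf.ipw u u \<le> (\<integral>s. (k s)\<^sup>2 * bend s \<partial>lborel) + (1 / m0) * (\<integral>s. (dd k 1 s)\<^sup>2 \<partial>lborel)"
    unfolding aw using first second by linarith
qed

lemma trial_exists:
  assumes neg: "(LINT s:{a..b}|lborel. bend s) < 0" and outside: "\<And>s. s \<notin> {a..b} \<Longrightarrow> bend s \<le> 0"
  shows "\<exists>u\<in>tf.D. tf.aw u u < lam * tf.ipw u u"
proof -
  let ?k = "\<lambda>n. plateau (real (Suc n))"
  have kp: "C1c UNIV (?k n)" "0 \<le> ?k n s" "?k n s \<le> 1" "(\<integral>s. (dd (?k n) 1 s)\<^sup>2 \<partial>lborel) \<le> 32 / real (Suc n)" for n s
    using plateau[of "real (Suc n)"] by auto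
  define I where "I n = (\<integral>s. indicator {a..b} s * ((?k n s)\<^sup>2 * bend s) \<partial>lborel)" for n
  have bi: "integrable lborel (\<lambda>s. indicator {a..b} s * bend s)"
    using borel_integrable_compact[of "{a..b}" bend] continuous_on_subset[OF bend_cont] by simp
  have kc: "continuous_on UNIV (?k n)" for n by (rule C1_continuous[OF C1c_C1[OF kp(1)]])
  have km: "?k n \<in> borel_measurable borel" for n by (rule borel_measurable_continuous_onI[OF kc])
  have bm: "bend \<in> borel_measurable borel" by (rule borel_measurable_continuous_onI[OF bend_cont])
  have k1: "(?k n s)\<^sup>2 \<le> 1" for n s using kp(2,3)[of n s] by (simp add: power_le_one)
  have Im: "(\<lambda>s. indicator {a..b} s * ((?k n s)\<^sup>2 * bend s)) \<in> borel_measurable lborel" for n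
    using km[of n] bm by (intro borel_measurable_times borel_measurable_indicator borel_measurable_power) auto
  have Ib: "norm (indicator {a..b} s * ((?k n s)\<^sup>2 * bend s)) \<le> \<bar>indicator {a..b} s * bend s\<bar>" for n s
    using k1[of n s] mult_right_mono[of "(?k n s)\<^sup>2" 1 "\<bar>bend s\<bar>"] by (auto simp: indicator_def abs_mult)
  have "(\<lambda>n. I n) \<longlonglongrightarrow> (\<integral>s. indicator {a..b} s * bend s \<partial>lborel)"
    unfolding I_def
  proof (rule integral_dominated_convergence[where w="\<lambda>s. \<bar>indicator {a..b} s * bend s\<bar>"])
    show "(\<lambda>s. indicator {a..b} s * bend s) \<in> borel_measurable lborel"
      using bm by (intro borel_measurable_times borel_measurable_indicator) auto
    show "integrable lborel (\<lambda>s. \<bar>indicator {a..b} s * bend s\<bar>)" using bi by (rule integrable_abs)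
    show "AE s in lborel. (\<lambda>n. indicator {a..b} s * ((?k n s)\<^sup>2 * bend s)) \<longlonglongrightarrow> indicator {a..b} s * bend s"
    proof (rule AE_I2)
      fix s
      have "(\<lambda>n. indicator {a..b} s * ((?k n s)\<^sup>2 * bend s)) \<longlonglongrightarrow> indicator {a..b} s * (1\<^sup>2 * bend s)"
        by (intro tendsto_intros plateau_tendsto)
      then show "(\<lambda>n. indicator {a..b} s * ((?k n s)\<^sup>2 * bend s)) \<longlonglongrightarrow> indicator {a..b} s * bend s" by simp
    qed
  qed (use Im Ib in auto)
  moreover have "(\<lambda>n. (1 / m0) * (32 * inverse (real (Suc n)))) \<longlonglongrightarrow> (1 / m0) * (32 * 0)"
    by (intro tendsto_intros LIMSEQ_inverse_real_of_nat)
  ultimately have "(\<lambda>n. I n + (1 / m0) * (32 * inverse (real (Suc n)))) \<longlonglongrightarrow> (\<integral>s. indicator {a..b} s * bend s \<partial>lborel) + (1 / m0) * (32 * 0)"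
    by (rule tendsto_add)
  moreover have "(\<integral>s. indicator {a..b} s * bend s \<partial>lborel) + (1 / m0) * (32 * 0) < 0"
    using neg by (simp add: set_lebesgue_integral_def)
  ultimately have "\<forall>\<^sub>F n in sequentially. I n + (1 / m0) * (32 * inverse (real (Suc n))) < 0"
    by (rule order_tendstoD)
  then obtain n where n: "I n + (1 / m0) * (32 * inverse (real (Suc n))) < 0" unfolding eventually_sequentially by blast
  let ?u = "\<lambda>z. psi (fst z) * ?k n (snd z)"
  note t = trial_form[OF kp(1), of n]
  have A: "(\<integral>s. (?k n s)\<^sup>2 * bend s \<partial>lborel) \<le> I n"
    unfolding I_def
  proof (rule integral_mono)
    have "compact (supp (?k n))" using kp(1) by (simp only: C1c_iff)
    have sk: "(?k n s)\<^sup>2 * bend s = 0" if "s \<notin> supp (?k n)" for s using notin_supp[OF that] by simp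
    show "integrable lborel (\<lambda>s. (?k n s)\<^sup>2 * bend s)"
      by (rule compact_support_integrable[OF _ \<open>compact (supp (?k n))\<close> sk]) (intro continuous_intros kc bend_cont)
    show "integrable lborel (\<lambda>s. indicator {a..b} s * ((?k n s)\<^sup>2 * bend s))"
      by (rule Bochner_Integration.integrable_bound[OF bi Im]) (use Ib in auto)
    show "(?k n s)\<^sup>2 * bend s \<le> indicator {a..b} s * ((?k n s)\<^sup>2 * bend s)" for s
      using outside[of s] by (cases "s \<in> {a..b}") (auto intro: mult_nonneg_nonpos)
  qed
  have "(\<integral>s. (dd (?k n) 1 s)\<^sup>2 \<partial>lborel) \<le> 32 * inverse (real (Suc n))"
    using kp(4)[of n] by (simp only: divide_inverse)
  then have B: "(1 / m0) * (\<integral>s. (dd (?k n) 1 s)\<^sup>2 \<partial>lborel) \<le> (1 / m0) * (32 * inverse (real (Suc n)))"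
    by (rule mult_left_mono) (use m0 in simp)
  have "tf.aw ?u ?u - lam * tf.ipw ?u ?u < 0"
    by (rule le_less_trans[OF order_trans[OF t(2) add_mono[OF A B]] n])
  then have "tf.aw ?u ?u < lam * tf.ipw ?u ?u" by (simp only: diff_less_0_iff_less)
  then show ?thesis using t(1) by blast
qed

end

section \<open>Compactly supported curvature: slices, local compactness and the finite-rank
  bound\<close>

lemma C1_slice:
  fixes f :: "'a::euclidean_space \<times> real \<Rightarrow> real"
  assumes f: "C1 f"
  shows "C1 (\<lambda>x. f (x, s))" "dd (\<lambda>x. f (x, s)) v x = dd f (v, 0) (x, s)"
proof -
  have d: "((\<lambda>x. f (x, s)) has_derivative (\<lambda>v. dd f (v, 0) (x, s))) (at x)" for x
  proof -
    have "((\<lambda>x. (x, s)) has_derivative (\<lambda>v. (v, 0))) (at x)" by (auto intro!: derivative_eq_intros)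
    from has_derivative_compose[OF this C1_has_derivative[OF f]] show ?thesis .
  qed
  have c: "continuous_on UNIV (\<lambda>x. dd f (v, 0) (x, s))" for v
    by (rule continuous_on_compose2[OF C1_dd_continuous[OF f, of UNIV]]) (auto intro!: continuous_intros)
  show "C1 (\<lambda>x. f (x, s))" by (rule C1I(1)[OF d c])
  show "dd (\<lambda>x. f (x, s)) v x = dd f (v, 0) (x, s)" by (rule C1I(2)[OF d c])
qed

text \<open>The slice of the closed support is closed and contains the points where the sliced
  function is nonzero, hence also the support of the slice; distance from the Dirichlet part is
  inherited.\<close>

lemma C1c_slice:
  fixes f :: "'a::euclidean_space \<times> real \<Rightarrow> real"
  assumes f: "C1c UNIV f" and G: "supp f \<inter> (G \<times> UNIV) = {}"
  shows "C1c UNIV (\<lambda>x. f (x, s))" "supp (\<lambda>x. f (x, s)) \<inter> G = {}"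
proof -
  let ?K = "{x. (x, s) \<in> supp f}"
  have "closed ((\<lambda>x. (x, s)) -` supp f)"
    by (rule closed_vimage) (auto intro!: continuous_intros)
  then have cl: "closed ?K" by (simp add: vimage_def)
  have sub: "supp (\<lambda>x. f (x, s)) \<subseteq> ?K"
    by (rule closure_minimal[OF _ cl]) (use closure_subset[of "{z. f z \<noteq> 0}"] in blast)
  have K: "compact (fst ` supp f)" using f unfolding C1c_iff by (intro compact_continuous_image continuous_intros) auto
  have "supp (\<lambda>x. f (x, s)) \<subseteq> fst ` supp f" using sub by force
  then have "compact (supp (\<lambda>x. f (x, s)))" using K by (metis closed_closure compact_Int_closed inf.absorb_iff2)
  then show "C1c UNIV (\<lambda>x. f (x, s))" using C1_slice(1)[OF C1c_C1[OF f]] by (simp add: C1c_iff)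
  show "supp (\<lambda>x. f (x, s)) \<inter> G = {}" using sub G by blast
qed

lemma gradsq_slice_le:
  fixes f :: "'a::euclidean_space \<times> real \<Rightarrow> real"
  assumes f: "C1 f"
  shows "energy (\<lambda>x. f (x, s)) x \<le> energy f (x, s)"
proof -
  have "gradsq f (x, s) = (\<Sum>i\<in>Basis. (dd f (i, 0) (x, s))\<^sup>2) + (dd f (0, 1) (x, s))\<^sup>2"
    unfolding gradsq_def by (simp add: sum_Basis_prod)
  then show ?thesis by (simp add: energy_def gradsq_def C1_slice(2)[OF f])
qed

locale compact_bent_tube = bent_tube +
  fixes R :: real
  assumes kzero: "\<And>s. \<bar>s\<bar> > R \<Longrightarrow> \<kappa> s = 0"
    and cone: "\<And>p. p \<in> frontier \<omega> \<Longrightarrow> \<exists>r>0. \<exists>v w. \<exists>L\<ge>0. norm v = 1 \<and> norm w = 1 \<and> w \<bullet> v = 0 \<and>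
       (\<forall>q\<in>frontier \<omega> \<inter> ball p r. \<forall>q'\<in>frontier \<omega> \<inter> ball p r. norm (q - q') \<le> L * \<bar>(q - q') \<bullet> v\<bar>)"
begin

lemma transverse_bound:
  assumes "C1c UNIV v" "supp v \<inter> \<gamma>D = {}"
  shows "lam * (\<integral>x. (v x)\<^sup>2 \<partial>Lb \<omega>) \<le> (\<Sum>e\<in>Basis. \<integral>x. (dd v e x)\<^sup>2 \<partial>Lb \<omega>)"
  by (rule barta[OF om psi_grad psi_pos psi_weak[OF hasgrad_C1c[OF om]] assms])

lemma test_integrable:
  fixes f :: "(real \<times> real) \<times> real \<Rightarrow> real"
  assumes "C1c UNIV f"
  shows "integrable (Lb Q) (\<lambda>z. (f z)\<^sup>2)" "integrable (Lb Q) (\<lambda>z. (dd f e z)\<^sup>2)"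
    "integrable (Lb Q) (\<lambda>z. g z * (f z)\<^sup>2)" "integrable (Lb Q) (\<lambda>z. g z * (dd f e z)\<^sup>2)"
proof -
  note L = C1c_L2[OF tf.Ub assms]
  show "integrable (Lb Q) (\<lambda>z. (f z)\<^sup>2)" "integrable (Lb Q) (\<lambda>z. (dd f e z)\<^sup>2)" using L2_square L by blast+
  show "integrable (Lb Q) (\<lambda>z. g z * (f z)\<^sup>2)" "integrable (Lb Q) (\<lambda>z. g z * (dd f e z)\<^sup>2)"
    using tf.weight_integrable[OF tf.b_meas tf.b_abs L(1) L(1)] tf.weight_integrable[OF tf.b_meas tf.b_abs L(2) L(2)]
    by (simp_all add: power2_eq_square mult.assoc)
qed

text \<open>Where |s| > R the curvature vanishes, \<open>g\<close> is 1 and each slice obeys the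
  transverse bound. On the remaining slices the whole term lam g f^2 is absorbed by the correction,
  whose factor 2 is the upper bound of \<open>g\<close>.\<close>

lemma form_lower_bound:
  assumes f: "C1c UNIV f" and G: "supp f \<inter> (\<gamma>D \<times> UNIV) = {}"
  shows "lam * tf.ipw f f \<le> tf.aw f f + 2 * lam * (\<integral>z. indicator {-R..R} (snd z) * (f z)\<^sup>2 \<partial>Lb Q)"
proof -
  have ii: "integrable (Lb Q) (\<lambda>z. indicator {-R..R} (snd z) * (f z)\<^sup>2)"
  proof (rule Bochner_Integration.integrable_bound[OF test_integrable(1)[OF f]])
    have "(\<lambda>z::(real\<times>real)\<times>real. indicator {-R..R} (snd z) :: real) \<in> borel_measurable (borel \<Otimes>\<^sub>M borel)" by measurable
    then have "(\<lambda>z::(real\<times>real)\<times>real. indicator {-R..R} (snd z) :: real) \<in> borel_measurable (Lb Q)"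
      by (intro Lb_measurable) (simp add: borel_prod)
    then show "(\<lambda>z. indicator {-R..R} (snd z) * (f z)\<^sup>2) \<in> borel_measurable (Lb Q)"
      using test_integrable(1)[OF f] by (intro borel_measurable_times) auto
  qed (auto simp: indicator_def)
  define F where "F z = g z * (dd f e1 z)\<^sup>2 + g z * (dd f e2 z)\<^sup>2 - lam * (g z * (f z)\<^sup>2) + 2 * lam * (indicator {-R..R} (snd z) * (f z)\<^sup>2)" for z
  note i = test_integrable[OF f] ii
  have Fi: "integrable (Lb Q) F"
    unfolding F_def by (intro Bochner_Integration.integrable_add Bochner_Integration.integrable_diff integrable_mult_right i)
  have inner: "0 \<le> (\<integral>x. F (x, s) \<partial>Lb \<omega>)" for s
  proof (cases "\<bar>s\<bar> > R")
    case True
    have g1: "g (x, s) = 1" for x using kzero[OF True] by (simp add: g_eq)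
    have F1: "F (x, s) = (dd (\<lambda>x. f (x, s)) (1, 0) x)\<^sup>2 + (dd (\<lambda>x. f (x, s)) (0, 1) x)\<^sup>2 - lam * (f (x, s))\<^sup>2" for x
      using True by (auto simp: F_def g1 C1_slice(2)[OF C1c_C1[OF f]] e1_def e2_def indicator_def)
    note v = C1c_slice[OF f G, of s]
    note vi = L2_square[OF C1c_L2(1)[OF omb v(1)]] L2_square[OF C1c_L2(2)[OF omb v(1)]]
    have "(\<integral>x. F (x, s) \<partial>Lb \<omega>) = (\<integral>x. (dd (\<lambda>x. f (x, s)) (1, 0) x)\<^sup>2 \<partial>Lb \<omega>) + (\<integral>x. (dd (\<lambda>x. f (x, s)) (0, 1) x)\<^sup>2 \<partial>Lb \<omega>) - lam * (\<integral>x. (f (x, s))\<^sup>2 \<partial>Lb \<omega>)"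
      unfolding F1 using vi by simp
    then show ?thesis using transverse_bound[OF v] by (simp add: sum_Basis_R2)
  next
    case False
    show ?thesis
    proof (rule Bochner_Integration.integral_nonneg)
      fix x assume "x \<in> space (Lb \<omega>)"
      then have b: "0 \<le> g (x, s)" "g (x, s) \<le> 2" using gw_bd[of x s] m0 cs.sp by auto
      have "lam * (g (x, s) * (f (x, s))\<^sup>2) \<le> lam * (2 * (f (x, s))\<^sup>2)"
        using b lam_nonneg by (intro mult_left_mono mult_right_mono) auto
      moreover have "0 \<le> g (x, s) * (dd f e1 (x, s))\<^sup>2" "0 \<le> g (x, s) * (dd f e2 (x, s))\<^sup>2" using b by simp_all
      moreover have "indicator {-R..R} (snd (x, s)) = (1::real)" using False by (auto simp: indicator_def)
      ultimately show "0 \<le> F (x, s)" unfolding F_def by simp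
    qed
  qed
  have "0 \<le> (\<integral>z. F z \<partial>Lb Q)"
    unfolding cylinder_Fubini(3)[OF omb Fi] by (intro Bochner_Integration.integral_nonneg inner)
  also have "(\<integral>z. F z \<partial>Lb Q) = (\<integral>z. g z * (dd f e1 z)\<^sup>2 \<partial>Lb Q) + (\<integral>z. g z * (dd f e2 z)\<^sup>2 \<partial>Lb Q) - lam * (\<integral>z. g z * (f z)\<^sup>2 \<partial>Lb Q)
     + 2 * lam * (\<integral>z. indicator {-R..R} (snd z) * (f z)\<^sup>2 \<partial>Lb Q)"
    unfolding F_def using i by simp
  also have "(\<integral>z. g z * (f z)\<^sup>2 \<partial>Lb Q) = tf.ipw f f" by (simp add: tf.ipw_def power2_eq_square mult.assoc)
  finally have 1: "lam * tf.ipw f f \<le> (\<integral>z. g z * (dd f e1 z)\<^sup>2 \<partial>Lb Q) + (\<integral>z. g z * (dd f e2 z)\<^sup>2 \<partial>Lb Q)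
     + 2 * lam * (\<integral>z. indicator {-R..R} (snd z) * (f z)\<^sup>2 \<partial>Lb Q)" by simp
  have "0 \<le> (\<integral>z. 1 / g z * dd f e3 z * dd f e3 z \<partial>Lb Q)"
    using tf.b_nonneg tf.sp by (intro Bochner_Integration.integral_nonneg) (auto simp: mult.assoc)
  then have "(\<integral>z. g z * (dd f e1 z)\<^sup>2 \<partial>Lb Q) + (\<integral>z. g z * (dd f e2 z)\<^sup>2 \<partial>Lb Q) \<le> tf.aw f f"
    unfolding tf.test_in_D(2)[OF f G] sum_Basis_R3 tube_weight_def
    by (simp add: e1_def e2_def e3_def power2_eq_square mult.assoc)
  then show ?thesis using 1 by linarith
qed

lemma energy_bound:
  assumes f: "C1c UNIV f" and G: "supp f \<inter> (\<gamma>D \<times> UNIV) = {}"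
  shows "integrable (Lb Q) (energy f)" "(\<integral>z. energy f z \<partial>Lb Q) \<le> (1 / m0) * (tf.aw f f + tf.ipw f f)"
proof -
  note i = test_integrable[OF f]
  show "integrable (Lb Q) (energy f)"
    unfolding energy_def[abs_def] gradsq_def using i by (intro Bochner_Integration.integrable_add Bochner_Integration.integrable_sum) auto
  have "(\<integral>z. energy f z \<partial>Lb Q) = (\<integral>z. (f z)\<^sup>2 \<partial>Lb Q) + (\<Sum>e\<in>Basis. \<integral>z. (dd f e z)\<^sup>2 \<partial>Lb Q)"
    unfolding energy_def gradsq_def using i by simp
  then have "m0 * (\<integral>z. energy f z \<partial>Lb Q) \<le> tf.aw f f + tf.ipw f f"
    using tf.energy_lower[OF hasgrad_C1c[OF Qo f G]] by (simp add: distrib_left)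
  then show "(\<integral>z. energy f z \<partial>Lb Q) \<le> (1 / m0) * (tf.aw f f + tf.ipw f f)"
    using m0 by (simp add: pos_le_divide_eq mult.commute)
qed

text \<open>The planar strip estimate holds on every slice with the same constants and is integrated
  along the tube; the boxes handle the compact rest. They may reach beyond |s| = R inside the
  infinite cylinder, so truncation creates no boundary terms.\<close>

lemma local_compactness:
  assumes \<eta>: "\<eta> > 0"
  obtains \<P> c where "finite \<P>" "\<And>P. P \<in> \<P> \<Longrightarrow> P \<in> sets borel \<and> bounded P \<and> P \<subseteq> Q" "c \<ge> 0"
    "\<And>f. C1c UNIV f \<Longrightarrow> supp f \<inter> (\<gamma>D \<times> UNIV) = {} \<Longrightarrow>
       (\<integral>z. indicator {-R..R} (snd z) * (f z)\<^sup>2 \<partial>Lb Q) \<le> c * (\<Sum>P\<in>\<P>. (LINT z:P|lborel. f z)\<^sup>2) + \<eta> * (\<integral>z. energy f z \<partial>Lb Q)"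
proof -
  obtain C \<delta>0 where C: "C \<ge> 0" "\<delta>0 > 0" and strip: "\<And>\<delta> f. 0 < \<delta> \<Longrightarrow> \<delta> \<le> \<delta>0 \<Longrightarrow> C1 f \<Longrightarrow>
     (\<integral>\<^sup>+x. ennreal ((f x)\<^sup>2) * indicator (\<omega> \<inter> (\<Union>q\<in>frontier \<omega>. ball q \<delta>)) x \<partial>lborel)
       \<le> ennreal (C * \<delta>) * (\<integral>\<^sup>+x. ennreal (energy f x) * indicator \<omega> x \<partial>lborel)"
    using boundary_strip[OF om bd cone] by blast
  \<comment> \<open>Half of \<open>\<eta>\<close> is spent on the strip and half on the boxes;
    \<open>C + 1\<close> in the denominator avoids dividing by zero.\<close>
  define \<delta> where "\<delta> = min \<delta>0 (\<eta> / (2 * (C + 1)))"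
  have \<delta>: "0 < \<delta>" "\<delta> \<le> \<delta>0" "C * \<delta> \<le> \<eta> / 2"
  proof -
    show "0 < \<delta>" "\<delta> \<le> \<delta>0" using C \<eta> by (auto simp: \<delta>_def)
    have "C * \<delta> \<le> (C + 1) * (\<eta> / (2 * (C + 1)))" using C \<eta> by (intro mult_mono) (auto simp: \<delta>_def)
    also have "\<dots> = \<eta> / 2"
    proof -
      have "C + 1 \<noteq> 0" using C by linarith
      then show ?thesis by (simp add: divide_simps)
    qed
    finally show "C * \<delta> \<le> \<eta> / 2" .
  qed
  define S where "S = (\<Union>q\<in>frontier \<omega>. ball q \<delta>)"
  have So: "open S" unfolding S_def by (intro open_UN) auto
  \<comment> \<open>Removing an open neighbourhood of the boundary from the closure leaves a compact
    subset of the open cross-section.\<close>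
  define K where "K = (closure \<omega> - S) \<times> {-R..R}"
  have "closure \<omega> - S \<subseteq> \<omega>"
  proof
    fix x assume x: "x \<in> closure \<omega> - S"
    have "x \<notin> frontier \<omega>" using x \<delta>(1) unfolding S_def by (metis DiffE UN_iff centre_in_ball)
    then show "x \<in> \<omega>" using x om by (simp add: frontier_def interior_open)
  qed
  then have KQ: "K \<subseteq> Q" by (auto simp: K_def)
  have "compact (closure \<omega> - S)" using bd So by (intro compact_diff) (auto simp: compact_closure)
  then have Kc: "compact K" unfolding K_def by (intro compact_Times) auto
  obtain \<P> c where P: "finite \<P>" "\<And>P. P \<in> \<P> \<Longrightarrow> P \<in> sets borel \<and> bounded P \<and> P \<subseteq> Q" "c \<ge> 0"
    and int: "\<And>f. C1 f \<Longrightarrow> (\<integral>\<^sup>+x. ennreal ((f x)\<^sup>2) * indicator K x \<partial>lborel)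
       \<le> ennreal (c * (\<Sum>P\<in>\<P>. (LINT x:P|lborel. f x)\<^sup>2)) + ennreal (\<eta> / 2) * (\<integral>\<^sup>+x. ennreal (gradsq f x) * indicator Q x \<partial>lborel)"
    using interior_compactness[OF Kc KQ Qo, of "\<eta> / 2"] \<eta> by auto
  have main: "(\<integral>z. indicator {-R..R} (snd z) * (f z)\<^sup>2 \<partial>Lb Q) \<le> c * (\<Sum>P\<in>\<P>. (LINT z:P|lborel. f z)\<^sup>2) + \<eta> * (\<integral>z. energy f z \<partial>Lb Q)"
    if f: "C1c UNIV f" and G: "supp f \<inter> (\<gamma>D \<times> UNIV) = {}" for f
  proof -
    have f1: "C1 f" by (rule C1c_C1[OF f])
    have fm: "f \<in> borel_measurable borel" using C1_continuous[OF f1] by (rule borel_measurable_continuous_onI)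
    have em: "energy f \<in> borel_measurable borel" by (rule energy_measurable[OF f1])
    note E = energy_bound(1)[OF f G]
    let ?E = "\<integral>z. energy f z \<partial>Lb Q"
    have E0: "0 \<le> ?E" by (intro Bochner_Integration.integral_nonneg energy_nonneg)
    have enn: "(\<integral>\<^sup>+z. ennreal (energy f z) * indicator Q z \<partial>lborel) = ennreal ?E"
      using nn_integral_restrict_space[of Q lborel "\<lambda>z. ennreal (energy f z)"] nn_integral_eq_integral[OF E AE_I2[OF energy_nonneg]] tf.Ub
      by simp
    have strip3: "(\<integral>\<^sup>+z. ennreal ((f z)\<^sup>2) * indicator (\<omega> \<inter> S) (fst z) \<partial>lborel) \<le> ennreal (C * \<delta>) * ennreal ?E"
    proof -
      have oS: "\<omega> \<inter> S \<in> sets borel" using om So by auto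
      have m1: "(\<lambda>z::(real\<times>real)\<times>real. ennreal ((f z)\<^sup>2) * indicator (\<omega> \<inter> S) (fst z)) \<in> borel_measurable borel"
      proof -
        have "(\<lambda>z::(real\<times>real)\<times>real. indicator (\<omega> \<inter> S) (fst z) :: ennreal) \<in> borel_measurable (borel \<Otimes>\<^sub>M borel)"
          using oS by measurable
        then have "(\<lambda>z::(real\<times>real)\<times>real. indicator (\<omega> \<inter> S) (fst z) :: ennreal) \<in> borel_measurable borel"
          by (simp only: borel_prod)
        then show ?thesis using fm by (intro borel_measurable_times_ennreal) auto
      qed
      have m2: "(\<lambda>z::(real\<times>real)\<times>real. ennreal (energy f z) * indicator Q z) \<in> borel_measurable borel"
        using em tf.Ub by (intro borel_measurable_times_ennreal borel_measurable_indicator) auto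
      have "(\<integral>\<^sup>+z. ennreal ((f z)\<^sup>2) * indicator (\<omega> \<inter> S) (fst z) \<partial>lborel)
         = (\<integral>\<^sup>+s. (\<integral>\<^sup>+x. ennreal ((f (x, s))\<^sup>2) * indicator (\<omega> \<inter> S) x \<partial>lborel) \<partial>lborel)"
        using cylinder_nn_Fubini[OF m1] by simp
      also have "\<dots> \<le> (\<integral>\<^sup>+s. ennreal (C * \<delta>) * (\<integral>\<^sup>+x. ennreal (energy f (x, s)) * indicator Q (x, s) \<partial>lborel) \<partial>lborel)"
      proof (rule nn_integral_mono)
        fix s :: real
        have "(\<integral>\<^sup>+x. ennreal ((f (x, s))\<^sup>2) * indicator (\<omega> \<inter> S) x \<partial>lborel)
          \<le> ennreal (C * \<delta>) * (\<integral>\<^sup>+x. ennreal (energy (\<lambda>x. f (x, s)) x) * indicator \<omega> x \<partial>lborel)"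
          unfolding S_def by (rule strip[OF \<delta>(1,2) C1_slice(1)[OF f1]])
        also have "\<dots> \<le> ennreal (C * \<delta>) * (\<integral>\<^sup>+x. ennreal (energy f (x, s)) * indicator Q (x, s) \<partial>lborel)"
        proof (intro mult_left_mono nn_integral_mono)
          fix x
          show "ennreal (energy (\<lambda>x. f (x, s)) x) * indicator \<omega> x \<le> ennreal (energy f (x, s)) * indicator Q (x, s)"
            using ennreal_leI[OF gradsq_slice_le[OF f1, of s x]] by (auto simp: indicator_def)
        qed simp
        finally show "(\<integral>\<^sup>+x. ennreal ((f (x, s))\<^sup>2) * indicator (\<omega> \<inter> S) x \<partial>lborel)
          \<le> ennreal (C * \<delta>) * (\<integral>\<^sup>+x. ennreal (energy f (x, s)) * indicator Q (x, s) \<partial>lborel)" .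
      qed
      also have "\<dots> = ennreal (C * \<delta>) * (\<integral>\<^sup>+s. (\<integral>\<^sup>+x. ennreal (energy f (x, s)) * indicator Q (x, s) \<partial>lborel) \<partial>lborel)"
      proof (rule nn_integral_cmult)
        have "(\<lambda>(x, s). ennreal (energy f (x, s)) * indicator Q (x, s)) \<in> borel_measurable (lborel \<Otimes>\<^sub>M lborel)"
          using m2 by (simp add: lborel_prod case_prod_unfold)
        then have "(\<lambda>(s, x). ennreal (energy f (x, s)) * indicator Q (x, s)) \<in> borel_measurable (lborel \<Otimes>\<^sub>M lborel)"
          using measurable_compose[OF measurable_pair_swap'] by (force simp: case_prod_unfold)
        then show "(\<lambda>s. \<integral>\<^sup>+x. ennreal (energy f (x, s)) * indicator Q (x, s) \<partial>lborel) \<in> borel_measurable lborel"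
          using lborel.borel_measurable_nn_integral by force
      qed
      also have "(\<integral>\<^sup>+s. (\<integral>\<^sup>+x. ennreal (energy f (x, s)) * indicator Q (x, s) \<partial>lborel) \<partial>lborel) = ennreal ?E"
        using cylinder_nn_Fubini[OF m2] enn by simp
      finally show ?thesis .
    qed
    have int3: "(\<integral>\<^sup>+z. ennreal ((f z)\<^sup>2) * indicator K z \<partial>lborel) \<le> ennreal (c * (\<Sum>P\<in>\<P>. (LINT x:P|lborel. f x)\<^sup>2)) + ennreal (\<eta> / 2) * ennreal ?E"
    proof -
      have "(\<integral>\<^sup>+z. ennreal (gradsq f z) * indicator Q z \<partial>lborel) \<le> (\<integral>\<^sup>+z. ennreal (energy f z) * indicator Q z \<partial>lborel)"
        by (intro nn_integral_mono mult_right_mono ennreal_leI) (auto simp: energy_def)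
      then have "ennreal (\<eta> / 2) * (\<integral>\<^sup>+z. ennreal (gradsq f z) * indicator Q z \<partial>lborel) \<le> ennreal (\<eta> / 2) * ennreal ?E"
        unfolding enn by (rule mult_left_mono) simp
      then show ?thesis using int[OF f1] by (meson add_left_mono order_trans)
    qed
    have "ennreal (\<integral>z. indicator {-R..R} (snd z) * (f z)\<^sup>2 \<partial>Lb Q) = (\<integral>\<^sup>+z. ennreal (indicator {-R..R} (snd z) * (f z)\<^sup>2) \<partial>Lb Q)"
    proof (rule nn_integral_eq_integral[symmetric])
      have "(\<lambda>z::(real\<times>real)\<times>real. indicator {-R..R} (snd z) :: real) \<in> borel_measurable (borel \<Otimes>\<^sub>M borel)" by measurable
      then have "(\<lambda>z::(real\<times>real)\<times>real. indicator {-R..R} (snd z) :: real) \<in> borel_measurable (Lb Q)"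
        by (intro Lb_measurable) (simp add: borel_prod)
      then have "(\<lambda>z. indicator {-R..R} (snd z) * (f z)\<^sup>2) \<in> borel_measurable (Lb Q)"
        using test_integrable(1)[OF f] by (intro borel_measurable_times) auto
      then show "integrable (Lb Q) (\<lambda>z. indicator {-R..R} (snd z) * (f z)\<^sup>2)"
        by (rule Bochner_Integration.integrable_bound[OF test_integrable(1)[OF f]]) (auto simp: indicator_def)
    qed simp
    also have "\<dots> = (\<integral>\<^sup>+z. ennreal (indicator {-R..R} (snd z) * (f z)\<^sup>2) * indicator Q z \<partial>lborel)"
      using tf.Ub by (intro nn_integral_restrict_space) simp
    also have "\<dots> \<le> (\<integral>\<^sup>+z. ennreal ((f z)\<^sup>2) * indicator (\<omega> \<inter> S) (fst z) + ennreal ((f z)\<^sup>2) * indicator K z \<partial>lborel)"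
    proof (rule nn_integral_mono)
      fix z :: "(real \<times> real) \<times> real"
      show "ennreal (indicator {-R..R} (snd z) * (f z)\<^sup>2) * indicator Q z \<le> ennreal ((f z)\<^sup>2) * indicator (\<omega> \<inter> S) (fst z) + ennreal ((f z)\<^sup>2) * indicator K z"
      proof (cases "z \<in> Q \<and> snd z \<in> {-R..R}")
        case True
        then have "fst z \<in> \<omega> \<inter> S \<or> z \<in> K" using closure_subset[of \<omega>] by (auto simp: K_def mem_Times_iff)
        then show ?thesis using True by (auto simp: indicator_def)
      next
        case False
        then show ?thesis by (auto simp: indicator_def)
      qed
    qed
    also have "\<dots> = (\<integral>\<^sup>+z. ennreal ((f z)\<^sup>2) * indicator (\<omega> \<inter> S) (fst z) \<partial>lborel) + (\<integral>\<^sup>+z. ennreal ((f z)\<^sup>2) * indicator K z \<partial>lborel)"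
    proof (rule nn_integral_add)
      have oS: "\<omega> \<inter> S \<in> sets borel" using om So by auto
        have "(\<lambda>z::(real\<times>real)\<times>real. indicator (\<omega> \<inter> S) (fst z) :: ennreal) \<in> borel_measurable (borel \<Otimes>\<^sub>M borel)"
          using oS by measurable
        then have "(\<lambda>z::(real\<times>real)\<times>real. indicator (\<omega> \<inter> S) (fst z) :: ennreal) \<in> borel_measurable borel"
          by (simp only: borel_prod)
      then show "(\<lambda>z. ennreal ((f z)\<^sup>2) * indicator (\<omega> \<inter> S) (fst z)) \<in> borel_measurable lborel"
        using fm by (auto intro!: borel_measurable_times_ennreal)
      have "K \<in> sets borel" using Kc by (intro borel_closed compact_imp_closed)
      then show "(\<lambda>z. ennreal ((f z)\<^sup>2) * indicator K z) \<in> borel_measurable lborel"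
        using fm by (auto intro!: borel_measurable_times_ennreal borel_measurable_indicator)
    qed
    also have "\<dots> \<le> ennreal (C * \<delta>) * ennreal ?E + (ennreal (c * (\<Sum>P\<in>\<P>. (LINT x:P|lborel. f x)\<^sup>2)) + ennreal (\<eta> / 2) * ennreal ?E)"
      by (rule add_mono[OF strip3 int3])
    also have "\<dots> = ennreal (C * \<delta> * ?E + (c * (\<Sum>P\<in>\<P>. (LINT x:P|lborel. f x)\<^sup>2) + \<eta> / 2 * ?E))"
    proof -
      have nn: "0 \<le> C * \<delta>" "0 \<le> \<eta> / 2" "0 \<le> c * (\<Sum>P\<in>\<P>. (LINT x:P|lborel. f x)\<^sup>2)"
        using C \<delta> P(3) \<eta> by (auto intro!: mult_nonneg_nonneg sum_nonneg)
      then have "0 \<le> C * \<delta> * ?E" "0 \<le> \<eta> / 2 * ?E" using E0 by (blast intro: mult_nonneg_nonneg)+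
      then show ?thesis
        by (simp only: ennreal_mult[OF nn(1) E0, symmetric] ennreal_mult[OF nn(2) E0, symmetric]
            ennreal_plus[symmetric] nn add_nonneg_nonneg)
    qed
    finally have "(\<integral>z. indicator {-R..R} (snd z) * (f z)\<^sup>2 \<partial>Lb Q) \<le> C * \<delta> * ?E + (c * (\<Sum>P\<in>\<P>. (LINT x:P|lborel. f x)\<^sup>2) + \<eta> / 2 * ?E)"
      using C \<delta> E0 P(3) \<eta> by (subst (asm) ennreal_le_iff) (auto intro!: add_nonneg_nonneg mult_nonneg_nonneg sum_nonneg)
    moreover have "C * \<delta> * ?E \<le> \<eta> / 2 * ?E" by (rule mult_right_mono[OF \<delta>(3) E0])
    ultimately show ?thesis by simp
  qed
  show thesis by (rule that[OF P main])
qed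

text \<open>Dividing the indicator by the weight turns the plain integral over a box into a
  functional of the weighted inner product, as the finite-rank inequality expects.\<close>

lemma indicator_functional:
  assumes P: "P \<in> sets borel" "bounded P" "P \<subseteq> Q"
  shows "(\<lambda>z. indicator P z / g z) \<in> tf.H" "(LINT z:P|lborel. f z) = tf.ipw (\<lambda>z. indicator P z / g z) f"
proof -
  have "L2 (Lb Q) (indicator P)"
    unfolding L2_def
  proof
    show "integrable (Lb Q) (\<lambda>z. (indicator P z :: real)\<^sup>2)"
      using P(1) emeasure_bounded_finite[OF P(2)]
      by (intro Lb_integrable tf.Ub) (simp add: power2_eq_square indicator_inter_arith[symmetric])
  qed (use P in \<open>auto intro: Lb_measurable\<close>)
  then have "L2 (Lb Q) (\<lambda>z. indicator P z / g z)"
  proof (rule L2_dom[where K="1 / m0"])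
    show "(\<lambda>z. indicator P z / g z) \<in> borel_measurable (Lb Q)"
      using P g_meas by (auto intro!: Lb_measurable borel_measurable_divide)
    fix z assume "z \<in> space (Lb Q)"
    then have b: "m0 \<le> g z" using tf.sp tf.b_bd by auto
    then have "1 / g z \<le> 1 / m0" using m0 by (intro divide_left_mono) auto
    then show "\<bar>indicator P z / g z\<bar> \<le> (1 / m0) * \<bar>indicator P z :: real\<bar>" using b m0 by (auto simp: indicator_def)
  qed
  then show "(\<lambda>z. indicator P z / g z) \<in> tf.H" by (simp add: tf.H_iff)
  have "tf.ipw (\<lambda>z. indicator P z / g z) f = (LINT z:Q|lborel. g z * (indicator P z / g z) * f z)"
    unfolding tf.ipw_def Lb_integral[OF tf.Ub] ..
  also have "\<dots> = (LINT z:P|lborel. f z)"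
    unfolding set_lebesgue_integral_def
  proof (rule Bochner_Integration.integral_cong[OF refl])
    fix z
    show "indicator Q z *\<^sub>R (g z * (indicator P z / g z) * f z) = indicator P z *\<^sub>R f z"
    proof (cases "z \<in> P")
      case True
      then have "z \<in> Q" using P by auto
      moreover have "g z \<noteq> 0" using tf.b_bd[OF \<open>z \<in> Q\<close>] m0 by auto
      ultimately show ?thesis using True by simp
    qed simp
  qed
  finally show "(LINT z:P|lborel. f z) = tf.ipw (\<lambda>z. indicator P z / g z) f" by simp
qed

lemma finite_rank_bound:
  assumes l: "0 \<le> lam'" "lam' < lam"
  obtains k :: nat and f C where "\<And>i. i < k \<Longrightarrow> f i \<in> tf.H" "C \<ge> 0"
    "\<And>u. u \<in> tf.D \<Longrightarrow> lam' * tf.ipw u u \<le> tf.aw u u + C * (\<Sum>i<k. (tf.ipw (f i) u)\<^sup>2)"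
proof -
  \<comment> \<open>The estimates will give (lam - \<eta>) I \<le> (1 + \<eta>) A up to functionals,
    and (lam - \<eta>) / (1 + \<eta>) is \<open>lam'\<close> exactly for this value.\<close>
  define \<eta> where "\<eta> = (lam - lam') / (1 + lam')"
  have \<eta>: "\<eta> > 0" "\<eta> * (1 + lam') = lam - lam'" using l by (auto simp: \<eta>_def)
  \<comment> \<open>Compensates the factor \<open>2 * lam\<close> of the lower bound and the factor
    \<open>1 / m0\<close> of the energy bound, so that their product with \<open>\<eta>'\<close> is
    \<open>\<eta>\<close>.\<close>
  define \<eta>' where "\<eta>' = \<eta> * m0 / (2 * lam)"
  have lam: "lam > 0" using l by simp
  have \<eta>': "\<eta>' > 0" "2 * lam * (\<eta>' * (1 / m0)) = \<eta>" using \<eta> m0 lam by (auto simp: \<eta>'_def)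
  obtain \<P> c where P: "finite \<P>" "\<And>P. P \<in> \<P> \<Longrightarrow> P \<in> sets borel \<and> bounded P \<and> P \<subseteq> Q" "c \<ge> 0"
    and est: "\<And>f. C1c UNIV f \<Longrightarrow> supp f \<inter> (\<gamma>D \<times> UNIV) = {} \<Longrightarrow>
       (\<integral>z. indicator {-R..R} (snd z) * (f z)\<^sup>2 \<partial>Lb Q) \<le> c * (\<Sum>P\<in>\<P>. (LINT z:P|lborel. f z)\<^sup>2) + \<eta>' * (\<integral>z. energy f z \<partial>Lb Q)"
    using local_compactness[OF \<eta>'(1)] by blast
  obtain b where b: "bij_betw b {0..<card \<P>} \<P>" using ex_bij_betw_nat_finite[OF P(1)] by blast
  let ?f = "\<lambda>i z. indicator (b i) z / g z"
  have bP: "b i \<in> \<P>" if "i < card \<P>" for i using bij_betwE[OF b] that by auto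
  have f: "?f i \<in> tf.H" if "i < card \<P>" for i using indicator_functional(1) P(2)[OF bP[OF that]] by blast
  have sum: "(\<Sum>P\<in>\<P>. (LINT z:P|lborel. u z)\<^sup>2) = (\<Sum>i<card \<P>. (tf.ipw (?f i) u)\<^sup>2)" for u
  proof -
    have "(\<Sum>P\<in>\<P>. (LINT z:P|lborel. u z)\<^sup>2) = (\<Sum>i\<in>{0..<card \<P>}. (LINT z:b i|lborel. u z)\<^sup>2)"
      by (rule sum.reindex_bij_betw[OF b, symmetric])
    also have "\<dots> = (\<Sum>i\<in>{0..<card \<P>}. (tf.ipw (?f i) u)\<^sup>2)"
    proof (rule sum.cong[OF refl])
      fix i assume "i \<in> {0..<card \<P>}"
      then have "b i \<in> \<P>" using bP by simp
      then show "(LINT z:b i|lborel. u z)\<^sup>2 = (tf.ipw (?f i) u)\<^sup>2" using indicator_functional(2)[of "b i" u] P(2) by simp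
    qed
    finally show ?thesis by (simp add: atLeast0LessThan)
  qed
  have C0: "2 * lam * c \<ge> 0" using lam P(3) by simp
  have test: "lam' * tf.ipw \<phi> \<phi> \<le> 1 * tf.aw \<phi> \<phi> + 2 * lam * c * (\<Sum>i<card \<P>. (tf.ipw (?f i) \<phi>)\<^sup>2)"
    if p: "C1c UNIV \<phi>" "supp \<phi> \<inter> (\<gamma>D \<times> UNIV) = {}" for \<phi>
  proof -
    define A where "A = tf.aw \<phi> \<phi>"
    define I where "I = tf.ipw \<phi> \<phi>"
    define \<Sigma> where "\<Sigma> = (\<Sum>i<card \<P>. (tf.ipw (?f i) \<phi>)\<^sup>2)"
    have S0: "0 \<le> 2 * lam * c * \<Sigma>" unfolding \<Sigma>_def by (intro mult_nonneg_nonneg C0 sum_nonneg) simp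
    have "\<eta>' * (\<integral>z. energy \<phi> z \<partial>Lb Q) \<le> \<eta>' * ((1 / m0) * (A + I))"
      unfolding A_def I_def using \<eta>' by (intro mult_left_mono energy_bound(2)[OF p]) auto
    then have "(\<integral>z. indicator {-R..R} (snd z) * (\<phi> z)\<^sup>2 \<partial>Lb Q) \<le> c * \<Sigma> + \<eta>' * ((1 / m0) * (A + I))"
      using est[OF p] unfolding sum \<Sigma>_def by linarith
    then have "2 * lam * (\<integral>z. indicator {-R..R} (snd z) * (\<phi> z)\<^sup>2 \<partial>Lb Q) \<le> 2 * lam * (c * \<Sigma> + \<eta>' * ((1 / m0) * (A + I)))"
      using lam by (intro mult_left_mono) auto
    also have "\<dots> = 2 * lam * c * \<Sigma> + (2 * lam * (\<eta>' * (1 / m0))) * (A + I)" by (simp add: algebra_simps)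
    finally have "lam * I \<le> A + (2 * lam * c * \<Sigma> + \<eta> * (A + I))"
      using form_lower_bound[OF p] unfolding \<eta>'(2) A_def I_def by linarith
    then have "(lam - \<eta>) * I \<le> (1 + \<eta>) * A + 2 * lam * c * \<Sigma>" by (simp add: algebra_simps)
    \<comment> \<open>Enlarging the nonnegative functional term gives every term the common factor 1
      + \<eta>, which is then cancelled.\<close>
    also have "\<dots> \<le> (1 + \<eta>) * A + (1 + \<eta>) * (2 * lam * c * \<Sigma>)"
      using \<eta>(1) S0 mult_right_mono[of 1 "1 + \<eta>" "2 * lam * c * \<Sigma>"] by simp
    also have "lam - \<eta> = (1 + \<eta>) * lam'" using \<eta>(2) by (simp add: algebra_simps)
    finally have "(1 + \<eta>) * (lam' * I) \<le> (1 + \<eta>) * (A + 2 * lam * c * \<Sigma>)" by (simp add: algebra_simps)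
    then have "lam' * I \<le> A + 2 * lam * c * \<Sigma>" using \<eta>(1) by simp
    then show ?thesis unfolding A_def I_def \<Sigma>_def by simp
  qed
  have "lam' * tf.ipw u u \<le> tf.aw u u + 2 * lam * c * (\<Sum>i<card \<P>. (tf.ipw (?f i) u)\<^sup>2)" if u: "u \<in> tf.D" for u
    using tf.inequality_by_density[OF test f u] by simp
  then show thesis using that[of "card \<P>" ?f "2 * lam * c"] f C0 by blast
qed

lemma discrete_bottom:
  assumes "form_bottom tf.H tf.D tf.aw tf.ipw m" "m < lam"
  shows "m \<in> T_discrete_spectrum \<omega> \<gamma>D \<kappa> \<beta>"
proof -
  interpret B: form_bottom tf.H tf.D tf.aw tf.ipw m by fact
  define lam' where "lam' = (m + lam) / 2"
  have l: "0 \<le> lam'" "lam' < lam" "m < lam'" using assms(2) B.m_nonneg by (auto simp: lam'_def)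
  obtain k :: nat and f C where "\<And>i. i < k \<Longrightarrow> f i \<in> tf.H" "C \<ge> 0"
    "\<And>u. u \<in> tf.D \<Longrightarrow> lam' * tf.ipw u u \<le> tf.aw u u + C * (\<Sum>i<k. (tf.ipw (f i) u)\<^sup>2)"
    using finite_rank_bound[OF l(1,2)] by blast
  then interpret form_discrete_bottom tf.H tf.D tf.aw tf.ipw m k f C lam'
    by unfold_locales (use l in auto)
  show ?thesis unfolding T_spectrum_eq by (rule bottom_in_discrete_spectrum)
qed

end

section \<open>Bounds on the weight from the smallness of the curvature, and the conclusion\<close>

lemma gw_bounds:
  assumes bd: "bounded \<omega>" and k: "\<And>s. 0 \<le> \<kappa> s" "bdd_above (range \<kappa>)"
    and small: "(SUP x\<in>\<omega>. norm x) * (SUP s. \<kappa> s) < 1" and x: "x \<in> \<omega>"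
  shows "1 - (SUP x\<in>\<omega>. norm x) * (SUP s. \<kappa> s) \<le> gw \<kappa> \<beta> (x, s) \<and> gw \<kappa> \<beta> (x, s) \<le> 2"
proof -
  let ?a = "SUP x\<in>\<omega>. norm x" and ?K = "SUP s. \<kappa> s"
  have "bdd_above (norm ` \<omega>)" using bd unfolding bounded_iff bdd_above_def by auto
  then have xa: "norm x \<le> ?a" using x by (intro cSUP_upper) auto
  have kK: "\<kappa> s \<le> ?K" using k(2) by (intro cSUP_upper) auto
  obtain x1 x2 where x12: "x = (x1, x2)" by (cases x)
  have "(x1, x2) \<bullet> (cos (\<beta> s), sin (\<beta> s)) = x1 * cos (\<beta> s) + x2 * sin (\<beta> s)" by simp
  then have "\<bar>x1 * cos (\<beta> s) + x2 * sin (\<beta> s)\<bar> \<le> norm x * norm (cos (\<beta> s), sin (\<beta> s))"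
    using Cauchy_Schwarz_ineq2[of x "(cos (\<beta> s), sin (\<beta> s))"] x12 by simp
  then have "\<bar>x1 * cos (\<beta> s) + x2 * sin (\<beta> s)\<bar> \<le> ?a" using xa by (simp add: norm_Pair)
  then have "\<bar>(x1 * cos (\<beta> s) + x2 * sin (\<beta> s)) * \<kappa> s\<bar> \<le> ?a * ?K"
    using kK k(1)[of s] unfolding abs_mult by (intro mult_mono) auto
  then show ?thesis using small by (auto simp: gw_def x12)
qed

theorem theorem1:
  fixes \<omega> \<gamma>D :: "(real \<times> real) set" and lam1 :: real and psi1 :: "real \<times> real \<Rightarrow> real"
    and ell Tf Nf Bf :: "real \<Rightarrow> real^3" and \<kappa> \<tau> \<beta> :: "real \<Rightarrow> real" and a b A1 A2 :: real
  assumes dom: "cross_section \<omega> \<gamma>D"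
    and ev: "form_eigenvalue {u. H1_0_on \<omega> \<gamma>D u} (cs_form \<omega>) (cs_ip \<omega>) lam1"
    and lowest: "\<And>\<mu>. form_eigenvalue {u. H1_0_on \<omega> \<gamma>D u} (cs_form \<omega>) (cs_ip \<omega>) \<mu> \<Longrightarrow> lam1 \<le> \<mu>"
    and psi_dom: "H1_0_on \<omega> \<gamma>D psi1"
    and psi_ef: "\<forall>v. H1_0_on \<omega> \<gamma>D v \<longrightarrow> cs_form \<omega> psi1 v = lam1 * cs_ip \<omega> psi1 v"
    and psi_pos: "\<forall>x\<in>\<omega>. psi1 x > 0"
    and psi_norm: "cs_ip \<omega> psi1 psi1 = 1"
    and curve: "frenet_curve ell \<kappa> \<tau> Tf Nf Bf"
    and beta: "continuous_on UNIV \<tau>" "\<forall>s. (\<beta> has_real_derivative \<tau> s) (at s)"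
    and small: "bdd_above (range \<kappa>)" "(SUP x\<in>\<omega>. norm x) * (SUP s. \<kappa> s) < 1"
    and noself: "inj_on (tube_map ell Nf Bf \<beta>) (\<omega> \<times> UNIV)"
    and A1_def: "A1 = (LINT x:\<omega>|lborel. psi1 x * wd \<omega> (1, 0) psi1 x)"
    and A2_def: "A2 = (LINT x:\<omega>|lborel. psi1 x * wd \<omega> (0, 1) psi1 x)"
    and neg: "(LINT s:{a..b}|lborel. \<kappa> s * (A1 * cos (\<beta> s) + A2 * sin (\<beta> s))) < 0"
    and outside: "\<forall>s. s \<notin> {a..b} \<longrightarrow> \<kappa> s * (A1 * cos (\<beta> s) + A2 * sin (\<beta> s)) \<le> 0"
  shows "Inf (T_spectrum \<omega> \<gamma>D \<kappa> \<beta>) < lam1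
    \<and> ((\<exists>R. \<forall>s. \<bar>s\<bar> > R \<longrightarrow> \<kappa> s = 0) \<longrightarrow> T_discrete_spectrum \<omega> \<gamma>D \<kappa> \<beta> \<noteq> {})"
proof -
  have om: "open \<omega>" "bounded \<omega>" using dom by (auto simp: cross_section_def)
  obtain d2 d3 :: "real \<Rightarrow> real^3" where
    d: "\<And>s. (d2 has_vector_derivative d3 s) (at s)" "\<And>s. \<kappa> s = norm (d2 s)"
    using curve unfolding frenet_curve_def by blast
  have k0: "0 \<le> \<kappa> s" for s by (simp add: d(2))
  have "continuous_on UNIV d2"
    by (intro continuous_at_imp_continuous_on ballI has_vector_derivative_continuous[OF d(1)])
  then have kc: "continuous_on UNIV \<kappa>" by (simp add: d(2)[abs_def] continuous_on_norm)
  have bc: "continuous_on UNIV \<beta>"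
    using beta(2) by (intro continuous_at_imp_continuous_on ballI DERIV_isCont) blast
  \<comment> \<open>The second entry is the lower bound of \<open>gw\<close> supplied by the
    smallness condition; the cap 1/2 makes \<open>m0\<close> also a lower bound for
    \<open>1 / gw\<close>.\<close>
  define m0 where "m0 = min (1/2) (1 - (SUP x\<in>\<omega>. norm x) * (SUP s. \<kappa> s))"
  have m0: "0 < m0" "m0 \<le> 1/2" "m0 \<le> 1 - (SUP x\<in>\<omega>. norm x) * (SUP s. \<kappa> s)" using small by (auto simp: m0_def min_def)
  interpret bt: bent_tube \<omega> \<gamma>D lam1 psi1 \<kappa> \<beta> m0
  proof
    show "m0 \<le> gw \<kappa> \<beta> (x, s) \<and> gw \<kappa> \<beta> (x, s) \<le> 2" if "x \<in> \<omega>" for x s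
      using gw_bounds[OF om(2) k0 small that, of \<beta> s] m0(3) by linarith
  qed (use om psi_dom psi_ef psi_pos psi_norm kc bc m0 in auto)
  have "bt.A1 = A1" "bt.A2 = A2"
    by (simp_all add: bt.A1_def bt.A2_def bt.h_def A1_def A2_def Lb_integral[OF bt.omb])
  then have bend: "bt.bend s = \<kappa> s * (A1 * cos (\<beta> s) + A2 * sin (\<beta> s))" for s
    by (simp add: bt.bend_def)
  obtain u where u: "u \<in> bt.tf.D" "bt.tf.aw u u < lam1 * bt.tf.ipw u u"
    using bt.trial_exists[of a b] neg outside unfolding bend by blast
  obtain m where m: "m < lam1" "form_bottom bt.tf.H bt.tf.D bt.tf.aw bt.tf.ipw m"
    using bt.tf.exists_bottom[OF u] by blast
  have "Inf (T_spectrum \<omega> \<gamma>D \<kappa> \<beta>) = m"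
    unfolding bt.T_spectrum_eq by (rule form_bottom.Inf_spectrum[OF m(2)])
  moreover have "T_discrete_spectrum \<omega> \<gamma>D \<kappa> \<beta> \<noteq> {}" if "\<forall>s. \<bar>s\<bar> > R \<longrightarrow> \<kappa> s = 0" for R
  proof -
    interpret cbt: compact_bent_tube \<omega> \<gamma>D lam1 psi1 \<kappa> \<beta> m0 R
      by unfold_locales (use that cross_section_cone[OF dom] in auto)
    show ?thesis using cbt.discrete_bottom[OF m(2,1)] by blast
  qed
  ultimately show ?thesis using m(1) by blast
qed

end
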